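(* Let $\varphi,\psi:\mathbb{R}^d\to\mathbb{C}$ be measurable functions such that, for some constants $C,\varepsilon>0$, both $\gamma=\varphi$ and $\gamma=\psi$ satisfy $|\gamma(x)|\le C(1+|x|)^{-d-\varepsilon}$ for every $x\in\mathbb{R}^d$. Let $(h_k)$, $(\varepsilon_k)$ be scales with $h_k/\varepsilon_k\to0$, and let $(u_k)$ be an $\varepsilon_k$-oscillatory, bounded sequence in $L^2(\mathbb{R}^d)$. If $\mu$ is its Wigner measure at scale $(\varepsilon_k)$, then the Wigner measure at scale $(\varepsilon_k)$ of the sequence $(T_\psi^{h_k}S_\varphi^{h_k}u_k)$ is $$\mu_{\varphi,\psi}=|\widehat\psi(0)|^2|\widehat\varphi(0)|^2\mu.$$ Moreover, if the densities $|T_\psi^{h_k}S_\varphi^{h_k}u_k|^2dx$ and $|u_k|^2dx$ weakly converge to $\nu_{\varphi,\psi}$ and $\nu$ respectively, then $$\nu_{\varphi,\psi}(x)=\sum_{n\in\mathbb{Z}^d}|\widehat\psi(2\pi n)|^2|\widehat\varphi(0)|^2\,\nu(x).$$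
   Context: A scale is a sequence of positive numbers tending to $0$. Fourier transform: $\widehat u(\xi)=\int_{\mathbb{R}^d}u(x)e^{-ix\cdot\xi}dx$. For $u\in\mathcal{S}'(\mathbb{R}^d)$ and $\varepsilon>0$, $m^\varepsilon[u]\in\mathcal{S}'(\mathbb{R}^d\times\mathbb{R}^d)$ is $$m^\varepsilon[u](x,\xi)=\frac{1}{(2\pi\varepsilon)^d}\overline{u(x)}\,\widehat u(\xi/\varepsilon)e^{ix\cdot\xi/\varepsilon}.$$ A positive Radon measure $\mu$ on $\mathbb{R}^d\times\mathbb{R}^d$ is the Wigner measure at scale $(\varepsilon_k)$ of $(u_k)$ if $m^{\varepsilon_k}[u_k]\to\mu$ weakly in $\mathcal{S}'(\mathbb{R}^d\times\mathbb{R}^d)$. A sequence $(u_k)$ in $L^2(\mathbb{R}^d)$ is $\varepsilon_k$-oscillatory if $\limsup_{k\to\infty}\int_{|\xi|>R/\varepsilon_k}|\widehat{u_k}(\xi)|^2d\xi\to0$ as $R\to\infty$. Sampling operator: $S_\varphi^hu(n)=h^{-d}\int_{\mathbb{R}^d}u(x)\overline{\varphi(x/h-n)}\,dx$, $n\in\mathbb{Z}^d$. Reconstruction operator: for $U=(U_n)_{n\in\mathbb{Z}^d}$ square-summable, $T_\psi^hU(x)=\sum_{n\in\mathbb{Z}^d}U_n\psi(x/h-n)$. Weak convergence of measures is convergence tested against $C_c(\mathbb{R}^d)$. *)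

theory Defs
  imports "HOL-Analysis.Analysis"
begin

section \<open>Schwartz functions and tempered distributions\<close>

definition partial_deriv ::
  "'a::euclidean_space \<Rightarrow> ('a \<Rightarrow> complex) \<Rightarrow> 'a \<Rightarrow> complex" where
  "partial_deriv b f x = frechet_derivative f (at x) b"

definition iter_partial ::
  "'a::euclidean_space list \<Rightarrow> ('a \<Rightarrow> complex) \<Rightarrow> 'a \<Rightarrow> complex" where
  "iter_partial bs f = foldr partial_deriv bs f"

text \<open>Multi-indices are lists of basis vectors. If all iterated partial derivatives are
  (Frechet) differentiable everywhere, then they are all continuous, so the function is smooth.\<close>

definition schwartz :: "('a::euclidean_space \<Rightarrow> complex) set" where
  "schwartz = {f. \<forall>bs\<in>lists Basis.
      (\<forall>x. iter_partial bs f differentiable (at x)) \<and>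
      (\<forall>m::nat. bounded (range (\<lambda>x. (1 + norm x) ^ m *\<^sub>R iter_partial bs f x)))}"

definition schwartz_seminorm ::
  "nat \<Rightarrow> 'a::euclidean_space list \<Rightarrow> ('a \<Rightarrow> complex) \<Rightarrow> real" where
  "schwartz_seminorm m bs f = (SUP x. (1 + norm x) ^ m * norm (iter_partial bs f x))"

text \<open>Distributions are represented as functionals on all functions; only their values on
  Schwartz functions matter.\<close>

type_synonym 'a functional = "('a \<Rightarrow> complex) \<Rightarrow> complex"

definition tempered_distribution :: "'a::euclidean_space functional \<Rightarrow> bool" where
  "tempered_distribution T \<longleftrightarrow>
     (\<forall>f\<in>schwartz. \<forall>g\<in>schwartz. T (\<lambda>x. f x + g x) = T f + T g) \<and>
     (\<forall>c. \<forall>f\<in>schwartz. T (\<lambda>x. c * f x) = c * T f) \<and>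
     (\<exists>C m. \<forall>f\<in>schwartz.
        norm (T f) \<le> C * (\<Sum>bs | set bs \<subseteq> Basis \<and> length bs \<le> m. schwartz_seminorm m bs f))"

definition fun_dist :: "('a::euclidean_space \<Rightarrow> complex) \<Rightarrow> 'a functional" where
  "fun_dist u = (\<lambda>f. \<integral>x. u x * f x \<partial>lebesgue)"

definition measure_dist :: "'a::euclidean_space measure \<Rightarrow> 'a functional" where
  "measure_dist \<mu> = (\<lambda>f. \<integral>x. f x \<partial>\<mu>)"

definition dist_cnj :: "'a functional \<Rightarrow> 'a functional" where
  "dist_cnj T = (\<lambda>f. cnj (T (\<lambda>x. cnj (f x))))"

text \<open>The distribution \<open>T(x / r)\<close>, for \<open>r > 0\<close>.\<close>

definition dist_rescale :: "real \<Rightarrow> 'a::euclidean_space functional \<Rightarrow> 'a functional" where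
  "dist_rescale r T = (\<lambda>f. complex_of_real (r ^ DIM('a)) * T (\<lambda>x. f (r *\<^sub>R x)))"

definition dist_tensor :: "'a functional \<Rightarrow> 'b functional \<Rightarrow> ('a \<times> 'b) functional" where
  "dist_tensor S T = (\<lambda>f. S (\<lambda>x. T (\<lambda>y. f (x, y))))"

definition dist_mult :: "('a \<Rightarrow> complex) \<Rightarrow> 'a functional \<Rightarrow> 'a functional" where
  "dist_mult g T = (\<lambda>f. T (\<lambda>x. g x * f x))"

section \<open>Fourier transform\<close>

definition fourier :: "('a::euclidean_space \<Rightarrow> complex) \<Rightarrow> 'a \<Rightarrow> complex" where
  "fourier f \<xi> = (\<integral>x. f x * exp (- \<i> * complex_of_real (x \<bullet> \<xi>)) \<partial>lebesgue)"

definition fourier_dist :: "'a::euclidean_space functional \<Rightarrow> 'a functional" where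
  "fourier_dist T = (\<lambda>f. T (fourier f))"

definition L2 :: "('a::euclidean_space \<Rightarrow> complex) set" where
  "L2 = {u. u \<in> borel_measurable lebesgue \<and> integrable lebesgue (\<lambda>x. (norm (u x))\<^sup>2)}"

definition L2_norm :: "('a::euclidean_space \<Rightarrow> complex) \<Rightarrow> real" where
  "L2_norm u = sqrt (\<integral>x. (norm (u x))\<^sup>2 \<partial>lebesgue)"

text \<open>For \<open>u\<close> in \<open>L2\<close>, the distributional Fourier transform of \<open>u\<close> is given by a function in
  \<open>L2\<close> (Plancherel), unique up to null sets.\<close>

definition fourier_L2 :: "('a::euclidean_space \<Rightarrow> complex) \<Rightarrow> 'a \<Rightarrow> complex" where
  "fourier_L2 u = (SOME v. v \<in> L2 \<and> (\<forall>f\<in>schwartz. fun_dist v f = fourier_dist (fun_dist u) f))"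

section \<open>Wigner measures\<close>

definition is_scale :: "(nat \<Rightarrow> real) \<Rightarrow> bool" where
  "is_scale h \<longleftrightarrow> (\<forall>k. 0 < h k) \<and> h \<longlonglongrightarrow> 0"

text \<open>The product of the function \<open>exp (\<i> x \<bullet> \<xi> / \<epsilon>) / (2 \<pi> \<epsilon>) ^ d\<close> with the tensor product of
  the conjugate of \<open>u\<close> (in the variable \<open>x\<close>) and its Fourier transform at \<open>\<xi> / \<epsilon>\<close>.\<close>

definition wigner_transform ::
  "real \<Rightarrow> 'a::euclidean_space functional \<Rightarrow> ('a \<times> 'a) functional" where
  "wigner_transform \<epsilon> u = (\<lambda>a. complex_of_real (1 / (2 * pi * \<epsilon>) ^ DIM('a)) *
     dist_mult (\<lambda>(x, \<xi>). exp (\<i> * complex_of_real ((x \<bullet> \<xi>) / \<epsilon>)))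
       (dist_tensor (dist_cnj u) (dist_rescale \<epsilon> (fourier_dist u))) a)"

text \<open>On a Euclidean space, Borel measures that are finite on compact sets are automatically
  regular.\<close>

definition radon_measure :: "'a::euclidean_space measure \<Rightarrow> bool" where
  "radon_measure \<mu> \<longleftrightarrow> sets \<mu> = sets borel \<and> (\<forall>K. compact K \<longrightarrow> emeasure \<mu> K < \<infinity>)"

definition is_wigner_measure ::
  "(nat \<Rightarrow> real) \<Rightarrow> (nat \<Rightarrow> 'a::euclidean_space functional) \<Rightarrow> ('a \<times> 'a) measure \<Rightarrow> bool" where
  "is_wigner_measure \<epsilon> u \<mu> \<longleftrightarrow>
     (\<forall>k. tempered_distribution (u k)) \<and>
     radon_measure \<mu> \<and>
     (\<forall>a\<in>schwartz. integrable \<mu> a) \<and> tempered_distribution (measure_dist \<mu>) \<and>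
     (\<forall>a\<in>schwartz. (\<lambda>k. wigner_transform (\<epsilon> k) (u k) a) \<longlonglongrightarrow> measure_dist \<mu> a)"

definition oscillatory ::
  "(nat \<Rightarrow> real) \<Rightarrow> (nat \<Rightarrow> 'a::euclidean_space \<Rightarrow> complex) \<Rightarrow> bool" where
  "oscillatory \<epsilon> u \<longleftrightarrow>
     ((\<lambda>R::real. limsup (\<lambda>k. \<integral>\<^sup>+\<xi>\<in>{\<xi>. norm \<xi> > R / \<epsilon> k}.
        ennreal ((norm (fourier_L2 (u k) \<xi>))\<^sup>2) \<partial>lebesgue)) \<longlongrightarrow> 0) at_top"

section \<open>Weak convergence of measures\<close>

definition Cc :: "('a::euclidean_space \<Rightarrow> complex) set" where
  "Cc = {f. continuous_on UNIV f \<and> compact (closure {x. f x \<noteq> 0})}"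

definition weakly_converges_to ::
  "(nat \<Rightarrow> 'a::euclidean_space measure) \<Rightarrow> 'a measure \<Rightarrow> bool" where
  "weakly_converges_to M N \<longleftrightarrow> radon_measure N \<and>
     (\<forall>f\<in>Cc. (\<lambda>k. \<integral>x. f x \<partial>M k) \<longlonglongrightarrow> (\<integral>x. f x \<partial>N))"

definition sq_density :: "('a::euclidean_space \<Rightarrow> complex) \<Rightarrow> 'a measure" where
  "sq_density u = density lebesgue (\<lambda>x. ennreal ((norm (u x))\<^sup>2))"

section \<open>Sampling and reconstruction\<close>

definition lattice_point :: "int ^ 'n \<Rightarrow> real ^ 'n" where
  "lattice_point n = (\<chi> i. of_int (n $ i))"

definition sampling ::
  "(real ^ 'n \<Rightarrow> complex) \<Rightarrow> real \<Rightarrow> (real ^ 'n \<Rightarrow> complex) \<Rightarrow> int ^ 'n \<Rightarrow> complex" where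
  "sampling \<phi> h u n = complex_of_real (1 / h ^ CARD('n)) *
     (\<integral>x. u x * cnj (\<phi> (x /\<^sub>R h - lattice_point n)) \<partial>lebesgue)"

definition reconstruction ::
  "(real ^ 'n \<Rightarrow> complex) \<Rightarrow> real \<Rightarrow> (int ^ 'n \<Rightarrow> complex) \<Rightarrow> real ^ 'n \<Rightarrow> complex" where
  "reconstruction \<psi> h U x = (\<Sum>\<^sub>\<infinity>n. U n * \<psi> (x /\<^sub>R h - lattice_point n))"

end

theory Submission
  imports Defs "HOL-Probability.Probability"
begin

text \<open>Let \<open>P\<close> be the periodization of \<open>\<psi>\<close> over the integer lattice and \<open>c\<close> the integral of the conjugate of
  \<open>\<phi>\<close>. Since \<open>h k / \<epsilon> k\<close> tends to 0, an oscillatory sequence satisfies \<open>u k (x + h k z) - u k x \<rightarrow> 0\<close>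
  in the mean square for every \<open>z\<close>, and therefore
  \<open>w k x = c P(x / h k) u k x + o(1)\<close> in the mean square. Both the Wigner pairing, a bilinear form with
  the kernel \<open>\<epsilon>\<^sup>-\<^sup>d A(x, (y - x) / \<epsilon>)\<close>, and the pairing of the density with a continuous function vary slowly
  at scale \<open>h k\<close>, so that the periodic factors may be replaced by their means. The mean of
  \<open>cnj (P x) P y\<close> over the product of two cells is the squared modulus of the integral of \<open>\<psi>\<close>; that of the
  squared modulus of \<open>P\<close> over one cell is, by Parseval's identity, the sum of the squared moduli of the
  Fourier transform of \<open>\<psi>\<close> at the points \<open>2 \<pi> n\<close>.\<close>

section \<open>Translations and dilations of Lebesgue measure\<close>

text \<open>Why the two means differ: the Wigner pairing sees points \<open>x\<close>,
  \<open>y\<close> at distance of order \<open>\<epsilon> k\<close>, far above \<open>h k\<close>,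
  so the phases \<open>x / h k\<close> and \<open>y / h k\<close> decouple and the mean factorises;
  the density sees only the diagonal, where the phases coincide and every harmonic of
  \<open>P\<close> contributes. Why oscillation gives slow variation: a shift by
  \<open>h k z\<close> multiplies the Fourier transform by a unimodular factor that is close to 1
  for frequencies up to \<open>R / \<epsilon> k\<close>, because \<open>h k / \<epsilon> k\<close>
  tends to 0; higher frequencies carry little mass once \<open>R\<close> is large. The transform of
  a square integrable function is known here only through its pairing with Schwartz functions, and
  Gaussians are the bridge from that pairing to norms. Decay of order above the dimension enters
  twice: it bounds lattice sums uniformly, and it turns the sum of products of translates of
  \<open>\<phi>\<close> and \<open>\<psi>\<close> into an integrable kernel, so that the error of
  reconstruction is an average of translation errors. Estimates are made for Borel representatives
  and carried back at the end.\<close>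

lemma tendsto_0_ennrealI:
  fixes f :: "'b \<Rightarrow> ennreal"
  assumes "\<And>e::real. e > 0 \<Longrightarrow> eventually (\<lambda>x. f x \<le> ennreal e) F"
  shows "(f \<longlongrightarrow> 0) F"
proof (rule order_tendstoI)
  fix a :: ennreal assume "0 < a"
  then obtain e where e: "0 < e" "e < a" using dense by blast
  then have "e < top" using less_le_trans[OF e(2) top_greatest] by simp
  then obtain r where r: "e = ennreal r" "r \<ge> 0" by (cases e) auto
  with e have "r > 0" by auto
  from assms[OF this] show "eventually (\<lambda>x. f x < a) F"
    by eventually_elim (use r e in auto)
qed auto

lemma tendsto_0_ennrealD:
  fixes f :: "'b \<Rightarrow> ennreal"
  assumes "(f \<longlongrightarrow> 0) F" "e > 0"
  shows "eventually (\<lambda>x. f x \<le> ennreal e) F"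
proof -
  have "eventually (\<lambda>x. f x < ennreal e) F" using assms by (intro order_tendstoD(2)) auto
  then show ?thesis by eventually_elim auto
qed

lemma tendsto_0_ennreal_cmult:
  fixes f :: "'b \<Rightarrow> ennreal"
  assumes "(f \<longlongrightarrow> 0) F" "c < top"
  shows "((\<lambda>x. c * f x) \<longlongrightarrow> 0) F"
  using tendsto_mult_ennreal[OF tendsto_const[of c F] assms(1)] assms(2)
  by (auto simp: less_top)

lemma tendsto_0_ennreal_le:
  fixes f g :: "'b \<Rightarrow> ennreal"
  assumes "(f \<longlongrightarrow> 0) F" "\<And>x. g x \<le> f x"
  shows "(g \<longlongrightarrow> 0) F"
  by (rule tendsto_sandwich[of "\<lambda>_. 0" g F f]) (use assms in auto)

lemma nn_integral_translate:
  fixes f :: "'a::euclidean_space \<Rightarrow> ennreal"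
  assumes [measurable]: "f \<in> borel_measurable borel"
  shows "(\<integral>\<^sup>+x. f (x + a) \<partial>lborel) = (\<integral>\<^sup>+x. f x \<partial>lborel)"
proof -
  have "(\<integral>\<^sup>+x. f x \<partial>lborel) = (\<integral>\<^sup>+x. f x \<partial>distr lborel borel ((+) a))"
    by (simp only: lborel_distr_plus)
  also have "\<dots> = (\<integral>\<^sup>+x. f (x + a) \<partial>lborel)"
    by (subst nn_integral_distr) (auto simp: add.commute)
  finally show ?thesis by simp
qed

lemma nn_integral_dilate:
  fixes f :: "'a::euclidean_space \<Rightarrow> ennreal"
  assumes [measurable]: "f \<in> borel_measurable borel" and r: "r \<noteq> 0"
  shows "(\<integral>\<^sup>+x. f x \<partial>lborel) = ennreal (\<bar>r\<bar> ^ DIM('a)) * (\<integral>\<^sup>+x. f (r *\<^sub>R x) \<partial>lborel)"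
  by (subst lborel_affine[OF r, of 0])
     (simp add: nn_integral_density nn_integral_distr nn_integral_cmult)

lemma has_bochner_integral_translate:
  fixes f :: "'a::euclidean_space \<Rightarrow> 'b::{banach, second_countable_topology}"
  assumes [measurable]: "f \<in> borel_measurable borel"
  shows integrable_translate_iff: "integrable lborel (\<lambda>x. f (x + a)) \<longleftrightarrow> integrable lborel f"
    and integral_translate: "(\<integral>x. f (x + a) \<partial>lborel) = (\<integral>x. f x \<partial>lborel)"
proof -
  have "integrable lborel f \<longleftrightarrow> integrable (distr lborel borel ((+) a)) f"
    by (simp only: lborel_distr_plus)
  also have "\<dots> \<longleftrightarrow> integrable lborel (\<lambda>x. f (x + a))"
    by (subst integrable_distr_eq) (auto simp: add.commute)
  finally show "integrable lborel (\<lambda>x. f (x + a)) \<longleftrightarrow> integrable lborel f" by simp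
  have "(\<integral>x. f x \<partial>lborel) = (\<integral>x. f x \<partial>distr lborel borel ((+) a))"
    by (simp only: lborel_distr_plus)
  also have "\<dots> = (\<integral>x. f (x + a) \<partial>lborel)"
    by (subst integral_distr) (auto simp: add.commute)
  finally show "(\<integral>x. f (x + a) \<partial>lborel) = (\<integral>x. f x \<partial>lborel)" by simp
qed

lemma
  fixes f :: "'a::euclidean_space \<Rightarrow> 'b::{banach, second_countable_topology}"
  assumes [measurable]: "f \<in> borel_measurable borel" and r: "r \<noteq> 0"
  shows integrable_dilate_iff: "integrable lborel (\<lambda>x. f (r *\<^sub>R x)) \<longleftrightarrow> integrable lborel f"
    and integral_dilate: "(\<integral>x. f x \<partial>lborel) = (\<bar>r\<bar> ^ DIM('a)) *\<^sub>R (\<integral>x. f (r *\<^sub>R x) \<partial>lborel)"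
proof -
  have nz: "\<bar>r\<bar> ^ DIM('a) \<noteq> 0" using r by simp
  have "integrable lborel f \<longleftrightarrow>
      integrable (density (distr lborel borel (\<lambda>x. 0 + r *\<^sub>R x)) (\<lambda>_. ennreal (\<bar>r\<bar>^DIM('a)))) f"
    by (subst (1) lborel_affine[OF r, of 0]) simp
  also have "\<dots> \<longleftrightarrow> integrable lborel (\<lambda>x. (\<bar>r\<bar>^DIM('a)) *\<^sub>R f (r *\<^sub>R x))"
    by (simp add: integrable_density integrable_distr_eq)
  also have "\<dots> \<longleftrightarrow> integrable lborel (\<lambda>x. f (r *\<^sub>R x))"
  proof
    assume "integrable lborel (\<lambda>x. (\<bar>r\<bar>^DIM('a)) *\<^sub>R f (r *\<^sub>R x))"
    from integrable_scaleR_right[OF this, of "inverse (\<bar>r\<bar>^DIM('a))"]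
    show "integrable lborel (\<lambda>x. f (r *\<^sub>R x))" using nz by simp
  qed (rule integrable_scaleR_right)
  finally show "integrable lborel (\<lambda>x. f (r *\<^sub>R x)) \<longleftrightarrow> integrable lborel f" by simp
  have "(\<integral>x. f x \<partial>lborel) =
      (\<integral>x. f x \<partial>density (distr lborel borel (\<lambda>x. 0 + r *\<^sub>R x)) (\<lambda>_. ennreal (\<bar>r\<bar>^DIM('a))))"
    by (subst (1) lborel_affine[OF r, of 0]) simp
  also have "\<dots> = (\<bar>r\<bar> ^ DIM('a)) *\<^sub>R (\<integral>x. f (r *\<^sub>R x) \<partial>lborel)"
    using nz by (simp add: integral_density integral_distr)
  finally show "(\<integral>x. f x \<partial>lborel) = (\<bar>r\<bar> ^ DIM('a)) *\<^sub>R (\<integral>x. f (r *\<^sub>R x) \<partial>lborel)" .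
qed

section \<open>Mean square norms\<close>

text \<open>Squared, and valued in \<open>ennreal\<close>, so that estimates need no integrability
  hypotheses; the triangle inequality then takes the weighted form
  \<open>sqn_add_le\<close>.\<close>

definition sqn :: "('a::euclidean_space \<Rightarrow> complex) \<Rightarrow> ennreal" where
  "sqn f = (\<integral>\<^sup>+x. ennreal ((norm (f x))\<^sup>2) \<partial>lborel)"

lemma sqn_translate:
  assumes "f \<in> borel_measurable borel"
  shows "sqn (\<lambda>x. f (x + a)) = sqn f"
  unfolding sqn_def using assms by (subst nn_integral_translate[of "\<lambda>x. ennreal ((norm (f x))\<^sup>2)" a, symmetric]) auto

lemma sqn_mono: "(\<And>x. norm (f x) \<le> norm (g x)) \<Longrightarrow> sqn f \<le> sqn g"
  unfolding sqn_def by (intro nn_integral_mono ennreal_leI power_mono) auto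

lemma sqn_cmult:
  assumes [measurable]: "f \<in> borel_measurable borel"
  shows "sqn (\<lambda>x. c * f x) = ennreal ((norm c)\<^sup>2) * sqn f"
  unfolding sqn_def by (subst nn_integral_cmult[symmetric]) (auto simp: norm_mult power_mult_distrib ennreal_mult)

lemma sqn_bounded_mult:
  assumes [measurable]: "f \<in> borel_measurable borel" and "\<And>x. norm (g x) \<le> B"
  shows "sqn (\<lambda>x. g x * f x) \<le> ennreal (B\<^sup>2) * sqn f"
proof -
  have "B \<ge> 0" using norm_ge_zero assms(2)[of undefined] by (rule order_trans)
  then have "sqn (\<lambda>x. g x * f x) \<le> sqn (\<lambda>x. complex_of_real B * f x)"
    by (intro sqn_mono) (auto simp: norm_mult assms intro!: mult_right_mono)
  also have "\<dots> = ennreal (B\<^sup>2) * sqn f" by (subst sqn_cmult) auto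
  finally show ?thesis .
qed

text \<open>Young's inequality for the cross term. The free \<open>t\<close> matters in
  \<open>parseval_cell\<close>, where \<open>t\<close> tends to 0 so that the main term keeps the
  constant 1.\<close>

lemma norm_add_sq_le:
  fixes a b :: "'b::real_normed_vector"
  assumes "t > 0"
  shows "(norm (a + b))\<^sup>2 \<le> (1 + t) * (norm a)\<^sup>2 + (1 + 1/t) * (norm b)\<^sup>2"
proof -
  have "(norm (a + b))\<^sup>2 \<le> (norm a + norm b)\<^sup>2"
    by (intro power_mono norm_triangle_ineq) auto
  also have "\<dots> = (norm a)\<^sup>2 + (norm b)\<^sup>2 + 2 * norm a * norm b"
    by (simp add: power2_sum)
  also have "2 * norm a * norm b \<le> t * (norm a)\<^sup>2 + (1/t) * (norm b)\<^sup>2"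
  proof -
    have "0 \<le> (sqrt t * norm a - norm b / sqrt t)\<^sup>2" by simp
    also have "\<dots> = t * (norm a)\<^sup>2 + (1/t) * (norm b)\<^sup>2 - 2 * norm a * norm b"
      using assms by (simp add: power2_diff power_mult_distrib power_divide field_simps)
    finally show ?thesis by simp
  qed
  finally show ?thesis by (simp add: algebra_simps)
qed

lemma sqn_add_le:
  assumes [measurable]: "f \<in> borel_measurable borel" "g \<in> borel_measurable borel" and t: "t > 0"
  shows "sqn (\<lambda>x. f x + g x) \<le> ennreal (1 + t) * sqn f + ennreal (1 + 1/t) * sqn g"
proof -
  have "sqn (\<lambda>x. f x + g x) \<le>
      (\<integral>\<^sup>+x. ennreal (1 + t) * ennreal ((norm (f x))\<^sup>2) + ennreal (1 + 1/t) * ennreal ((norm (g x))\<^sup>2) \<partial>lborel)"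
    unfolding sqn_def
  proof (intro nn_integral_mono)
    fix x
    have "ennreal ((norm (f x + g x))\<^sup>2) \<le> ennreal ((1 + t) * (norm (f x))\<^sup>2 + (1 + 1/t) * (norm (g x))\<^sup>2)"
      by (intro ennreal_leI norm_add_sq_le t)
    also have "\<dots> = ennreal (1 + t) * ennreal ((norm (f x))\<^sup>2) + ennreal (1 + 1/t) * ennreal ((norm (g x))\<^sup>2)"
      using t by (simp add: ennreal_mult ennreal_plus)
    finally show "ennreal ((norm (f x + g x))\<^sup>2) \<le> \<dots>" .
  qed
  also have "\<dots> = ennreal (1 + t) * sqn f + ennreal (1 + 1/t) * sqn g"
    unfolding sqn_def by (subst nn_integral_add) (auto simp: nn_integral_cmult)
  finally show ?thesis .
qed

lemma sqn_add_le2: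
  assumes "f \<in> borel_measurable borel" "g \<in> borel_measurable borel"
  shows "sqn (\<lambda>x. f x + g x) \<le> 2 * sqn f + 2 * sqn g"
  using sqn_add_le[OF assms, of 1] by simp

lemma sqn_uminus: "sqn (\<lambda>x. - f x) = sqn f"
  by (simp add: sqn_def)

lemma sqn_diff_le2:
  assumes "f \<in> borel_measurable borel" "g \<in> borel_measurable borel"
  shows "sqn (\<lambda>x. f x - g x) \<le> 2 * sqn f + 2 * sqn g"
  using sqn_add_le2[of f "\<lambda>x. - g x"] assms by (simp add: sqn_uminus)

lemma sqn_finite_iff:
  assumes [measurable]: "f \<in> borel_measurable borel"
  shows "sqn f < \<infinity> \<longleftrightarrow> integrable lborel (\<lambda>x. (norm (f x))\<^sup>2)"
  by (simp add: sqn_def integrable_iff_bounded)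

lemma sqn_eq_integral:
  assumes [measurable]: "f \<in> borel_measurable borel" "sqn f < \<infinity>"
  shows "sqn f = ennreal (\<integral>x. (norm (f x))\<^sup>2 \<partial>lborel)"
  unfolding sqn_def by (rule nn_integral_eq_integral) (use sqn_finite_iff[OF assms(1)] assms(2) in auto)

lemma nn_integral_mult_le_sqn:
  assumes [measurable]: "f \<in> borel_measurable borel" "g \<in> borel_measurable borel"
  shows "(\<integral>\<^sup>+x. ennreal (norm (f x) * norm (g x)) \<partial>lborel)\<^sup>2 \<le> sqn f * sqn g"
  using Cauchy_Schwarz_nn_integral[of "\<lambda>x. ennreal (norm (f x))" lborel "\<lambda>x. ennreal (norm (g x))"]
  by (simp add: sqn_def ennreal_mult ennreal_power)

lemma integrable_mult_sqn:
  assumes [measurable]: "f \<in> borel_measurable borel" "g \<in> borel_measurable borel"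
    and "sqn f < \<infinity>" "sqn g < \<infinity>"
  shows "integrable lborel (\<lambda>x. f x * g x)"
proof -
  have "(\<integral>\<^sup>+x. ennreal (norm (f x) * norm (g x)) \<partial>lborel)\<^sup>2 < \<infinity>"
    using nn_integral_mult_le_sqn[OF assms(1,2)] assms(3,4) by (auto simp: ennreal_mult_less_top intro: order.strict_trans1)
  then have "(\<integral>\<^sup>+x. ennreal (norm (f x) * norm (g x)) \<partial>lborel) < \<infinity>"
    by (simp add: power_less_top_ennreal)
  then show ?thesis by (simp add: integrable_iff_bounded norm_mult)
qed

text \<open>A substitute for Minkowski's integral inequality: split the weight as
  \<open>sqrt (\<kappa> z) * sqrt (\<kappa> z)\<close>, apply Cauchy-Schwarz in \<open>z\<close>,
  then Tonelli. It serves both for mollification by Gaussians and for the error of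
  reconstruction.\<close>

lemma sqn_average:
  fixes G :: "'b::euclidean_space \<Rightarrow> 'a::euclidean_space \<Rightarrow> complex" and \<kappa> :: "'b \<Rightarrow> real"
  assumes [measurable]: "(\<lambda>(z, x). G z x) \<in> borel_measurable (borel \<Otimes>\<^sub>M borel)" "\<kappa> \<in> borel_measurable borel"
    and \<kappa>: "\<And>z. \<kappa> z \<ge> 0" and [measurable]: "D \<in> borel_measurable borel"
    and D: "\<And>x. ennreal (norm (D x)) \<le> (\<integral>\<^sup>+z. ennreal (\<kappa> z) * ennreal (norm (G z x)) \<partial>lborel)"
  shows "sqn D \<le> (\<integral>\<^sup>+z. ennreal (\<kappa> z) \<partial>lborel) * (\<integral>\<^sup>+z. ennreal (\<kappa> z) * sqn (G z) \<partial>lborel)"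
proof -
  have m: "(\<lambda>z. G z x) \<in> borel_measurable borel" for x by measurable
  have m2: "(\<lambda>x. G z x) \<in> borel_measurable borel" for z by measurable
  have "sqn D \<le> (\<integral>\<^sup>+x. (\<integral>\<^sup>+z. ennreal (\<kappa> z) \<partial>lborel) * (\<integral>\<^sup>+z. ennreal (\<kappa> z) * ennreal ((norm (G z x))\<^sup>2) \<partial>lborel) \<partial>lborel)"
    unfolding sqn_def
  proof (intro nn_integral_mono)
    fix x
    have "ennreal ((norm (D x))\<^sup>2) = (ennreal (norm (D x)))\<^sup>2" by (simp add: ennreal_power)
    also have "\<dots> \<le> (\<integral>\<^sup>+z. ennreal (\<kappa> z) * ennreal (norm (G z x)) \<partial>lborel)\<^sup>2"
      by (intro power_mono D) auto
    also have "\<dots> = (\<integral>\<^sup>+z. ennreal (sqrt (\<kappa> z)) * ennreal (sqrt (\<kappa> z) * norm (G z x)) \<partial>lborel)\<^sup>2"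
      using \<kappa> by (intro arg_cong[where f = "\<lambda>x. x\<^sup>2"] nn_integral_cong)
        (simp flip: ennreal_mult add: mult.assoc[symmetric])
    also have "\<dots> \<le> (\<integral>\<^sup>+z. (ennreal (sqrt (\<kappa> z)))\<^sup>2 \<partial>lborel) * (\<integral>\<^sup>+z. (ennreal (sqrt (\<kappa> z) * norm (G z x)))\<^sup>2 \<partial>lborel)"
      using m[of x] by (intro Cauchy_Schwarz_nn_integral) auto
    also have "\<dots> = (\<integral>\<^sup>+z. ennreal (\<kappa> z) \<partial>lborel) * (\<integral>\<^sup>+z. ennreal (\<kappa> z) * ennreal ((norm (G z x))\<^sup>2) \<partial>lborel)"
      using \<kappa> by (simp add: ennreal_power power_mult_distrib flip: ennreal_mult)
    finally show "ennreal ((norm (D x))\<^sup>2) \<le> \<dots>" .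
  qed
  also have "\<dots> = (\<integral>\<^sup>+z. ennreal (\<kappa> z) \<partial>lborel) * (\<integral>\<^sup>+x. (\<integral>\<^sup>+z. ennreal (\<kappa> z) * ennreal ((norm (G z x))\<^sup>2) \<partial>lborel) \<partial>lborel)"
    by (intro nn_integral_cmult) measurable
  also have "(\<integral>\<^sup>+x. (\<integral>\<^sup>+z. ennreal (\<kappa> z) * ennreal ((norm (G z x))\<^sup>2) \<partial>lborel) \<partial>lborel)
     = (\<integral>\<^sup>+z. (\<integral>\<^sup>+x. ennreal (\<kappa> z) * ennreal ((norm (G z x))\<^sup>2) \<partial>lborel) \<partial>lborel)"
    by (rule lborel_pair.Fubini') measurable
  also have "\<dots> = (\<integral>\<^sup>+z. ennreal (\<kappa> z) * sqn (G z) \<partial>lborel)"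
    unfolding sqn_def using m2 by (intro nn_integral_cong nn_integral_cmult) auto
  finally show ?thesis .
qed

section \<open>Continuity of translations\<close>

text \<open>The modulus of continuity of translation in L1, the notion of slow variation that
  \<open>averaging\<close> requires.\<close>

definition shift_dist :: "('a::euclidean_space \<Rightarrow> 'b::{banach, second_countable_topology}) \<Rightarrow> 'a \<Rightarrow> ennreal" where
  "shift_dist f p = (\<integral>\<^sup>+x. ennreal (norm (f (x + p) - f x)) \<partial>lborel)"

lemma nn_integral_norm_add:
  fixes f g :: "'a::euclidean_space \<Rightarrow> 'b::{banach, second_countable_topology}"
  assumes [measurable]: "f \<in> borel_measurable borel" "g \<in> borel_measurable borel"
  shows "(\<integral>\<^sup>+x. ennreal (norm (f x + g x)) \<partial>lborel) \<le> (\<integral>\<^sup>+x. ennreal (norm (f x)) \<partial>lborel) + (\<integral>\<^sup>+x. ennreal (norm (g x)) \<partial>lborel)"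
  by (subst nn_integral_add[symmetric]) (auto intro!: nn_integral_mono simp: norm_triangle_ineq simp flip: ennreal_plus)

lemma shift_dist_add:
  assumes [measurable]: "f \<in> borel_measurable borel" "g \<in> borel_measurable borel"
  shows "shift_dist (\<lambda>x. f x + g x) p \<le> shift_dist f p + shift_dist g p"
  unfolding shift_dist_def
  using nn_integral_norm_add[of "\<lambda>x. f (x + p) - f x" "\<lambda>x. g (x + p) - g x"] by (simp add: algebra_simps)

lemma shift_dist_le:
  assumes [measurable]: "f \<in> borel_measurable borel"
  shows "shift_dist f p \<le> 2 * (\<integral>\<^sup>+x. ennreal (norm (f x)) \<partial>lborel)"
proof -
  have "shift_dist f p \<le> (\<integral>\<^sup>+x. ennreal (norm (f (x + p))) \<partial>lborel) + (\<integral>\<^sup>+x. ennreal (norm (f x)) \<partial>lborel)"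
    unfolding shift_dist_def using nn_integral_norm_add[of "\<lambda>x. f (x + p)" "\<lambda>x. - f x"] by simp
  also have "(\<integral>\<^sup>+x. ennreal (norm (f (x + p))) \<partial>lborel) = (\<integral>\<^sup>+x. ennreal (norm (f x)) \<partial>lborel)"
    by (rule nn_integral_translate[of "\<lambda>x. ennreal (norm (f x))"]) measurable
  finally show ?thesis by (simp add: mult_2)
qed

text \<open>Openness makes every point of \<open>U\<close> stay in \<open>U\<close> under small
  shifts, so the part that leaves \<open>U\<close> shrinks to a null set by dominated convergence.
  The part that enters \<open>U\<close> has the same measure, because \<open>U\<close> and its
  translate \<open>W\<close> have equal finite measure.\<close>

lemma shift_dist_indicator_open:
  fixes U :: "'a::euclidean_space set" and c :: "'b::{banach, second_countable_topology}"
  assumes U: "open U" "emeasure lborel U < \<infinity>" and p: "p \<longlonglongrightarrow> 0"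
  shows "(\<lambda>j. shift_dist (\<lambda>x. indicator U x *\<^sub>R c) (p j)) \<longlonglongrightarrow> 0"
proof -
  define V where "V j = {x\<in>U. x + p j \<in> U}" for j :: nat
  have [measurable]: "U \<in> sets borel" using U by auto
  have V[measurable]: "V j \<in> sets borel" for j unfolding V_def by measurable
  have fin: "(\<integral>\<^sup>+x. indicator U x \<partial>lborel) < \<infinity>"
    using U by (subst nn_integral_indicator) auto
  have lim: "(\<lambda>j. \<integral>\<^sup>+x. indicator (U - V j) x \<partial>lborel) \<longlonglongrightarrow> (\<integral>\<^sup>+x. 0 \<partial>(lborel :: 'a measure))"
  proof (rule nn_integral_dominated_convergence[where w = "indicator U"])
    show "AE x in lborel. (\<lambda>j. indicator (U - V j) x :: ennreal) \<longlonglongrightarrow> 0"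
    proof (rule AE_I2)
      fix x :: 'a
      show "(\<lambda>j. indicator (U - V j) x :: ennreal) \<longlonglongrightarrow> 0"
      proof (cases "x \<in> U")
        case True
        have "(\<lambda>j. x + p j) \<longlonglongrightarrow> x + 0" by (intro tendsto_intros p)
        then have "eventually (\<lambda>j. x + p j \<in> U) sequentially"
          using U True by (intro topological_tendstoD) auto
        then have "eventually (\<lambda>j. indicator (U - V j) x = (0::ennreal)) sequentially"
          by eventually_elim (use True in \<open>auto simp: V_def indicator_def\<close>)
        then show ?thesis by (rule tendsto_eventually)
      qed (auto simp: indicator_def)
    qed
  qed (use fin in \<open>auto intro!: AE_I2 simp: indicator_def\<close>)
  have *: "shift_dist (\<lambda>x. indicator U x *\<^sub>R c) (p j) \<le> ennreal (2 * norm c) * (\<integral>\<^sup>+x. indicator (U - V j) x \<partial>lborel)" for j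
  proof -
    define W where "W = (\<lambda>x. x + p j) -` U"
    have [measurable]: "W \<in> sets borel" unfolding W_def using measurable_sets[of "\<lambda>x. x + p j" borel borel U] by simp
    have VUW: "V j = U \<inter> W" by (auto simp: V_def W_def)
    have eW: "emeasure lborel W = emeasure lborel U"
    proof -
      have "emeasure lborel W = (\<integral>\<^sup>+x. indicator W x \<partial>lborel)" by (subst nn_integral_indicator) auto
      also have "\<dots> = (\<integral>\<^sup>+x. indicator U (x + p j) \<partial>lborel)"
        by (intro nn_integral_cong) (auto simp: W_def indicator_def)
      also have "\<dots> = (\<integral>\<^sup>+x. indicator U x \<partial>lborel)" by (rule nn_integral_translate) measurable
      also have "\<dots> = emeasure lborel U" by (subst nn_integral_indicator) auto
      finally show ?thesis .
    qed
    have fV: "emeasure lborel (V j) \<noteq> \<infinity>"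
      using emeasure_mono[of "V j" U lborel] U by (auto simp: V_def top_unique less_top)
    have eq: "emeasure lborel (W - V j) = emeasure lborel (U - V j)"
      using eW fV by (subst (1 2) emeasure_Diff) (auto simp: VUW)
    have "shift_dist (\<lambda>x. indicator U x *\<^sub>R c) (p j)
        \<le> (\<integral>\<^sup>+x. ennreal (norm c) * (indicator (U - V j) x + indicator (W - V j) x) \<partial>lborel)"
      unfolding shift_dist_def by (intro nn_integral_mono) (auto simp: V_def W_def indicator_def)
    also have "\<dots> = ennreal (norm c) * (emeasure lborel (U - V j) + emeasure lborel (W - V j))"
      by (subst nn_integral_cmult) (auto simp: nn_integral_add)
    also have "\<dots> = ennreal (2 * norm c) * (\<integral>\<^sup>+x. indicator (U - V j) x \<partial>lborel)"
      by (subst nn_integral_indicator) (auto simp: eq ennreal_mult simp flip: mult_2, simp add: mult_ac)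
    finally show ?thesis .
  qed
  show ?thesis
    by (rule tendsto_0_ennreal_le[OF tendsto_0_ennreal_cmult[of "\<lambda>j. \<integral>\<^sup>+x. indicator (U - V j) x \<partial>lborel" _ "ennreal (2 * norm c)"] *])
       (use lim in auto)
qed

text \<open>The property is stable under sums and, by \<open>shift_dist_le\<close>, under L1 limits,
  so indicators suffice; outer regularity replaces a measurable set by an open one.\<close>

lemma shift_dist_tendsto_0:
  fixes f :: "'a::euclidean_space \<Rightarrow> 'b::{banach, second_countable_topology}"
  assumes "integrable lborel f" "p \<longlonglongrightarrow> 0"
  shows "(\<lambda>j. shift_dist f (p j)) \<longlonglongrightarrow> 0"
  using assms(1)
proof (induction rule: integrable_induct)
  case (base A c)
  then have A: "A \<in> sets borel" by simp
  show ?case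
  proof (rule tendsto_0_ennrealI)
    fix e :: real assume e: "e > 0"
    \<comment> \<open>Chosen so that \<open>2 * norm c * e'\<close> is at most \<open>e / 2\<close>;
      the summand 4 covers \<open>c = 0\<close>.\<close>
    define e' where "e' = e / (4 * norm c + 4)"
    have e': "e' > 0" using e by (auto simp: e'_def intro!: divide_pos_pos add_nonneg_pos)
    obtain U where U: "open U" "A \<subseteq> U" "emeasure lborel (U - A) < ennreal e'"
      using outer_regular_lborel[OF A, of e'] e' by (auto simp: less_top)
    have [measurable]: "U \<in> sets borel" "A \<in> sets borel" using U A by auto
    have "emeasure lborel U = emeasure lborel A + emeasure lborel (U - A)"
      using U by (subst plus_emeasure) (auto intro!: arg_cong[where f = "emeasure lborel"])
    then have fin: "emeasure lborel U < \<infinity>" using base U(3) by (auto intro: order.strict_trans)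
    have ev: "eventually (\<lambda>j. shift_dist (\<lambda>x. indicator U x *\<^sub>R c) (p j) \<le> ennreal (e/2)) sequentially"
      using e by (intro tendsto_0_ennrealD shift_dist_indicator_open U fin assms) auto
    have le: "shift_dist (\<lambda>x. indicator A x *\<^sub>R c) q \<le> shift_dist (\<lambda>x. indicator U x *\<^sub>R c) q + ennreal (e / 2)" for q
    proof -
      have "(\<lambda>x. indicator A x *\<^sub>R c) = (\<lambda>x. indicator U x *\<^sub>R c + indicator (U - A) x *\<^sub>R (- c))"
        using U(2) by (auto simp: indicator_def fun_eq_iff)
      then have "shift_dist (\<lambda>x. indicator A x *\<^sub>R c) q \<le>
         shift_dist (\<lambda>x. indicator U x *\<^sub>R c) q + shift_dist (\<lambda>x. indicator (U - A) x *\<^sub>R (- c)) q"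
        using shift_dist_add[of "\<lambda>x. indicator U x *\<^sub>R c" "\<lambda>x. indicator (U - A) x *\<^sub>R (- c)" q] by simp
      moreover have "shift_dist (\<lambda>x. indicator (U - A) x *\<^sub>R (- c)) q \<le> ennreal (e / 2)"
      proof -
        have "shift_dist (\<lambda>x. indicator (U - A) x *\<^sub>R (- c)) q
            \<le> 2 * (\<integral>\<^sup>+x. ennreal (norm (indicator (U - A) x *\<^sub>R (- c))) \<partial>lborel)"
          by (intro shift_dist_le) measurable
        also have "(\<integral>\<^sup>+x. ennreal (norm (indicator (U - A) x *\<^sub>R (- c))) \<partial>lborel)
            = (\<integral>\<^sup>+x. ennreal (norm c) * indicator (U - A) x \<partial>lborel)"
          by (intro nn_integral_cong) (auto simp: indicator_def)
        also have "\<dots> = ennreal (norm c) * emeasure lborel (U - A)"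
          by (subst nn_integral_cmult) auto
        also have "2 * \<dots> \<le> 2 * (ennreal (norm c) * ennreal e')"
          using U(3) by (intro mult_left_mono) auto
        also have "\<dots> = ennreal (2 * norm c * e')"
          using e' by (simp add: ennreal_mult mult.assoc)
        also have "\<dots> \<le> ennreal (e / 2)"
        proof (rule ennreal_leI)
          have "e' * (4 * norm c + 4) = e"
            unfolding e'_def by (simp add: add_nonneg_eq_0_iff)
          then show "2 * norm c * e' \<le> e / 2" using e' by (simp add: algebra_simps)
        qed
        finally show ?thesis .
      qed
      ultimately show ?thesis by (rule order_trans[OF _ add_left_mono])
    qed
    from ev show "eventually (\<lambda>j. shift_dist (\<lambda>x. indicator A x *\<^sub>R c) (p j) \<le> ennreal e) sequentially"
    proof eventually_elim
      case (elim j)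
      have "shift_dist (\<lambda>x. indicator A x *\<^sub>R c) (p j) \<le> ennreal (e/2) + ennreal (e/2)"
        by (rule order_trans[OF le]) (use elim in \<open>auto intro: add_right_mono\<close>)
      then show ?case using e by (simp flip: ennreal_plus)
    qed
  qed
next
  case (add f g)
  show ?case
    by (rule tendsto_0_ennreal_le[OF _ shift_dist_add])
       (use add tendsto_add[OF add.IH(1,2)] in \<open>auto simp: integrable_iff_bounded\<close>)
next
  case (lim f s)
  have m[measurable]: "f \<in> borel_measurable borel" "\<And>i. s i \<in> borel_measurable borel"
    using lim by (auto simp: integrable_iff_bounded)
  have conv: "(\<lambda>i. \<integral>\<^sup>+x. norm (f x - s i x) \<partial>lborel) \<longlonglongrightarrow> 0"
    using lim by (intro nn_integral_dominated_convergence_norm[where w = "\<lambda>x. 2 * norm (f x)"])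
      (auto simp: integrable_iff_bounded ennreal_mult nn_integral_cmult ennreal_mult_less_top)
  show ?case
  proof (rule tendsto_0_ennrealI)
    fix e :: real assume e: "e > 0"
    have "eventually (\<lambda>i. (\<integral>\<^sup>+x. norm (f x - s i x) \<partial>lborel) \<le> ennreal (e/4)) sequentially"
      using e by (intro tendsto_0_ennrealD conv) auto
    then obtain i where i: "(\<integral>\<^sup>+x. norm (f x - s i x) \<partial>lborel) \<le> ennreal (e/4)"
      by (auto simp: eventually_sequentially)
    have "eventually (\<lambda>j. shift_dist (s i) (p j) \<le> ennreal (e/2)) sequentially"
      using e by (intro tendsto_0_ennrealD lim) auto
    then show "eventually (\<lambda>j. shift_dist f (p j) \<le> ennreal e) sequentially"
    proof eventually_elim
      case (elim j)
      have "shift_dist f (p j) \<le> shift_dist (\<lambda>x. f x - s i x) (p j) + shift_dist (s i) (p j)"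
        using shift_dist_add[of "\<lambda>x. f x - s i x" "s i" "p j"] by simp
      also have "\<dots> \<le> 2 * ennreal (e/4) + ennreal (e/2)"
        by (intro add_mono elim order_trans[OF shift_dist_le] mult_left_mono i) auto
      also have "\<dots> = ennreal e" using e by (simp flip: ennreal_plus ennreal_mult'' add: ennreal_mult[symmetric] flip: ennreal_numeral)
      finally show ?case .
    qed
  qed
qed

lemma measurable_translate_pair:
  fixes f :: "'a::euclidean_space \<Rightarrow> 'b::{banach, second_countable_topology}"
  assumes [measurable]: "f \<in> borel_measurable borel"
  shows "(\<lambda>(z, x). f (x + r *\<^sub>R z)) \<in> borel_measurable (borel \<Otimes>\<^sub>M borel)"
  by measurable

text \<open>Truncating values and support gives a bounded integrable function at small cost in mean
  square. For a function bounded by \<open>K\<close> the squared increment is at most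
  \<open>2 K\<close> times the increment, which reduces the claim to L1.\<close>

lemma sqn_shift_tendsto_0:
  fixes f :: "'a::euclidean_space \<Rightarrow> complex"
  assumes [measurable]: "f \<in> borel_measurable borel" and fin: "sqn f < \<infinity>" and p: "p \<longlonglongrightarrow> 0"
  shows "(\<lambda>j. sqn (\<lambda>x. f (x + p j) - f x)) \<longlonglongrightarrow> 0"
proof (rule tendsto_0_ennrealI)
  fix e :: real assume e: "e > 0"
  define g where "g K x = (if norm (f x) \<le> real K \<and> norm x \<le> real K then f x else 0)" for K :: nat and x
  have g_meas[measurable]: "g K \<in> borel_measurable borel" for K unfolding g_def by measurable
  have "(\<lambda>K. sqn (\<lambda>x. f x - g K x)) \<longlonglongrightarrow> (\<integral>\<^sup>+x. 0 \<partial>(lborel :: 'a measure))"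
    unfolding sqn_def
  proof (rule nn_integral_dominated_convergence[where w = "\<lambda>x. ennreal ((norm (f x))\<^sup>2)"])
    show "AE x in lborel. (\<lambda>K. ennreal ((norm (f x - g K x))\<^sup>2)) \<longlonglongrightarrow> 0"
    proof (rule AE_I2)
      fix x
      have "eventually (\<lambda>K. real K \<ge> max (norm (f x)) (norm x)) sequentially"
        by (meson eventually_sequentiallyI le_trans of_nat_ceiling of_nat_le_iff order_trans real_nat_ceiling_ge)
      then have "eventually (\<lambda>K. ennreal ((norm (f x - g K x))\<^sup>2) = 0) sequentially"
        by eventually_elim (auto simp: g_def)
      then show "(\<lambda>K. ennreal ((norm (f x - g K x))\<^sup>2)) \<longlonglongrightarrow> 0" by (rule tendsto_eventually)
    qed
    show "AE x in lborel. ennreal ((norm (f x - g j x))\<^sup>2) \<le> ennreal ((norm (f x))\<^sup>2)" for j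
      by (auto simp: g_def)
  qed (use fin in \<open>auto simp: sqn_def\<close>)
  \<comment> \<open>The remainder enters the final estimate with weight 8 and the truncation with
    weight 2, so \<open>e/12\<close> and \<open>e/6\<close> add up to \<open>e\<close>.\<close>
  then have "eventually (\<lambda>K. sqn (\<lambda>x. f x - g K x) \<le> ennreal (e/12)) sequentially"
    using e by (intro tendsto_0_ennrealD) auto
  then obtain K where K: "sqn (\<lambda>x. f x - g K x) \<le> ennreal (e/12)"
    by (auto simp: eventually_sequentially)
  have gb: "norm (g K x) \<le> real K" for x by (auto simp: g_def)
  have "(\<integral>\<^sup>+x. ennreal (norm (g K x)) \<partial>lborel) \<le> (\<integral>\<^sup>+x. ennreal (real K) * indicator (cball (0::'a) (real K)) x \<partial>lborel)"
    by (intro nn_integral_mono) (auto simp: g_def indicator_def)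
  also have "\<dots> = ennreal (real K) * emeasure lborel (cball (0::'a) (real K))"
    by (subst nn_integral_cmult) (auto intro!: borel_measurable_indicator borel_closed)
  also have "\<dots> < \<infinity>" using emeasure_lborel_cball_finite[of "0::'a" "real K"] by (auto simp: ennreal_mult_less_top)
  finally have int: "integrable lborel (g K)" by (simp add: integrable_iff_bounded)
  have sg: "sqn (\<lambda>x. g K (x + q) - g K x) \<le> ennreal (2 * real K) * shift_dist (g K) q" for q
  proof -
    have "sqn (\<lambda>x. g K (x + q) - g K x) \<le> (\<integral>\<^sup>+x. ennreal (2 * real K) * ennreal (norm (g K (x + q) - g K x)) \<partial>lborel)"
      unfolding sqn_def
    proof (intro nn_integral_mono)
      fix x
      have "norm (g K (x + q) - g K x) \<le> 2 * real K"
        using norm_triangle_ineq4[of "g K (x + q)" "g K x"] gb[of x] gb[of "x + q"] by linarith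
      then have "(norm (g K (x + q) - g K x))\<^sup>2 \<le> 2 * real K * norm (g K (x + q) - g K x)"
        by (simp add: power2_eq_square mult_right_mono)
      then show "ennreal ((norm (g K (x + q) - g K x))\<^sup>2) \<le> ennreal (2 * real K) * ennreal (norm (g K (x + q) - g K x))"
        by (simp flip: ennreal_mult add: ennreal_leI)
    qed
    also have "\<dots> = ennreal (2 * real K) * shift_dist (g K) q"
      unfolding shift_dist_def by (subst nn_integral_cmult) auto
    finally show ?thesis .
  qed
  have "(\<lambda>j. ennreal (2 * real K) * shift_dist (g K) (p j)) \<longlonglongrightarrow> 0"
    by (intro tendsto_0_ennreal_cmult shift_dist_tendsto_0 int p) auto
  then have "eventually (\<lambda>j. ennreal (2 * real K) * shift_dist (g K) (p j) \<le> ennreal (e/6)) sequentially"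
    using e by (intro tendsto_0_ennrealD) auto
  then show "eventually (\<lambda>j. sqn (\<lambda>x. f (x + p j) - f x) \<le> ennreal e) sequentially"
  proof eventually_elim
    case (elim j)
    let ?r = "\<lambda>x. f x - g K x"
    have "sqn (\<lambda>x. f (x + p j) - f x) = sqn (\<lambda>x. (?r (x + p j) - ?r x) + (g K (x + p j) - g K x))"
      by (intro arg_cong[where f = sqn]) auto
    also have "\<dots> \<le> 2 * sqn (\<lambda>x. ?r (x + p j) - ?r x) + 2 * sqn (\<lambda>x. g K (x + p j) - g K x)"
      by (rule sqn_add_le2) measurable
    also have "\<dots> \<le> 2 * (2 * sqn (\<lambda>x. ?r (x + p j)) + 2 * sqn ?r) + 2 * ennreal (e/6)"
      by (intro add_mono mult_left_mono sqn_diff_le2 order_trans[OF sg elim]) auto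
    also have "sqn (\<lambda>x. ?r (x + p j)) = sqn ?r" by (rule sqn_translate[of ?r]) measurable
    also have "2 * (2 * sqn ?r + 2 * sqn ?r) + 2 * ennreal (e/6) \<le> 2 * (2 * ennreal (e/12) + 2 * ennreal (e/12)) + 2 * ennreal (e/6)"
      by (intro add_mono mult_left_mono K) auto
    also have "\<dots> = ennreal (2 * (2 * (e/12) + 2 * (e/12)) + 2 * (e/6))"
      using e by (simp flip: ennreal_plus ennreal_mult'' add: ennreal_mult[symmetric] flip: ennreal_numeral)
    also have "2 * (2 * (e/12) + 2 * (e/12)) + 2 * (e/6) = e" by simp
    finally show ?case .
  qed
qed

section \<open>Averaging against a rapidly oscillating periodic factor\<close>

text \<open>Integrability can be dispensed with since the Bochner integral of a non-integrable
  function is 0 by convention.\<close>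

lemma norm_integral_le_nn:
  fixes f :: "_ \<Rightarrow> 'b::{banach, second_countable_topology}"
  assumes "f \<in> borel_measurable M"
  shows "ennreal (norm (integral\<^sup>L M f)) \<le> (\<integral>\<^sup>+x. ennreal (norm (f x)) \<partial>M)"
proof (cases "integrable M f")
  case True
  then show ?thesis by (rule integral_norm_bound_ennreal)
qed (simp add: not_integrable_integral_eq)

text \<open>Replacing \<open>F k x\<close> by \<open>F k (x + h k z)\<close> costs \<open>o(1)\<close>; a substitution moves the shift to \<open>Q\<close>, and
  averaging over \<open>z \<in> Z\<close> turns \<open>Q\<close> into its mean.\<close>

lemma averaging:
  fixes F :: "nat \<Rightarrow> 'a::euclidean_space \<Rightarrow> complex" and Q :: "'a \<Rightarrow> complex"
  assumes F: "\<And>k. integrable lborel (F k)"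
    and bnd: "\<And>k. (\<integral>\<^sup>+x. ennreal (norm (F k x)) \<partial>lborel) \<le> ennreal K"
    and shift: "\<And>z. (\<lambda>k. shift_dist (F k) (h k *\<^sub>R z)) \<longlonglongrightarrow> 0"
    and h: "\<And>k. h k > 0"
    and Q[measurable]: "Q \<in> borel_measurable borel" and QB: "\<And>x. norm (Q x) \<le> B"
    and Z[measurable]: "Z \<in> sets borel" and Z1: "emeasure lborel Z = 1"
    and mean: "\<And>x. (LINT z:Z|lborel. Q (x + z)) = m"
  shows "(\<lambda>k. (\<integral>x. F k x * Q (x /\<^sub>R h k) \<partial>lborel) - (\<integral>x. F k x \<partial>lborel) * m) \<longlonglongrightarrow> 0"
proof -
  have Fm[measurable]: "F k \<in> borel_measurable borel" for k using F[of k] by (auto simp: integrable_iff_bounded)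
  have B0: "B \<ge> 0" using norm_ge_zero QB[of undefined] by (rule order_trans)
  have intZ: "integrable lborel (indicator Z :: 'a \<Rightarrow> real)" using Z1 by simp
  have measZ: "measure lborel Z = 1" using Z1 by (simp add: measure_def)
  have intQ: "integrable lborel (\<lambda>x. G x * Q (c *\<^sub>R x + z))" if "integrable lborel G" for G :: "'a \<Rightarrow> complex" and c z
  proof (rule Bochner_Integration.integrable_bound)
    show "integrable lborel (\<lambda>x. B * norm (G x))" using that by simp
    show "(\<lambda>x. G x * Q (c *\<^sub>R x + z)) \<in> borel_measurable lborel"
      using that by (auto simp: integrable_iff_bounded)
    show "AE x in lborel. norm (G x * Q (c *\<^sub>R x + z)) \<le> norm (B * norm (G x))"
      using B0 by (auto simp: norm_mult mult.commute[of B] intro!: mult_left_mono QB)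
  qed
  define E where "E k z = (\<integral>x. (F k (x + h k *\<^sub>R z) - F k x) * Q (x /\<^sub>R h k + z) \<partial>lborel)" for k z
  have Em: "E k \<in> borel_measurable borel" for k
    unfolding E_def by (subst measurable_lborel2[symmetric]) (rule lborel.borel_measurable_lebesgue_integral, measurable)
  \<comment> \<open>An exact identity: by \<open>FQ\<close> the shifted term does not depend on
    \<open>z\<close>, and \<open>Z\<close> has measure 1, so all the error sits in
    \<open>E\<close>.\<close>
  have key: "(\<integral>x. F k x * Q (x /\<^sub>R h k) \<partial>lborel) - (\<integral>x. F k x \<partial>lborel) * m = (\<integral>z. indicator Z z *\<^sub>R E k z \<partial>lborel)" for k
  proof -
    have hk: "h k > 0" by (rule h)
    let ?G = "\<lambda>z x. indicator Z z *\<^sub>R (F k x * Q (x /\<^sub>R h k + z))"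
    have int2: "integrable (lborel \<Otimes>\<^sub>M lborel) (\<lambda>(z, x). ?G z x)"
    proof (rule Bochner_Integration.integrable_bound)
      have "integrable (lborel \<Otimes>\<^sub>M lborel) (\<lambda>(z, x). indicator Z z * norm (F k x))"
        by (rule lborel_pair.Fubini_integrable) (use intZ F in \<open>auto simp: abs_mult\<close>)
      then show "integrable (lborel \<Otimes>\<^sub>M lborel) (\<lambda>p. B * (case p of (z, x) \<Rightarrow> indicator Z z * norm (F k x)))"
        by (rule integrable_mult_right)
      show "(\<lambda>(z, x). ?G z x) \<in> borel_measurable (lborel \<Otimes>\<^sub>M lborel)" by measurable
      show "AE p in lborel \<Otimes>\<^sub>M lborel. norm (case p of (z, x) \<Rightarrow> ?G z x)
          \<le> norm (B * (case p of (z, x) \<Rightarrow> indicator Z z * norm (F k x)))"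
        using B0 QB by (intro AE_I2) (auto simp: split_beta norm_mult abs_mult indicator_def mult.commute[of B] intro!: mult_left_mono)
    qed
    have m1: "(\<integral>x. F k x \<partial>lborel) * m = (\<integral>z. \<integral>x. ?G z x \<partial>lborel \<partial>lborel)"
    proof -
      have "(\<integral>x. F k x \<partial>lborel) * m = (\<integral>x. F k x * m \<partial>lborel)" by simp
      also have "\<dots> = (\<integral>x. \<integral>z. ?G z x \<partial>lborel \<partial>lborel)"
      proof (rule Bochner_Integration.integral_cong[OF refl])
        fix x
        have "F k x * m = F k x * (LINT z:Z|lborel. Q (x /\<^sub>R h k + z))" by (simp add: mean)
        also have "\<dots> = (\<integral>z. ?G z x \<partial>lborel)"
          unfolding set_lebesgue_integral_def
          by (subst integral_mult_right_zero[symmetric]) (intro Bochner_Integration.integral_cong, auto)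
        finally show "F k x * m = (\<integral>z. ?G z x \<partial>lborel)" .
      qed
      also have "\<dots> = (\<integral>z. \<integral>x. ?G z x \<partial>lborel \<partial>lborel)"
        using int2 by (rule lborel_pair.Fubini_integral)
      finally show ?thesis .
    qed
    have FQ: "(\<integral>x. F k (x + h k *\<^sub>R z) * Q (x /\<^sub>R h k + z) \<partial>lborel) = (\<integral>x. F k x * Q (x /\<^sub>R h k) \<partial>lborel)" for z
      using integral_translate[of "\<lambda>x. F k x * Q (x /\<^sub>R h k)" "h k *\<^sub>R z"] hk
      by (simp add: scaleR_add_right)
    have "indicator Z z *\<^sub>R E k z = indicator Z z *\<^sub>R (\<integral>x. F k x * Q (x /\<^sub>R h k) \<partial>lborel) - (\<integral>x. ?G z x \<partial>lborel)" for z
    proof -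
      have "E k z = (\<integral>x. F k (x + h k *\<^sub>R z) * Q (x /\<^sub>R h k + z) - F k x * Q (x /\<^sub>R h k + z) \<partial>lborel)"
        unfolding E_def by (intro Bochner_Integration.integral_cong) (auto simp: algebra_simps)
      also have "\<dots> = (\<integral>x. F k (x + h k *\<^sub>R z) * Q (x /\<^sub>R h k + z) \<partial>lborel) - (\<integral>x. F k x * Q (x /\<^sub>R h k + z) \<partial>lborel)"
        by (intro Bochner_Integration.integral_diff intQ) (use F in \<open>auto simp: integrable_translate_iff\<close>)
      finally show ?thesis by (simp add: FQ scaleR_diff_right)
    qed
    then have "(\<integral>z. indicator Z z *\<^sub>R E k z \<partial>lborel) =
      (\<integral>z. indicator Z z *\<^sub>R (\<integral>x. F k x * Q (x /\<^sub>R h k) \<partial>lborel) - (\<integral>x. ?G z x \<partial>lborel) \<partial>lborel)" by simp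
    also have "\<dots> = (\<integral>z. indicator Z z *\<^sub>R (\<integral>x. F k x * Q (x /\<^sub>R h k) \<partial>lborel) \<partial>lborel) - (\<integral>z. \<integral>x. ?G z x \<partial>lborel \<partial>lborel)"
      using lborel_pair.integrable_fst[OF int2] intZ by (intro Bochner_Integration.integral_diff) auto
    also have "(\<integral>z. indicator Z z *\<^sub>R (\<integral>x. F k x * Q (x /\<^sub>R h k) \<partial>lborel) \<partial>lborel) = (\<integral>x. F k x * Q (x /\<^sub>R h k) \<partial>lborel)"
      using measZ Z1 by simp
    finally show ?thesis by (simp add: m1)
  qed
  have Eb: "ennreal (norm (E k z)) \<le> ennreal B * shift_dist (F k) (h k *\<^sub>R z)" for k z
  proof -
    have "ennreal (norm (E k z)) \<le> (\<integral>\<^sup>+x. ennreal (norm ((F k (x + h k *\<^sub>R z) - F k x) * Q (x /\<^sub>R h k + z))) \<partial>lborel)"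
      unfolding E_def by (rule norm_integral_le_nn) measurable
    also have "\<dots> \<le> (\<integral>\<^sup>+x. ennreal B * ennreal (norm (F k (x + h k *\<^sub>R z) - F k x)) \<partial>lborel)"
      using B0 by (intro nn_integral_mono) (auto simp: norm_mult mult.commute[of B] QB simp flip: ennreal_mult intro!: ennreal_leI mult_left_mono)
    also have "\<dots> = ennreal B * shift_dist (F k) (h k *\<^sub>R z)"
      unfolding shift_dist_def by (intro nn_integral_cmult) measurable
    finally show ?thesis .
  qed
  have sm[measurable]: "(\<lambda>z. shift_dist (F k) (h k *\<^sub>R z)) \<in> borel_measurable borel" for k
    unfolding shift_dist_def by (subst measurable_lborel2[symmetric]) (rule lborel.borel_measurable_nn_integral, measurable)
  \<comment> \<open>For each fixed \<open>z\<close> the error vanishes; the uniform bound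
    \<open>K\<close> supplies an integrable majorant on \<open>Z\<close>, so it also vanishes on
    average.\<close>
  have "(\<lambda>k. \<integral>\<^sup>+z. indicator Z z * shift_dist (F k) (h k *\<^sub>R z) \<partial>lborel) \<longlonglongrightarrow> (\<integral>\<^sup>+z. 0 \<partial>(lborel :: 'a measure))"
  proof (rule nn_integral_dominated_convergence[where w = "\<lambda>z. 2 * ennreal K * indicator Z z"])
    show "AE z in lborel. indicator Z z * shift_dist (F j) (h j *\<^sub>R z) \<le> 2 * ennreal K * indicator Z z" for j
      by (auto simp: indicator_def intro!: order_trans[OF shift_dist_le] mult_left_mono bnd)
    show "AE z in lborel. (\<lambda>j. indicator Z z * shift_dist (F j) (h j *\<^sub>R z)) \<longlonglongrightarrow> 0"
      by (intro AE_I2 tendsto_0_ennreal_cmult shift) (auto simp: indicator_def)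
    have "(\<integral>\<^sup>+z. 2 * ennreal K * indicator Z z \<partial>lborel) = 2 * ennreal K"
      by (subst nn_integral_cmult) (auto simp: Z1)
    then show "(\<integral>\<^sup>+z. 2 * ennreal K * indicator Z z \<partial>lborel) < \<infinity>" by (simp add: ennreal_mult_less_top)
  qed auto
  then have "(\<lambda>k. ennreal B * (\<integral>\<^sup>+z. indicator Z z * shift_dist (F k) (h k *\<^sub>R z) \<partial>lborel)) \<longlonglongrightarrow> 0"
    by (intro tendsto_0_ennreal_cmult) auto
  moreover have "ennreal (norm (\<integral>z. indicator Z z *\<^sub>R E k z \<partial>lborel)) \<le>
      ennreal B * (\<integral>\<^sup>+z. indicator Z z * shift_dist (F k) (h k *\<^sub>R z) \<partial>lborel)" for k
  proof -
    have "ennreal (norm (\<integral>z. indicator Z z *\<^sub>R E k z \<partial>lborel)) \<le> (\<integral>\<^sup>+z. ennreal (norm (indicator Z z *\<^sub>R E k z)) \<partial>lborel)"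
      using Em[of k] by (intro norm_integral_le_nn) auto
    also have "\<dots> \<le> (\<integral>\<^sup>+z. ennreal B * (indicator Z z * shift_dist (F k) (h k *\<^sub>R z)) \<partial>lborel)"
      by (intro nn_integral_mono) (auto simp: indicator_def Eb)
    also have "\<dots> = ennreal B * (\<integral>\<^sup>+z. indicator Z z * shift_dist (F k) (h k *\<^sub>R z) \<partial>lborel)"
      by (intro nn_integral_cmult) measurable
    finally show ?thesis .
  qed
  ultimately have "(\<lambda>k. ennreal (norm (\<integral>z. indicator Z z *\<^sub>R E k z \<partial>lborel))) \<longlonglongrightarrow> 0"
    by (rule tendsto_0_ennreal_le)
  then have "(\<lambda>k. norm (\<integral>z. indicator Z z *\<^sub>R E k z \<partial>lborel)) \<longlonglongrightarrow> 0"
    by (subst (asm) ennreal_0[symmetric], subst (asm) tendsto_ennreal_iff) auto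
  then show ?thesis unfolding key by (rule tendsto_norm_zero_cancel)
qed

section \<open>The Fourier transform of integrable functions\<close>

lemma measurable_cis[measurable]: "cis \<in> borel_measurable borel"
  by (intro borel_measurable_continuous_onI continuous_intros)

lemma measurable_cnj[measurable]: "cnj \<in> borel_measurable borel"
  by (intro borel_measurable_continuous_onI continuous_intros)

text \<open>The transform over \<open>lborel\<close>, for Borel functions;
  \<open>fourier_eq_ft\<close> links it with \<open>fourier\<close>.\<close>

definition ft :: "('a::euclidean_space \<Rightarrow> complex) \<Rightarrow> 'a \<Rightarrow> complex" where
  "ft f \<xi> = (\<integral>x. f x * cis (- (x \<bullet> \<xi>)) \<partial>lborel)"

lemma fourier_eq_ft:
  assumes "f \<in> borel_measurable borel"
  shows "fourier f = ft f"
proof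
  fix \<xi>
  have [measurable]: "f \<in> borel_measurable borel" by fact
  show "fourier f \<xi> = ft f \<xi>"
    unfolding fourier_def ft_def
    by (subst integral_completion) (auto simp: cis_conv_exp)
qed

lemma integrable_mult_cis:
  assumes "integrable lborel f" "g \<in> borel_measurable borel"
  shows "integrable lborel (\<lambda>x. f x * cis (g x))"
  using assms by (intro Bochner_Integration.integrable_bound[OF assms(1)]) (auto simp: norm_mult integrable_iff_bounded)

lemma measurable_ft[measurable]:
  assumes [measurable]: "f \<in> borel_measurable borel"
  shows "ft f \<in> borel_measurable borel"
  unfolding ft_def by (subst measurable_lborel2[symmetric]) (rule lborel.borel_measurable_lebesgue_integral, measurable)

text \<open>True even for non-integrable \<open>f\<close>: a unimodular factor can be undone by its
  inverse, so the integrand of \<open>ft\<close> is then not integrable either and \<open>ft\<close>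
  takes the value 0.\<close>

lemma norm_ft_le: "norm (ft f \<xi>) \<le> (\<integral>x. norm (f x) \<partial>lborel)"
proof (cases "integrable lborel f")
  case True
  have "norm (ft f \<xi>) \<le> (\<integral>x. norm (f x * cis (- (x \<bullet> \<xi>))) \<partial>lborel)"
    unfolding ft_def by (rule integral_norm_bound)
  then show ?thesis by (simp add: norm_mult)
next
  case False
  have "\<not> integrable lborel (\<lambda>x. f x * cis (- (x \<bullet> \<xi>)))"
  proof
    assume "integrable lborel (\<lambda>x. f x * cis (- (x \<bullet> \<xi>)))"
    from integrable_mult_cis[OF this, of "\<lambda>x. x \<bullet> \<xi>"] have "integrable lborel f"
      by (simp add: mult.assoc cis_mult)
    with False show False by simp
  qed
  then show ?thesis by (simp add: ft_def not_integrable_integral_eq)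
qed

text \<open>Fubini's theorem, together with the symmetry of the kernel
  \<open>cis (- (x \<bullet> \<xi>))\<close> in its two variables.\<close>

lemma ft_multiplication_formula:
  assumes f: "integrable lborel f" and g: "integrable lborel g"
  shows "(\<integral>\<xi>. ft f \<xi> * g \<xi> \<partial>lborel) = (\<integral>x. f x * ft g x \<partial>lborel)"
proof -
  have [measurable]: "f \<in> borel_measurable borel" "g \<in> borel_measurable borel"
    using f g by (auto simp: integrable_iff_bounded)
  let ?H = "\<lambda>\<xi> x. f x * g \<xi> * cis (- (x \<bullet> \<xi>))"
  have int: "integrable (lborel \<Otimes>\<^sub>M lborel) (\<lambda>(\<xi>, x). ?H \<xi> x)"
    by (rule lborel_pair.Fubini_integrable)
       (use f g in \<open>auto simp: norm_mult intro!: integrable_mult_cis\<close>)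
  have "(\<integral>\<xi>. ft f \<xi> * g \<xi> \<partial>lborel) = (\<integral>\<xi>. \<integral>x. ?H \<xi> x \<partial>lborel \<partial>lborel)"
    unfolding ft_def
    by (intro Bochner_Integration.integral_cong refl, subst integral_mult_left_zero[symmetric])
       (auto intro!: Bochner_Integration.integral_cong simp: mult_ac)
  also have "\<dots> = (\<integral>x. \<integral>\<xi>. ?H \<xi> x \<partial>lborel \<partial>lborel)"
    using int by (rule lborel_pair.Fubini_integral[symmetric])
  also have "\<dots> = (\<integral>x. f x * ft g x \<partial>lborel)"
    unfolding ft_def
    by (intro Bochner_Integration.integral_cong refl, subst integral_mult_right_zero[symmetric])
       (auto intro!: Bochner_Integration.integral_cong simp: mult_ac inner_commute)
  finally show ?thesis .
qed

section \<open>Gaussians\<close>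

text \<open>With this width the function is an eigenfunction of \<open>ft\<close>, see
  \<open>ft_gauss\<close>.\<close>

definition gauss :: "'a::euclidean_space \<Rightarrow> real" where
  "gauss x = exp (- (norm x)\<^sup>2 / 2)"

lemma gauss_pos[simp]: "gauss x > 0" and gauss_nonneg[simp]: "gauss x \<ge> 0" and gauss_le_1[simp]: "gauss x \<le> 1"
  by (auto simp: gauss_def)

lemma measurable_gauss[measurable]: "gauss \<in> borel_measurable borel"
  unfolding gauss_def by measurable

text \<open>Read off from the characteristic function of the standard normal distribution, whose
  density differs by the factor \<open>1 / sqrt (2 * pi)\<close>.\<close>

lemma gauss_real_integral:
  "integrable lborel (\<lambda>x::real. complex_of_real (exp (- x\<^sup>2 / 2)) * cis (- (x * w)))" (is ?i)
  "(\<integral>x. complex_of_real (exp (- x\<^sup>2 / 2)) * cis (- (x * w)) \<partial>(lborel :: real measure)) = complex_of_real (sqrt (2 * pi) * exp (- w\<^sup>2 / 2))" (is ?e)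
proof -
  have "integrable lborel std_normal_density" by (rule integrable_normal_density) simp
  from integrable_mult_right[OF this, of "sqrt (2 * pi)"]
  have "integrable lborel (\<lambda>x::real. exp (- x\<^sup>2 / 2))" by (simp add: std_normal_density_def)
  then have "integrable lborel (\<lambda>x::real. complex_of_real (exp (- x\<^sup>2 / 2)))" by (rule integrable_of_real)
  then show ?i by (rule integrable_mult_cis) measurable
  have "complex_of_real (exp (- (- w)\<^sup>2 / 2)) = char std_normal_distribution (- w)"
    by (simp add: char_std_normal_distribution)
  also have "\<dots> = (\<integral>x. std_normal_density x *\<^sub>R cis (- (x * w)) \<partial>lborel)"
    unfolding char_def by (subst integral_density) (auto simp: cis_conv_exp mult_ac)
  also have "\<dots> = (\<integral>x. complex_of_real (1 / sqrt (2 * pi)) * (complex_of_real (exp (- x\<^sup>2 / 2)) * cis (- (x * w))) \<partial>lborel)"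
    by (intro Bochner_Integration.integral_cong refl) (simp add: std_normal_density_def scaleR_conv_of_real mult_ac)
  also have "\<dots> = complex_of_real (1 / sqrt (2 * pi)) * (\<integral>x. complex_of_real (exp (- x\<^sup>2 / 2)) * cis (- (x * w)) \<partial>lborel)"
    by (rule integral_mult_right_zero)
  finally have *: "complex_of_real (exp (- w\<^sup>2 / 2)) = complex_of_real (1 / sqrt (2 * pi)) * (\<integral>x. complex_of_real (exp (- x\<^sup>2 / 2)) * cis (- (x * w)) \<partial>lborel)"
    by simp
  have "complex_of_real (sqrt (2 * pi) * exp (- w\<^sup>2 / 2)) = complex_of_real (sqrt (2 * pi)) * complex_of_real (exp (- w\<^sup>2 / 2))"
    by simp
  also have "\<dots> = complex_of_real (sqrt (2 * pi) * (1 / sqrt (2 * pi))) * (\<integral>x. complex_of_real (exp (- x\<^sup>2 / 2)) * cis (- (x * w)) \<partial>lborel)"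
    unfolding * of_real_mult by (simp only: mult.assoc)
  also have "complex_of_real (sqrt (2 * pi) * (1 / sqrt (2 * pi))) = 1" by simp
  finally show ?e by simp
qed

lemma gauss_prod: "complex_of_real (gauss x) * cis (- (x \<bullet> w)) =
    (\<Prod>b\<in>Basis. complex_of_real (exp (- (x \<bullet> b)\<^sup>2 / 2)) * cis (- ((x \<bullet> b) * (w \<bullet> b))))"
proof -
  have "gauss x = (\<Prod>b\<in>Basis. exp (- (x \<bullet> b)\<^sup>2 / 2))"
    unfolding gauss_def power2_norm_eq_inner
    by (subst euclidean_inner) (simp add: exp_sum sum_divide_distrib flip: power2_eq_square sum_negf)
  moreover have "cis (- (x \<bullet> w)) = (\<Prod>b\<in>Basis. cis (- ((x \<bullet> b) * (w \<bullet> b))))"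
    unfolding cis_conv_exp
    by (subst exp_sum[symmetric], simp, subst euclidean_inner) (simp add: sum_distrib_left sum_negf)
  ultimately show ?thesis by (simp add: prod.distrib)
qed

text \<open>Lebesgue measure is the image of a product of one-dimensional Lebesgue measures, under
  which \<open>gauss_prod\<close> splits the integral into one-dimensional ones.\<close>

lemma
  shows integrable_gauss_cis: "integrable lborel (\<lambda>x. complex_of_real (gauss x) * cis (- (x \<bullet> w)))"
    and ft_gauss: "ft (\<lambda>x. complex_of_real (gauss x)) w = complex_of_real (sqrt (2 * pi) ^ DIM('a) * gauss (w :: 'a::euclidean_space))"
proof -
  interpret product_sigma_finite "\<lambda>_::'a. lborel :: real measure" ..
  let ?f = "\<lambda>(b::'a) (t::real). complex_of_real (exp (- t\<^sup>2 / 2)) * cis (- (t * (w \<bullet> b)))"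
  have inn: "(\<Sum>c\<in>Basis. f c *\<^sub>R c) \<bullet> b = f b" if "b \<in> Basis" for f :: "'a \<Rightarrow> real" and b
    using that by simp
  have m: "(\<lambda>f. \<Sum>b\<in>Basis. f b *\<^sub>R b) \<in> (\<Pi>\<^sub>M b\<in>Basis. lborel :: real measure) \<rightarrow>\<^sub>M (borel :: 'a measure)"
    by measurable
  have pr: "complex_of_real (gauss (\<Sum>c\<in>Basis. f c *\<^sub>R c)) * cis (- ((\<Sum>c\<in>Basis. f c *\<^sub>R c) \<bullet> w)) = (\<Prod>b\<in>Basis. ?f b (f b))"
    for f :: "'a \<Rightarrow> real"
    unfolding gauss_prod by (intro prod.cong refl) (simp only: inn)
  have ig: "integrable (\<Pi>\<^sub>M b\<in>Basis. lborel) (\<lambda>f. \<Prod>b\<in>Basis. ?f b (f b))"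
    by (rule product_integrable_prod, simp, rule gauss_real_integral)
  show "integrable lborel (\<lambda>x. complex_of_real (gauss x) * cis (- (x \<bullet> w)))"
    by (subst lborel_eq, subst integrable_distr_eq[OF m]) (measurable, use ig in \<open>simp only: pr\<close>)
  have "ft (\<lambda>x. complex_of_real (gauss x)) w = (\<integral>f. (\<Prod>b\<in>Basis. ?f b (f b)) \<partial>(\<Pi>\<^sub>M b\<in>Basis. lborel))"
    unfolding ft_def by (subst lborel_eq, subst integral_distr[OF m]) (measurable, simp only: pr)
  also have "\<dots> = (\<Prod>b\<in>Basis. \<integral>t. ?f b t \<partial>lborel)"
    by (rule product_integral_prod, simp, rule gauss_real_integral)
  also have "\<dots> = (\<Prod>b\<in>Basis. complex_of_real (sqrt (2 * pi)) * complex_of_real (exp (- (w \<bullet> b)\<^sup>2 / 2)))"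
    by (simp only: gauss_real_integral(2) of_real_mult)
  also have "\<dots> = complex_of_real (sqrt (2 * pi)) ^ DIM('a) * (\<Prod>b\<in>Basis. complex_of_real (exp (- (w \<bullet> b)\<^sup>2 / 2)))"
    by (simp add: prod.distrib)
  also have "(\<Prod>b\<in>Basis. complex_of_real (exp (- (w \<bullet> b)\<^sup>2 / 2))) = complex_of_real (gauss w)"
    using gauss_prod[of w 0] by simp
  finally show "ft (\<lambda>x. complex_of_real (gauss x)) w = complex_of_real (sqrt (2 * pi) ^ DIM('a) * gauss w)" by simp
qed

lemma integrable_gauss: "integrable lborel (gauss :: 'a::euclidean_space \<Rightarrow> real)"
  using integrable_gauss_cis[of 0] by (simp add: complex_of_real_integrable_eq)

lemma integral_gauss: "(\<integral>x. gauss (x :: 'a::euclidean_space) \<partial>lborel) = sqrt (2 * pi) ^ DIM('a)"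
proof -
  have "complex_of_real (\<integral>x. gauss (x :: 'a) \<partial>lborel) = ft (\<lambda>x. complex_of_real (gauss x)) (0 :: 'a)"
    unfolding ft_def by simp
  then show ?thesis unfolding ft_gauss by (simp only: of_real_eq_iff) (simp add: gauss_def)
qed

lemma integrable_gauss_scale: "s \<noteq> 0 \<Longrightarrow> integrable lborel (\<lambda>x::'a::euclidean_space. gauss (s *\<^sub>R x))"
  using integrable_gauss by (subst integrable_dilate_iff) auto

text \<open>Modulation moves the centre to \<open>x\<close>, dilation sets the width
  \<open>s\<close>. As functions of \<open>y\<close> these have total mass
  \<open>(2 * pi) ^ DIM('a)\<close> and concentrate at \<open>x\<close> as \<open>s\<close> tends to
  0, which is how the transform gets inverted.\<close>

lemma ft_modulated_gauss:
  fixes x y :: "'a::euclidean_space"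
  assumes s: "s > 0"
  shows "ft (\<lambda>\<xi>. complex_of_real (gauss (s *\<^sub>R \<xi>)) * cis (x \<bullet> \<xi>)) y
    = complex_of_real (inverse s ^ DIM('a) * sqrt (2 * pi) ^ DIM('a) * gauss ((y - x) /\<^sub>R s))"
proof -
  have "ft (\<lambda>\<xi>. complex_of_real (gauss (s *\<^sub>R \<xi>)) * cis (x \<bullet> \<xi>)) y
      = (\<integral>\<xi>. complex_of_real (gauss (s *\<^sub>R \<xi>)) * cis (- (\<xi> \<bullet> (y - x))) \<partial>lborel)"
    unfolding ft_def by (intro Bochner_Integration.integral_cong refl)
      (simp add: mult.assoc cis_mult inner_diff_right inner_commute)
  also have "\<dots> = (\<bar>inverse s\<bar> ^ DIM('a)) *\<^sub>R (\<integral>\<xi>. complex_of_real (gauss (s *\<^sub>R (inverse s *\<^sub>R \<xi>))) * cis (- ((inverse s *\<^sub>R \<xi>) \<bullet> (y - x))) \<partial>lborel)"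
    using s by (intro integral_dilate) auto
  also have "(\<integral>\<xi>. complex_of_real (gauss (s *\<^sub>R (inverse s *\<^sub>R \<xi>))) * cis (- ((inverse s *\<^sub>R \<xi>) \<bullet> (y - x))) \<partial>lborel)
      = ft (\<lambda>\<xi>. complex_of_real (gauss \<xi>)) ((y - x) /\<^sub>R s)"
    unfolding ft_def using s by simp
  also have "(\<bar>inverse s\<bar> ^ DIM('a)) *\<^sub>R \<dots> = complex_of_real (inverse s ^ DIM('a) * sqrt (2 * pi) ^ DIM('a) * gauss ((y - x) /\<^sub>R s))"
    using s by (simp add: ft_gauss scaleR_conv_of_real)
  finally show ?thesis .
qed

section \<open>Plancherel's theorem\<close>

text \<open>The additive form of Cauchy-Schwarz. It avoids square roots in \<open>ennreal\<close>,
  and the choice of \<open>t\<close> recovers the smallness of a product from that of one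
  factor.\<close>

lemma nn_integral_mult_le:
  assumes [measurable]: "f \<in> borel_measurable borel" "g \<in> borel_measurable borel" and t: "t > 0"
  shows "(\<integral>\<^sup>+x. ennreal (norm (f x) * norm (g x)) \<partial>lborel) \<le> ennreal (t/2) * sqn f + ennreal (1/(2*t)) * sqn g"
proof -
  have "(\<integral>\<^sup>+x. ennreal (norm (f x) * norm (g x)) \<partial>lborel) \<le>
     (\<integral>\<^sup>+x. ennreal (t/2) * ennreal ((norm (f x))\<^sup>2) + ennreal (1/(2*t)) * ennreal ((norm (g x))\<^sup>2) \<partial>lborel)"
  proof (intro nn_integral_mono)
    fix x
    have "0 \<le> (sqrt t * norm (f x) - norm (g x) / sqrt t)\<^sup>2" by simp
    also have "\<dots> = t * (norm (f x))\<^sup>2 + (1/t) * (norm (g x))\<^sup>2 - 2 * norm (f x) * norm (g x)"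
      using t by (simp add: power2_diff power_mult_distrib power_divide field_simps)
    finally have "norm (f x) * norm (g x) \<le> t/2 * (norm (f x))\<^sup>2 + 1/(2*t) * (norm (g x))\<^sup>2" by simp
    then have "ennreal (norm (f x) * norm (g x)) \<le> ennreal (t/2 * (norm (f x))\<^sup>2 + 1/(2*t) * (norm (g x))\<^sup>2)"
      by (rule ennreal_leI)
    also have "\<dots> = ennreal (t/2) * ennreal ((norm (f x))\<^sup>2) + ennreal (1/(2*t)) * ennreal ((norm (g x))\<^sup>2)"
      using t by (subst ennreal_plus) (auto simp: ennreal_mult[symmetric])
    finally show "ennreal (norm (f x) * norm (g x)) \<le> \<dots>" .
  qed
  also have "\<dots> = ennreal (t/2) * sqn f + ennreal (1/(2*t)) * sqn g"
    unfolding sqn_def by (subst nn_integral_add) (auto simp: nn_integral_cmult)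
  finally show ?thesis .
qed

lemma Re_mult_cnj_polar: "Re (a * cnj b) = ((norm a)\<^sup>2 + (norm b)\<^sup>2 - (norm (b - a))\<^sup>2) / 2"
  unfolding cmod_power2 by (simp add: power2_eq_square algebra_simps)

text \<open>By \<open>ftg\<close> the transform of the damped conjugate is a Gaussian average of
  translates of \<open>cnj f\<close>. The multiplication formula then turns the damped energy into
  an average of autocorrelations of \<open>f\<close>, whose real parts are expressed through shift
  distances by polarization.\<close>

lemma ft_gauss_energy:
  fixes f :: "'a::euclidean_space \<Rightarrow> complex"
  assumes f: "integrable lborel f" and fin: "sqn f < \<infinity>" and s: "s > 0"
  shows "(\<integral>\<^sup>+\<xi>. ennreal ((norm (ft f \<xi>))\<^sup>2 * gauss (s *\<^sub>R \<xi>)) \<partial>lborel) =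
    ennreal (sqrt (2 * pi) ^ DIM('a) * (\<integral>z. gauss z * (enn2real (sqn f) - enn2real (sqn (\<lambda>x. f (x + s *\<^sub>R z) - f x)) / 2) \<partial>lborel))"
proof -
  let ?c = "sqrt (2 * pi) ^ DIM('a)"
  have fm[measurable]: "f \<in> borel_measurable borel" using f by (auto simp: integrable_iff_bounded)
  define g where "g \<xi> = ft f \<xi> * complex_of_real (gauss (s *\<^sub>R \<xi>))" for \<xi>
  define B where "B = (\<integral>x. norm (f x) \<partial>lborel)"
  have Bb: "norm (ft f \<xi>) \<le> B" for \<xi> unfolding B_def by (rule norm_ft_le)
  then have B0: "B \<ge> 0" using norm_ge_zero[of "ft f undefined"] order_trans by blast
  have ig: "integrable lborel (\<lambda>\<xi>. complex_of_real (gauss (s *\<^sub>R \<xi>)))"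
    using integrable_gauss_scale[of s] s by auto
  have ig': "integrable lborel (\<lambda>\<xi>. ft f \<xi> * (complex_of_real (gauss (s *\<^sub>R \<xi>)) * cis (x \<bullet> \<xi>)))" for x
    by (rule Bochner_Integration.integrable_bound[OF integrable_mult_right[OF ig, of "complex_of_real B"]])
       (use B0 Bb in \<open>auto simp: norm_mult intro!: mult_right_mono\<close>)
  have int_g: "integrable lborel (\<lambda>\<xi>. cnj (g \<xi>))" using integrable_cnj[OF ig'[of 0]] unfolding g_def by simp
  have ftg: "ft (\<lambda>\<xi>. cnj (g \<xi>)) x = complex_of_real ?c * (\<integral>z. cnj (f (x + s *\<^sub>R z)) * complex_of_real (gauss z) \<partial>lborel)" for x
  proof -
    have "ft (\<lambda>\<xi>. cnj (g \<xi>)) x = (\<integral>\<xi>. cnj (ft f \<xi> * (complex_of_real (gauss (s *\<^sub>R \<xi>)) * cis (x \<bullet> \<xi>))) \<partial>lborel)"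
      unfolding ft_def[of "\<lambda>\<xi>. cnj (g \<xi>)"] unfolding g_def
      by (intro Bochner_Integration.integral_cong refl) (simp add: cis_cnj mult.assoc inner_commute)
    also have "\<dots> = cnj (\<integral>\<xi>. ft f \<xi> * (complex_of_real (gauss (s *\<^sub>R \<xi>)) * cis (x \<bullet> \<xi>)) \<partial>lborel)"
      by (rule Bochner_Integration.integral_cnj)
    also have "(\<integral>\<xi>. ft f \<xi> * (complex_of_real (gauss (s *\<^sub>R \<xi>)) * cis (x \<bullet> \<xi>)) \<partial>lborel)
       = (\<integral>y. f y * ft (\<lambda>\<xi>. complex_of_real (gauss (s *\<^sub>R \<xi>)) * cis (x \<bullet> \<xi>)) y \<partial>lborel)"
      by (intro ft_multiplication_formula f integrable_mult_cis ig) auto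
    also have "\<dots> = (\<integral>y. f y * complex_of_real (inverse s ^ DIM('a) * ?c * gauss ((y - x) /\<^sub>R s)) \<partial>lborel)"
      using s by (simp add: ft_modulated_gauss)
    also have "\<dots> = (\<integral>y. f (y + x) * complex_of_real (inverse s ^ DIM('a) * ?c * gauss (y /\<^sub>R s)) \<partial>lborel)"
      by (subst integral_translate[of _ x, symmetric]) auto
    also have "\<dots> = (\<bar>s\<bar> ^ DIM('a)) *\<^sub>R (\<integral>z. f (s *\<^sub>R z + x) * complex_of_real (inverse s ^ DIM('a) * ?c * gauss ((s *\<^sub>R z) /\<^sub>R s)) \<partial>lborel)"
      using s by (intro integral_dilate) auto
    also have "\<dots> = (\<bar>s\<bar> ^ DIM('a)) *\<^sub>R (\<integral>z. complex_of_real (inverse s ^ DIM('a) * ?c) * (f (x + s *\<^sub>R z) * complex_of_real (gauss z)) \<partial>lborel)"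
      using s by (intro arg_cong[where f = "\<lambda>x. _ *\<^sub>R x"] Bochner_Integration.integral_cong refl) (simp add: add.commute mult_ac)
    also have "\<dots> = complex_of_real (\<bar>s\<bar> ^ DIM('a) * (inverse s ^ DIM('a) * ?c)) * (\<integral>z. f (x + s *\<^sub>R z) * complex_of_real (gauss z) \<partial>lborel)"
      by (subst integral_mult_right_zero) (simp add: scaleR_conv_of_real mult.assoc)
    also have "\<bar>s\<bar> ^ DIM('a) * (inverse s ^ DIM('a) * ?c) = ?c"
      unfolding mult.assoc[symmetric] power_mult_distrib[symmetric] using s by simp
    finally show ?thesis by (simp flip: Bochner_Integration.integral_cnj)
  qed
  define D where "D z x = f x * cnj (f (x + s *\<^sub>R z))" for z x
  have Dn: "(\<integral>\<^sup>+x. ennreal (norm (D z x)) \<partial>lborel) \<le> sqn f" for z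
  proof -
    have "(\<integral>\<^sup>+x. ennreal (norm (f x) * norm (f (x + s *\<^sub>R z))) \<partial>lborel) \<le> ennreal (1/2) * sqn f + ennreal (1/(2*1)) * sqn (\<lambda>x. f (x + s *\<^sub>R z))"
      by (rule nn_integral_mult_le) auto
    also have "\<dots> = ennreal (1/2 + 1/2) * sqn f"
      by (simp only: sqn_translate[OF fm] ennreal_plus distrib_right) simp
    finally show ?thesis by (simp add: D_def norm_mult)
  qed
  have Dint: "integrable lborel (D z)" for z
    using Dn[of z] fin unfolding D_def by (auto simp: integrable_iff_bounded intro: le_less_trans)
  have int2: "integrable (lborel \<Otimes>\<^sub>M lborel) (\<lambda>(z, x). D z x * complex_of_real (gauss z))"
  proof (rule integrableI_bounded)
    show "(\<lambda>(z, x). D z x * complex_of_real (gauss z)) \<in> borel_measurable (lborel \<Otimes>\<^sub>M lborel)"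
      unfolding D_def by measurable
    have "(\<integral>\<^sup>+p. ennreal (norm (case p of (z, x) \<Rightarrow> D z x * complex_of_real (gauss z))) \<partial>(lborel \<Otimes>\<^sub>M lborel))
       = (\<integral>\<^sup>+z. \<integral>\<^sup>+x. ennreal (norm (D z x * complex_of_real (gauss z))) \<partial>lborel \<partial>lborel)"
      unfolding D_def by (subst lborel.nn_integral_fst[symmetric]) auto
    also have "\<dots> = (\<integral>\<^sup>+z. ennreal (gauss z) * (\<integral>\<^sup>+x. ennreal (norm (D z x)) \<partial>lborel) \<partial>lborel)"
      using Dint by (intro nn_integral_cong, subst nn_integral_cmult[symmetric])
        (auto simp: norm_mult ennreal_mult mult.commute integrable_iff_bounded)
    also have "\<dots> \<le> (\<integral>\<^sup>+z. ennreal (gauss z) * sqn f \<partial>(lborel::'a measure))"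
      by (intro nn_integral_mono mult_left_mono Dn) auto
    also have "\<dots> = (\<integral>\<^sup>+z. ennreal (gauss z) \<partial>(lborel::'a measure)) * sqn f" by (subst nn_integral_multc) auto
    also have "\<dots> < \<infinity>"
      using fin integrable_gauss by (auto simp: ennreal_mult_less_top integrable_iff_bounded)
    finally show "(\<integral>\<^sup>+p. ennreal (norm (case p of (z, x) \<Rightarrow> D z x * complex_of_real (gauss z))) \<partial>(lborel \<Otimes>\<^sub>M lborel)) < \<infinity>" .
  qed
  have cint: "complex_integrable lborel (\<lambda>z. (\<integral>x. D z x \<partial>lborel) * complex_of_real (gauss z))"
    using lborel_pair.integrable_fst[OF int2] by simp
  have "(\<integral>\<xi>. complex_of_real ((norm (ft f \<xi>))\<^sup>2 * gauss (s *\<^sub>R \<xi>)) \<partial>lborel) = (\<integral>\<xi>. ft f \<xi> * cnj (g \<xi>) \<partial>lborel)"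
    unfolding g_def by (intro Bochner_Integration.integral_cong refl) (simp only: of_real_mult complex_norm_square complex_cnj_mult complex_cnj_complex_of_real mult.assoc)
  also have "\<dots> = (\<integral>x. f x * ft (\<lambda>\<xi>. cnj (g \<xi>)) x \<partial>lborel)"
    by (rule ft_multiplication_formula[OF f int_g])
  also have "\<dots> = (\<integral>x. complex_of_real ?c * (\<integral>z. D z x * complex_of_real (gauss z) \<partial>lborel) \<partial>lborel)"
  proof (intro Bochner_Integration.integral_cong refl)
    fix x
    have "f x * (\<integral>z. cnj (f (x + s *\<^sub>R z)) * complex_of_real (gauss z) \<partial>lborel) = (\<integral>z. D z x * complex_of_real (gauss z) \<partial>lborel)"
      unfolding D_def by (subst integral_mult_right_zero[symmetric]) (simp add: mult.assoc)
    then show "f x * ft (\<lambda>\<xi>. cnj (g \<xi>)) x = complex_of_real ?c * (\<integral>z. D z x * complex_of_real (gauss z) \<partial>lborel)"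
      unfolding ftg by (simp only: mult.left_commute[of "f x" "complex_of_real ?c"])
  qed
  also have "\<dots> = complex_of_real ?c * (\<integral>x. (\<integral>z. D z x * complex_of_real (gauss z) \<partial>lborel) \<partial>lborel)"
    by (rule integral_mult_right_zero)
  also have "(\<integral>x. (\<integral>z. D z x * complex_of_real (gauss z) \<partial>lborel) \<partial>lborel) = (\<integral>z. (\<integral>x. D z x * complex_of_real (gauss z) \<partial>lborel) \<partial>lborel)"
    by (rule lborel_pair.Fubini_integral[OF int2])
  also have "\<dots> = (\<integral>z. (\<integral>x. D z x \<partial>lborel) * complex_of_real (gauss z) \<partial>lborel)" by simp
  finally have "complex_of_real (\<integral>\<xi>. (norm (ft f \<xi>))\<^sup>2 * gauss (s *\<^sub>R \<xi>) \<partial>lborel)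
     = complex_of_real ?c * (\<integral>z. (\<integral>x. D z x \<partial>lborel) * complex_of_real (gauss z) \<partial>lborel)"
    by (simp only: integral_complex_of_real)
  \<comment> \<open>The left side is real, so nothing is lost; only the real part of the
    autocorrelation has an expression by norms.\<close>
  then have "Re (complex_of_real (\<integral>\<xi>. (norm (ft f \<xi>))\<^sup>2 * gauss (s *\<^sub>R \<xi>) \<partial>lborel))
     = Re (complex_of_real ?c * (\<integral>z. (\<integral>x. D z x \<partial>lborel) * complex_of_real (gauss z) \<partial>lborel))"
    by (rule arg_cong)
  then have "(\<integral>\<xi>. (norm (ft f \<xi>))\<^sup>2 * gauss (s *\<^sub>R \<xi>) \<partial>lborel)
     = ?c * Re (\<integral>z. (\<integral>x. D z x \<partial>lborel) * complex_of_real (gauss z) \<partial>lborel)"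
    by (simp only: times_complex.sel Re_complex_of_real Im_complex_of_real mult_zero_left diff_zero)
  also have "Re (\<integral>z. (\<integral>x. D z x \<partial>lborel) * complex_of_real (gauss z) \<partial>lborel) = (\<integral>z. Re ((\<integral>x. D z x \<partial>lborel) * complex_of_real (gauss z)) \<partial>lborel)"
    using cint by (rule integral_Re[symmetric])
  also have "\<dots> = (\<integral>z. gauss z * (enn2real (sqn f) - enn2real (sqn (\<lambda>x. f (x + s *\<^sub>R z) - f x)) / 2) \<partial>lborel)"
  proof (intro Bochner_Integration.integral_cong refl)
    fix z
    let ?f' = "\<lambda>x. f (x + s *\<^sub>R z)"
    have f'm[measurable]: "?f' \<in> borel_measurable borel" by measurable
    have f'fin: "sqn ?f' < \<infinity>" using fin by (simp add: sqn_translate)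
    have dfin: "sqn (\<lambda>x. ?f' x - f x) < \<infinity>"
      using sqn_diff_le2[OF f'm fm] fin f'fin by (auto simp: ennreal_mult_less_top intro: le_less_trans)
    have i1: "integrable lborel (\<lambda>x. (norm (f x))\<^sup>2)" "integrable lborel (\<lambda>x. (norm (?f' x))\<^sup>2)"
      "integrable lborel (\<lambda>x. (norm (?f' x - f x))\<^sup>2)"
      using sqn_finite_iff[OF fm] sqn_finite_iff[OF f'm] sqn_finite_iff[of "\<lambda>x. ?f' x - f x"] fin f'fin dfin by auto
    have sq: "enn2real (sqn h) = (\<integral>x. (norm (h x))\<^sup>2 \<partial>lborel)" if "h \<in> borel_measurable borel" "sqn h < \<infinity>" for h :: "'a \<Rightarrow> complex"
      using sqn_eq_integral[OF that] by simp
    have "Re (\<integral>x. D z x \<partial>lborel) = (\<integral>x. Re (D z x) \<partial>lborel)" by (rule integral_Re[symmetric, OF Dint])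
    also have "\<dots> = (\<integral>x. ((norm (f x))\<^sup>2 + (norm (?f' x))\<^sup>2 - (norm (?f' x - f x))\<^sup>2) / 2 \<partial>lborel)"
      unfolding D_def Re_mult_cnj_polar by simp
    also have "\<dots> = (enn2real (sqn f) + enn2real (sqn ?f') - enn2real (sqn (\<lambda>x. ?f' x - f x))) / 2"
      using i1 fin f'fin dfin by (simp add: sq)
    also have "sqn ?f' = sqn f" by (rule sqn_translate) measurable
    finally have "Re (\<integral>x. D z x \<partial>lborel) = enn2real (sqn f) - enn2real (sqn (\<lambda>x. ?f' x - f x)) / 2"
      by (simp add: field_simps)
    then show "Re ((\<integral>x. D z x \<partial>lborel) * complex_of_real (gauss z)) =
        gauss z * (enn2real (sqn f) - enn2real (sqn (\<lambda>x. ?f' x - f x)) / 2)"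
      by simp
  qed
  finally have eq: "(\<integral>\<xi>. (norm (ft f \<xi>))\<^sup>2 * gauss (s *\<^sub>R \<xi>) \<partial>lborel) =
      ?c * (\<integral>z. gauss z * (enn2real (sqn f) - enn2real (sqn (\<lambda>x. f (x + s *\<^sub>R z) - f x)) / 2) \<partial>lborel)" .
  have "integrable lborel (\<lambda>\<xi>. (norm (ft f \<xi>))\<^sup>2 * gauss (s *\<^sub>R \<xi>))"
  proof (rule Bochner_Integration.integrable_bound)
    show "integrable lborel (\<lambda>\<xi>::'a. B\<^sup>2 * gauss (s *\<^sub>R \<xi>))"
      using integrable_gauss_scale[of s] s by auto
  qed (use B0 Bb in \<open>auto simp: abs_mult intro!: mult_right_mono power_mono\<close>)
  then show ?thesis unfolding eq[symmetric] by (intro nn_integral_eq_integral) auto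
qed


text \<open>Let \<open>s\<close> tend to 0 in \<open>ft_gauss_energy\<close>. The left side
  increases to the full energy by monotone convergence; the right side converges by dominated
  convergence, as translations are continuous in mean square. One factor
  \<open>sqrt (2 * pi) ^ DIM('a)\<close> comes from the transform of the Gaussian, the other from
  its integral.\<close>

theorem plancherel:
  fixes f :: "'a::euclidean_space \<Rightarrow> complex"
  assumes f: "integrable lborel f" and fin: "sqn f < \<infinity>"
  shows "sqn (ft f) = ennreal ((2 * pi) ^ DIM('a)) * sqn f"
proof -
  let ?c = "sqrt (2 * pi) ^ DIM('a)"
  have fm[measurable]: "f \<in> borel_measurable borel" using f by (auto simp: integrable_iff_bounded)
  define N where "N = enn2real (sqn f)"
  have N0: "N \<ge> 0" and Nf: "sqn f = ennreal N" using fin by (auto simp: N_def less_top)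
  define s where "s n = 1 / real (Suc n)" for n
  have s: "s n > 0" for n by (simp add: s_def)
  have slim: "s \<longlonglongrightarrow> 0" unfolding s_def using LIMSEQ_inverse_real_of_nat by (simp add: inverse_eq_divide)
  define D where "D p = enn2real (sqn (\<lambda>x. f (x + p) - f x))" for p
  have D4: "sqn (\<lambda>x. f (x + p) - f x) \<le> ennreal (4 * N)" for p
  proof -
    have "sqn (\<lambda>x. f (x + p) - f x) \<le> 2 * sqn (\<lambda>x. f (x + p)) + 2 * sqn f" by (rule sqn_diff_le2) measurable
    also have "\<dots> = ennreal (4 * N)" using N0 by (simp add: sqn_translate Nf ennreal_mult flip: distrib_right)
    finally show ?thesis .
  qed
  have Db: "0 \<le> D p" "D p \<le> 4 * N" for p
    using enn2real_mono[OF D4[of p]] N0 by (auto simp: D_def)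
  have Dlim: "(\<lambda>n. D (p n)) \<longlonglongrightarrow> 0" if "p \<longlonglongrightarrow> 0" for p
  proof -
    have "sqn (\<lambda>x. f (x + p n) - f x) = ennreal (D (p n))" for n
      using D4[of "p n"] unfolding D_def by (subst ennreal_enn2real) (auto simp: less_top[symmetric] top_unique)
    then have "(\<lambda>n. ennreal (D (p n))) \<longlonglongrightarrow> ennreal 0"
      using sqn_shift_tendsto_0[OF fm fin that] by simp
    then show ?thesis by (subst (asm) tendsto_ennreal_iff) (auto simp: Db)
  qed
  have Dm[measurable]: "D \<in> borel_measurable borel"
    unfolding D_def sqn_def by (subst measurable_lborel2[symmetric]) measurable
  have lim1: "(\<lambda>n. \<integral>z. gauss z * (N - D (s n *\<^sub>R z) / 2) \<partial>lborel) \<longlonglongrightarrow> (\<integral>z. gauss (z::'a) * (N - 0 / 2) \<partial>lborel)"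
  proof (rule integral_dominated_convergence[where w = "\<lambda>z. gauss z * N"])
    show "AE z in lborel. (\<lambda>n. gauss z * (N - D (s n *\<^sub>R z) / 2)) \<longlonglongrightarrow> gauss z * (N - 0 / 2)"
    proof (rule AE_I2)
      fix z :: 'a
      have "(\<lambda>n. s n *\<^sub>R z) \<longlonglongrightarrow> 0 *\<^sub>R z" by (intro tendsto_intros slim)
      then have "(\<lambda>n. D (s n *\<^sub>R z)) \<longlonglongrightarrow> 0" by (intro Dlim) simp
      then show "(\<lambda>n. gauss z * (N - D (s n *\<^sub>R z) / 2)) \<longlonglongrightarrow> gauss z * (N - 0 / 2)" by (intro tendsto_intros) auto
    qed
    show "AE z in lborel. norm (gauss z * (N - D (s n *\<^sub>R z) / 2)) \<le> gauss z * N" for n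
    proof (rule AE_I2)
      fix z :: 'a
      have "\<bar>N - D (s n *\<^sub>R z) / 2\<bar> \<le> N" using Db[of "s n *\<^sub>R z"] by (auto simp: abs_le_iff)
      then show "norm (gauss z * (N - D (s n *\<^sub>R z) / 2)) \<le> gauss z * N" by (simp add: abs_mult mult_left_mono)
    qed
  qed (use integrable_gauss in auto)
  have lim: "(\<lambda>n. ennreal (?c * (\<integral>z. gauss z * (N - D (s n *\<^sub>R z) / 2) \<partial>(lborel::'a measure)))) \<longlonglongrightarrow> ennreal (?c * (?c * N))"
    using lim1 by (intro tendsto_ennrealI tendsto_intros) (simp add: integral_gauss)
  have en: "(\<integral>\<^sup>+\<xi>. ennreal ((norm (ft f \<xi>))\<^sup>2 * gauss (s n *\<^sub>R \<xi>)) \<partial>lborel) = ennreal (?c * (\<integral>z. gauss z * (N - D (s n *\<^sub>R z) / 2) \<partial>(lborel::'a measure)))" for n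
    unfolding N_def D_def by (rule ft_gauss_energy[OF f fin s])
  have gmono: "gauss (s m *\<^sub>R \<xi>) \<le> gauss (s n *\<^sub>R \<xi>)" if "m \<le> n" for m n and \<xi> :: 'a
  proof -
    have "s n \<le> s m" using that by (auto simp: s_def frac_le)
    then have "norm (s n *\<^sub>R \<xi>) \<le> norm (s m *\<^sub>R \<xi>)" using s[of n] s[of m] by (simp add: mult_right_mono)
    then show ?thesis by (simp add: gauss_def power_mono)
  qed
  have inc: "incseq (\<lambda>n \<xi>. ennreal ((norm (ft f \<xi>))\<^sup>2 * gauss (s n *\<^sub>R \<xi>)))"
    by (auto simp: incseq_def le_fun_def intro!: ennreal_leI mult_left_mono gmono)
  have glim: "(\<lambda>n. gauss (s n *\<^sub>R \<xi>)) \<longlonglongrightarrow> 1" for \<xi> :: 'a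
  proof -
    have "(\<lambda>n. exp (- (norm (s n *\<^sub>R \<xi>))\<^sup>2 / 2)) \<longlonglongrightarrow> exp (- (norm (0 *\<^sub>R \<xi>))\<^sup>2 / 2)"
      by (intro tendsto_intros slim) auto
    then show ?thesis by (simp add: gauss_def)
  qed
  have sup: "(SUP n. ennreal ((norm (ft f \<xi>))\<^sup>2 * gauss (s n *\<^sub>R \<xi>))) = ennreal ((norm (ft f \<xi>))\<^sup>2)" for \<xi>
  proof (rule LIMSEQ_unique)
    show "(\<lambda>n. ennreal ((norm (ft f \<xi>))\<^sup>2 * gauss (s n *\<^sub>R \<xi>))) \<longlonglongrightarrow> (SUP n. ennreal ((norm (ft f \<xi>))\<^sup>2 * gauss (s n *\<^sub>R \<xi>)))"
      using inc by (intro LIMSEQ_SUP) (auto simp: incseq_def le_fun_def)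
    have "(\<lambda>n. (norm (ft f \<xi>))\<^sup>2 * gauss (s n *\<^sub>R \<xi>)) \<longlonglongrightarrow> (norm (ft f \<xi>))\<^sup>2 * 1" by (intro tendsto_intros glim)
    then show "(\<lambda>n. ennreal ((norm (ft f \<xi>))\<^sup>2 * gauss (s n *\<^sub>R \<xi>))) \<longlonglongrightarrow> ennreal ((norm (ft f \<xi>))\<^sup>2)"
      by (intro tendsto_ennrealI) simp
  qed
  have "sqn (ft f) = (SUP n. \<integral>\<^sup>+\<xi>. ennreal ((norm (ft f \<xi>))\<^sup>2 * gauss (s n *\<^sub>R \<xi>)) \<partial>lborel)"
    unfolding sqn_def sup[symmetric] by (rule nn_integral_monotone_convergence_SUP[OF inc]) measurable
  also have "\<dots> = ennreal (?c * (?c * N))"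
  proof (rule LIMSEQ_unique)
    show "(\<lambda>n. \<integral>\<^sup>+\<xi>. ennreal ((norm (ft f \<xi>))\<^sup>2 * gauss (s n *\<^sub>R \<xi>)) \<partial>lborel) \<longlonglongrightarrow> (SUP n. \<integral>\<^sup>+\<xi>. ennreal ((norm (ft f \<xi>))\<^sup>2 * gauss (s n *\<^sub>R \<xi>)) \<partial>lborel)"
      using inc by (intro LIMSEQ_SUP) (auto simp: incseq_def le_fun_def intro!: nn_integral_mono)
    show "(\<lambda>n. \<integral>\<^sup>+\<xi>. ennreal ((norm (ft f \<xi>))\<^sup>2 * gauss (s n *\<^sub>R \<xi>)) \<partial>lborel) \<longlonglongrightarrow> ennreal (?c * (?c * N))"
      unfolding en by (rule lim)
  qed
  also have "?c * (?c * N) = (2 * pi) ^ DIM('a) * N"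
    unfolding mult.assoc[symmetric] power_mult_distrib[symmetric] by simp
  finally show ?thesis using N0 by (simp add: Nf ennreal_mult)
qed

section \<open>Schwartz functions\<close>

lemma iter_partial_append: "iter_partial (bs @ cs) f = iter_partial bs (iter_partial cs f)"
  by (simp add: iter_partial_def)

lemma schwartz_partial_deriv:
  assumes "f \<in> schwartz" "b \<in> Basis"
  shows "partial_deriv b f \<in> schwartz"
proof -
  \<comment> \<open>\<open>foldr\<close> applies the last entry of the list first, so the innermost
    derivative goes to the end.\<close>
  have "iter_partial bs (partial_deriv b f) = iter_partial (bs @ [b]) f" for bs
    by (simp add: iter_partial_append) (simp add: iter_partial_def)
  moreover have "bs @ [b] \<in> lists Basis" if "bs \<in> lists Basis" for bs using that assms by auto
  ultimately show ?thesis using assms(1) unfolding schwartz_def by auto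
qed

lemma schwartz_differentiable:
  assumes "f \<in> schwartz"
  shows "f differentiable (at x)"
proof -
  have "iter_partial [] f differentiable (at x)" using assms unfolding schwartz_def by blast
  then show ?thesis by (simp add: iter_partial_def)
qed

lemma schwartz_continuous: "f \<in> schwartz \<Longrightarrow> continuous_on A f"
  by (meson continuous_at_imp_continuous_on differentiable_imp_continuous_within schwartz_differentiable)

lemma schwartz_measurable: "f \<in> schwartz \<Longrightarrow> f \<in> borel_measurable borel"
  by (intro borel_measurable_continuous_onI schwartz_continuous)

lemma schwartz_bounded:
  assumes "f \<in> schwartz"
  obtains C where "C > 0" "\<And>x. (1 + norm x) ^ m * norm (f x) \<le> C"
proof -
  have "bounded (range (\<lambda>x. (1 + norm x) ^ m *\<^sub>R iter_partial [] f x))"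
    using assms unfolding schwartz_def by blast
  then obtain C where "C > 0" "\<And>x. norm ((1 + norm x) ^ m *\<^sub>R f x) \<le> C"
    by (auto simp: bounded_pos iter_partial_def)
  then show ?thesis by (intro that[of C]) auto
qed

text \<open>The span of polynomials times a modulated Gaussian is stable under partial derivatives.\<close>

inductive_set poly_gauss :: "real \<Rightarrow> 'a::euclidean_space \<Rightarrow> ('a \<Rightarrow> complex) set" for s x where
  base: "(\<lambda>\<xi>. complex_of_real (gauss (s *\<^sub>R \<xi>)) * cis (x \<bullet> \<xi>)) \<in> poly_gauss s x"
| coord: "f \<in> poly_gauss s x \<Longrightarrow> b \<in> Basis \<Longrightarrow> (\<lambda>\<xi>. complex_of_real (\<xi> \<bullet> b) * f \<xi>) \<in> poly_gauss s x"
| scale: "f \<in> poly_gauss s x \<Longrightarrow> (\<lambda>\<xi>. c * f \<xi>) \<in> poly_gauss s x"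
| plus: "f \<in> poly_gauss s x \<Longrightarrow> g \<in> poly_gauss s x \<Longrightarrow> (\<lambda>\<xi>. f \<xi> + g \<xi>) \<in> poly_gauss s x"

lemma modulated_gauss_exp:
  "complex_of_real (gauss (s *\<^sub>R \<xi>)) * cis (x \<bullet> \<xi>) = exp (complex_of_real (- (s\<^sup>2 * (\<xi> \<bullet> \<xi>)) / 2) + \<i> * complex_of_real (x \<bullet> \<xi>))"
proof -
  have "gauss (s *\<^sub>R \<xi>) = exp (- (s\<^sup>2 * (\<xi> \<bullet> \<xi>)) / 2)"
    unfolding gauss_def power2_norm_eq_inner by (simp add: power2_eq_square mult.assoc)
  then show ?thesis by (simp only: cis_conv_exp exp_add exp_of_real)
qed

text \<open>The derivative and the membership of its components are proved in one induction, since
  the product rule in the case \<open>coord\<close> brings in both \<open>f\<close> and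
  \<open>f'\<close>.\<close>

lemma poly_gauss_deriv:
  assumes "f \<in> poly_gauss s x"
  shows "\<exists>f'. (\<forall>\<xi>. (f has_derivative f' \<xi>) (at \<xi>)) \<and> (\<forall>b\<in>Basis. (\<lambda>\<xi>. f' \<xi> b) \<in> poly_gauss s x)"
  using assms
proof induction
  case base
  let ?G = "\<lambda>\<xi>. complex_of_real (gauss (s *\<^sub>R \<xi>)) * cis (x \<bullet> \<xi>)"
  let ?f' = "\<lambda>\<xi> v. (complex_of_real (- (s\<^sup>2 * (\<xi> \<bullet> v))) + \<i> * complex_of_real (x \<bullet> v)) * ?G \<xi>"
  have "(?G has_derivative ?f' \<xi>) (at \<xi>)" for \<xi>
  proof -
    have "((\<lambda>\<xi>. complex_of_real (- (s\<^sup>2 * (\<xi> \<bullet> \<xi>)) / 2) + \<i> * complex_of_real (x \<bullet> \<xi>)) has_derivative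
        (\<lambda>v. complex_of_real (- (s\<^sup>2 * (\<xi> \<bullet> v))) + \<i> * complex_of_real (x \<bullet> v))) (at \<xi>)"
      by (rule has_derivative_eq_rhs, (rule derivative_intros)+)
         (auto simp: fun_eq_iff inner_commute algebra_simps intro!: bounded_linear_imp_has_derivative bounded_linear_const_mult bounded_linear_compose[OF bounded_linear_of_real] bounded_linear_inner_left)
    from has_derivative_compose[OF this DERIV_exp[unfolded has_field_derivative_def]] show ?thesis
      unfolding modulated_gauss_exp by (rule has_derivative_eq_rhs) (auto simp: fun_eq_iff mult_ac)
  qed
  moreover have "(\<lambda>\<xi>. ?f' \<xi> b) \<in> poly_gauss s x" if "b \<in> Basis" for b
  proof -
    have "(\<lambda>\<xi>. complex_of_real (- (s\<^sup>2)) * (complex_of_real (\<xi> \<bullet> b) * ?G \<xi>) + (\<i> * complex_of_real (x \<bullet> b)) * ?G \<xi>) \<in> poly_gauss s x"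
      by (intro poly_gauss.intros that)
    then show ?thesis by (simp add: algebra_simps)
  qed
  ultimately show ?case by (intro exI[of _ ?f'] conjI allI ballI)
next
  case (coord f b)
  then obtain f' where f': "\<And>\<xi>. (f has_derivative f' \<xi>) (at \<xi>)" "\<And>b. b \<in> Basis \<Longrightarrow> (\<lambda>\<xi>. f' \<xi> b) \<in> poly_gauss s x"
    by blast
  have "((\<lambda>\<xi>. complex_of_real (\<xi> \<bullet> b) * f \<xi>) has_derivative (\<lambda>v. complex_of_real (\<xi> \<bullet> b) * f' \<xi> v + complex_of_real (v \<bullet> b) * f \<xi>)) (at \<xi>)" for \<xi>
    by (rule has_derivative_eq_rhs, (rule derivative_intros f')+) (auto simp: fun_eq_iff)
  moreover have "(\<lambda>\<xi>. complex_of_real (\<xi> \<bullet> b) * f' \<xi> c + complex_of_real (c \<bullet> b) * f \<xi>) \<in> poly_gauss s x" if "c \<in> Basis" for c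
    by (intro poly_gauss.intros f' coord that)
  ultimately show ?case by (intro exI[of _ "\<lambda>\<xi> v. complex_of_real (\<xi> \<bullet> b) * f' \<xi> v + complex_of_real (v \<bullet> b) * f \<xi>"]) auto
next
  case (scale f c)
  then obtain f' where f': "\<And>\<xi>. (f has_derivative f' \<xi>) (at \<xi>)" "\<And>b. b \<in> Basis \<Longrightarrow> (\<lambda>\<xi>. f' \<xi> b) \<in> poly_gauss s x"
    by blast
  have "((\<lambda>\<xi>. c * f \<xi>) has_derivative (\<lambda>v. c * f' \<xi> v)) (at \<xi>)" for \<xi>
    by (intro has_derivative_mult_right f')
  then show ?case by (intro exI[of _ "\<lambda>\<xi> v. c * f' \<xi> v"]) (auto intro: poly_gauss.intros f')
next
  case (plus f g)
  then obtain f' g' where f': "\<And>\<xi>. (f has_derivative f' \<xi>) (at \<xi>)" "\<And>b. b \<in> Basis \<Longrightarrow> (\<lambda>\<xi>. f' \<xi> b) \<in> poly_gauss s x"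
     and g': "\<And>\<xi>. (g has_derivative g' \<xi>) (at \<xi>)" "\<And>b. b \<in> Basis \<Longrightarrow> (\<lambda>\<xi>. g' \<xi> b) \<in> poly_gauss s x"
    by metis
  have "((\<lambda>\<xi>. f \<xi> + g \<xi>) has_derivative (\<lambda>v. f' \<xi> v + g' \<xi> v)) (at \<xi>)" for \<xi>
    by (intro has_derivative_add f' g')
  then show ?case by (intro exI[of _ "\<lambda>\<xi> v. f' \<xi> v + g' \<xi> v"]) (auto intro: poly_gauss.intros f' g')
qed

lemma poly_gauss_partial:
  assumes "f \<in> poly_gauss s x" "b \<in> Basis"
  shows "partial_deriv b f \<in> poly_gauss s x"
proof -
  obtain f' where f': "\<And>\<xi>. (f has_derivative f' \<xi>) (at \<xi>)" "(\<lambda>\<xi>. f' \<xi> b) \<in> poly_gauss s x"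
    using poly_gauss_deriv[OF assms(1)] assms(2) by blast
  have "partial_deriv b f = (\<lambda>\<xi>. f' \<xi> b)"
    unfolding partial_deriv_def using frechet_derivative_at[OF f'(1)] by (auto simp: fun_eq_iff)
  with f' show ?thesis by simp
qed

text \<open>The exponent \<open>m\<close> is arbitrary in the induction because a coordinate factor
  is paid for by raising \<open>m\<close> by one.\<close>

lemma poly_gauss_bounded:
  assumes s: "s > 0" and "f \<in> poly_gauss s x"
  shows "\<exists>C. \<forall>\<xi>. (1 + norm \<xi>) ^ m * norm (f \<xi>) \<le> C"
  using assms(2)
proof (induction arbitrary: m)
  case base
  \<comment> \<open>With \<open>r = norm \<xi>\<close>, \<open>(1 + r) ^ m\<close> is at most
    \<open>exp (m r)\<close>, and \<open>m r - s^2 r^2 / 2\<close> is largest at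
    \<open>r = m / s^2\<close>.\<close>
  have "(1 + norm \<xi>) ^ m * norm (complex_of_real (gauss (s *\<^sub>R \<xi>)) * cis (x \<bullet> \<xi>)) \<le> exp ((real m)\<^sup>2 / (2 * s\<^sup>2))" for \<xi>
  proof -
    let ?r = "norm \<xi>"
    have "(1 + ?r) ^ m \<le> exp ?r ^ m" by (intro power_mono exp_ge_add_one_self) auto
    also have "\<dots> = exp (real m * ?r)" by (simp add: exp_of_nat_mult)
    finally have "(1 + ?r) ^ m * gauss (s *\<^sub>R \<xi>) \<le> exp (real m * ?r) * gauss (s *\<^sub>R \<xi>)"
      by (intro mult_right_mono) auto
    also have "\<dots> = exp (real m * ?r - s\<^sup>2 * ?r\<^sup>2 / 2)"
      by (simp add: gauss_def power_mult_distrib flip: exp_add)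
    also have "\<dots> \<le> exp ((real m)\<^sup>2 / (2 * s\<^sup>2))"
    proof -
      have "0 \<le> (s * ?r - real m / s)\<^sup>2" by simp
      also have "\<dots> = s\<^sup>2 * ?r\<^sup>2 - 2 * (real m * ?r) + (real m)\<^sup>2 / s\<^sup>2"
        using s by (simp add: power2_diff power_mult_distrib power_divide)
      finally have "0 \<le> s\<^sup>2 * ?r\<^sup>2 - 2 * (real m * ?r) + (real m)\<^sup>2 / s\<^sup>2" .
      moreover have "B - A / 2 \<le> D / 2" if "0 \<le> A - 2 * B + D" for A B D :: real using that by simp
      ultimately have "real m * ?r - s\<^sup>2 * ?r\<^sup>2 / 2 \<le> (real m)\<^sup>2 / s\<^sup>2 / 2" by blast
      then show ?thesis by (simp add: mult.commute)
    qed
    finally show ?thesis by (simp add: norm_mult)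
  qed
  then show ?case by blast
next
  case (coord f b)
  obtain C where C: "\<And>\<xi>. (1 + norm \<xi>) ^ Suc m * norm (f \<xi>) \<le> C" using coord.IH[of "Suc m"] by blast
  have "(1 + norm \<xi>) ^ m * norm (complex_of_real (\<xi> \<bullet> b) * f \<xi>) \<le> C" for \<xi>
  proof -
    have "\<bar>\<xi> \<bullet> b\<bar> \<le> 1 + norm \<xi>" using Basis_le_norm[OF coord.hyps(2), of \<xi>] by simp
    then have "(1 + norm \<xi>) ^ m * (\<bar>\<xi> \<bullet> b\<bar> * norm (f \<xi>)) \<le> (1 + norm \<xi>) ^ m * ((1 + norm \<xi>) * norm (f \<xi>))"
      by (intro mult_left_mono mult_right_mono) auto
    also have "\<dots> \<le> C" using C[of \<xi>] by (simp add: mult_ac)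
    finally show ?thesis by (simp add: norm_mult)
  qed
  then show ?case by blast
next
  case (scale f c)
  obtain C where C: "\<And>\<xi>. (1 + norm \<xi>) ^ m * norm (f \<xi>) \<le> C" using scale.IH[of m] by blast
  have "(1 + norm \<xi>) ^ m * norm (c * f \<xi>) \<le> norm c * C" for \<xi>
    using mult_left_mono[OF C[of \<xi>], of "norm c"] by (simp add: norm_mult mult_ac)
  then show ?case by blast
next
  case (plus f g)
  obtain C where C: "\<And>\<xi>. (1 + norm \<xi>) ^ m * norm (f \<xi>) \<le> C" using plus.IH(1)[of m] by blast
  obtain D where D: "\<And>\<xi>. (1 + norm \<xi>) ^ m * norm (g \<xi>) \<le> D" using plus.IH(2)[of m] by blast
  have "(1 + norm \<xi>) ^ m * norm (f \<xi> + g \<xi>) \<le> C + D" for \<xi>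
  proof -
    have "(1 + norm \<xi>) ^ m * norm (f \<xi> + g \<xi>) \<le> (1 + norm \<xi>) ^ m * (norm (f \<xi>) + norm (g \<xi>))"
      by (intro mult_left_mono norm_triangle_ineq) auto
    also have "\<dots> \<le> C + D" using C[of \<xi>] D[of \<xi>] by (simp add: distrib_left)
    finally show ?thesis .
  qed
  then show ?case by blast
qed

text \<open>Admits modulated Gaussians as test functions, which is the only information about
  \<open>fourier_L2\<close> that the later argument extracts.\<close>

lemma modulated_gauss_schwartz:
  assumes s: "s > 0"
  shows "(\<lambda>\<xi>. complex_of_real (gauss (s *\<^sub>R \<xi>)) * cis (x \<bullet> \<xi>)) \<in> schwartz"
proof -
  have "iter_partial bs (\<lambda>\<xi>. complex_of_real (gauss (s *\<^sub>R \<xi>)) * cis (x \<bullet> \<xi>)) \<in> poly_gauss s x"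
    if "bs \<in> lists Basis" for bs
    using that by (induction bs) (auto simp: iter_partial_def intro: poly_gauss.base poly_gauss_partial)
  moreover have "f differentiable (at \<xi>)" if "f \<in> poly_gauss s x" for f \<xi>
    using poly_gauss_deriv[OF that] by (auto simp: differentiable_def)
  moreover have "bounded (range (\<lambda>\<xi>. (1 + norm \<xi>) ^ m *\<^sub>R f \<xi>))" if f: "f \<in> poly_gauss s x" for f m
  proof -
    obtain C where "\<And>\<xi>. (1 + norm \<xi>) ^ m * norm (f \<xi>) \<le> C" using poly_gauss_bounded[OF s f] by blast
    then show ?thesis by (intro boundedI[of _ C]) auto
  qed
  ultimately show ?thesis unfolding schwartz_def by blast
qed

section \<open>Integrability of powers of the distance to the origin\<close>

text \<open>Dyadic decomposition: where \<open>1 + norm x\<close> is of size \<open>2 ^ j\<close>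
  the integrand is at most \<open>2 powr (- a * j)\<close> and the volume is of order
  \<open>2 ^ (j * d)\<close>, which leaves a geometric series of ratio
  \<open>q = 2 powr (d - a) < 1\<close>.\<close>

lemma nn_integral_decay_finite:
  assumes a: "a > real DIM('a::euclidean_space)"
  shows "(\<integral>\<^sup>+x. ennreal ((1 + norm (x::'a)) powr (- a)) \<partial>lborel) < \<infinity>"
proof -
  let ?d = "DIM('a)"
  define v where "v = unit_ball_vol (real ?d)"
  have v0: "v \<ge> 0" by (simp add: v_def)
  define q where "q = (2::real) powr (real ?d - a)"
  have [measurable]: "cball (0::'a) r \<in> sets borel" for r by auto
  have q: "0 < q" "q < 1" unfolding q_def using a by (auto simp: powr_less_one)
  have "(\<integral>\<^sup>+x. ennreal ((1 + norm (x::'a)) powr (- a)) \<partial>lborel)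
      \<le> (\<integral>\<^sup>+x. (\<Sum>j. ennreal (2 powr (- a * real j)) * indicator (cball (0::'a) (2 ^ Suc j)) x) \<partial>lborel)"
  proof (intro nn_integral_mono)
    fix x :: 'a
    define j where "j = nat \<lfloor>log 2 (1 + norm x)\<rfloor>"
    have l0: "log 2 (1 + norm x) \<ge> 0" by (subst zero_le_log_cancel_iff) (auto intro: add_pos_nonneg)
    have j: "real j \<le> log 2 (1 + norm x)" "log 2 (1 + norm x) < real j + 1"
      unfolding j_def using l0 by (auto simp: of_nat_nat floor_correct)
    have "2 powr real j \<le> 1 + norm x" using j(1) by (subst le_log_iff[symmetric]) (auto intro: add_pos_nonneg)
    then have "(1 + norm x) powr (- a) \<le> (2 powr real j) powr (- a)"
      using a by (intro powr_mono2') auto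
    then have 1: "(1 + norm x) powr (- a) \<le> 2 powr (- a * real j)" by (simp add: powr_powr mult.commute)
    have "1 + norm x < 2 powr (real j + 1)" using j(2) by (subst log_less_iff[symmetric]) (auto intro: add_pos_nonneg)
    also have "\<dots> = 2 ^ Suc j" by (simp add: powr_add powr_realpow)
    finally have 2: "x \<in> cball 0 (2 ^ Suc j)" by simp
    have "ennreal ((1 + norm x) powr (- a)) \<le> ennreal (2 powr (- a * real j)) * indicator (cball (0::'a) (2 ^ Suc j)) x"
      using 1 2 by (auto intro: ennreal_leI)
    also have "\<dots> \<le> (\<Sum>i. ennreal (2 powr (- a * real i)) * indicator (cball (0::'a) (2 ^ Suc i)) x)"
    proof -
      define F where "F i = ennreal (2 powr (- a * real i)) * indicator (cball (0::'a) (2 ^ Suc i)) x" for i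
      have "F j \<le> suminf F" using sum_le_suminf[of F "{j}"] by simp
      then show ?thesis by (simp add: F_def[abs_def])
    qed
    finally show "ennreal ((1 + norm x) powr (- a)) \<le> \<dots>" .
  qed
  also have "\<dots> = (\<Sum>j. \<integral>\<^sup>+x. ennreal (2 powr (- a * real j)) * indicator (cball (0::'a) (2 ^ Suc j)) x \<partial>lborel)"
    by (rule nn_integral_suminf) measurable
  also have "\<dots> = (\<Sum>j. ennreal (2 ^ ?d * v * q ^ j))"
  proof (intro suminf_cong)
    fix j
    have "(\<integral>\<^sup>+x. ennreal (2 powr (- a * real j)) * indicator (cball (0::'a) (2 ^ Suc j)) x \<partial>lborel)
        = ennreal (2 powr (- a * real j)) * emeasure lborel (cball (0::'a) (2 ^ Suc j))"
      by (rule nn_integral_cmult_indicator) auto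
    also have "\<dots> = ennreal (2 powr (- a * real j) * (v * (2 ^ Suc j) ^ ?d))"
      unfolding v_def by (subst emeasure_cball) (auto simp: ennreal_mult)
    also have "2 powr (- a * real j) * (v * (2 ^ Suc j) ^ ?d) = 2 ^ ?d * v * q ^ j"
    proof -
      have "q ^ j = 2 powr (- a * real j) * 2 powr (real ?d * real j)"
        unfolding q_def by (simp add: powr_realpow[symmetric] powr_powr flip: powr_add) (simp add: algebra_simps)
      also have "2 powr (real ?d * real j) = (2 ^ j) ^ ?d"
        by (simp add: powr_realpow flip: power_mult of_nat_mult)
      finally show ?thesis by (simp add: power_mult_distrib)
    qed
    finally show "(\<integral>\<^sup>+x. ennreal (2 powr (- a * real j)) * indicator (cball (0::'a) (2 ^ Suc j)) x \<partial>lborel) = ennreal (2 ^ ?d * v * q ^ j)" .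
  qed
  also have "\<dots> < \<infinity>"
  proof -
    have "summable (\<lambda>j. 2 ^ ?d * v * q ^ j)" using q by (intro summable_mult summable_geometric) auto
    then show ?thesis using v0 q by (subst suminf_ennreal_eq[OF _ summable_sums]) auto
  qed
  finally show ?thesis .
qed

lemma integrable_decay:
  "a > real DIM('a::euclidean_space) \<Longrightarrow> integrable lborel (\<lambda>x::'a. (1 + norm x) powr (- a))"
  using nn_integral_decay_finite[of a] by (auto simp: integrable_iff_bounded)

lemma integrable_decay_nat: "integrable lborel (\<lambda>x::'a::euclidean_space. inverse ((1 + norm x) ^ Suc DIM('a)))"
proof -
  have "(1 + norm x) powr (- real (Suc DIM('a))) = inverse ((1 + norm x) ^ Suc DIM('a))" for x :: 'a
    by (subst powr_minus, subst powr_realpow) (auto intro: add_pos_nonneg)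
  then show ?thesis using integrable_decay[of "real (Suc DIM('a))", where 'a = 'a] by simp
qed

lemma schwartz_decay:
  fixes f :: "'a::euclidean_space \<Rightarrow> complex"
  assumes "f \<in> schwartz"
  obtains C where "C > 0" "\<And>x. norm (f x) \<le> C * inverse ((1 + norm x) ^ m)"
proof -
  obtain C where "C > 0" "\<And>x. (1 + norm x) ^ m * norm (f x) \<le> C" using schwartz_bounded[OF assms] by blast
  then show ?thesis
    by (intro that[of C]) (auto simp: divide_inverse[symmetric] pos_le_divide_eq add_pos_nonneg mult.commute)
qed

lemma schwartz_integrable:
  fixes f :: "'a::euclidean_space \<Rightarrow> complex"
  assumes "f \<in> schwartz"
  shows "integrable lborel f"
proof -
  obtain C where "\<And>x. norm (f x) \<le> C * inverse ((1 + norm x) ^ Suc DIM('a))"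
    using schwartz_decay[OF assms] by blast
  then show ?thesis using schwartz_measurable[OF assms]
    by (intro Bochner_Integration.integrable_bound[OF integrable_mult_right[OF integrable_decay_nat, of C]])
       (auto intro!: AE_I2 order_trans[OF _ abs_ge_self])
qed

lemma sqn_finite_bounded_integrable:
  fixes f :: "'a::euclidean_space \<Rightarrow> complex"
  assumes f: "integrable lborel f" and B: "\<And>x. norm (f x) \<le> B"
  shows "sqn f < \<infinity>"
proof -
  have B0: "B \<ge> 0" using norm_ge_zero B[of undefined] by (rule order_trans)
  have [measurable]: "f \<in> borel_measurable borel" using f by (auto simp: integrable_iff_bounded)
  have "sqn f \<le> (\<integral>\<^sup>+x. ennreal B * ennreal (norm (f x)) \<partial>lborel)"
    unfolding sqn_def using B B0
    by (intro nn_integral_mono) (auto simp: power2_eq_square intro!: mult_right_mono ennreal_leI simp flip: ennreal_mult)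
  also have "\<dots> = ennreal B * (\<integral>\<^sup>+x. ennreal (norm (f x)) \<partial>lborel)" by (intro nn_integral_cmult) auto
  also have "\<dots> < \<infinity>" using f by (auto simp: integrable_iff_bounded ennreal_mult_less_top)
  finally show ?thesis .
qed

lemma schwartz_sqn_finite:
  fixes f :: "'a::euclidean_space \<Rightarrow> complex"
  assumes "f \<in> schwartz"
  shows "sqn f < \<infinity>"
proof -
  obtain C where "\<And>x. (1 + norm x) ^ 0 * norm (f x) \<le> C" using schwartz_bounded[OF assms] by blast
  then show ?thesis by (intro sqn_finite_bounded_integrable[OF schwartz_integrable[OF assms], of C]) simp
qed

section \<open>The Fourier transform of square integrable functions\<close>

lemma tendsto_integral_mult_sqn:
  fixes g :: "'a::euclidean_space \<Rightarrow> complex"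
  assumes [measurable]: "\<And>j. G j \<in> borel_measurable borel" "g \<in> borel_measurable borel" "f \<in> borel_measurable borel"
    and lim: "(\<lambda>j. sqn (\<lambda>x. G j x - g x)) \<longlonglongrightarrow> 0"
    and fin: "\<And>j. sqn (G j) < \<infinity>" "sqn g < \<infinity>" "sqn f < \<infinity>"
  shows "(\<lambda>j. \<integral>x. G j x * f x \<partial>lborel) \<longlonglongrightarrow> (\<integral>x. g x * f x \<partial>lborel)"
proof -
  have e: "(\<integral>x. G j x * f x \<partial>lborel) - (\<integral>x. g x * f x \<partial>lborel) = (\<integral>x. (G j x - g x) * f x \<partial>lborel)" for j
    by (subst Bochner_Integration.integral_diff[symmetric])
       (auto intro!: integrable_mult_sqn fin Bochner_Integration.integral_cong simp: left_diff_distrib)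
  have "(\<lambda>j. ennreal ((norm (\<integral>x. (G j x - g x) * f x \<partial>lborel))\<^sup>2)) \<longlonglongrightarrow> 0"
  proof (rule tendsto_0_ennreal_le)
    show "(\<lambda>j. sqn f * sqn (\<lambda>x. G j x - g x)) \<longlonglongrightarrow> 0"
      using fin by (intro tendsto_0_ennreal_cmult lim) auto
    fix j
    have "ennreal ((norm (\<integral>x. (G j x - g x) * f x \<partial>lborel))\<^sup>2) = (ennreal (norm (\<integral>x. (G j x - g x) * f x \<partial>lborel)))\<^sup>2"
      by (simp add: ennreal_power)
    also have "\<dots> \<le> (\<integral>\<^sup>+x. ennreal (norm ((G j x - g x) * f x)) \<partial>lborel)\<^sup>2"
      by (intro power_mono norm_integral_le_nn) auto
    also have "\<dots> \<le> sqn (\<lambda>x. G j x - g x) * sqn f"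
      unfolding norm_mult by (rule nn_integral_mult_le_sqn) auto
    finally show "ennreal ((norm (\<integral>x. (G j x - g x) * f x \<partial>lborel))\<^sup>2) \<le> sqn f * sqn (\<lambda>x. G j x - g x)"
      by (simp add: mult.commute)
  qed
  then have "(\<lambda>j. (norm (\<integral>x. (G j x - g x) * f x \<partial>lborel))\<^sup>2) \<longlonglongrightarrow> 0"
    by (subst (asm) ennreal_0[symmetric], subst (asm) tendsto_ennreal_iff) auto
  then have "(\<lambda>j. sqrt ((norm (\<integral>x. (G j x - g x) * f x \<partial>lborel))\<^sup>2)) \<longlonglongrightarrow> sqrt 0" by (rule tendsto_real_sqrt)
  then have "(\<lambda>j. \<integral>x. (G j x - g x) * f x \<partial>lborel) \<longlonglongrightarrow> 0" by (simp add: tendsto_norm_zero_iff)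
  then show ?thesis unfolding e[symmetric] by (subst LIM_zero_iff[symmetric])
qed

text \<open>Fatou's lemma, for passing norm bounds to almost everywhere limits.\<close>

lemma sqn_le_liminf:
  assumes [measurable]: "\<And>i. F i \<in> borel_measurable borel" "f \<in> borel_measurable borel"
    and lim: "AE x in lborel. (\<lambda>i. F i x) \<longlonglongrightarrow> f x"
    and b: "eventually (\<lambda>i. sqn (F i) \<le> B) sequentially"
  shows "sqn f \<le> B"
proof -
  have "sqn f = (\<integral>\<^sup>+x. liminf (\<lambda>i. ennreal ((norm (F i x))\<^sup>2)) \<partial>lborel)"
    unfolding sqn_def using lim
  proof (intro nn_integral_cong_AE, eventually_elim)
    fix x assume "(\<lambda>i. F i x) \<longlonglongrightarrow> f x"
    then have "(\<lambda>i. ennreal ((norm (F i x))\<^sup>2)) \<longlonglongrightarrow> ennreal ((norm (f x))\<^sup>2)" by (intro tendsto_ennrealI tendsto_intros)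
    then show "ennreal ((norm (f x))\<^sup>2) = liminf (\<lambda>i. ennreal ((norm (F i x))\<^sup>2))"
      by (intro lim_imp_Liminf[symmetric]) auto
  qed
  also have "\<dots> \<le> liminf (\<lambda>i. sqn (F i))" unfolding sqn_def by (rule nn_integral_liminf) auto
  also have "\<dots> \<le> limsup (\<lambda>i. sqn (F i))" by (rule Liminf_le_Limsup) auto
  also have "\<dots> \<le> B" by (rule Limsup_bounded[OF b])
  finally show ?thesis .
qed

text \<open>Completeness of L2 for sequences with a prescribed rate. The rate gives convergence
  almost everywhere, and Fatou's lemma upgrades it to convergence in mean square.\<close>

lemma L2_complete_fast:
  fixes F :: "nat \<Rightarrow> 'a::euclidean_space \<Rightarrow> complex"
  assumes [measurable]: "\<And>i. F i \<in> borel_measurable borel"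
    and C: "C \<ge> 0" and cauchy: "\<And>i j. j \<le> i \<Longrightarrow> sqn (\<lambda>x. F i x - F j x) \<le> ennreal (C * (1/16) ^ j)"
  obtains v where "v \<in> borel_measurable borel" "(\<lambda>j. sqn (\<lambda>x. F j x - v x)) \<longlonglongrightarrow> 0"
proof -
  define v where "v x = lim (\<lambda>i. F i x)" for x
  have vm[measurable]: "v \<in> borel_measurable borel"
    unfolding v_def by (rule borel_measurable_lim_metric) auto
  \<comment> \<open>The weight \<open>4 ^ j\<close> leaves a summable series out of the rate
    \<open>(1/16) ^ j\<close>, and finiteness of the weighted sum at a point forces increments of
    order \<open>(1/2) ^ j\<close> there.\<close>
  let ?T = "\<lambda>j x. ennreal (4 ^ j) * ennreal ((norm (F (Suc j) x - F j x))\<^sup>2)"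
  have "(\<integral>\<^sup>+x. (\<Sum>j. ?T j x) \<partial>lborel) = (\<Sum>j. \<integral>\<^sup>+x. ?T j x \<partial>lborel)"
    by (rule nn_integral_suminf) auto
  also have "\<dots> \<le> (\<Sum>j. ennreal (C * (1/4) ^ j))"
  proof (intro suminf_le)
    fix j
    have "(\<integral>\<^sup>+x. ?T j x \<partial>lborel) = ennreal (4 ^ j) * sqn (\<lambda>x. F (Suc j) x - F j x)"
      unfolding sqn_def by (rule nn_integral_cmult) auto
    also have "\<dots> \<le> ennreal (4 ^ j) * ennreal (C * (1/16) ^ j)" by (intro mult_left_mono cauchy) auto
    also have "\<dots> = ennreal (C * (1/4) ^ j)"
      using C by (simp add: ennreal_mult[symmetric] power_divide power_mult_distrib[symmetric] field_simps flip: power_mult_distrib)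
    finally show "(\<integral>\<^sup>+x. ?T j x \<partial>lborel) \<le> ennreal (C * (1/4) ^ j)" .
  qed auto
  also have "\<dots> < \<infinity>"
  proof -
    have "summable (\<lambda>j. C * (1/4::real) ^ j)" by (intro summable_mult summable_geometric) auto
    then show ?thesis using C by (subst suminf_ennreal_eq[OF _ summable_sums]) auto
  qed
  finally have "AE x in lborel. (\<Sum>j. ?T j x) \<noteq> \<infinity>" by (intro nn_integral_PInf_AE) auto
  then have lim: "AE x in lborel. (\<lambda>i. F i x) \<longlonglongrightarrow> v x"
  proof eventually_elim
    fix x assume fin: "(\<Sum>j. ?T j x) \<noteq> \<infinity>"
    then obtain M where M: "(\<Sum>j. ?T j x) = ennreal M" "M \<ge> 0" by (cases "\<Sum>j. ?T j x") auto
    have b: "norm (F (Suc j) x - F j x) \<le> sqrt M * (1/2) ^ j" for j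
    proof -
      have "?T j x \<le> ennreal M" unfolding M(1)[symmetric] using sum_le_suminf[of "\<lambda>j. ?T j x" "{j}"] by simp
      then have "4 ^ j * (norm (F (Suc j) x - F j x))\<^sup>2 \<le> M" using M(2) by (simp flip: ennreal_mult)
      then have "(2 ^ j * norm (F (Suc j) x - F j x))\<^sup>2 \<le> M"
      proof -
        have "((2::real) ^ j)\<^sup>2 = (2\<^sup>2) ^ j" by (simp only: power_mult[symmetric] mult.commute)
        then show ?thesis using \<open>4 ^ j * (norm (F (Suc j) x - F j x))\<^sup>2 \<le> M\<close> by (simp add: power_mult_distrib)
      qed
      then have "2 ^ j * norm (F (Suc j) x - F j x) \<le> sqrt M" by (intro real_le_rsqrt)
      then show ?thesis by (simp add: power_divide field_simps)
    qed
    have "summable (\<lambda>j. norm (F (Suc j) x - F j x))"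
      by (rule summable_comparison_test'[where g = "\<lambda>j. sqrt M * (1/2) ^ j" and N = 0])
         (use b in \<open>auto intro!: summable_mult summable_geometric\<close>)
    then have "summable (\<lambda>j. F (Suc j) x - F j x)" by (rule summable_norm_cancel)
    then have "convergent (\<lambda>n. \<Sum>j<n. F (Suc j) x - F j x)" by (simp add: summable_iff_convergent)
    then have "convergent (\<lambda>n. F n x - F 0 x)" by (simp add: sum_lessThan_telescope[of "\<lambda>j. F j x"])
    then have "convergent (\<lambda>n. F n x)" by (simp add: convergent_diff_const_right_iff)
    then show "(\<lambda>i. F i x) \<longlonglongrightarrow> v x" unfolding v_def by (simp add: convergent_LIMSEQ_iff)
  qed
  have le: "sqn (\<lambda>x. F j x - v x) \<le> ennreal (C * (1/16) ^ j)" for j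
  proof (rule sqn_le_liminf[where F = "\<lambda>i x. F j x - F i x"])
    show "AE x in lborel. (\<lambda>i. F j x - F i x) \<longlonglongrightarrow> F j x - v x"
      using lim by eventually_elim (intro tendsto_intros)
    show "eventually (\<lambda>i. sqn (\<lambda>x. F j x - F i x) \<le> ennreal (C * (1/16) ^ j)) sequentially"
      using eventually_ge_at_top[of j]
    proof eventually_elim
      case (elim i)
      have "sqn (\<lambda>x. F j x - F i x) = sqn (\<lambda>x. F i x - F j x)" by (simp add: sqn_def norm_minus_commute)
      with cauchy[OF elim] show ?case by simp
    qed
  qed auto
  have "(\<lambda>j. C * (1/16) ^ j) \<longlonglongrightarrow> C * 0" by (intro tendsto_intros LIMSEQ_realpow_zero) auto
  then have "(\<lambda>j. ennreal (C * (1/16) ^ j)) \<longlonglongrightarrow> 0" using tendsto_ennrealI by fastforce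
  then have "(\<lambda>j. sqn (\<lambda>x. F j x - v x)) \<longlonglongrightarrow> 0" by (rule tendsto_0_ennreal_le) (rule le)
  with vm show ?thesis by (rule that)
qed

lemma integrable_truncate_sqn:
  fixes u :: "'a::euclidean_space \<Rightarrow> complex"
  assumes [measurable]: "u \<in> borel_measurable borel" and fin: "sqn u < \<infinity>"
  shows "integrable lborel (\<lambda>x. u x * indicator (cball 0 r) x)"
proof (rule integrable_mult_sqn)
  have [measurable]: "cball (0::'a) r \<in> sets borel" by auto
  show "indicator (cball (0::'a) r) \<in> borel_measurable borel" by measurable
  have "sqn (indicator (cball (0::'a) r)) = (\<integral>\<^sup>+x. indicator (cball (0::'a) r) x \<partial>lborel)"
    unfolding sqn_def by (intro nn_integral_cong) (auto simp: indicator_def)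
  also have "\<dots> = emeasure lborel (cball (0::'a) r)" by (rule nn_integral_indicator) auto
  also have "\<dots> < \<infinity>" using emeasure_lborel_cball_finite[of "0::'a" r] by auto
  finally show "sqn (indicator (cball (0::'a) r)) < \<infinity>" .
qed (use assms in auto)

text \<open>The usual extension by density: truncations of \<open>u\<close> to balls are integrable,
  Plancherel's theorem makes their transforms a Cauchy sequence, and the multiplication formula
  survives the limit because both factors converge in mean square.\<close>

lemma L2_fourier_exists:
  fixes u :: "'a::euclidean_space \<Rightarrow> complex"
  assumes [measurable]: "u \<in> borel_measurable borel" and fin: "sqn u < \<infinity>"
  obtains v where "v \<in> borel_measurable borel" "sqn v < \<infinity>"
    "\<And>f. integrable lborel f \<Longrightarrow> sqn f < \<infinity> \<Longrightarrow> (\<integral>x. v x * f x \<partial>lborel) = (\<integral>x. u x * ft f x \<partial>lborel)"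
proof -
  let ?c = "(2 * pi) ^ DIM('a)"
  have [measurable]: "cball (0::'a) r \<in> sets borel" for r by auto
  have "(\<lambda>n. sqn (\<lambda>x. u x - u x * indicator (cball 0 (real n)) x)) \<longlonglongrightarrow> (\<integral>\<^sup>+x. 0 \<partial>(lborel :: 'a measure))"
    unfolding sqn_def
  proof (rule nn_integral_dominated_convergence[where w = "\<lambda>x. ennreal ((norm (u x))\<^sup>2)"])
    show "AE x in lborel. (\<lambda>n. ennreal ((norm (u x - u x * indicator (cball 0 (real n)) x))\<^sup>2)) \<longlonglongrightarrow> 0"
    proof (rule AE_I2)
      fix x :: 'a
      have "eventually (\<lambda>n. real n \<ge> norm x) sequentially"
        by (meson eventually_sequentiallyI of_nat_le_iff order_trans real_nat_ceiling_ge)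
      then have "eventually (\<lambda>n. ennreal ((norm (u x - u x * indicator (cball 0 (real n)) x))\<^sup>2) = 0) sequentially"
        by eventually_elim (auto simp: indicator_def)
      then show "(\<lambda>n. ennreal ((norm (u x - u x * indicator (cball 0 (real n)) x))\<^sup>2)) \<longlonglongrightarrow> 0" by (rule tendsto_eventually)
    qed
    show "AE x in lborel. ennreal ((norm (u x - u x * indicator (cball 0 (real n)) x))\<^sup>2) \<le> ennreal ((norm (u x))\<^sup>2)" for n
      by (auto simp: indicator_def)
  qed (use fin in \<open>auto simp: sqn_def\<close>)
  \<comment> \<open>Radii are selected so that the errors decay at the rate that
    \<open>L2_complete_fast\<close> expects.\<close>
  then have "\<exists>n. sqn (\<lambda>x. u x - u x * indicator (cball 0 (real n)) x) \<le> ennreal ((1/16) ^ j)" for j :: nat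
    using tendsto_0_ennrealD[of _ sequentially "(1/16) ^ j"] by (auto simp: eventually_sequentially)
  then obtain n where n: "\<And>j. sqn (\<lambda>x. u x - u x * indicator (cball 0 (real (n j))) x) \<le> ennreal ((1/16) ^ j)"
    by metis
  define U where "U j x = u x * indicator (cball 0 (real (n j))) x" for j x
  have Um[measurable]: "U j \<in> borel_measurable borel" for j unfolding U_def by measurable
  have Ui: "integrable lborel (U j)" for j unfolding U_def by (rule integrable_truncate_sqn) fact+
  have Uu: "sqn (\<lambda>x. u x - U j x) \<le> ennreal ((1/16) ^ j)" for j unfolding U_def by (rule n)
  have Ufin: "sqn (U j) < \<infinity>" for j
    by (rule le_less_trans[OF sqn_mono fin]) (auto simp: U_def indicator_def)
  have UU: "sqn (\<lambda>x. U i x - U j x) \<le> ennreal (4 * (1/16) ^ j)" if "j \<le> i" for i j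
  proof -
    have "sqn (\<lambda>x. U i x - U j x) = sqn (\<lambda>x. (u x - U j x) - (u x - U i x))" by simp
    also have "\<dots> \<le> 2 * sqn (\<lambda>x. u x - U j x) + 2 * sqn (\<lambda>x. u x - U i x)" by (rule sqn_diff_le2) auto
    also have "\<dots> \<le> 2 * ennreal ((1/16) ^ j) + 2 * ennreal ((1/16) ^ j)"
      using that by (intro add_mono mult_left_mono Uu order_trans[OF Uu] ennreal_leI power_decreasing) auto
    also have "\<dots> = ennreal (4 * (1/16) ^ j)" by (simp add: ennreal_mult flip: distrib_right)
    finally show ?thesis .
  qed
  have FF: "sqn (\<lambda>x. ft (U i) x - ft (U j) x) \<le> ennreal (?c * 4 * (1/16) ^ j)" if "j \<le> i" for i j
  proof -
    have "(\<lambda>x. ft (U i) x - ft (U j) x) = ft (\<lambda>x. U i x - U j x)"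
      unfolding ft_def using Ui by (subst Bochner_Integration.integral_diff[symmetric])
        (auto simp: left_diff_distrib intro!: integrable_mult_cis)
    moreover have "sqn (\<lambda>x. U i x - U j x) < \<infinity>" using UU[OF that] by (auto intro: le_less_trans)
    ultimately have "sqn (\<lambda>x. ft (U i) x - ft (U j) x) = ennreal ?c * sqn (\<lambda>x. U i x - U j x)"
      using Ui by (simp add: plancherel)
    also have "\<dots> \<le> ennreal ?c * ennreal (4 * (1/16) ^ j)" by (intro mult_left_mono UU that) auto
    finally show ?thesis by (simp add: ennreal_mult[symmetric] mult.assoc)
  qed
  obtain v where v[measurable]: "v \<in> borel_measurable borel" and vlim: "(\<lambda>j. sqn (\<lambda>x. ft (U j) x - v x)) \<longlonglongrightarrow> 0"
    using L2_complete_fast[of "\<lambda>j. ft (U j)" "?c * 4"] FF by auto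
  have Ffin: "sqn (ft (U j)) < \<infinity>" for j
    using Ufin[of j] Ui[of j] by (simp add: plancherel ennreal_mult_less_top)
  have vfin: "sqn v < \<infinity>"
  proof -
    obtain j where j: "sqn (\<lambda>x. ft (U j) x - v x) \<le> ennreal 1"
      using tendsto_0_ennrealD[OF vlim, of 1] by (auto simp: eventually_sequentially)
    have "sqn v = sqn (\<lambda>x. ft (U j) x - (ft (U j) x - v x))" by simp
    also have "\<dots> \<le> 2 * sqn (ft (U j)) + 2 * sqn (\<lambda>x. ft (U j) x - v x)" by (rule sqn_diff_le2) auto
    also have "\<dots> < \<infinity>" using Ffin[of j] j by (auto simp: ennreal_mult_less_top intro: le_less_trans)
    finally show ?thesis .
  qed
  have Ulim: "(\<lambda>j. sqn (\<lambda>x. U j x - u x)) \<longlonglongrightarrow> 0"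
  proof (rule tendsto_0_ennreal_le)
    have "(\<lambda>j. (1/16::real) ^ j) \<longlonglongrightarrow> 0" by (intro LIMSEQ_realpow_zero) auto
    then show "(\<lambda>j. ennreal ((1/16) ^ j)) \<longlonglongrightarrow> 0" using tendsto_ennrealI by fastforce
    show "sqn (\<lambda>x. U j x - u x) \<le> ennreal ((1/16) ^ j)" for j
      using Uu[of j] by (simp add: sqn_def norm_minus_commute)
  qed
  have "(\<integral>x. v x * f x \<partial>lborel) = (\<integral>x. u x * ft f x \<partial>lborel)" if f: "integrable lborel f" and ff: "sqn f < \<infinity>" for f
  proof -
    have fm[measurable]: "f \<in> borel_measurable borel" using f by (auto simp: integrable_iff_bounded)
    have "sqn (ft f) < \<infinity>" using ff f by (simp add: plancherel ennreal_mult_less_top)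
    then have 1: "(\<lambda>j. \<integral>x. U j x * ft f x \<partial>lborel) \<longlonglongrightarrow> (\<integral>x. u x * ft f x \<partial>lborel)"
      by (intro tendsto_integral_mult_sqn Ulim Ufin fin) auto
    have 2: "(\<lambda>j. \<integral>x. ft (U j) x * f x \<partial>lborel) \<longlonglongrightarrow> (\<integral>x. v x * f x \<partial>lborel)"
      by (intro tendsto_integral_mult_sqn vlim Ffin vfin ff) auto
    have "(\<integral>x. ft (U j) x * f x \<partial>lborel) = (\<integral>x. U j x * ft f x \<partial>lborel)" for j
      by (rule ft_multiplication_formula[OF Ui f])
    with 1 2 show ?thesis using LIMSEQ_unique by auto
  qed
  then show ?thesis using v vfin by (intro that) auto
qed

section \<open>Oscillatory sequences\<close>

lemma sqn_reflect:
  assumes [measurable]: "f \<in> borel_measurable borel"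
  shows "sqn (\<lambda>x. f (- x)) = sqn f"
  unfolding sqn_def using nn_integral_dilate[of "\<lambda>x. ennreal ((norm (f x))\<^sup>2)" "-1"] by simp

lemma nn_integral_gauss: "(\<integral>\<^sup>+z. ennreal (gauss z) \<partial>(lborel :: 'a::euclidean_space measure)) = ennreal (sqrt (2 * pi) ^ DIM('a))"
  by (subst nn_integral_eq_integral[OF integrable_gauss]) (auto simp: integral_gauss)

lemma sqn_gauss_scale: 
  assumes "s \<noteq> 0"
  shows "sqn (\<lambda>\<xi>::'a::euclidean_space. complex_of_real (gauss (s *\<^sub>R \<xi>))) < \<infinity>"
proof -
  have "sqn (\<lambda>\<xi>::'a. complex_of_real (gauss (s *\<^sub>R \<xi>))) \<le> (\<integral>\<^sup>+\<xi>. ennreal (gauss (s *\<^sub>R (\<xi>::'a))) \<partial>lborel)"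
    unfolding sqn_def by (intro nn_integral_mono ennreal_leI) (auto simp: power2_eq_square intro: mult_left_le)
  also have "\<dots> < \<infinity>" using integrable_gauss_scale[OF assms, where 'a = 'a] by (auto simp: integrable_iff_bounded)
  finally show ?thesis .
qed

lemma sqrt_2pi_power_sq: "(sqrt (2 * pi) ^ n)\<^sup>2 = (2 * pi) ^ n"
  by (simp add: power_mult[symmetric] mult.commute[of n]) (simp add: power_mult)

text \<open>Here \<open>v\<close> is the Fourier transform of \<open>u\<close> in the sense of distributions. Damping \<open>v\<close> by a Gaussian makes
  it integrable and mollifies \<open>u\<close>, so that Plancherel's theorem for integrable functions applies;
  the width of the Gaussian then tends to infinity.\<close>

locale L2_fourier_pair =
  fixes u v :: "'a::euclidean_space \<Rightarrow> complex" and c :: real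
  assumes c_def: "c = sqrt (2 * pi) ^ DIM('a)"
    and um[measurable]: "u \<in> borel_measurable borel" and ufin: "sqn u < \<infinity>"
    and vm[measurable]: "v \<in> borel_measurable borel" and vfin: "sqn v < \<infinity>"
    and pairing: "\<And>f. f \<in> schwartz \<Longrightarrow> (\<integral>x. v x * f x \<partial>lborel) = (\<integral>x. u x * ft f x \<partial>lborel)"
begin

definition "damped s \<xi> = v \<xi> * complex_of_real (gauss (s *\<^sub>R \<xi>))"
text \<open>The Gaussian is not normalised: its mass is \<open>c\<close>, so
  \<open>smoothed s\<close> approximates \<open>c * u\<close>.\<close>

definition "smoothed s x = (\<integral>z. u (x + s *\<^sub>R z) * complex_of_real (gauss z) \<partial>lborel)"

lemma damped_meas[measurable]: "damped s \<in> borel_measurable borel"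
  unfolding damped_def by measurable

lemma smoothed_meas[measurable]: "smoothed s \<in> borel_measurable borel"
  unfolding smoothed_def by (subst measurable_lborel2[symmetric]) (rule lborel.borel_measurable_lebesgue_integral, measurable)

lemma damped_integrable: "s \<noteq> 0 \<Longrightarrow> integrable lborel (damped s)"
  unfolding damped_def by (intro integrable_mult_sqn sqn_gauss_scale vfin) auto

lemma damped_le: "norm (damped s \<xi>) \<le> norm (v \<xi>)"
  unfolding damped_def by (auto simp: norm_mult intro: mult_left_le)

text \<open>Test \<open>pairing\<close> with the modulated Gaussian centred at \<open>x\<close>. The
  reflected argument appears because transforming \<open>v\<close>, itself a transform, inverts it
  up to reflection.\<close>

lemma ft_damped:
  assumes s: "s > 0"
  shows "ft (damped s) (- x) = complex_of_real c * smoothed s x"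
proof -
  have "ft (damped s) (- x) = (\<integral>\<xi>. v \<xi> * (complex_of_real (gauss (s *\<^sub>R \<xi>)) * cis (x \<bullet> \<xi>)) \<partial>lborel)"
    unfolding ft_def damped_def by (simp add: mult.assoc inner_commute)
  also have "\<dots> = (\<integral>y. u y * ft (\<lambda>\<xi>. complex_of_real (gauss (s *\<^sub>R \<xi>)) * cis (x \<bullet> \<xi>)) y \<partial>lborel)"
    by (intro pairing modulated_gauss_schwartz s)
  also have "\<dots> = (\<integral>y. u y * complex_of_real (inverse s ^ DIM('a) * c * gauss ((y - x) /\<^sub>R s)) \<partial>lborel)"
    using s by (simp add: ft_modulated_gauss c_def)
  also have "\<dots> = (\<integral>y. u (y + x) * complex_of_real (inverse s ^ DIM('a) * c * gauss (y /\<^sub>R s)) \<partial>lborel)"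
    by (subst integral_translate[of _ x, symmetric]) auto
  also have "\<dots> = (\<bar>s\<bar> ^ DIM('a)) *\<^sub>R (\<integral>z. u (s *\<^sub>R z + x) * complex_of_real (inverse s ^ DIM('a) * c * gauss ((s *\<^sub>R z) /\<^sub>R s)) \<partial>lborel)"
    using s by (intro integral_dilate) auto
  also have "\<dots> = (\<bar>s\<bar> ^ DIM('a)) *\<^sub>R (\<integral>z. complex_of_real (inverse s ^ DIM('a) * c) * (u (x + s *\<^sub>R z) * complex_of_real (gauss z)) \<partial>lborel)"
    using s by (intro arg_cong[where f = "\<lambda>x. _ *\<^sub>R x"] Bochner_Integration.integral_cong refl) (simp add: add.commute mult_ac)
  also have "\<dots> = complex_of_real (\<bar>s\<bar> ^ DIM('a) * (inverse s ^ DIM('a) * c)) * smoothed s x"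
    unfolding smoothed_def by (subst integral_mult_right_zero) (simp add: scaleR_conv_of_real mult.assoc)
  also have "\<bar>s\<bar> ^ DIM('a) * (inverse s ^ DIM('a) * c) = c"
    unfolding mult.assoc[symmetric] power_mult_distrib[symmetric] using s by simp
  finally show ?thesis .
qed

lemma sqn_smoothed_le: "sqn (smoothed s) \<le> ennreal (c\<^sup>2) * sqn u"
proof -
  have "sqn (smoothed s) \<le> (\<integral>\<^sup>+z. ennreal (gauss (z::'a)) \<partial>lborel) * (\<integral>\<^sup>+z. ennreal (gauss z) * sqn (\<lambda>x. u (x + s *\<^sub>R z)) \<partial>lborel)"
  proof (rule sqn_average)
    show "ennreal (norm (smoothed s x)) \<le> (\<integral>\<^sup>+z. ennreal (gauss z) * ennreal (norm (u (x + s *\<^sub>R z))) \<partial>lborel)" for x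
      unfolding smoothed_def by (rule order_trans[OF norm_integral_le_nn]) (auto simp: norm_mult ennreal_mult mult.commute)
  qed (auto intro: measurable_translate_pair)
  also have "(\<integral>\<^sup>+z. ennreal (gauss z) * sqn (\<lambda>x. u (x + s *\<^sub>R z)) \<partial>lborel) = (\<integral>\<^sup>+z. ennreal (gauss (z::'a)) \<partial>lborel) * sqn u"
    by (simp add: sqn_translate nn_integral_multc)
  finally show ?thesis by (simp add: nn_integral_gauss c_def mult.assoc[symmetric] power2_eq_square ennreal_mult)
qed

lemma ennreal_cancel_c:
  assumes "ennreal (c\<^sup>2) * a = ennreal (c\<^sup>2) * b"
  shows "a = b"
  using assms by (subst (asm) ennreal_mult_cancel_left) (auto simp: c_def)

text \<open>Plancherel's theorem for the integrable function \<open>damped s * m\<close>; its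
  constant is \<open>c\<^sup>2\<close>, so it cancels. The multipliers in use are 1 and
  \<open>cis (p \<bullet> \<xi>) - 1\<close>, hence the bound 2.\<close>

lemma sqn_damped_modulated:
  assumes s: "s > 0" and m[measurable]: "m \<in> borel_measurable borel" and mb: "\<And>\<xi>. norm (m \<xi>) \<le> 2"
    and U: "\<And>x. complex_of_real c * U x = ft (\<lambda>\<xi>. damped s \<xi> * m \<xi>) (- x)" and Um[measurable]: "U \<in> borel_measurable borel"
  shows "sqn U = sqn (\<lambda>\<xi>. damped s \<xi> * m \<xi>)"
proof -
  let ?g = "\<lambda>\<xi>. damped s \<xi> * m \<xi>"
  have di: "integrable lborel (damped s)" using s by (intro damped_integrable) auto
  have i: "integrable lborel ?g"
    by (rule Bochner_Integration.integrable_bound[OF integrable_mult_right[OF di, of 2]])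
       (use mb in \<open>auto simp: norm_mult mult.commute[of "norm (damped s _)"] intro!: AE_I2 mult_right_mono\<close>)
  have "sqn ?g \<le> ennreal (2\<^sup>2) * sqn v"
    by (rule order_trans[OF sqn_mono sqn_bounded_mult[of v "\<lambda>_. 2"]])
       (auto simp: norm_mult mult.commute[of _ "norm (m _)"] intro!: mult_mono mb damped_le)
  also have "\<dots> < \<infinity>" using vfin by (simp add: ennreal_mult_less_top)
  finally have f: "sqn ?g < \<infinity>" .
  have "ennreal (c\<^sup>2) * sqn U = sqn (\<lambda>x. complex_of_real c * U x)" by (subst sqn_cmult) (auto simp: norm_power)
  also have "\<dots> = sqn (\<lambda>x. ft ?g (- x))" by (simp only: U)
  also have "\<dots> = sqn (ft ?g)" by (rule sqn_reflect) measurable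
  also have "\<dots> = ennreal (c\<^sup>2) * sqn ?g" unfolding c_def sqrt_2pi_power_sq by (rule plancherel[OF i f])
  finally show ?thesis by (rule ennreal_cancel_c)
qed

text \<open>Half of Plancherel's identity for the pair: the bound holds for each damped
  \<open>v\<close>, and Fatou's lemma removes the damping.\<close>

lemma sqn_fourier_le: "sqn v \<le> ennreal (c\<^sup>2) * sqn u"
proof (rule sqn_le_liminf[where F = "\<lambda>n. damped (1 / real (Suc n))"])
  show "AE \<xi> in lborel. (\<lambda>n. damped (1 / real (Suc n)) \<xi>) \<longlonglongrightarrow> v \<xi>"
  proof (rule AE_I2)
    fix \<xi> :: 'a
    have "(\<lambda>n. 1 / real (Suc n)) \<longlonglongrightarrow> 0" using LIMSEQ_inverse_real_of_nat by (simp add: inverse_eq_divide)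
    then have "(\<lambda>n. v \<xi> * complex_of_real (exp (- (norm ((1 / real (Suc n)) *\<^sub>R \<xi>))\<^sup>2 / 2))) \<longlonglongrightarrow> v \<xi> * complex_of_real (exp (- (norm (0 *\<^sub>R \<xi>))\<^sup>2 / 2))"
      by (intro tendsto_intros) auto
    then show "(\<lambda>n. damped (1 / real (Suc n)) \<xi>) \<longlonglongrightarrow> v \<xi>" by (simp add: damped_def gauss_def)
  qed
  have "sqn (damped s) \<le> ennreal (c\<^sup>2) * sqn u" if s: "s > 0" for s
    using sqn_damped_modulated[OF s, of "\<lambda>_. 1" "smoothed s"] sqn_smoothed_le[of s] by (simp add: ft_damped[OF s])
  then show "eventually (\<lambda>n. sqn (damped (1 / real (Suc n))) \<le> ennreal (c\<^sup>2) * sqn u) sequentially"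
    by (intro always_eventually) simp
qed auto

text \<open>Translating \<open>smoothed s\<close> by \<open>p\<close> multiplies its frequency side
  by \<open>cis (p \<bullet> \<xi>)\<close>; the damping is then dropped, since it only decreases
  the norm.\<close>

lemma smoothed_shift_le:
  assumes s: "s > 0"
  shows "sqn (\<lambda>x. smoothed s (x + p) - smoothed s x) \<le> sqn (\<lambda>\<xi>. v \<xi> * (cis (p \<bullet> \<xi>) - 1))"
proof -
  have mb: "norm (cis t - 1) \<le> 2" for t using norm_triangle_ineq4[of "cis t" 1] by simp
  have "sqn (\<lambda>x. smoothed s (x + p) - smoothed s x) = sqn (\<lambda>\<xi>. damped s \<xi> * (cis (p \<bullet> \<xi>) - 1))"
  proof (rule sqn_damped_modulated[OF s])
    fix x
    have i: "integrable lborel (\<lambda>\<xi>. damped s \<xi> * cis (y \<bullet> \<xi>))" for y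
      using s by (intro integrable_mult_cis damped_integrable) auto
    have e: "complex_of_real c * smoothed s y = (\<integral>\<xi>. damped s \<xi> * cis (y \<bullet> \<xi>) \<partial>lborel)" for y
      using ft_damped[OF s, of y] by (simp add: ft_def inner_commute)
    have "complex_of_real c * (smoothed s (x + p) - smoothed s x) = (\<integral>\<xi>. damped s \<xi> * cis ((x + p) \<bullet> \<xi>) \<partial>lborel) - (\<integral>\<xi>. damped s \<xi> * cis (x \<bullet> \<xi>) \<partial>lborel)"
      by (simp only: right_diff_distrib e)
    also have "\<dots> = (\<integral>\<xi>. damped s \<xi> * cis ((x + p) \<bullet> \<xi>) - damped s \<xi> * cis (x \<bullet> \<xi>) \<partial>lborel)"
      by (rule Bochner_Integration.integral_diff[symmetric]) (rule i)+
    also have "\<dots> = ft (\<lambda>\<xi>. damped s \<xi> * (cis (p \<bullet> \<xi>) - 1)) (- x)"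
      unfolding ft_def by (intro Bochner_Integration.integral_cong refl)
        (simp add: inner_add_left inner_commute[of _ x] algebra_simps flip: cis_mult)
    finally show "complex_of_real c * (smoothed s (x + p) - smoothed s x) = ft (\<lambda>\<xi>. damped s \<xi> * (cis (p \<bullet> \<xi>) - 1)) (- x)" .
  qed (use mb in auto)
  also have "\<dots> \<le> sqn (\<lambda>\<xi>. v \<xi> * (cis (p \<bullet> \<xi>) - 1))"
    by (rule sqn_mono) (auto simp: norm_mult intro!: mult_right_mono damped_le)
  finally show ?thesis .
qed

text \<open>The error is a Gaussian average of the increments \<open>u (x + s z) - u x\<close>, to
  which \<open>sqn_average\<close>, continuity of translations and dominated convergence in
  \<open>z\<close> apply.\<close>

lemma smoothed_tendsto:
  assumes s: "\<And>n. s n > 0" and slim: "s \<longlonglongrightarrow> 0"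
  shows "(\<lambda>n. sqn (\<lambda>x. smoothed (s n) x - complex_of_real c * u x)) \<longlonglongrightarrow> 0"
proof (rule tendsto_0_ennreal_le)
  let ?B = "\<lambda>n. (\<integral>\<^sup>+z. ennreal (gauss (z::'a)) \<partial>lborel) * (\<integral>\<^sup>+z. ennreal (gauss z) * sqn (\<lambda>x. u (x + s n *\<^sub>R z) - u x) \<partial>lborel)"
  have [measurable]: "(\<lambda>z. sqn (\<lambda>x. u (x + r *\<^sub>R z) - u x)) \<in> borel_measurable borel" for r
    unfolding sqn_def by (subst measurable_lborel2[symmetric]) measurable
  have "(\<lambda>n. \<integral>\<^sup>+z. ennreal (gauss z) * sqn (\<lambda>x. u (x + s n *\<^sub>R z) - u x) \<partial>lborel) \<longlonglongrightarrow> (\<integral>\<^sup>+z. 0 \<partial>(lborel :: 'a measure))"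
  proof (rule nn_integral_dominated_convergence[where w = "\<lambda>z. ennreal (gauss z) * (4 * sqn u)"])
    show "AE z in lborel. ennreal (gauss z) * sqn (\<lambda>x. u (x + s n *\<^sub>R z) - u x) \<le> ennreal (gauss z) * (4 * sqn u)" for n
    proof (intro AE_I2 mult_left_mono)
      fix z
      have "sqn (\<lambda>x. u (x + s n *\<^sub>R z) - u x) \<le> 2 * sqn (\<lambda>x. u (x + s n *\<^sub>R z)) + 2 * sqn u" by (rule sqn_diff_le2) auto
      also have "\<dots> = 4 * sqn u" by (simp add: sqn_translate flip: distrib_right)
      finally show "sqn (\<lambda>x. u (x + s n *\<^sub>R z) - u x) \<le> 4 * sqn u" .
    qed auto
    show "AE z in lborel. (\<lambda>n. ennreal (gauss z) * sqn (\<lambda>x. u (x + s n *\<^sub>R z) - u x)) \<longlonglongrightarrow> 0"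
    proof (intro AE_I2 tendsto_0_ennreal_cmult sqn_shift_tendsto_0 um ufin)
      fix z :: 'a
      have "(\<lambda>n. s n *\<^sub>R z) \<longlonglongrightarrow> 0 *\<^sub>R z" by (intro tendsto_intros slim)
      then show "(\<lambda>n. s n *\<^sub>R z) \<longlonglongrightarrow> 0" by simp
    qed auto
    show "(\<integral>\<^sup>+z. ennreal (gauss z) * (4 * sqn u) \<partial>(lborel :: 'a measure)) < \<infinity>"
      using ufin by (subst nn_integral_multc) (auto simp: nn_integral_gauss ennreal_mult_less_top)
  qed auto
  then show "?B \<longlonglongrightarrow> 0" by (intro tendsto_0_ennreal_cmult) (auto simp: nn_integral_gauss)
  fix n
  show "sqn (\<lambda>x. smoothed (s n) x - complex_of_real c * u x) \<le> ?B n"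
  proof (rule sqn_average)
    fix x
    have "complex_of_real c * u x = (\<integral>z. u x * complex_of_real (gauss z) \<partial>(lborel :: 'a measure))"
      by (simp add: integral_complex_of_real integral_gauss c_def mult.commute)
    moreover have "integrable lborel (\<lambda>z. u (x + s n *\<^sub>R z) * complex_of_real (gauss z))"
    proof (rule integrable_mult_sqn)
      have "sqn u = ennreal (\<bar>s n\<bar> ^ DIM('a)) * sqn (\<lambda>z. u (x + s n *\<^sub>R z))"
        unfolding sqn_def
        by (subst nn_integral_translate[of _ x, symmetric], measurable, subst nn_integral_dilate[of _ "s n"])
           (use s[of n] in \<open>auto simp: add.commute\<close>)
      then show "sqn (\<lambda>z. u (x + s n *\<^sub>R z)) < \<infinity>" using ufin s[of n] by (auto simp: ennreal_mult_less_top)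
      show "sqn (\<lambda>z. complex_of_real (gauss (z::'a))) < \<infinity>" using sqn_gauss_scale[of 1, where 'a = 'a] by simp
    qed auto
    moreover have "integrable lborel (\<lambda>z. u x * complex_of_real (gauss (z::'a)))" using integrable_gauss by auto
    ultimately have "smoothed (s n) x - complex_of_real c * u x = (\<integral>z. (u (x + s n *\<^sub>R z) - u x) * complex_of_real (gauss z) \<partial>lborel)"
      unfolding smoothed_def by (simp add: left_diff_distrib)
    then show "ennreal (norm (smoothed (s n) x - complex_of_real c * u x)) \<le> (\<integral>\<^sup>+z. ennreal (gauss z) * ennreal (norm (u (x + s n *\<^sub>R z) - u x)) \<partial>lborel)"
      by (auto intro!: order_trans[OF norm_integral_le_nn] simp: norm_mult ennreal_mult mult.commute)
  qed (auto simp: split_beta)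
qed

text \<open>Replace \<open>c * u\<close> by \<open>smoothed s\<close>; both replacement errors
  vanish with \<open>s\<close>. The factor 2 is the cost of \<open>sqn_add_le2\<close> and is
  harmless where only convergence to 0 is wanted.\<close>

lemma sqn_shift_le: "ennreal (c\<^sup>2) * sqn (\<lambda>x. u (x + p) - u x) \<le> 2 * sqn (\<lambda>\<xi>. v \<xi> * (cis (p \<bullet> \<xi>) - 1))"
proof -
  define s where "s n = 1 / real (Suc n)" for n
  have s: "s n > 0" for n by (simp add: s_def)
  have slim: "s \<longlonglongrightarrow> 0" unfolding s_def using LIMSEQ_inverse_real_of_nat by (simp add: inverse_eq_divide)
  let ?R = "\<lambda>n x. smoothed (s n) x - complex_of_real c * u x"
  let ?V = "sqn (\<lambda>\<xi>. v \<xi> * (cis (p \<bullet> \<xi>) - 1))"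
  have le: "ennreal (c\<^sup>2) * sqn (\<lambda>x. u (x + p) - u x) \<le> 8 * sqn (?R n) + 2 * ?V" for n
  proof -
    have "ennreal (c\<^sup>2) * sqn (\<lambda>x. u (x + p) - u x) = sqn (\<lambda>x. complex_of_real c * (u (x + p) - u x))"
      by (subst sqn_cmult) (auto simp: norm_power)
    also have "\<dots> = sqn (\<lambda>x. (?R n x - ?R n (x + p)) + (smoothed (s n) (x + p) - smoothed (s n) x))"
      by (intro arg_cong[where f = sqn]) (auto simp: algebra_simps)
    also have "\<dots> \<le> 2 * sqn (\<lambda>x. ?R n x - ?R n (x + p)) + 2 * sqn (\<lambda>x. smoothed (s n) (x + p) - smoothed (s n) x)"
      by (rule sqn_add_le2) measurable
    also have "\<dots> \<le> 2 * (2 * sqn (?R n) + 2 * sqn (\<lambda>x. ?R n (x + p))) + 2 * ?V"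
      by (intro add_mono mult_left_mono sqn_diff_le2 smoothed_shift_le s) auto
    also have "sqn (\<lambda>x. ?R n (x + p)) = sqn (?R n)" by (rule sqn_translate[of "?R n"]) measurable
    also have "2 * (2 * sqn (?R n) + 2 * sqn (?R n)) = 8 * sqn (?R n)" by (simp add: mult.assoc[symmetric] flip: distrib_right)
    finally show ?thesis .
  qed
  have "(\<lambda>n. 8 * sqn (?R n)) \<longlonglongrightarrow> 0" by (intro tendsto_0_ennreal_cmult smoothed_tendsto s slim) auto
  then have "(\<lambda>n. 8 * sqn (?R n) + 2 * ?V) \<longlonglongrightarrow> 0 + 2 * ?V" by (intro tendsto_add tendsto_const)
  then show ?thesis using le by (intro LIMSEQ_le_const[of _ "2 * ?V"]) auto
qed

end

section \<open>From the distribution of frequencies to small translation errors\<close>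

lemma norm_cis_minus_1_le: "norm (cis t - 1) \<le> \<bar>t\<bar>"
  using iexp_approx1[of t 0] by (simp add: cis_conv_exp)

text \<open>Low frequencies use \<open>|cis t - 1| \<le> |t|\<close>, high ones the trivial bound 2,
  whose square is the factor 4.\<close>

lemma sqn_frequency_split:
  fixes v :: "'a::euclidean_space \<Rightarrow> complex"
  assumes [measurable]: "v \<in> borel_measurable borel" and R: "R \<ge> 0"
  shows "sqn (\<lambda>\<xi>. v \<xi> * (cis (p \<bullet> \<xi>) - 1)) \<le> ennreal ((norm p * R)\<^sup>2) * sqn v
     + 4 * (\<integral>\<^sup>+\<xi>\<in>{\<xi>. norm \<xi> > R}. ennreal ((norm (v \<xi>))\<^sup>2) \<partial>lborel)"
proof -
  have [measurable]: "{\<xi>::'a. norm \<xi> > R} \<in> sets borel" by measurable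
  have "sqn (\<lambda>\<xi>. v \<xi> * (cis (p \<bullet> \<xi>) - 1)) \<le>
     (\<integral>\<^sup>+\<xi>. ennreal ((norm p * R)\<^sup>2) * ennreal ((norm (v \<xi>))\<^sup>2) + 4 * (ennreal ((norm (v \<xi>))\<^sup>2) * indicator {\<xi>. norm \<xi> > R} \<xi>) \<partial>lborel)"
    unfolding sqn_def
  proof (intro nn_integral_mono)
    fix \<xi> :: 'a
    show "ennreal ((norm (v \<xi> * (cis (p \<bullet> \<xi>) - 1)))\<^sup>2) \<le> ennreal ((norm p * R)\<^sup>2) * ennreal ((norm (v \<xi>))\<^sup>2) + 4 * (ennreal ((norm (v \<xi>))\<^sup>2) * indicator {\<xi>. norm \<xi> > R} \<xi>)"
    proof (cases "norm \<xi> > R")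
      case True
      have "norm (cis (p \<bullet> \<xi>) - 1) \<le> 2" using norm_triangle_ineq4[of "cis (p \<bullet> \<xi>)" 1] by simp
      then have "(norm (cis (p \<bullet> \<xi>) - 1))\<^sup>2 \<le> 2\<^sup>2" by (intro power_mono) auto
      then have "(norm (v \<xi> * (cis (p \<bullet> \<xi>) - 1)))\<^sup>2 \<le> 4 * (norm (v \<xi>))\<^sup>2"
        using mult_right_mono[of "(norm (cis (p \<bullet> \<xi>) - 1))\<^sup>2" 4 "(norm (v \<xi>))\<^sup>2"] by (simp add: norm_mult power_mult_distrib mult.commute)
      then have "ennreal ((norm (v \<xi> * (cis (p \<bullet> \<xi>) - 1)))\<^sup>2) \<le> ennreal (4 * (norm (v \<xi>))\<^sup>2)" by (rule ennreal_leI)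
      then show ?thesis using True by (simp add: ennreal_mult add_increasing)
    next
      case False
      have "norm (cis (p \<bullet> \<xi>) - 1) \<le> norm p * R"
        using norm_cis_minus_1_le[of "p \<bullet> \<xi>"] Cauchy_Schwarz_ineq2[of p \<xi>] False mult_left_mono[of "norm \<xi>" R "norm p"] by simp
      then have "(norm (cis (p \<bullet> \<xi>) - 1))\<^sup>2 \<le> (norm p * R)\<^sup>2" by (intro power_mono) auto
      then have "(norm (v \<xi> * (cis (p \<bullet> \<xi>) - 1)))\<^sup>2 \<le> (norm p * R)\<^sup>2 * (norm (v \<xi>))\<^sup>2"
        using mult_right_mono[of "(norm (cis (p \<bullet> \<xi>) - 1))\<^sup>2" "(norm p * R)\<^sup>2" "(norm (v \<xi>))\<^sup>2"] by (simp add: norm_mult power_mult_distrib mult.commute)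
      then have "ennreal ((norm (v \<xi> * (cis (p \<bullet> \<xi>) - 1)))\<^sup>2) \<le> ennreal ((norm p * R)\<^sup>2 * (norm (v \<xi>))\<^sup>2)" by (rule ennreal_leI)
      then show ?thesis using False by (simp add: ennreal_mult)
    qed
  qed
  also have "\<dots> = ennreal ((norm p * R)\<^sup>2) * sqn v + 4 * (\<integral>\<^sup>+\<xi>\<in>{\<xi>. norm \<xi> > R}. ennreal ((norm (v \<xi>))\<^sup>2) \<partial>lborel)"
    unfolding sqn_def by (subst nn_integral_add) (auto simp: nn_integral_cmult)
  finally show ?thesis .
qed

lemma lebesgue_borel_representative:
  fixes f :: "'a::euclidean_space \<Rightarrow> complex"
  assumes f: "f \<in> borel_measurable lebesgue"
  obtains g where "g \<in> borel_measurable borel" "AE x in lborel. f x = g x"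
proof -
  have "(\<lambda>x. Re (f x)) \<in> borel_measurable lebesgue" "(\<lambda>x. Im (f x)) \<in> borel_measurable lebesgue"
    using f by (auto intro: borel_measurable_continuous_on[of Re] borel_measurable_continuous_on[of Im] continuous_intros)
  then obtain g1 g2 where g: "g1 \<in> borel_measurable lborel" "AE x in lborel. Re (f x) = g1 x"
    "g2 \<in> borel_measurable lborel" "AE x in lborel. Im (f x) = g2 x"
    using completion_ex_borel_measurable_real by metis
  show ?thesis
  proof (rule that[of "\<lambda>x. complex_of_real (g1 x) + \<i> * complex_of_real (g2 x)"])
    show "AE x in lborel. f x = complex_of_real (g1 x) + \<i> * complex_of_real (g2 x)"
      using g(2,4) by eventually_elim (auto simp: complex_eq_iff)
  qed (use g in auto)
qed

lemma integral_lebesgue_AE: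
  fixes f g :: "'a::euclidean_space \<Rightarrow> complex"
  assumes "g \<in> borel_measurable borel" "AE x in lborel. f x = g x"
  shows "(\<integral>x. f x \<partial>lebesgue) = (\<integral>x. g x \<partial>lborel)"
proof -
  have ae: "AE x in lebesgue. f x = g x" using assms(2) by (rule AE_completion)
  have gm: "g \<in> borel_measurable lebesgue" using assms(1) by (intro measurable_completion) simp
  have fm: "f \<in> borel_measurable lebesgue"
    using borel_measurable_AE[OF gm, of f] ae by (auto simp: eq_commute)
  have "(\<integral>x. f x \<partial>lebesgue) = (\<integral>x. g x \<partial>lebesgue)" by (rule integral_cong_AE[OF fm gm ae])
  also have "\<dots> = (\<integral>x. g x \<partial>lborel)" using assms(1) by (intro integral_completion) simp
  finally show ?thesis .
qed

text \<open>\<open>fourier_L2\<close> is a Hilbert choice, so \<open>L2_fourier_exists\<close> must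
  first guarantee its defining property. Thereafter only this property of the chosen function is
  used, on a Borel version of it.\<close>

lemma fourier_L2_pair:
  fixes u :: "'a::euclidean_space \<Rightarrow> complex"
  assumes um[measurable]: "u \<in> borel_measurable borel" and ufin: "sqn u < \<infinity>"
  obtains v where "L2_fourier_pair u v (sqrt (2 * pi) ^ DIM('a))" "AE x in lborel. fourier_L2 u x = v x"
proof -
  have ftf: "(\<integral>x. u x * fourier f x \<partial>lebesgue) = (\<integral>x. u x * ft f x \<partial>lborel)" if "f \<in> schwartz" for f
    using schwartz_measurable[OF that] by (subst fourier_eq_ft) (auto intro!: integral_completion)
  obtain v0 where v0[measurable]: "v0 \<in> borel_measurable borel" and v0f: "sqn v0 < \<infinity>"
    and p: "\<And>f. integrable lborel f \<Longrightarrow> sqn f < \<infinity> \<Longrightarrow> (\<integral>x. v0 x * f x \<partial>lborel) = (\<integral>x. u x * ft f x \<partial>lborel)"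
    using L2_fourier_exists[OF um ufin] by blast
  have v0i: "(\<integral>x. v0 x * f x \<partial>lebesgue) = (\<integral>x. v0 x * f x \<partial>lborel)" if "f \<in> schwartz" for f
    using schwartz_measurable[OF that] by (intro integral_completion) auto
  have "v0 \<in> L2 \<and> (\<forall>f\<in>schwartz. fun_dist v0 f = fourier_dist (fun_dist u) f)"
    unfolding L2_def fun_dist_def fourier_dist_def
    using sqn_finite_iff[OF v0] v0f schwartz_measurable
    by (auto simp: ftf v0i p[OF schwartz_integrable schwartz_sqn_finite] intro!: measurable_completion integrable_completion[THEN iffD2])
  then have "fourier_L2 u \<in> L2 \<and> (\<forall>f\<in>schwartz. fun_dist (fourier_L2 u) f = fourier_dist (fun_dist u) f)"
    unfolding fourier_L2_def by (rule someI[where P = "\<lambda>v. v \<in> L2 \<and> (\<forall>f\<in>schwartz. fun_dist v f = fourier_dist (fun_dist u) f)"])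
  then have L: "fourier_L2 u \<in> borel_measurable lebesgue" "integrable lebesgue (\<lambda>x. (norm (fourier_L2 u x))\<^sup>2)"
    and pr: "\<And>f. f \<in> schwartz \<Longrightarrow> (\<integral>x. fourier_L2 u x * f x \<partial>lebesgue) = (\<integral>x. u x * fourier f x \<partial>lebesgue)"
    by (auto simp: L2_def fun_dist_def fourier_dist_def)
  obtain v where v[measurable]: "v \<in> borel_measurable borel" and ae: "AE x in lborel. fourier_L2 u x = v x"
    using lebesgue_borel_representative[OF L(1)] by blast
  have "sqn v = (\<integral>\<^sup>+x. ennreal ((norm (fourier_L2 u x))\<^sup>2) \<partial>lebesgue)"
    unfolding sqn_def nn_integral_completion using ae by (intro nn_integral_cong_AE) auto
  also have "\<dots> < \<infinity>" using L(2) by (auto simp: integrable_iff_bounded)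
  finally have vf: "sqn v < \<infinity>" .
  have "L2_fourier_pair u v (sqrt (2 * pi) ^ DIM('a))"
  proof
    fix f :: "'a \<Rightarrow> complex" assume f: "f \<in> schwartz"
    have [measurable]: "f \<in> borel_measurable borel" by (rule schwartz_measurable[OF f])
    have "(\<integral>x. fourier_L2 u x * f x \<partial>lebesgue) = (\<integral>x. v x * f x \<partial>lborel)"
      using ae by (intro integral_lebesgue_AE) auto
    then show "(\<integral>x. v x * f x \<partial>lborel) = (\<integral>x. u x * ft f x \<partial>lborel)"
      using pr[OF f] ftf[OF f] by simp
  qed (use um ufin v vf in auto)
  then show ?thesis using ae by (rule that)
qed

text \<open>First \<open>R\<close> is chosen by oscillation, so that frequencies above
  \<open>R / \<epsilon> k\<close> eventually contribute little; below that threshold the multiplier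
  is at most \<open>norm z * (h k / \<epsilon> k) * R\<close>, which tends to 0 for this fixed
  \<open>R\<close>.\<close>

lemma oscillatory_shift:
  fixes u :: "nat \<Rightarrow> 'a::euclidean_space \<Rightarrow> complex"
  assumes um: "\<And>k. u k \<in> borel_measurable borel" and uK: "\<And>k. sqn (u k) \<le> ennreal K"
    and osc: "oscillatory \<epsilon> u" and h: "\<And>k. h k > 0" and e: "\<And>k. \<epsilon> k > 0"
    and he: "(\<lambda>k. h k / \<epsilon> k) \<longlonglongrightarrow> 0"
  shows "(\<lambda>k. sqn (\<lambda>x. u k (x + h k *\<^sub>R z) - u k x)) \<longlonglongrightarrow> 0"
proof (rule tendsto_0_ennrealI)
  fix r :: real assume r: "r > 0"
  define c where "c = sqrt (2 * pi) ^ DIM('a)"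
  \<comment> \<open>Lets the factor \<open>c\<^sup>2\<close> in \<open>sqn_shift_le\<close> be
    dropped.\<close>
  have c1: "c\<^sup>2 \<ge> 1"
  proof -
    have "(2 * pi) ^ DIM('a) \<ge> 1" using pi_ge_two by (intro one_le_power) auto
    then show ?thesis by (simp add: c_def sqrt_2pi_power_sq)
  qed
  have uf: "sqn (u k) < \<infinity>" for k using uK[of k] by (auto intro: le_less_trans)
  define K' where "K' = max K 0"
  have uK': "sqn (u k) \<le> ennreal K'" and K'0: "K' \<ge> 0" for k
    using uK[of k] by (auto simp: K'_def max_def ennreal_neg)
  define tail where "tail R k = (\<integral>\<^sup>+\<xi>\<in>{\<xi>. norm \<xi> > R / \<epsilon> k}. ennreal ((norm (fourier_L2 (u k) \<xi>))\<^sup>2) \<partial>lebesgue)" for R k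
  \<comment> \<open>\<open>r/16\<close> is multiplied by 4 in \<open>sqn_frequency_split\<close> and
    by 2 in \<open>sqn_shift_le\<close>, which leaves \<open>r/2\<close>.\<close>
  have "eventually (\<lambda>R. limsup (tail R) < ennreal (r/16)) at_top"
    using osc r unfolding oscillatory_def tail_def by (intro order_tendstoD(2)) auto
  then have "eventually (\<lambda>R. R \<ge> 0 \<and> limsup (tail R) < ennreal (r/16)) at_top"
    using eventually_ge_at_top[of 0] by eventually_elim auto
  then obtain R where R: "R \<ge> 0" "limsup (tail R) < ennreal (r/16)"
    by (auto simp: eventually_at_top_linorder)
  have ev1: "eventually (\<lambda>k. tail R k < ennreal (r/16)) sequentially"
    using R(2) by (rule Limsup_lessD)
  have "(\<lambda>k. 2 * (norm z * (h k / \<epsilon> k) * R)\<^sup>2 * (c\<^sup>2 * K')) \<longlonglongrightarrow> 2 * (norm z * 0 * R)\<^sup>2 * (c\<^sup>2 * K')"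
    by (intro tendsto_intros he)
  then have ev2: "eventually (\<lambda>k. 2 * (norm z * (h k / \<epsilon> k) * R)\<^sup>2 * (c\<^sup>2 * K') < r/2) sequentially"
    using r by (intro order_tendstoD(2)) auto
  show "eventually (\<lambda>k. sqn (\<lambda>x. u k (x + h k *\<^sub>R z) - u k x) \<le> ennreal r) sequentially"
    using ev1 ev2
  proof eventually_elim
    case (elim k)
    obtain v where v: "L2_fourier_pair (u k) v c" and ae: "AE x in lborel. fourier_L2 (u k) x = v x"
      using fourier_L2_pair[OF um uf, of k] unfolding c_def by blast
    interpret L2_fourier_pair "u k" v c by (rule v)
    let ?p = "h k *\<^sub>R z" and ?R = "R / \<epsilon> k"
    have R0: "?R \<ge> 0" using R e[of k] by simp
    have tl: "(\<integral>\<^sup>+\<xi>\<in>{\<xi>. norm \<xi> > ?R}. ennreal ((norm (v \<xi>))\<^sup>2) \<partial>lborel) = tail R k"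
      unfolding tail_def nn_integral_completion using ae by (intro nn_integral_cong_AE) auto
    have "sqn (\<lambda>x. u k (x + ?p) - u k x) \<le> ennreal (c\<^sup>2) * sqn (\<lambda>x. u k (x + ?p) - u k x)"
      using mult_right_mono[of 1 "ennreal (c\<^sup>2)" "sqn (\<lambda>x. u k (x + ?p) - u k x)"] c1 by simp
    also have "\<dots> \<le> 2 * sqn (\<lambda>\<xi>. v \<xi> * (cis (?p \<bullet> \<xi>) - 1))" by (rule sqn_shift_le)
    also have "\<dots> \<le> 2 * (ennreal ((norm ?p * ?R)\<^sup>2) * sqn v + 4 * tail R k)"
      unfolding tl[symmetric] by (intro mult_left_mono sqn_frequency_split vm R0) auto
    also have "\<dots> \<le> 2 * (ennreal ((norm ?p * ?R)\<^sup>2) * ennreal (c\<^sup>2 * K') + 4 * ennreal (r/16))"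
    proof (intro mult_left_mono add_mono)
      have "sqn v \<le> ennreal (c\<^sup>2) * sqn (u k)" by (rule sqn_fourier_le)
      also have "\<dots> \<le> ennreal (c\<^sup>2) * ennreal K'" by (intro mult_left_mono uK') auto
      also have "\<dots> = ennreal (c\<^sup>2 * K')" using K'0 by (simp add: ennreal_mult)
      finally show "sqn v \<le> ennreal (c\<^sup>2 * K')" .
    qed (use elim in auto)
    also have "\<dots> = ennreal (2 * (norm ?p * ?R)\<^sup>2 * (c\<^sup>2 * K') + r/2)"
    proof -
      have "2 * (ennreal a + 4 * ennreal (r/16)) = ennreal (2 * a + r/2)" if "a \<ge> 0" for a
      proof -
        have "2 * (ennreal a + 4 * ennreal (r/16)) = ennreal 2 * (ennreal a + ennreal 4 * ennreal (r/16))" by simp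
        also have "\<dots> = ennreal (2 * (a + 4 * (r/16)))"
          using that r by (simp add: ennreal_mult[symmetric] ennreal_plus[symmetric] del: ennreal_plus ennreal_numeral)
        finally show ?thesis by simp
      qed
      from this[of "(norm ?p * ?R)\<^sup>2 * (c\<^sup>2 * K')"] K'0 show ?thesis by (simp add: ennreal_mult mult.assoc)
    qed
    also have "norm ?p * ?R = norm z * (h k / \<epsilon> k) * R" using h[of k] by simp
    also have "ennreal (2 * (norm z * (h k / \<epsilon> k) * R)\<^sup>2 * (c\<^sup>2 * K') + r/2) \<le> ennreal r"
      using elim(2) by (intro ennreal_leI) linarith
    finally show ?case .
  qed
qed

section \<open>The unit cell and the integer lattice\<close>

text \<open>Half-open, so that its lattice translates partition the space with no overlap at
  all.\<close>

definition cell :: "(real ^ 'n) set" where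
  "cell = {x. \<forall>i. 0 \<le> x $ i \<and> x $ i < 1}"

lemma cell_measurable[measurable]: "cell \<in> sets borel"
proof -
  have "cell = (\<Inter>i\<in>UNIV. {x::real^'n. 0 \<le> x $ i \<and> x $ i < 1})" by (auto simp: cell_def)
  also have "\<dots> \<in> sets borel" by (intro sets.finite_INT) (auto, measurable)
  finally show ?thesis .
qed

lemma emeasure_cell: "emeasure lborel (cell :: (real^'n) set) = 1"
proof (rule antisym)
  have one: "(1::real^'n) \<bullet> b = 1" if "b \<in> Basis" for b :: "real^'n"
    using that by (auto simp: Basis_vec_def inner_axis)
  have "(cell :: (real^'n) set) \<subseteq> cbox 0 1"
    by (auto simp: cell_def mem_box_cart less_imp_le)
  then have "emeasure lborel (cell :: (real^'n) set) \<le> emeasure lborel (cbox (0::real^'n) 1)" by (intro emeasure_mono) auto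
  also have "\<dots> = 1" by (subst emeasure_lborel_cbox) (simp_all add: one)
  finally show "emeasure lborel (cell :: (real^'n) set) \<le> 1" .
  have "1 = emeasure lborel (box (0::real^'n) 1)" by (subst emeasure_lborel_box) (simp_all add: one)
  also have "\<dots> \<le> emeasure lborel (cell :: (real^'n) set)"
    by (intro emeasure_mono) (auto simp: cell_def mem_box_cart less_imp_le)
  finally show "1 \<le> emeasure lborel (cell :: (real^'n) set)" .
qed

lemma cell_bounded: "\<exists>B>0. \<forall>z\<in>(cell :: (real^'n) set). norm z \<le> B"
proof -
  have "norm z \<le> real CARD('n)" if "z \<in> cell" for z :: "real^'n"
  proof -
    have "norm z \<le> (\<Sum>i\<in>UNIV. \<bar>z $ i\<bar>)" by (rule norm_le_l1_cart)
    also have "\<dots> \<le> (\<Sum>i\<in>(UNIV::'n set). 1)" using that by (intro sum_mono) (auto simp: cell_def less_imp_le)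
    finally show ?thesis by simp
  qed
  then show ?thesis by (intro exI[of _ "real CARD('n)"]) auto
qed

lemma ex1_lattice_cell: "\<exists>!n. x + lattice_point n \<in> (cell :: (real^'n) set)"
proof (rule ex1I[of _ "\<chi> i. - \<lfloor>x $ i\<rfloor>"])
  show "x + lattice_point (\<chi> i. - \<lfloor>x $ i\<rfloor>) \<in> cell"
    unfolding cell_def lattice_point_def by (auto; linarith)
  fix n assume "x + lattice_point n \<in> cell"
  then have "0 \<le> x $ i + of_int (n $ i)" "x $ i + of_int (n $ i) < 1" for i
    by (auto simp: cell_def lattice_point_def)
  then have "\<lfloor>x $ i\<rfloor> = - (n $ i)" for i
    by (intro floor_unique) (simp_all add: add_nonneg_eq_0_iff, smt+)
  then show "n = (\<chi> i. - \<lfloor>x $ i\<rfloor>)" by (simp add: vec_eq_iff)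
qed

lemma lattice_point_add: "lattice_point (n + m) = lattice_point n + lattice_point m"
  and lattice_point_uminus: "lattice_point (- n) = - lattice_point n"
  by (simp_all add: lattice_point_def vec_eq_iff)

text \<open>Insert the partition of unity by translates of the cell and translate each piece back.
  Writing the sum as an integral over counting measure lets Tonelli give both orders.\<close>

lemma nn_integral_lattice_tiling:
  fixes f :: "real ^ 'n \<Rightarrow> ennreal"
  assumes [measurable]: "f \<in> borel_measurable borel"
  shows "(\<integral>\<^sup>+x. f x \<partial>lborel) = (\<integral>\<^sup>+n. (\<integral>\<^sup>+x. f (x - lattice_point n) * indicator cell x \<partial>lborel) \<partial>count_space UNIV)"
    and "(\<integral>\<^sup>+x. f x \<partial>lborel) = (\<integral>\<^sup>+x. (\<integral>\<^sup>+n. f (x - lattice_point n) \<partial>count_space UNIV) * indicator cell x \<partial>lborel)"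
proof -
  have "(\<integral>\<^sup>+x. f x \<partial>lborel) = (\<integral>\<^sup>+x. (\<integral>\<^sup>+n. f x * indicator cell (x + lattice_point n) \<partial>count_space UNIV) \<partial>lborel)"
  proof (intro nn_integral_cong)
    fix x :: "real^'n"
    obtain m where m: "x + lattice_point m \<in> cell" "\<And>n. x + lattice_point n \<in> cell \<Longrightarrow> n = m"
      using ex1_lattice_cell[of x] by auto
    have ind: "indicator cell (x + lattice_point n) = (indicator {m} n :: ennreal)" for n
    proof (cases "n = m")
      case False
      then have "x + lattice_point n \<notin> cell" using m(2) by blast
      with False show ?thesis by simp
    qed (use m(1) in simp)
    have "(\<integral>\<^sup>+n. f x * indicator cell (x + lattice_point n) \<partial>count_space UNIV) = (\<integral>\<^sup>+n. f x * indicator {m} n \<partial>count_space UNIV)"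
      by (simp only: ind)
    also have "\<dots> = f x" by (subst nn_integral_cmult_indicator) auto
    finally show "f x = (\<integral>\<^sup>+n. f x * indicator cell (x + lattice_point n) \<partial>count_space UNIV)" by simp
  qed
  also have "\<dots> = (\<integral>\<^sup>+n. (\<integral>\<^sup>+x. f x * indicator cell (x + lattice_point n) \<partial>lborel) \<partial>count_space UNIV)"
    by (rule nn_integral_count_space_nn_integral) auto
  also have "\<dots> = (\<integral>\<^sup>+n. (\<integral>\<^sup>+x. f (x - lattice_point n) * indicator cell x \<partial>lborel) \<partial>count_space UNIV)"
  proof (rule nn_integral_cong)
    fix n :: "int^'n"
    show "(\<integral>\<^sup>+x. f x * indicator cell (x + lattice_point n) \<partial>lborel) = (\<integral>\<^sup>+x. f (x - lattice_point n) * indicator cell x \<partial>lborel)"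
      using nn_integral_translate[of "\<lambda>x. f (x - lattice_point n) * indicator cell x" "lattice_point n"] by simp
  qed
  finally show 1: "(\<integral>\<^sup>+x. f x \<partial>lborel) = (\<integral>\<^sup>+n. (\<integral>\<^sup>+x. f (x - lattice_point n) * indicator cell x \<partial>lborel) \<partial>count_space UNIV)" .
  also have "\<dots> = (\<integral>\<^sup>+x. (\<integral>\<^sup>+n. f (x - lattice_point n) * indicator cell x \<partial>count_space UNIV) \<partial>lborel)"
    by (rule nn_integral_count_space_nn_integral[symmetric]) auto
  also have "\<dots> = (\<integral>\<^sup>+x. (\<integral>\<^sup>+n. f (x - lattice_point n) \<partial>count_space UNIV) * indicator cell x \<partial>lborel)"
    by (intro nn_integral_cong) (auto simp: indicator_def)
  finally show "(\<integral>\<^sup>+x. f x \<partial>lborel) = (\<integral>\<^sup>+x. (\<integral>\<^sup>+n. f (x - lattice_point n) \<partial>count_space UNIV) * indicator cell x \<partial>lborel)" .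
qed

section \<open>Lattice sums of decaying functions\<close>

definition decay :: "real \<Rightarrow> 'a::euclidean_space \<Rightarrow> real" where
  "decay a x = (1 + norm x) powr (- a)"

lemma decay_nonneg[simp]: "decay a x \<ge> 0"
  by (simp add: decay_def)

lemma measurable_decay[measurable]: "decay a \<in> borel_measurable borel"
  unfolding decay_def by measurable

lemma decay_antimono: "a \<ge> 0 \<Longrightarrow> norm x \<le> norm y \<Longrightarrow> decay a y \<le> decay a x"
  unfolding decay_def by (intro powr_mono2') (auto intro: add_pos_nonneg)

lemma decay_le_1: "a \<ge> 0 \<Longrightarrow> decay a x \<le> 1"
  using decay_antimono[of a 0 x] by (simp add: decay_def)

text \<open>The weight \<open>1 + norm x\<close> is submultiplicative.\<close>

lemma decay_add_ge:
  assumes "a \<ge> 0"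
  shows "decay a x * decay a z \<le> decay a (x + z)"
proof -
  have "1 + norm (x + z) \<le> 1 + (norm x + norm z)" by (simp add: norm_triangle_ineq)
  also have "\<dots> \<le> (1 + norm x) * (1 + norm z)" by (simp add: algebra_simps)
  finally have "((1 + norm x) * (1 + norm z)) powr (- a) \<le> decay a (x + z)"
    unfolding decay_def using assms by (intro powr_mono2') (auto intro: add_pos_nonneg)
  then show ?thesis by (simp add: decay_def powr_mult)
qed

lemma decay_half_le:
  assumes "a \<ge> 0"
  shows "decay a (z /\<^sub>R 2) \<le> 2 powr a * decay a z"
proof -
  have "decay a (z /\<^sub>R 2) \<le> ((1 + norm z) / 2) powr (- a)"
    unfolding decay_def using assms by (intro powr_mono2') (auto intro: add_pos_nonneg)
  also have "\<dots> = 2 powr a * decay a z" by (simp add: decay_def powr_divide powr_minus divide_simps)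
  finally show ?thesis .
qed

text \<open>One of \<open>x\<close> and \<open>x + z\<close> has norm at least
  \<open>norm z / 2\<close>; its factor is bounded by \<open>decay a (z /\<^sub>R 2)\<close> and the
  other one is kept. This extracts decay in \<open>z\<close> while leaving something summable over
  the lattice.\<close>

lemma decay_mult_le:
  assumes a: "a \<ge> 0"
  shows "decay a x * decay a (x + z) \<le> 2 powr a * decay a z * (decay a x + decay a (x + z))"
proof -
  have "norm (z /\<^sub>R 2) \<le> norm x \<or> norm (z /\<^sub>R 2) \<le> norm (x + z)"
    using norm_triangle_ineq4[of "x + z" x] by auto
  then have "decay a x \<le> decay a (z /\<^sub>R 2) \<or> decay a (x + z) \<le> decay a (z /\<^sub>R 2)"
    using decay_antimono[OF a] by blast
  then have "decay a x * decay a (x + z) \<le> decay a (z /\<^sub>R 2) * (decay a x + decay a (x + z))"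
  proof
    assume "decay a x \<le> decay a (z /\<^sub>R 2)"
    then have "decay a x * decay a (x + z) \<le> decay a (z /\<^sub>R 2) * decay a (x + z)" by (intro mult_right_mono) auto
    then show ?thesis by (simp add: distrib_left add_increasing)
  next
    assume "decay a (x + z) \<le> decay a (z /\<^sub>R 2)"
    then have "decay a (x + z) * decay a x \<le> decay a (z /\<^sub>R 2) * decay a x" by (intro mult_right_mono) auto
    then have "decay a x * decay a (x + z) \<le> decay a (z /\<^sub>R 2) * decay a x" by (simp only: mult.commute)
    then show ?thesis by (simp add: distrib_left add_increasing2)
  qed
  also have "\<dots> \<le> 2 powr a * decay a z * (decay a x + decay a (x + z))"
    by (intro mult_right_mono decay_half_le a) auto
  finally show ?thesis .
qed

lemma nn_integral_decay: "a > real DIM('a::euclidean_space) \<Longrightarrow> (\<integral>\<^sup>+x. ennreal (decay a (x::'a)) \<partial>lborel) < \<infinity>"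
  unfolding decay_def by (rule nn_integral_decay_finite)

text \<open>By \<open>decay_add_ge\<close> the value at \<open>y\<close> is at most a constant times
  the mean over \<open>y + cell\<close>, and the tiling lemma sums these means to one integral over
  the whole space.\<close>

lemma lattice_sum_decay:
  assumes a: "a > real CARD('n)"
  obtains M where "M > 0" "\<And>x::real^'n. (\<integral>\<^sup>+n. ennreal (decay a (x - lattice_point n)) \<partial>count_space UNIV) \<le> ennreal M"
proof -
  have a0: "a \<ge> 0" using a by simp
  obtain B where B: "B > 0" "\<And>z. z \<in> (cell :: (real^'n) set) \<Longrightarrow> norm z \<le> B" using cell_bounded by blast
  define K where "K = (1 + B) powr a"
  have K0: "K \<ge> 0" by (simp add: K_def)
  have le: "ennreal (decay a y) \<le> ennreal K * (\<integral>\<^sup>+z. ennreal (decay a (y + z)) * indicator cell z \<partial>lborel)" for y :: "real^'n"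
  proof -
    have "decay a y \<le> K * decay a (y + z)" if "z \<in> cell" for z
    proof -
      have "(1 + B) powr (- a) \<le> decay a z"
        unfolding decay_def using B(2)[OF that] a0 by (intro powr_mono2') (auto intro: add_pos_nonneg)
      then have "decay a y * (1 + B) powr (- a) \<le> decay a y * decay a z" by (intro mult_left_mono) auto
      also have "\<dots> \<le> decay a (y + z)" by (rule decay_add_ge[OF a0])
      finally have "K * (decay a y * (1 + B) powr (- a)) \<le> K * decay a (y + z)" using K0 by (rule mult_left_mono)
      moreover have "K * (decay a y * (1 + B) powr (- a)) = decay a y"
        using B(1) by (simp add: K_def powr_minus)
      ultimately show ?thesis by simp
    qed
    then have "(\<integral>\<^sup>+z. ennreal (decay a y) * indicator (cell :: (real^'n) set) z \<partial>lborel) \<le> (\<integral>\<^sup>+z. ennreal K * (ennreal (decay a (y + z)) * indicator cell z) \<partial>lborel)"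
      using K0 by (intro nn_integral_mono) (auto simp: indicator_def ennreal_mult[symmetric] intro!: ennreal_leI)
    also have "\<dots> = ennreal K * (\<integral>\<^sup>+z. ennreal (decay a (y + z)) * indicator cell z \<partial>lborel)"
      by (intro nn_integral_cmult) measurable
    finally show ?thesis by (simp add: nn_integral_cmult_indicator emeasure_cell)
  qed
  define I where "I = (\<integral>\<^sup>+x. ennreal (decay a (x::real^'n)) \<partial>lborel)"
  have If: "I < \<infinity>" unfolding I_def using a by (intro nn_integral_decay) simp
  have "(\<integral>\<^sup>+n. ennreal (decay a (x - lattice_point n)) \<partial>count_space UNIV) \<le> ennreal K * I" for x :: "real^'n"
  proof -
    have "(\<integral>\<^sup>+n. ennreal (decay a (x - lattice_point n)) \<partial>count_space UNIV) \<le>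
       (\<integral>\<^sup>+n. ennreal K * (\<integral>\<^sup>+z. ennreal (decay a (x - lattice_point n + z)) * indicator cell z \<partial>lborel) \<partial>count_space UNIV)"
      by (intro nn_integral_mono le)
    also have "\<dots> = ennreal K * (\<integral>\<^sup>+n. (\<integral>\<^sup>+z. ennreal (decay a (x + (z - lattice_point n))) * indicator cell z \<partial>lborel) \<partial>count_space UNIV)"
      by (subst nn_integral_cmult) (auto simp: algebra_simps)
    also have "(\<integral>\<^sup>+n. (\<integral>\<^sup>+z. ennreal (decay a (x + (z - lattice_point n))) * indicator cell z \<partial>lborel) \<partial>count_space UNIV) = (\<integral>\<^sup>+z. ennreal (decay a (x + z)) \<partial>lborel)"
      by (rule nn_integral_lattice_tiling(1)[symmetric, of "\<lambda>z. ennreal (decay a (x + z))"]) measurable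
    also have "\<dots> = I"
      unfolding I_def using nn_integral_translate[of "\<lambda>z. ennreal (decay a z)" x] by (simp add: add.commute)
    finally show ?thesis .
  qed
  \<comment> \<open>The added 1 makes the bound strictly positive.\<close>
  moreover have "ennreal K * I \<le> ennreal (K * enn2real I + 1)"
    using If K0 by (cases I) (auto simp: ennreal_mult[symmetric] intro!: ennreal_leI)
  ultimately show ?thesis using K0
    by (intro that[of "K * enn2real I + 1"]) (auto intro: order_trans add_nonneg_pos)
qed

section \<open>Sampling and reconstruction is asymptotically multiplication\<close>

lemma sqn_affine:
  fixes f :: "'a::euclidean_space \<Rightarrow> complex"
  assumes [measurable]: "f \<in> borel_measurable borel" and r: "r \<noteq> 0"
  shows "sqn f = ennreal (\<bar>r\<bar> ^ DIM('a)) * sqn (\<lambda>x. f (r *\<^sub>R x + p))"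
proof -
  have "sqn f = sqn (\<lambda>x. f (x + p))" by (rule sqn_translate[symmetric]) measurable
  also have "\<dots> = ennreal (\<bar>r\<bar> ^ DIM('a)) * sqn (\<lambda>x. f (r *\<^sub>R x + p))"
    unfolding sqn_def by (rule nn_integral_dilate[OF _ r]) measurable
  finally show ?thesis .
qed

lemma sqn_affine_finite:
  fixes f :: "'a::euclidean_space \<Rightarrow> complex"
  assumes "f \<in> borel_measurable borel" "r \<noteq> 0" "sqn f < \<infinity>"
  shows "sqn (\<lambda>x. f (r *\<^sub>R x + p)) < \<infinity>"
  using sqn_affine[OF assms(1,2), of p] assms(2,3) by (auto simp: ennreal_mult_less_top)

text \<open>Here \<open>\<phi>\<close> and \<open>\<psi>\<close> are Borel and satisfy the decay
  bound at every point, with \<open>a\<close> in the role of the dimension plus a positive number.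
  \<open>M\<close> is fixed as a parameter so that all constants can refer to it.\<close>

locale sampling_kernel =
  fixes \<phi> \<psi> :: "real ^ 'n \<Rightarrow> complex" and C a M :: real
  assumes a: "a > real CARD('n)" and C: "C > 0" and M: "M > 0"
    and phi_meas[measurable]: "\<phi> \<in> borel_measurable borel" and psi_meas[measurable]: "\<psi> \<in> borel_measurable borel"
    and phi_le: "\<And>x. norm (\<phi> x) \<le> C * decay a x" and psi_le: "\<And>x. norm (\<psi> x) \<le> C * decay a x"
    and lattice_sum: "\<And>x::real^'n. (\<integral>\<^sup>+n. ennreal (decay a (x - lattice_point n)) \<partial>count_space UNIV) \<le> ennreal M"
begin

lemma a0: "a \<ge> 0" using a by simp

lemma integrable_decay_le:
  assumes "f \<in> borel_measurable borel" "\<And>x. norm (f x) \<le> C * decay a x"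
  shows "integrable lborel (f :: real^'n \<Rightarrow> complex)"
proof (rule Bochner_Integration.integrable_bound)
  show "integrable lborel (\<lambda>x::real^'n. C * decay a x)"
    unfolding decay_def using a by (intro integrable_mult_right integrable_decay) simp
qed (use assms C in \<open>auto simp: abs_mult\<close>)

lemma phi_integrable: "integrable lborel \<phi>" and psi_integrable: "integrable lborel \<psi>"
  by (rule integrable_decay_le; auto intro: phi_le psi_le)+

lemma phi_sqn: "sqn \<phi> < \<infinity>"
proof (rule sqn_finite_bounded_integrable[OF phi_integrable])
  show "norm (\<phi> x) \<le> C" for x
    by (rule order_trans[OF phi_le]) (use C in \<open>simp add: mult_left_le decay_le_1[OF a0]\<close>)
qed

lemma nn_psi_lattice: "(\<integral>\<^sup>+n. ennreal (norm (\<psi> (x - lattice_point n))) \<partial>count_space UNIV) \<le> ennreal (C * M)"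
proof -
  have "(\<integral>\<^sup>+n. ennreal (norm (\<psi> (x - lattice_point n))) \<partial>count_space UNIV) \<le> (\<integral>\<^sup>+n. ennreal C * ennreal (decay a (x - lattice_point n)) \<partial>count_space UNIV)"
    using C by (intro nn_integral_mono) (auto simp: ennreal_mult[symmetric] intro!: ennreal_leI psi_le)
  also have "\<dots> = ennreal C * (\<integral>\<^sup>+n. ennreal (decay a (x - lattice_point n)) \<partial>count_space UNIV)"
    by (intro nn_integral_cmult) auto
  also have "\<dots> \<le> ennreal C * ennreal M" by (intro mult_left_mono lattice_sum) auto
  finally show ?thesis using C M by (simp add: ennreal_mult)
qed

lemma psi_lattice_integrable: "integrable (count_space UNIV) (\<lambda>n. \<psi> (x - lattice_point n))"
  using nn_psi_lattice[of x] by (auto simp: integrable_iff_bounded intro: le_less_trans)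

text \<open>The lattice sum is a Bochner integral over counting measure, so that it is open to
  Fubini's theorem and to bounds by \<open>nn_integral\<close>.\<close>

definition periodization :: "real^'n \<Rightarrow> complex" where
  "periodization x = (\<integral>n. \<psi> (x - lattice_point n) \<partial>count_space UNIV)"

lemma periodization_le: "norm (periodization x) \<le> C * M"
proof -
  have "ennreal (norm (periodization x)) \<le> ennreal (C * M)"
    unfolding periodization_def by (rule order_trans[OF norm_integral_le_nn nn_psi_lattice]) auto
  then show ?thesis using C M by (subst (asm) ennreal_le_iff) auto
qed

lemma measurable_lattice_integral:
  fixes f :: "int^'n \<Rightarrow> real^'n \<Rightarrow> complex"
  assumes "\<And>n. f n \<in> borel_measurable borel"
  shows "(\<lambda>x. \<integral>n. f n x \<partial>count_space UNIV) \<in> borel_measurable borel"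
proof -
  interpret pair_sigma_finite "lborel :: (real^'n) measure" "count_space (UNIV :: (int^'n) set)"
    by (intro pair_sigma_finite.intro sigma_finite_lborel sigma_finite_measure_count_space_countable) auto
  have "(\<lambda>(n, x). f n x) \<in> borel_measurable (count_space (UNIV :: (int^'n) set) \<Otimes>\<^sub>M lborel)"
    by (rule measurable_pair_measure_countable1) (use assms in auto)
  from measurable_compose[OF measurable_pair_swap' this]
  have "(\<lambda>(x, n). f n x) \<in> borel_measurable (lborel \<Otimes>\<^sub>M count_space (UNIV :: (int^'n) set))"
    by (simp add: split_beta')
  then have "(\<lambda>x. \<integral>n. f n x \<partial>count_space UNIV) \<in> borel_measurable lborel"
    by (rule M2.borel_measurable_lebesgue_integral)
  then show ?thesis by simp
qed

lemma periodization_measurable[measurable]: "periodization \<in> borel_measurable borel"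
  unfolding periodization_def by (rule measurable_lattice_integral) measurable

lemma periodization_periodic: "periodization (x + lattice_point m) = periodization x"
proof -
  have "periodization (x + lattice_point m) = (\<integral>n. \<psi> (x - lattice_point (n - m)) \<partial>count_space UNIV)"
    unfolding periodization_def diff_conv_add_uminus lattice_point_add lattice_point_uminus by (simp add: algebra_simps)
  also have "\<dots> = periodization x"
    unfolding periodization_def
    by (rule integral_bij_count_space[where g = "\<lambda>n. n - m" and f = "\<lambda>n. \<psi> (x - lattice_point n)"])
       (auto intro!: bij_betwI[where g = "\<lambda>n. n + m"])
  finally show ?thesis .
qed

definition sample :: "real \<Rightarrow> (real^'n \<Rightarrow> complex) \<Rightarrow> int^'n \<Rightarrow> complex" where
  "sample h u n = complex_of_real (1 / h ^ CARD('n)) * (\<integral>x. u x * cnj (\<phi> (x /\<^sub>R h - lattice_point n)) \<partial>lborel)"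

definition reconstruct :: "real \<Rightarrow> (real^'n \<Rightarrow> complex) \<Rightarrow> real^'n \<Rightarrow> complex" where
  "reconstruct h u x = (\<integral>n. sample h u n * \<psi> (x /\<^sub>R h - lattice_point n) \<partial>count_space UNIV)"

lemma reconstruct_measurable[measurable]: "reconstruct h u \<in> borel_measurable borel"
  unfolding reconstruct_def by (rule measurable_lattice_integral) measurable

definition phi_mean :: complex where "phi_mean = (\<integral>x. cnj (\<phi> x) \<partial>lborel)"

text \<open>The base point \<open>x\<close> is free: the sample is rewritten as a weighted average
  of \<open>u\<close> around whichever point it is to be compared with.\<close>

lemma sample_eq:
  assumes h: "h > 0" and [measurable]: "u \<in> borel_measurable borel"
  shows "sample h u n = (\<integral>z. u (x + h *\<^sub>R z) * cnj (\<phi> (x /\<^sub>R h + z - lattice_point n)) \<partial>lborel)"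
proof -
  let ?f = "\<lambda>y. u y * cnj (\<phi> (y /\<^sub>R h - lattice_point n))"
  have "(\<integral>y. ?f y \<partial>lborel) = (\<integral>y. ?f (y + x) \<partial>lborel)" by (rule integral_translate[symmetric]) measurable
  also have "\<dots> = (\<bar>h\<bar> ^ DIM(real^'n)) *\<^sub>R (\<integral>z. ?f (h *\<^sub>R z + x) \<partial>lborel)"
    using h by (intro integral_dilate[of "\<lambda>y. ?f (y + x)"]) auto
  also have "(\<integral>z. ?f (h *\<^sub>R z + x) \<partial>lborel) = (\<integral>z. u (x + h *\<^sub>R z) * cnj (\<phi> (x /\<^sub>R h + z - lattice_point n)) \<partial>lborel)"
    using h by (intro Bochner_Integration.integral_cong refl) (simp add: scaleR_add_right add.commute)
  finally show ?thesis using h by (simp add: sample_def scaleR_conv_of_real)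
qed

text \<open>Makes the reconstruction series converge absolutely at every point. The bound may depend
  on \<open>u\<close> and \<open>h\<close>.\<close>

lemma sample_bounded:
  assumes h: "h > 0" and [measurable]: "u \<in> borel_measurable borel" and fin: "sqn u < \<infinity>"
  shows "\<exists>B. \<forall>n. norm (sample h u n) \<le> B"
proof -
  have half: "ennreal (1/2) * t \<le> t" for t
  proof -
    have "(1/2::real) \<le> 1" by simp
    from mult_right_mono[OF ennreal_leI[OF this], of t] show ?thesis by (simp only: ennreal_1 mult_1_left) auto
  qed
  have "norm (sample h u n) \<le> enn2real (sqn (\<lambda>z. u (h *\<^sub>R z)) + sqn \<phi>)" for n
  proof -
    have f1: "sqn (\<lambda>z. u (h *\<^sub>R z)) < \<infinity>" using sqn_affine_finite[of u h 0] h fin by simp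
    have "ennreal (norm (sample h u n)) \<le> (\<integral>\<^sup>+z. ennreal (norm (u (h *\<^sub>R z)) * norm (\<phi> (z + (- lattice_point n)))) \<partial>lborel)"
      unfolding sample_eq[OF h assms(2), of n 0]
      by (rule order_trans[OF norm_integral_le_nn]) (auto simp: norm_mult)
    also have "\<dots> \<le> ennreal (1/2) * sqn (\<lambda>z. u (h *\<^sub>R z)) + ennreal (1/(2*1)) * sqn (\<lambda>z. \<phi> (z + (- lattice_point n)))"
      by (rule nn_integral_mult_le) auto
    also have "sqn (\<lambda>z. \<phi> (z + (- lattice_point n))) = sqn \<phi>" by (rule sqn_translate) measurable
    also have "ennreal (1/2) * sqn (\<lambda>z. u (h *\<^sub>R z)) + ennreal (1/(2*1)) * sqn \<phi> \<le> sqn (\<lambda>z. u (h *\<^sub>R z)) + sqn \<phi>"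
      unfolding mult_1_right by (intro add_mono half)
    finally have "ennreal (norm (sample h u n)) \<le> sqn (\<lambda>z. u (h *\<^sub>R z)) + sqn \<phi>" .
    then have "enn2real (ennreal (norm (sample h u n))) \<le> enn2real (sqn (\<lambda>z. u (h *\<^sub>R z)) + sqn \<phi>)"
      using f1 phi_sqn by (intro enn2real_mono) auto
    then show ?thesis by simp
  qed
  then show ?thesis by blast
qed

text \<open>With \<open>t = x / h\<close>, the difference of \<open>reconstruct h u x\<close> and \<open>phi_mean * periodization t * u x\<close> is the integral
  over \<open>z\<close> of \<open>u (x + h z) - u x\<close> times the sum of \<open>cnj (\<phi> (t + z - n)) \<psi> (t - n)\<close> over the lattice. The
  following kernel dominates that sum.\<close>

definition residual_kernel :: "real^'n \<Rightarrow> real" where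
  "residual_kernel z = 2 * C\<^sup>2 * M * 2 powr a * decay a z"

lemma residual_kernel_nonneg: "residual_kernel z \<ge> 0"
  using C M by (simp add: residual_kernel_def)

lemma residual_kernel_measurable[measurable]: "residual_kernel \<in> borel_measurable borel"
  unfolding residual_kernel_def by measurable

lemma residual_kernel_finite: "(\<integral>\<^sup>+z. ennreal (residual_kernel z) \<partial>lborel) < \<infinity>"
proof -
  have "(\<integral>\<^sup>+z. ennreal (residual_kernel z) \<partial>lborel) = ennreal (2 * C\<^sup>2 * M * 2 powr a) * (\<integral>\<^sup>+z. ennreal (decay a (z::real^'n)) \<partial>lborel)"
    unfolding residual_kernel_def using C M by (subst nn_integral_cmult[symmetric]) (auto simp: ennreal_mult)
  also have "\<dots> < \<infinity>" using nn_integral_decay[where 'a = "real^'n", of a] a by (auto simp: ennreal_mult_less_top)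
  finally show ?thesis .
qed

lemma residual_le:
  assumes h: "h > 0" and um[measurable]: "u \<in> borel_measurable borel" and fin: "sqn u < \<infinity>"
  shows "ennreal (norm (reconstruct h u x - phi_mean * periodization (x /\<^sub>R h) * u x))
    \<le> (\<integral>\<^sup>+z. ennreal (residual_kernel z) * ennreal (norm (u (x + h *\<^sub>R z) - u x)) \<partial>lborel)"
proof -
  let ?t = "x /\<^sub>R h"
  let ?L = "lattice_point :: int^'n \<Rightarrow> real^'n"
  obtain B where B: "\<And>n. norm (sample h u n) \<le> B" using sample_bounded[OF h um fin] by blast
  have i1: "integrable (count_space UNIV) (\<lambda>n. sample h u n * \<psi> (?t - ?L n))"
    by (rule Bochner_Integration.integrable_bound[OF integrable_mult_right[OF psi_lattice_integrable[of ?t], of "complex_of_real \<bar>B\<bar>"]])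
       (auto simp: norm_mult intro!: mult_right_mono order_trans[OF B])
  have i2: "integrable (count_space UNIV) (\<lambda>n. phi_mean * u x * \<psi> (?t - ?L n))"
    by (intro integrable_mult_right psi_lattice_integrable)
  have "reconstruct h u x - phi_mean * periodization ?t * u x = (\<integral>n. sample h u n * \<psi> (?t - ?L n) \<partial>count_space UNIV) - (\<integral>n. phi_mean * u x * \<psi> (?t - ?L n) \<partial>count_space UNIV)"
    unfolding reconstruct_def periodization_def by simp
  also have "\<dots> = (\<integral>n. (sample h u n - phi_mean * u x) * \<psi> (?t - ?L n) \<partial>count_space UNIV)"
    using i1 i2 by (simp add: left_diff_distrib)
  finally have "ennreal (norm (reconstruct h u x - phi_mean * periodization ?t * u x))
     \<le> (\<integral>\<^sup>+n. ennreal (norm ((sample h u n - phi_mean * u x) * \<psi> (?t - ?L n))) \<partial>count_space UNIV)"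
    by (simp only:) (rule norm_integral_le_nn, simp)
  also have "\<dots> \<le> (\<integral>\<^sup>+n. (\<integral>\<^sup>+z. ennreal (norm (u (x + h *\<^sub>R z) - u x)) * ennreal (C\<^sup>2 * (decay a (?t - ?L n) * decay a ((?t - ?L n) + z))) \<partial>lborel) \<partial>count_space UNIV)"
  proof (rule nn_integral_mono)
    fix n
    \<comment> \<open>Every translate of \<open>cnj \<phi>\<close> has the same integral, so
      \<open>phi_mean * u x\<close> is the sample of the constant \<open>u x\<close>, and the
      difference involves only increments of \<open>u\<close>.\<close>
    have pm: "phi_mean * u x = (\<integral>z. u x * cnj (\<phi> (?t + z - ?L n)) \<partial>lborel)"
    proof -
      have "(\<integral>z. cnj (\<phi> (z + (?t - ?L n))) \<partial>lborel) = phi_mean"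
        unfolding phi_mean_def by (rule integral_translate) measurable
      then show ?thesis by (simp add: algebra_simps)
    qed
    have j1: "integrable lborel (\<lambda>z. u (x + h *\<^sub>R z) * cnj (\<phi> (?t + z - ?L n)))"
    proof (rule integrable_mult_sqn)
      show "sqn (\<lambda>z. u (x + h *\<^sub>R z)) < \<infinity>" using sqn_affine_finite[OF um, of h x] h fin by (simp add: add.commute)
      have "sqn (\<lambda>z. cnj (\<phi> (?t + z - ?L n))) = sqn (\<lambda>z. \<phi> (z + (?t - ?L n)))" by (simp add: sqn_def algebra_simps)
      also have "\<dots> = sqn \<phi>" by (rule sqn_translate) measurable
      finally show "sqn (\<lambda>z. cnj (\<phi> (?t + z - ?L n))) < \<infinity>" using phi_sqn by simp
    qed auto
    have j2: "integrable lborel (\<lambda>z. u x * cnj (\<phi> (?t + z - ?L n)))"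
      using integrable_translate_iff[of "\<lambda>z. cnj (\<phi> z)" "?t - ?L n"] phi_integrable
      by (intro integrable_mult_right) (simp add: algebra_simps)
    have "sample h u n - phi_mean * u x = (\<integral>z. (u (x + h *\<^sub>R z) - u x) * cnj (\<phi> (?t + z - ?L n)) \<partial>lborel)"
      unfolding pm sample_eq[OF h um, of n x] using j1 j2 by (simp add: left_diff_distrib)
    then have "ennreal (norm (sample h u n - phi_mean * u x)) \<le> (\<integral>\<^sup>+z. ennreal (norm ((u (x + h *\<^sub>R z) - u x) * cnj (\<phi> (?t + z - ?L n)))) \<partial>lborel)"
      by (simp only:) (rule norm_integral_le_nn, measurable)
    then have "ennreal (norm ((sample h u n - phi_mean * u x) * \<psi> (?t - ?L n))) \<le>
       (\<integral>\<^sup>+z. ennreal (norm ((u (x + h *\<^sub>R z) - u x) * cnj (\<phi> (?t + z - ?L n)))) \<partial>lborel) * ennreal (norm (\<psi> (?t - ?L n)))"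
      by (simp add: norm_mult ennreal_mult mult_right_mono)
    also have "\<dots> = (\<integral>\<^sup>+z. ennreal (norm ((u (x + h *\<^sub>R z) - u x) * cnj (\<phi> (?t + z - ?L n)))) * ennreal (norm (\<psi> (?t - ?L n))) \<partial>lborel)"
      by (intro nn_integral_multc[symmetric]) measurable
    also have "\<dots> \<le> (\<integral>\<^sup>+z. ennreal (norm (u (x + h *\<^sub>R z) - u x)) * ennreal (C\<^sup>2 * (decay a (?t - ?L n) * decay a ((?t - ?L n) + z))) \<partial>lborel)"
    proof (intro nn_integral_mono)
      fix z
      have "norm (\<phi> (?t + z - ?L n)) * norm (\<psi> (?t - ?L n)) \<le> (C * decay a (?t + z - ?L n)) * (C * decay a (?t - ?L n))"
        using C by (intro mult_mono phi_le psi_le) auto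
      also have "\<dots> = C\<^sup>2 * (decay a (?t - ?L n) * decay a ((?t - ?L n) + z))"
        by (simp add: power2_eq_square algebra_simps)
      finally have "norm (u (x + h *\<^sub>R z) - u x) * (norm (\<phi> (?t + z - ?L n)) * norm (\<psi> (?t - ?L n))) \<le> norm (u (x + h *\<^sub>R z) - u x) * (C\<^sup>2 * (decay a (?t - ?L n) * decay a ((?t - ?L n) + z)))"
        by (intro mult_left_mono) auto
      then show "ennreal (norm ((u (x + h *\<^sub>R z) - u x) * cnj (\<phi> (?t + z - ?L n)))) * ennreal (norm (\<psi> (?t - ?L n)))
        \<le> ennreal (norm (u (x + h *\<^sub>R z) - u x)) * ennreal (C\<^sup>2 * (decay a (?t - ?L n) * decay a ((?t - ?L n) + z)))"
        by (simp add: norm_mult ennreal_mult[symmetric] mult.assoc ennreal_leI)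
    qed
    finally show "ennreal (norm ((sample h u n - phi_mean * u x) * \<psi> (?t - ?L n))) \<le>
       (\<integral>\<^sup>+z. ennreal (norm (u (x + h *\<^sub>R z) - u x)) * ennreal (C\<^sup>2 * (decay a (?t - ?L n) * decay a ((?t - ?L n) + z))) \<partial>lborel)" .
  qed
  also have "\<dots> = (\<integral>\<^sup>+z. (\<integral>\<^sup>+n. ennreal (norm (u (x + h *\<^sub>R z) - u x)) * ennreal (C\<^sup>2 * (decay a (?t - ?L n) * decay a ((?t - ?L n) + z))) \<partial>count_space UNIV) \<partial>lborel)"
    by (rule nn_integral_count_space_nn_integral[symmetric]) auto
  also have "\<dots> \<le> (\<integral>\<^sup>+z. ennreal (residual_kernel z) * ennreal (norm (u (x + h *\<^sub>R z) - u x)) \<partial>lborel)"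
  proof (rule nn_integral_mono)
    fix z :: "real^'n"
    let ?K = "C\<^sup>2 * 2 powr a * decay a z"
    have K0: "?K \<ge> 0" by simp
    \<comment> \<open>\<open>decay_mult_le\<close> pulls out the factor in \<open>z\<close> and
      leaves two lattice sums, each at most \<open>M\<close>; hence the 2 in
      \<open>residual_kernel\<close>.\<close>
    have "(\<integral>\<^sup>+n. ennreal (C\<^sup>2 * (decay a (?t - ?L n) * decay a ((?t - ?L n) + z))) \<partial>count_space UNIV)
       \<le> (\<integral>\<^sup>+n. ennreal ?K * (ennreal (decay a (?t - ?L n)) + ennreal (decay a ((?t + z) - ?L n))) \<partial>count_space UNIV)"
    proof (rule nn_integral_mono)
      fix n
      have "C\<^sup>2 * (decay a (?t - ?L n) * decay a ((?t - ?L n) + z)) \<le> C\<^sup>2 * (2 powr a * decay a z * (decay a (?t - ?L n) + decay a ((?t - ?L n) + z)))"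
        by (intro mult_left_mono decay_mult_le a0) auto
      also have "\<dots> = ?K * (decay a (?t - ?L n) + decay a ((?t + z) - ?L n))" by (simp add: algebra_simps)
      finally show "ennreal (C\<^sup>2 * (decay a (?t - ?L n) * decay a ((?t - ?L n) + z))) \<le> ennreal ?K * (ennreal (decay a (?t - ?L n)) + ennreal (decay a ((?t + z) - ?L n)))"
        using K0 by (simp add: ennreal_mult[symmetric] ennreal_plus[symmetric] ennreal_leI del: ennreal_plus)
    qed
    also have "\<dots> = ennreal ?K * ((\<integral>\<^sup>+n. ennreal (decay a (?t - ?L n)) \<partial>count_space UNIV) + (\<integral>\<^sup>+n. ennreal (decay a ((?t + z) - ?L n)) \<partial>count_space UNIV))"
      by (subst nn_integral_cmult) (auto simp: nn_integral_add)
    also have "\<dots> \<le> ennreal ?K * (ennreal M + ennreal M)" by (intro mult_left_mono add_mono lattice_sum) auto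
    also have "\<dots> = ennreal (residual_kernel z)"
      using K0 M by (simp add: ennreal_mult[symmetric] ennreal_plus[symmetric] residual_kernel_def del: ennreal_plus)
    finally have le: "(\<integral>\<^sup>+n. ennreal (C\<^sup>2 * (decay a (?t - ?L n) * decay a ((?t - ?L n) + z))) \<partial>count_space UNIV) \<le> ennreal (residual_kernel z)" .
    have "(\<integral>\<^sup>+n. ennreal (norm (u (x + h *\<^sub>R z) - u x)) * ennreal (C\<^sup>2 * (decay a (?t - ?L n) * decay a ((?t - ?L n) + z))) \<partial>count_space UNIV)
       = ennreal (norm (u (x + h *\<^sub>R z) - u x)) * (\<integral>\<^sup>+n. ennreal (C\<^sup>2 * (decay a (?t - ?L n) * decay a ((?t - ?L n) + z))) \<partial>count_space UNIV)"
      by (intro nn_integral_cmult) auto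
    also have "\<dots> \<le> ennreal (norm (u (x + h *\<^sub>R z) - u x)) * ennreal (residual_kernel z)" by (intro mult_left_mono le) auto
    finally show "(\<integral>\<^sup>+n. ennreal (norm (u (x + h *\<^sub>R z) - u x)) * ennreal (C\<^sup>2 * (decay a (?t - ?L n) * decay a ((?t - ?L n) + z))) \<partial>count_space UNIV)
        \<le> ennreal (residual_kernel z) * ennreal (norm (u (x + h *\<^sub>R z) - u x))" by (simp add: mult.commute)
  qed
  finally show ?thesis .
qed

lemma sqn_residual_le:
  assumes h: "h > 0" and um[measurable]: "u \<in> borel_measurable borel" and fin: "sqn u < \<infinity>"
  shows "sqn (\<lambda>x. reconstruct h u x - phi_mean * periodization (x /\<^sub>R h) * u x) \<le>
    (\<integral>\<^sup>+z. ennreal (residual_kernel z) \<partial>lborel) * (\<integral>\<^sup>+z. ennreal (residual_kernel z) * sqn (\<lambda>x. u (x + h *\<^sub>R z) - u x) \<partial>lborel)"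
  by (rule sqn_average) (auto simp: residual_kernel_nonneg split_beta intro: residual_le[OF h um fin])

lemma sqn_residual_tendsto:
  fixes u :: "nat \<Rightarrow> real^'n \<Rightarrow> complex"
  assumes h: "\<And>k. h k > 0" and um[measurable]: "\<And>k. u k \<in> borel_measurable borel" and K: "\<And>k. sqn (u k) \<le> ennreal K"
    and shift: "\<And>z. (\<lambda>k. sqn (\<lambda>x. u k (x + h k *\<^sub>R z) - u k x)) \<longlonglongrightarrow> 0"
  shows "(\<lambda>k. sqn (\<lambda>x. reconstruct (h k) (u k) x - phi_mean * periodization (x /\<^sub>R h k) * u k x)) \<longlonglongrightarrow> 0"
proof (rule tendsto_0_ennreal_le)
  have fin: "sqn (u k) < \<infinity>" for k using K[of k] by (auto intro: le_less_trans)
  have [measurable]: "(\<lambda>z. sqn (\<lambda>x. u k (x + h k *\<^sub>R z) - u k x)) \<in> borel_measurable borel" for k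
    unfolding sqn_def by (subst measurable_lborel2[symmetric]) measurable
  have "(\<lambda>k. \<integral>\<^sup>+z. ennreal (residual_kernel z) * sqn (\<lambda>x. u k (x + h k *\<^sub>R z) - u k x) \<partial>lborel) \<longlonglongrightarrow> (\<integral>\<^sup>+z. 0 \<partial>(lborel :: (real^'n) measure))"
  proof (rule nn_integral_dominated_convergence[where w = "\<lambda>z. ennreal (residual_kernel z) * (4 * ennreal K)"])
    show "AE z in lborel. ennreal (residual_kernel z) * sqn (\<lambda>x. u k (x + h k *\<^sub>R z) - u k x) \<le> ennreal (residual_kernel z) * (4 * ennreal K)" for k
    proof (intro AE_I2 mult_left_mono)
      fix z
      have "sqn (\<lambda>x. u k (x + h k *\<^sub>R z) - u k x) \<le> 2 * sqn (\<lambda>x. u k (x + h k *\<^sub>R z)) + 2 * sqn (u k)" by (rule sqn_diff_le2) auto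
      also have "\<dots> = 4 * sqn (u k)" by (simp add: sqn_translate flip: distrib_right)
      also have "\<dots> \<le> 4 * ennreal K" by (intro mult_left_mono K) auto
      finally show "sqn (\<lambda>x. u k (x + h k *\<^sub>R z) - u k x) \<le> 4 * ennreal K" .
    qed auto
    show "AE z in lborel. (\<lambda>k. ennreal (residual_kernel z) * sqn (\<lambda>x. u k (x + h k *\<^sub>R z) - u k x)) \<longlonglongrightarrow> 0"
      by (intro AE_I2 tendsto_0_ennreal_cmult shift) auto
    show "(\<integral>\<^sup>+z. ennreal (residual_kernel z) * (4 * ennreal K) \<partial>lborel) < \<infinity>"
      using residual_kernel_finite by (subst nn_integral_multc) (auto simp: ennreal_mult_less_top)
  qed auto
  then show "(\<lambda>k. (\<integral>\<^sup>+z. ennreal (residual_kernel z) \<partial>lborel) * (\<integral>\<^sup>+z. ennreal (residual_kernel z) * sqn (\<lambda>x. u k (x + h k *\<^sub>R z) - u k x) \<partial>lborel)) \<longlonglongrightarrow> 0"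
    using residual_kernel_finite by (intro tendsto_0_ennreal_cmult) auto
  show "sqn (\<lambda>x. reconstruct (h k) (u k) x - phi_mean * periodization (x /\<^sub>R h k) * u k x) \<le> (\<integral>\<^sup>+z. ennreal (residual_kernel z) \<partial>lborel) * (\<integral>\<^sup>+z. ennreal (residual_kernel z) * sqn (\<lambda>x. u k (x + h k *\<^sub>R z) - u k x) \<partial>lborel)" for k
    by (rule sqn_residual_le[OF h um fin])
qed

end

section \<open>Integrals of periodic functions\<close>

lemma lattice_cell_partition_integral:
  fixes c :: complex
  shows "(\<integral>n. indicator cell (x + lattice_point n) *\<^sub>R c \<partial>count_space UNIV) = (c :: complex)"
    and "(\<integral>n. indicator cell (x - lattice_point n) *\<^sub>R c \<partial>count_space UNIV) = (c :: complex)"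
proof -
  have *: "(\<integral>n. indicator cell (x + lattice_point n) *\<^sub>R c \<partial>count_space UNIV) = c" for x :: "real^'n"
  proof -
    obtain m where m: "x + lattice_point m \<in> cell" "\<And>n. x + lattice_point n \<in> cell \<Longrightarrow> n = m"
      using ex1_lattice_cell[of x] by auto
    have ind: "indicator cell (x + lattice_point n) = (indicator {m} n :: real)" for n
    proof (cases "n = m")
      case False
      then have "x + lattice_point n \<notin> cell" using m(2) by blast
      with False show ?thesis by simp
    qed (use m(1) in simp)
    show ?thesis unfolding ind by simp
  qed
  show "(\<integral>n. indicator cell (x + lattice_point n) *\<^sub>R c \<partial>count_space UNIV) = (c :: complex)" by (rule *)
  have "(\<integral>n. indicator cell (x - lattice_point n) *\<^sub>R c \<partial>count_space UNIV) = (\<integral>n. indicator cell (x + lattice_point (- n)) *\<^sub>R c \<partial>count_space UNIV)"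
    by (simp add: lattice_point_uminus)
  also have "\<dots> = (\<integral>n. indicator cell (x + lattice_point n) *\<^sub>R c \<partial>count_space UNIV)"
    by (rule integral_bij_count_space[where g = uminus and f = "\<lambda>n. indicator cell (x + lattice_point n) *\<^sub>R c"]) (auto intro!: bij_betwI[where g = uminus])
  finally show "(\<integral>n. indicator cell (x - lattice_point n) *\<^sub>R c \<partial>count_space UNIV) = (c :: complex)" by (simp only: *)
qed

text \<open>The nonnegative version, applied to the norm, provides integrability over the product
  with counting measure, so that Fubini can be used before and after translating the cells.\<close>

lemma integral_lattice_tiling:
  fixes f :: "real ^ 'n \<Rightarrow> complex"
  assumes f: "integrable lborel f"
  shows "(\<integral>x. f x \<partial>lborel) = (\<integral>x. indicator cell x *\<^sub>R (\<integral>n. f (x - lattice_point n) \<partial>count_space UNIV) \<partial>lborel)"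
proof -
  have fm[measurable]: "f \<in> borel_measurable borel" using f by (auto simp: integrable_iff_bounded)
  interpret pair_sigma_finite "count_space (UNIV :: (int^'n) set)" "lborel :: (real^'n) measure"
    by (intro pair_sigma_finite.intro sigma_finite_lborel sigma_finite_measure_count_space_countable) auto
  let ?L = "lattice_point :: int^'n \<Rightarrow> real^'n"
  have nnfin: "(\<integral>\<^sup>+n. (\<integral>\<^sup>+x. ennreal (norm (f (x - ?L n))) * indicator cell x \<partial>lborel) \<partial>count_space UNIV) < \<infinity>"
    using nn_integral_lattice_tiling(1)[of "\<lambda>x. ennreal (norm (f x))"] f by (auto simp: integrable_iff_bounded)
  have tr: "(\<integral>\<^sup>+x. ennreal (norm (f x)) * indicator cell (x + ?L n) \<partial>lborel) = (\<integral>\<^sup>+x. ennreal (norm (f (x - ?L n))) * indicator cell x \<partial>lborel)" for n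
    using nn_integral_translate[of "\<lambda>x. ennreal (norm (f (x - ?L n))) * indicator cell x" "?L n"] by simp
  have i1: "integrable (count_space UNIV \<Otimes>\<^sub>M lborel) (\<lambda>(n, x). indicator cell (x + ?L n) *\<^sub>R f x)"
  proof (rule integrableI_bounded)
    show m: "(\<lambda>(n, x). indicator cell (x + ?L n) *\<^sub>R f x) \<in> borel_measurable (count_space UNIV \<Otimes>\<^sub>M lborel)"
      by (rule measurable_pair_measure_countable1) auto
    have "(\<integral>\<^sup>+p. ennreal (norm (case p of (n, x) \<Rightarrow> indicator cell (x + ?L n) *\<^sub>R f x)) \<partial>(count_space UNIV \<Otimes>\<^sub>M lborel))
      = (\<integral>\<^sup>+n. (\<integral>\<^sup>+x. ennreal (norm (indicator cell (x + ?L n) *\<^sub>R f x)) \<partial>lborel) \<partial>count_space UNIV)"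
      using m by (subst lborel.nn_integral_fst[symmetric]) auto
    also have "\<dots> = (\<integral>\<^sup>+n. (\<integral>\<^sup>+x. ennreal (norm (f x)) * indicator cell (x + ?L n) \<partial>lborel) \<partial>count_space UNIV)"
      by (rule nn_integral_cong, rule nn_integral_cong) (auto simp: indicator_def)
    finally show "(\<integral>\<^sup>+p. ennreal (norm (case p of (n, x) \<Rightarrow> indicator cell (x + ?L n) *\<^sub>R f x)) \<partial>(count_space UNIV \<Otimes>\<^sub>M lborel)) < \<infinity>"
      using nnfin by (simp add: tr)
  qed
  have i2: "integrable (count_space UNIV \<Otimes>\<^sub>M lborel) (\<lambda>(n, x). indicator cell x *\<^sub>R f (x - ?L n))"
  proof (rule integrableI_bounded)
    show m: "(\<lambda>(n, x). indicator cell x *\<^sub>R f (x - ?L n)) \<in> borel_measurable (count_space UNIV \<Otimes>\<^sub>M lborel)"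
      by (rule measurable_pair_measure_countable1) auto
    have "(\<integral>\<^sup>+p. ennreal (norm (case p of (n, x) \<Rightarrow> indicator cell x *\<^sub>R f (x - ?L n))) \<partial>(count_space UNIV \<Otimes>\<^sub>M lborel))
      = (\<integral>\<^sup>+n. (\<integral>\<^sup>+x. ennreal (norm (indicator cell x *\<^sub>R f (x - ?L n))) \<partial>lborel) \<partial>count_space UNIV)"
      using m by (subst lborel.nn_integral_fst[symmetric]) auto
    also have "\<dots> = (\<integral>\<^sup>+n. (\<integral>\<^sup>+x. ennreal (norm (f (x - ?L n))) * indicator cell x \<partial>lborel) \<partial>count_space UNIV)"
      by (rule nn_integral_cong, rule nn_integral_cong) (auto simp: indicator_def)
    finally show "(\<integral>\<^sup>+p. ennreal (norm (case p of (n, x) \<Rightarrow> indicator cell x *\<^sub>R f (x - ?L n))) \<partial>(count_space UNIV \<Otimes>\<^sub>M lborel)) < \<infinity>"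
      using nnfin by simp
  qed
  have "(\<integral>x. f x \<partial>lborel) = (\<integral>x. (\<integral>n. indicator cell (x + ?L n) *\<^sub>R f x \<partial>count_space UNIV) \<partial>lborel)"
    by (simp only: lattice_cell_partition_integral)
  also have "\<dots> = (\<integral>n. (\<integral>x. indicator cell (x + ?L n) *\<^sub>R f x \<partial>lborel) \<partial>count_space UNIV)"
    using i1 by (rule Fubini_integral)
  also have "\<dots> = (\<integral>n. (\<integral>x. indicator cell x *\<^sub>R f (x - ?L n) \<partial>lborel) \<partial>count_space UNIV)"
  proof (rule Bochner_Integration.integral_cong[OF refl])
    fix n
    show "(\<integral>x. indicator cell (x + ?L n) *\<^sub>R f x \<partial>lborel) = (\<integral>x. indicator cell x *\<^sub>R f (x - ?L n) \<partial>lborel)"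
      using integral_translate[of "\<lambda>x. indicator cell x *\<^sub>R f (x - ?L n)" "?L n"] by simp
  qed
  also have "\<dots> = (\<integral>x. (\<integral>n. indicator cell x *\<^sub>R f (x - ?L n) \<partial>count_space UNIV) \<partial>lborel)"
    using i2 by (rule Fubini_integral[symmetric])
  also have "\<dots> = (\<integral>x. indicator cell x *\<^sub>R (\<integral>n. f (x - ?L n) \<partial>count_space UNIV) \<partial>lborel)"
    by simp
  finally show ?thesis .
qed

lemma integrable_cell_bounded:
  fixes g :: "real^'n \<Rightarrow> complex"
  assumes [measurable]: "g \<in> borel_measurable borel" and B: "\<And>x. norm (g x) \<le> B"
  shows "integrable lborel (\<lambda>x. indicator cell (x + p) *\<^sub>R g x)"
proof (rule Bochner_Integration.integrable_bound)
  have "integrable lborel (\<lambda>x. indicator cell x * B :: real)" by (simp add: emeasure_cell)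
  then show "integrable lborel (\<lambda>x. indicator cell (x + p) * B :: real)"
    by (subst integrable_translate_iff[of "\<lambda>x. indicator cell x * B"]) auto
qed (use B in \<open>auto simp: indicator_def intro!: AE_I2 order_trans[OF B]\<close>)

text \<open>The translated cell is cut along the lattice and its pieces are moved back into
  \<open>cell\<close>; by periodicity \<open>g\<close> does not change, and the pieces cover every
  point exactly once.\<close>

lemma integral_periodic_cell:
  fixes g :: "real^'n \<Rightarrow> complex"
  assumes gm[measurable]: "g \<in> borel_measurable borel" and B: "\<And>x. norm (g x) \<le> B"
    and per: "\<And>x n. g (x + lattice_point n) = g x"
  shows "(LINT z:cell|lborel. g (x + z)) = (LINT z:cell|lborel. g z)"
proof -
  have per': "g (y - lattice_point n) = g y" for y n
    using per[of "y - lattice_point n" n] by simp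
  have "(LINT z:cell|lborel. g (x + z)) = (\<integral>z. indicator cell ((z + x) - x) *\<^sub>R g (z + x) \<partial>lborel)"
    unfolding set_lebesgue_integral_def by (simp add: add.commute)
  also have "\<dots> = (\<integral>y. indicator cell (y - x) *\<^sub>R g y \<partial>lborel)" by (rule integral_translate[of "\<lambda>y. indicator cell (y - x) *\<^sub>R g y"]) measurable
  also have "\<dots> = (\<integral>y. indicator cell y *\<^sub>R (\<integral>n. indicator cell (y - lattice_point n - x) *\<^sub>R g (y - lattice_point n) \<partial>count_space UNIV) \<partial>lborel)"
    using integrable_cell_bounded[OF gm B, of "- x"] by (intro integral_lattice_tiling) simp
  also have "\<dots> = (\<integral>y. indicator cell y *\<^sub>R g y \<partial>lborel)"
  proof (rule Bochner_Integration.integral_cong[OF refl])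
    fix y
    have "y - lattice_point n - x = (y - x) - lattice_point n" for n by simp
    then show "indicator cell y *\<^sub>R (\<integral>n. indicator cell (y - lattice_point n - x) *\<^sub>R g (y - lattice_point n) \<partial>count_space UNIV) = indicator cell y *\<^sub>R g y"
      by (simp only: per' lattice_cell_partition_integral)
  qed
  finally show ?thesis by (simp add: set_lebesgue_integral_def)
qed

section \<open>Characters of the lattice\<close>

lemma lattice_point_0: "lattice_point 0 = 0"
  by (simp add: lattice_point_def vec_eq_iff)

lemma inner_lattice_points: "lattice_point n \<bullet> lattice_point m = real_of_int (\<Sum>i\<in>UNIV. n $ i * m $ i)"
  by (simp add: inner_vec_def lattice_point_def)

lemma cis_2pi_lattice: "cis (2 * pi * (lattice_point n \<bullet> lattice_point m)) = 1"
  unfolding inner_lattice_points by (rule cis_multiple_2pi, rule Ints_of_int)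

text \<open>A translation by half a period in a coordinate with \<open>n $ i \<noteq> 0\<close>
  leaves the integral unchanged and reverses its sign.\<close>

lemma character_orthogonal:
  fixes n :: "int^'n"
  assumes "n \<noteq> 0"
  shows "(LINT z:cell|lborel. cis (2 * pi * (z \<bullet> lattice_point n))) = 0"
proof -
  obtain i where i: "n $ i \<noteq> 0" using assms by (auto simp: vec_eq_iff)
  let ?g = "\<lambda>z. cis (2 * pi * (z \<bullet> lattice_point n))"
  let ?x = "axis i (1 / (2 * real_of_int (n $ i))) :: real^'n"
  have gx: "?g ?x = -1"
  proof -
    have "?x \<bullet> lattice_point n = 1 / 2" using i by (simp add: inner_axis' lattice_point_def)
    then have "2 * pi * (?x \<bullet> lattice_point n) = pi" by simp
    then show ?thesis by (simp only: cis_pi)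
  qed
  have "(LINT z:cell|lborel. ?g z) = (LINT z:cell|lborel. ?g (?x + z))"
  proof (rule integral_periodic_cell[symmetric, where B = 1])
    show "?g (y + lattice_point m) = ?g y" for y m
      by (simp add: inner_add_left distrib_left cis_mult[symmetric] cis_2pi_lattice)
  qed auto
  also have "\<dots> = (LINT z:cell|lborel. ?g ?x * ?g z)"
    by (simp only: inner_add_left distrib_left cis_mult)
  also have "\<dots> = ?g ?x * (LINT z:cell|lborel. ?g z)" by (rule set_integral_mult_right)
  finally show ?thesis unfolding gx by (simp add: equation_minus_iff eq_neg_iff_add_eq_0) 
qed

section \<open>Parseval's identity for periodic functions\<close>

text \<open>Links the sum in the theorem with integrals over counting measure, by enumerating the
  countably infinite index set.\<close>

lemma infsum_ennreal_eq_nn_integral: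
  fixes f :: "int^'n \<Rightarrow> ennreal"
  shows "(\<Sum>\<^sub>\<infinity>n. f n) = (\<integral>\<^sup>+n. f n \<partial>count_space UNIV)"
proof -
  have inf: "infinite (UNIV :: (int^'n) set)"
  proof
    assume "finite (UNIV :: (int^'n) set)"
    then have "finite ((\<lambda>v::int^'n. v $ undefined) ` UNIV)" by (rule finite_imageI)
    moreover have "(\<lambda>v::int^'n. v $ undefined) ` UNIV = UNIV"
      by (auto intro!: image_eqI[where x = "\<chi> i. _"])
    ultimately show False using infinite_UNIV_int by simp
  qed
  define e where "e = from_nat_into (UNIV :: (int^'n) set)"
  have bij: "bij_betw e UNIV UNIV" unfolding e_def using bij_betw_from_nat_into[OF _ inf] by simp
  have "((\<lambda>j. f (e j)) has_sum infsum (\<lambda>j. f (e j)) UNIV) UNIV"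
    by (intro has_sum_infsum nonneg_summable_on_complete) auto
  then have "(\<lambda>j. f (e j)) sums infsum (\<lambda>j. f (e j)) UNIV" by (rule has_sum_imp_sums)
  then have "(\<Sum>j. f (e j)) = infsum (\<lambda>j. f (e j)) UNIV" by (rule sums_unique[symmetric])
  moreover have "infsum (\<lambda>j. f (e j)) UNIV = infsum f UNIV" using bij by (rule infsum_reindex_bij_betw)
  moreover have "(\<integral>\<^sup>+j. f (e j) \<partial>count_space UNIV) = (\<integral>\<^sup>+n. f n \<partial>count_space UNIV)"
    using bij by (rule nn_integral_bij_count_space)
  ultimately show ?thesis by (simp add: nn_integral_count_space_nat)
qed

text \<open>The squared distance from \<open>g\<close> to its partial sum \<open>S\<close> is
  nonnegative, and orthonormality of the characters evaluates it as the norm of \<open>G\<close>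
  minus the sum of squares. Frequencies carry a minus sign to match the shifts
  \<open>x - lattice_point n\<close> of the tiling lemmas.\<close>

lemma bessel_finite:
  fixes g :: "real^'n \<Rightarrow> complex"
  assumes gm[measurable]: "g \<in> borel_measurable borel" and B: "\<And>x. norm (g x) \<le> B" and A: "finite A"
  defines "G \<equiv> \<lambda>x. indicator cell x *\<^sub>R g x"
  shows "(\<Sum>n\<in>A. ennreal ((norm (ft G (- (2 * pi) *\<^sub>R lattice_point n)))\<^sup>2)) \<le> sqn G"
proof -
  define e where "e n x = cis (- (2 * pi) * (x \<bullet> lattice_point n))" for n :: "int^'n" and x :: "real^'n"
  define c where "c n = ft G (- (2 * pi) *\<^sub>R lattice_point n)" for n
  define S where "S x = (\<Sum>n\<in>A. c n * e n x)" for x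
  have em[measurable]: "e n \<in> borel_measurable borel" for n unfolding e_def by measurable
  have Sm[measurable]: "S \<in> borel_measurable borel" unfolding S_def by measurable
  have e1: "norm (e n x) = 1" for n x by (simp add: e_def)
  have SB: "norm (S x) \<le> (\<Sum>n\<in>A. norm (c n))" for x
    unfolding S_def by (rule sum_norm_le) (simp add: norm_mult e1)
  have int: "integrable lborel (\<lambda>x. indicator cell x *\<^sub>R k x)"
    if "k \<in> borel_measurable borel" "\<And>x. norm (k x) \<le> D" for k :: "real^'n \<Rightarrow> complex" and D
    using integrable_cell_bounded[OF that, of 0] by simp
  have B0: "B \<ge> 0" using norm_ge_zero B[of undefined] by (rule order_trans)
  have c_eq: "c n = (\<integral>x. indicator cell x *\<^sub>R (g x * cnj (e n x)) \<partial>lborel)" for n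
    unfolding c_def ft_def G_def e_def by (intro Bochner_Integration.integral_cong refl) (simp add: cis_cnj)
  have igS: "(\<integral>x. indicator cell x *\<^sub>R (g x * cnj (S x)) \<partial>lborel) = (\<Sum>n\<in>A. c n * cnj (c n))"
  proof -
    have "(\<integral>x. indicator cell x *\<^sub>R (g x * cnj (S x)) \<partial>lborel) = (\<integral>x. (\<Sum>n\<in>A. cnj (c n) * (indicator cell x *\<^sub>R (g x * cnj (e n x)))) \<partial>lborel)"
      unfolding S_def by (intro Bochner_Integration.integral_cong refl) (simp add: sum_distrib_left scaleR_sum_right mult_ac)
    also have "\<dots> = (\<Sum>n\<in>A. \<integral>x. cnj (c n) * (indicator cell x *\<^sub>R (g x * cnj (e n x))) \<partial>lborel)"
      by (intro Bochner_Integration.integral_sum integrable_mult_right int[where D = B]) (auto simp: norm_mult e1 B)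
    finally show ?thesis by (simp only: integral_mult_right_zero c_eq[symmetric] mult.commute)
  qed
  have orth: "(\<integral>x. indicator cell x *\<^sub>R (e n x * cnj (e m x)) \<partial>lborel) = (if n = m then 1 else 0)" for n m
  proof -
    have "e n x * cnj (e m x) = cis (2 * pi * (x \<bullet> lattice_point (m - n)))" for x
      unfolding e_def cis_cnj cis_mult
      by (simp add: diff_conv_add_uminus lattice_point_add lattice_point_uminus inner_add_right algebra_simps del: add_uminus_conv_diff)
    moreover have "(\<integral>x. indicator cell x *\<^sub>R (1::complex) \<partial>(lborel :: (real^'n) measure)) = 1"
      by (simp add: measure_def emeasure_cell)
    ultimately show ?thesis
      using character_orthogonal[of "m - n"] by (auto simp: set_lebesgue_integral_def lattice_point_0)
  qed
  have iSS: "(\<integral>x. indicator cell x *\<^sub>R (S x * cnj (S x)) \<partial>lborel) = (\<Sum>n\<in>A. c n * cnj (c n))"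
  proof -
    have "(\<integral>x. indicator cell x *\<^sub>R (S x * cnj (S x)) \<partial>lborel) = (\<integral>x. (\<Sum>n\<in>A. \<Sum>m\<in>A. (c n * cnj (c m)) * (indicator cell x *\<^sub>R (e n x * cnj (e m x)))) \<partial>lborel)"
      unfolding S_def by (intro Bochner_Integration.integral_cong refl) (simp add: sum_product scaleR_sum_right mult_ac)
    also have "\<dots> = (\<Sum>n\<in>A. \<integral>x. (\<Sum>m\<in>A. (c n * cnj (c m)) * (indicator cell x *\<^sub>R (e n x * cnj (e m x)))) \<partial>lborel)"
      by (intro Bochner_Integration.integral_sum Bochner_Integration.integrable_sum integrable_mult_right int[where D = 1]) (auto simp: norm_mult e1)
    also have "\<dots> = (\<Sum>n\<in>A. \<Sum>m\<in>A. \<integral>x. (c n * cnj (c m)) * (indicator cell x *\<^sub>R (e n x * cnj (e m x))) \<partial>lborel)"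
      by (intro sum.cong refl Bochner_Integration.integral_sum integrable_mult_right int[where D = 1]) (auto simp: norm_mult e1)
    also have "\<dots> = (\<Sum>n\<in>A. \<Sum>m\<in>A. (c n * cnj (c m)) * (if n = m then 1 else 0))"
      by (simp only: integral_mult_right_zero orth)
    also have "\<dots> = (\<Sum>n\<in>A. c n * cnj (c n))"
      using A by (intro sum.cong refl) (simp add: if_distrib cong: if_cong)
    finally show ?thesis .
  qed
  define D where "D = (\<Sum>n\<in>A. norm (c n))"
  have SD: "norm (S x) \<le> D" for x unfolding D_def by (rule SB)
  have D0: "D \<ge> 0" unfolding D_def by (intro sum_nonneg) auto
  have I: "integrable lborel (\<lambda>x. indicator cell x *\<^sub>R (g x * cnj (g x)))" "integrable lborel (\<lambda>x. indicator cell x *\<^sub>R (g x * cnj (S x)))"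
     "integrable lborel (\<lambda>x. indicator cell x *\<^sub>R (S x * cnj (g x)))" "integrable lborel (\<lambda>x. indicator cell x *\<^sub>R (S x * cnj (S x)))"
    by (rule int[where D = "B * B"], measurable, simp add: norm_mult, intro mult_mono B B0 norm_ge_zero)
       (rule int[where D = "B * D"], measurable, simp add: norm_mult, intro mult_mono B B0 SD norm_ge_zero,
        rule int[where D = "D * B"], measurable, simp add: norm_mult, intro mult_mono B D0 SD norm_ge_zero,
        rule int[where D = "D * D"], measurable, simp add: norm_mult, intro mult_mono D0 SD norm_ge_zero)
  have isg: "(\<integral>x. indicator cell x *\<^sub>R (S x * cnj (g x)) \<partial>lborel) = (\<Sum>n\<in>A. c n * cnj (c n))"
  proof -
    have "(\<integral>x. indicator cell x *\<^sub>R (S x * cnj (g x)) \<partial>lborel) = cnj (\<integral>x. indicator cell x *\<^sub>R (g x * cnj (S x)) \<partial>lborel)"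
      by (subst Bochner_Integration.integral_cnj[symmetric]) (simp add: mult.commute)
    then show ?thesis unfolding igS by (simp add: mult.commute)
  qed
  have "(\<integral>x. indicator cell x *\<^sub>R ((g x - S x) * cnj (g x - S x)) \<partial>lborel) =
     (\<integral>x. (indicator cell x *\<^sub>R (g x * cnj (g x)) - indicator cell x *\<^sub>R (g x * cnj (S x))) - (indicator cell x *\<^sub>R (S x * cnj (g x)) - indicator cell x *\<^sub>R (S x * cnj (S x))) \<partial>lborel)"
    by (intro Bochner_Integration.integral_cong refl) (simp add: algebra_simps)
  also have "\<dots> = ((\<integral>x. indicator cell x *\<^sub>R (g x * cnj (g x)) \<partial>lborel) - (\<Sum>n\<in>A. c n * cnj (c n))) - ((\<Sum>n\<in>A. c n * cnj (c n)) - (\<Sum>n\<in>A. c n * cnj (c n)))"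
    by (simp only: Bochner_Integration.integral_diff[OF Bochner_Integration.integrable_diff[OF I(1,2)] Bochner_Integration.integrable_diff[OF I(3,4)]]
        Bochner_Integration.integral_diff[OF I(1,2)] Bochner_Integration.integral_diff[OF I(3,4)] igS iSS isg)
  finally have eq: "(\<integral>x. indicator cell x *\<^sub>R ((g x - S x) * cnj (g x - S x)) \<partial>lborel) = (\<integral>x. indicator cell x *\<^sub>R (g x * cnj (g x)) \<partial>lborel) - (\<Sum>n\<in>A. c n * cnj (c n))"
    by simp
  have rl: "(\<integral>x. indicator cell x *\<^sub>R (k x * cnj (k x)) \<partial>lborel) = complex_of_real (\<integral>x. indicator cell x * (norm (k x))\<^sup>2 \<partial>lborel)" for k :: "real^'n \<Rightarrow> complex"
    by (subst integral_complex_of_real[symmetric], intro Bochner_Integration.integral_cong refl)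
       (simp only: complex_norm_square[symmetric] scaleR_conv_of_real of_real_mult)
  have "complex_of_real (\<integral>x. indicator cell x * (norm (g x - S x))\<^sup>2 \<partial>lborel) = complex_of_real ((\<integral>x. indicator cell x * (norm (g x))\<^sup>2 \<partial>lborel) - (\<Sum>n\<in>A. (norm (c n))\<^sup>2))"
    using eq unfolding rl by (simp only: of_real_diff of_real_sum complex_norm_square)
  then have "(\<integral>x. indicator cell x * (norm (g x - S x))\<^sup>2 \<partial>lborel) = (\<integral>x. indicator cell x * (norm (g x))\<^sup>2 \<partial>lborel) - (\<Sum>n\<in>A. (norm (c n))\<^sup>2)"
    by (simp only: of_real_eq_iff)
  moreover have "(\<integral>x. indicator cell x * (norm (g x - S x))\<^sup>2 \<partial>lborel) \<ge> 0" by (rule Bochner_Integration.integral_nonneg) auto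
  ultimately have le: "(\<Sum>n\<in>A. (norm (c n))\<^sup>2) \<le> (\<integral>x. indicator cell x * (norm (g x))\<^sup>2 \<partial>lborel)" by simp
  have "sqn G = (\<integral>\<^sup>+x. ennreal (indicator cell x * (norm (g x))\<^sup>2) \<partial>lborel)"
    unfolding sqn_def G_def by (intro nn_integral_cong) (auto simp: indicator_def)
  also have "\<dots> = ennreal (\<integral>x. indicator cell x * (norm (g x))\<^sup>2 \<partial>lborel)"
  proof (rule nn_integral_eq_integral)
    have "integrable lborel (\<lambda>x. Re (indicator cell x *\<^sub>R (g x * cnj (g x))))" using I(1) by (rule integrable_Re)
    moreover have "Re (indicator cell x *\<^sub>R (g x * cnj (g x))) = indicator cell x * (norm (g x))\<^sup>2" for x
      by (simp only: complex_norm_square[symmetric] scaleR_complex.sel Re_complex_of_real)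
    ultimately show "integrable lborel (\<lambda>x. indicator cell x * (norm (g x))\<^sup>2)" by (simp only:)
  qed auto
  finally show ?thesis using le by (simp add: c_def sum_ennreal ennreal_leI)
qed

lemma bessel:
  fixes g :: "real^'n \<Rightarrow> complex"
  assumes gm: "g \<in> borel_measurable borel" and B: "\<And>x. norm (g x) \<le> B"
  shows "(\<integral>\<^sup>+n. ennreal ((norm (ft (\<lambda>x. indicator cell x *\<^sub>R g x) (- (2 * pi) *\<^sub>R lattice_point n)))\<^sup>2) \<partial>count_space UNIV)
    \<le> sqn (\<lambda>x. indicator cell x *\<^sub>R g x)"
  unfolding infsum_ennreal_eq_nn_integral[symmetric]
  by (rule infsum_le_finite_sums, simp add: nonneg_summable_on_complete, rule bessel_finite[OF gm B])

lemma ft_shift_frequency: "ft f (\<theta> + \<xi>) = ft (\<lambda>x. f x * cis (- (x \<bullet> \<theta>))) \<xi>"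
  unfolding ft_def by (intro Bochner_Integration.integral_cong refl) (simp add: inner_add_right cis_mult mult.assoc)

text \<open>The squared moduli of the Fourier coefficients of \<open>exp (-\<i> x \<bullet> \<theta>) g x\<close> sum up to a function of \<open>\<theta>\<close> that is
  at most the mean square of \<open>g\<close> by Bessel's inequality, and whose average over \<open>\<theta>\<close> is that mean
  square by Plancherel's theorem on the whole space. So equality holds almost everywhere, and at
  \<open>\<theta> = 0\<close> by continuity.\<close>

theorem parseval_cell:
  fixes g :: "real^'n \<Rightarrow> complex"
  assumes gm[measurable]: "g \<in> borel_measurable borel" and B: "\<And>x. norm (g x) \<le> B"
  defines "G \<equiv> \<lambda>x. indicator cell x *\<^sub>R g x"
  shows "(\<integral>\<^sup>+n. ennreal ((norm (ft G (- (2 * pi) *\<^sub>R lattice_point n)))\<^sup>2) \<partial>count_space UNIV) = sqn G"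
proof -
  let ?L = "lattice_point :: int^'n \<Rightarrow> real^'n"
  have Gm[measurable]: "G \<in> borel_measurable borel" unfolding G_def by measurable
  have Gi: "integrable lborel G" unfolding G_def using integrable_cell_bounded[OF gm B, of 0] by simp
  have B0: "B \<ge> 0" using norm_ge_zero B[of undefined] by (rule order_trans)
  have GB: "norm (G x) \<le> B" for x using B[of x] B0 by (auto simp: G_def indicator_def)
  have Gf: "sqn G < \<infinity>" by (rule sqn_finite_bounded_integrable[OF Gi GB])
  \<comment> \<open>The sum of squared coefficients after modulation, as a function of the frequency
    offset; \<open>H 0\<close> is the left side of the claim.\<close>
  define H where "H \<eta> = (\<integral>\<^sup>+n. ennreal ((norm (ft G ((2 * pi) *\<^sub>R (\<eta> - ?L n))))\<^sup>2) \<partial>count_space UNIV)" for \<eta>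
  have G_mod: "(\<lambda>x. G x * cis (k x)) = (\<lambda>x. indicator cell x *\<^sub>R (g x * cis (k x)))" for k
    by (auto simp: G_def)
  have arg: "(2 * pi) *\<^sub>R (\<eta> - ?L n) = (2 * pi) *\<^sub>R \<eta> + (- (2 * pi) *\<^sub>R ?L n)" for \<eta> n
    by (simp add: scaleR_diff_right)
  have H_le: "H \<eta> \<le> sqn G" for \<eta>
  proof -
    have "H \<eta> \<le> sqn (\<lambda>x. G x * cis (- (x \<bullet> ((2 * pi) *\<^sub>R \<eta>))))"
      unfolding H_def arg ft_shift_frequency[of G] G_mod
      by (rule bessel[where B = B]) (auto simp: norm_mult B)
    then show ?thesis by (simp add: sqn_def norm_mult)
  qed
  have Hm: "(\<lambda>\<eta>. H \<eta>) \<in> borel_measurable borel"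
  proof -
    interpret pair_sigma_finite "lborel :: (real^'n) measure" "count_space (UNIV :: (int^'n) set)"
      by (intro pair_sigma_finite.intro sigma_finite_lborel sigma_finite_measure_count_space_countable) auto
    have "(\<lambda>(n, \<eta>). ennreal ((norm (ft G ((2 * pi) *\<^sub>R (\<eta> - ?L n))))\<^sup>2)) \<in> borel_measurable (count_space (UNIV :: (int^'n) set) \<Otimes>\<^sub>M lborel)"
      by (rule measurable_pair_measure_countable1) auto
    from measurable_compose[OF measurable_pair_swap' this]
    have "(\<lambda>(\<eta>, n). ennreal ((norm (ft G ((2 * pi) *\<^sub>R (\<eta> - ?L n))))\<^sup>2)) \<in> borel_measurable (lborel \<Otimes>\<^sub>M count_space (UNIV :: (int^'n) set))"
      by (simp add: split_beta')
    then have "(\<lambda>\<eta>. H \<eta>) \<in> borel_measurable lborel"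
      unfolding H_def by (rule M2.borel_measurable_nn_integral)
    then show ?thesis by simp
  qed
  note [measurable] = Hm
  \<comment> \<open>The factor \<open>(2 * pi) ^ CARD('n)\<close> of Plancherel's theorem is
    cancelled by the substitution of \<open>2 * pi * \<eta>\<close> for the frequency; the frequency
    space is then tiled.\<close>
  have mean: "(\<integral>\<^sup>+\<eta>. H \<eta> * indicator cell \<eta> \<partial>lborel) = sqn G"
  proof -
    let ?q = "ennreal ((2 * pi) ^ CARD('n))"
    have "?q * sqn G = sqn (ft G)" using plancherel[OF Gi Gf] by simp
    also have "\<dots> = ennreal (\<bar>2 * pi\<bar> ^ DIM(real^'n)) * (\<integral>\<^sup>+\<eta>. ennreal ((norm (ft G ((2 * pi) *\<^sub>R \<eta>)))\<^sup>2) \<partial>lborel)"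
      unfolding sqn_def by (rule nn_integral_dilate) auto
    also have "(\<integral>\<^sup>+\<eta>. ennreal ((norm (ft G ((2 * pi) *\<^sub>R \<eta>)))\<^sup>2) \<partial>lborel) = (\<integral>\<^sup>+\<eta>. H \<eta> * indicator cell \<eta> \<partial>lborel)"
      unfolding H_def by (rule nn_integral_lattice_tiling(2)) measurable
    finally have "?q * sqn G = ?q * (\<integral>\<^sup>+\<eta>. H \<eta> * indicator cell \<eta> \<partial>lborel)" by simp
    then show ?thesis by (subst (asm) ennreal_mult_cancel_left) auto
  qed
  \<comment> \<open>\<open>sqn G - H\<close> is nonnegative on the cell and has integral 0 there,
    because the cell has measure 1.\<close>
  have ae: "AE \<eta> in lborel. \<eta> \<in> cell \<longrightarrow> H \<eta> = sqn G"
  proof -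
    have "(\<integral>\<^sup>+\<eta>. (sqn G * indicator cell \<eta> - H \<eta> * indicator cell \<eta>) \<partial>lborel) = (\<integral>\<^sup>+\<eta>. sqn G * indicator (cell :: (real^'n) set) \<eta> \<partial>lborel) - (\<integral>\<^sup>+\<eta>. H \<eta> * indicator cell \<eta> \<partial>lborel)"
      using Gf mean H_le by (intro nn_integral_diff) (auto intro!: AE_I2 mult_right_mono)
    also have "\<dots> = sqn G - sqn G" by (simp add: mean nn_integral_cmult_indicator emeasure_cell)
    also have "\<dots> = 0" using Gf by simp
    finally have "AE \<eta> in lborel. sqn G * indicator cell \<eta> - H \<eta> * indicator (cell :: (real^'n) set) \<eta> = 0"
      by (subst (asm) nn_integral_0_iff_AE) auto
    then show ?thesis
    proof eventually_elim
      case (elim \<eta>)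
      have "H \<eta> = sqn G" if "\<eta> \<in> cell"
        using elim that H_le[of \<eta>] Gf by (auto simp: diff_eq_0_iff_ennreal less_top intro: antisym)
      then show ?case by blast
    qed
  qed
  obtain R where R: "R > 0" "\<And>z. z \<in> (cell :: (real^'n) set) \<Longrightarrow> norm z \<le> R" using cell_bounded by blast
  have close: "\<exists>\<eta>. norm \<eta> \<le> r \<and> H \<eta> = sqn G" if r: "r > 0" for r
  proof (rule ccontr)
    assume none: "\<not> (\<exists>\<eta>. norm \<eta> \<le> r \<and> H \<eta> = sqn G)"
    \<comment> \<open>\<open>s < 1\<close> keeps the box inside the cell, and
      \<open>s * CARD('n) \<le> r\<close> keeps it inside the ball, by comparison with the l1 norm.
      A box of positive measure cannot avoid a property that holds almost everywhere.\<close>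
    define s where "s = min (1/2) (r / real CARD('n))"
    have s: "0 < s" "s < 1" using r by (auto simp: s_def)
    let ?b = "\<chi> i::'n. s"
    have sub: "box 0 ?b \<subseteq> {\<eta>. \<not> (\<eta> \<in> cell \<longrightarrow> H \<eta> = sqn G)}"
    proof
      fix \<eta> assume "\<eta> \<in> box 0 ?b"
      then have \<eta>: "0 < \<eta> $ i" "\<eta> $ i < s" for i by (auto simp: mem_box_cart)
      have "\<eta> \<in> cell" unfolding cell_def using \<eta> s(2) by (auto intro: less_imp_le less_trans)
      have "norm \<eta> \<le> (\<Sum>i\<in>UNIV. \<bar>\<eta> $ i\<bar>)" by (rule norm_le_l1_cart)
      also have "\<dots> \<le> (\<Sum>i\<in>(UNIV::'n set). s)" using \<eta> by (intro sum_mono) (auto simp: less_imp_le abs_of_pos)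
      also have "\<dots> \<le> r" unfolding s_def by (simp add: min_def field_simps)
      finally have "H \<eta> \<noteq> sqn G" using none by blast
      with \<open>\<eta> \<in> cell\<close> show "\<eta> \<in> {\<eta>. \<not> (\<eta> \<in> cell \<longrightarrow> H \<eta> = sqn G)}" by simp
    qed
    from ae obtain N where N: "{\<eta>. \<not> (\<eta> \<in> cell \<longrightarrow> H \<eta> = sqn G)} \<subseteq> N" "emeasure lborel N = 0" "N \<in> sets lborel"
      by (elim AE_E) auto
    have "emeasure lborel (box 0 ?b) \<le> emeasure lborel N" using sub N by (intro emeasure_mono) auto
    moreover have "emeasure lborel (box 0 ?b) = ennreal (s ^ CARD('n))"
    proof -
      have b: "?b \<bullet> b = s" if "b \<in> Basis" for b :: "real^'n" using that by (auto simp: Basis_vec_def inner_axis)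
      show ?thesis by (subst emeasure_lborel_box) (use s in \<open>simp_all add: b\<close>)
    qed
    ultimately show False using N(2) s by auto
  qed
  \<comment> \<open>Continuity of \<open>H\<close> at 0 in quantitative form: the coefficients at
    \<open>\<eta>\<close> are those of \<open>G\<close> plus those of the error \<open>E\<close>,
    and Bessel's inequality bounds all the latter at once. \<open>E\<close> is small because
    \<open>|k x|\<close> is at most \<open>2 * pi * r * R\<close> on the cell.\<close>
  have cont: "sqn G \<le> ennreal (1 + t) * H 0 + ennreal (1 + 1/t) * (ennreal ((2 * pi * r * R)\<^sup>2) * sqn G)" if t: "t > 0" and r: "r > 0" for t r
  proof -
    obtain \<eta> where \<eta>: "norm \<eta> \<le> r" "H \<eta> = sqn G" using close[OF r] by blast
    define k where "k x = - (x \<bullet> ((2 * pi) *\<^sub>R \<eta>))" for x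
    define E where "E x = G x * (cis (k x) - 1)" for x
    have Eeq: "E = (\<lambda>x. indicator cell x *\<^sub>R (g x * (cis (k x) - 1)))" by (auto simp: E_def G_def)
    have c2: "norm (cis y - 1) \<le> 2" for y using norm_triangle_ineq4[of "cis y" 1] by simp
    have km[measurable]: "k \<in> borel_measurable borel" unfolding k_def by measurable
    have gE: "norm (g x * (cis (k x) - 1)) \<le> B * 2" for x
      unfolding norm_mult by (intro mult_mono B c2 B0) auto
    have Ei: "integrable lborel E"
      unfolding Eeq using integrable_cell_bounded[of "\<lambda>x. g x * (cis (k x) - 1)" "B * 2" 0] gE by simp
    have Gki: "integrable lborel (\<lambda>x. G x * cis (k x))" by (intro integrable_mult_cis Gi) auto
    have dec: "ft G ((2 * pi) *\<^sub>R (\<eta> - ?L n)) = ft G (- (2 * pi) *\<^sub>R ?L n) + ft E (- (2 * pi) *\<^sub>R ?L n)" for n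
    proof -
      have "ft G ((2 * pi) *\<^sub>R (\<eta> - ?L n)) = ft (\<lambda>x. G x * cis (k x)) (- (2 * pi) *\<^sub>R ?L n)"
        unfolding arg ft_shift_frequency[of G] k_def ..
      also have "\<dots> = (\<integral>x. G x * cis (- (x \<bullet> (- (2 * pi) *\<^sub>R ?L n))) + E x * cis (- (x \<bullet> (- (2 * pi) *\<^sub>R ?L n))) \<partial>lborel)"
        unfolding ft_def by (intro Bochner_Integration.integral_cong refl) (simp add: E_def algebra_simps)
      also have "\<dots> = ft G (- (2 * pi) *\<^sub>R ?L n) + ft E (- (2 * pi) *\<^sub>R ?L n)"
        unfolding ft_def by (intro Bochner_Integration.integral_add integrable_mult_cis Gi Ei) auto
      finally show ?thesis .
    qed
    have "sqn G = H \<eta>" using \<eta> by simp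
    also have "\<dots> \<le> (\<integral>\<^sup>+n. ennreal (1 + t) * ennreal ((norm (ft G (- (2 * pi) *\<^sub>R ?L n)))\<^sup>2) + ennreal (1 + 1/t) * ennreal ((norm (ft E (- (2 * pi) *\<^sub>R ?L n)))\<^sup>2) \<partial>count_space UNIV)"
      unfolding H_def dec
    proof (rule nn_integral_mono)
      fix n
      let ?a = "ft G (- (2 * pi) *\<^sub>R ?L n)" and ?b = "ft E (- (2 * pi) *\<^sub>R ?L n)"
      have "ennreal ((norm (?a + ?b))\<^sup>2) \<le> ennreal ((1 + t) * (norm ?a)\<^sup>2 + (1 + 1/t) * (norm ?b)\<^sup>2)"
        by (intro ennreal_leI norm_add_sq_le t)
      also have "\<dots> = ennreal (1 + t) * ennreal ((norm ?a)\<^sup>2) + ennreal (1 + 1/t) * ennreal ((norm ?b)\<^sup>2)"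
        using t by (simp add: ennreal_mult ennreal_plus)
      finally show "ennreal ((norm (?a + ?b))\<^sup>2) \<le> \<dots>" .
    qed
    also have "\<dots> = ennreal (1 + t) * H 0 + ennreal (1 + 1/t) * (\<integral>\<^sup>+n. ennreal ((norm (ft E (- (2 * pi) *\<^sub>R ?L n)))\<^sup>2) \<partial>count_space UNIV)"
      unfolding H_def by (subst nn_integral_add) (auto simp: nn_integral_cmult)
    also have "(\<integral>\<^sup>+n. ennreal ((norm (ft E (- (2 * pi) *\<^sub>R ?L n)))\<^sup>2) \<partial>count_space UNIV) \<le> sqn E"
      unfolding Eeq by (rule bessel[where B = "B * 2"]) (measurable, rule gE)
    also have "sqn E \<le> ennreal ((2 * pi * r * R)\<^sup>2) * sqn G"
    proof -
      have "sqn E \<le> sqn (\<lambda>x. complex_of_real (2 * pi * r * R) * G x)"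
      proof (rule sqn_mono)
        fix x
        show "norm (E x) \<le> norm (complex_of_real (2 * pi * r * R) * G x)"
        proof (cases "x \<in> cell")
          case True
          have "norm (cis (k x) - 1) \<le> \<bar>k x\<bar>" by (rule norm_cis_minus_1_le)
          also have "\<bar>k x\<bar> \<le> norm x * norm ((2 * pi) *\<^sub>R \<eta>)" unfolding k_def abs_minus_cancel by (rule Cauchy_Schwarz_ineq2)
          also have "\<dots> \<le> R * (2 * pi * r)"
            using \<eta>(1) R(1) R(2)[OF True] by (intro mult_mono) auto
          finally have "norm (G x) * norm (cis (k x) - 1) \<le> norm (G x) * (2 * pi * r * R)"
            by (intro mult_left_mono) (auto simp: mult_ac)
          then show ?thesis using r R by (simp add: E_def norm_mult mult_ac abs_mult)
        qed (simp add: E_def G_def)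
      qed
      also have "\<dots> = ennreal ((2 * pi * r * R)\<^sup>2) * sqn G" by (subst sqn_cmult[OF Gm]) (simp only: norm_of_real power2_abs)
      finally show ?thesis .
    qed
    finally show ?thesis by (simp add: add_left_mono mult_left_mono)
  qed
  have "sqn G \<le> H 0"
  proof -
    obtain S where S: "sqn G = ennreal S" "S \<ge> 0" using Gf by (cases "sqn G") auto
    obtain H0 where H0: "H 0 = ennreal H0" "H0 \<ge> 0" using H_le[of 0] Gf by (cases "H 0") (auto simp: top_unique)
    \<comment> \<open>The order of limits matters: \<open>r\<close> tends to 0 for fixed
      \<open>t\<close>, since \<open>1/t\<close> multiplies the error, and only then does
      \<open>t\<close>.\<close>
    have le: "S \<le> (1 + t) * H0 + (1 + 1/t) * ((2 * pi * r * R)\<^sup>2 * S)" if t: "t > 0" and r: "r > 0" for t r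
    proof -
      have "ennreal S \<le> ennreal ((1 + t) * H0 + (1 + 1/t) * ((2 * pi * r * R)\<^sup>2 * S))"
        using cont[OF t r] t r S(2) H0(2) unfolding S(1) H0(1)
        by (simp add: ennreal_mult[symmetric] ennreal_plus[symmetric] del: ennreal_plus)
      then show ?thesis using t S H0 by (subst (asm) ennreal_le_iff) auto
    qed
    have le2: "S \<le> (1 + t) * H0" if t: "t > 0" for t
    proof (rule LIMSEQ_le_const)
      have l: "(\<lambda>m. 1 / real (Suc m)) \<longlonglongrightarrow> 0" using LIMSEQ_inverse_real_of_nat by (simp add: inverse_eq_divide)
      have "(\<lambda>m. (1 + t) * H0 + (1 + 1/t) * ((2 * pi * (1 / real (Suc m)) * R)\<^sup>2 * S)) \<longlonglongrightarrow> (1 + t) * H0 + (1 + 1/t) * ((2 * pi * 0 * R)\<^sup>2 * S)"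
        by (intro tendsto_intros l)
      then show "(\<lambda>m. (1 + t) * H0 + (1 + 1/t) * ((2 * pi * (1 / real (Suc m)) * R)\<^sup>2 * S)) \<longlonglongrightarrow> (1 + t) * H0" by simp
      show "\<exists>N. \<forall>m\<ge>N. S \<le> (1 + t) * H0 + (1 + 1/t) * ((2 * pi * (1 / real (Suc m)) * R)\<^sup>2 * S)"
        by (intro exI allI impI le[OF t]) simp
    qed
    have "S \<le> H0"
    proof (rule LIMSEQ_le_const)
      have l: "(\<lambda>m. 1 / real (Suc m)) \<longlonglongrightarrow> 0" using LIMSEQ_inverse_real_of_nat by (simp add: inverse_eq_divide)
      have "(\<lambda>m. (1 + 1 / real (Suc m)) * H0) \<longlonglongrightarrow> (1 + 0) * H0" by (intro tendsto_intros l)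
      then show "(\<lambda>m. (1 + 1 / real (Suc m)) * H0) \<longlonglongrightarrow> H0" by simp
      show "\<exists>N. \<forall>m\<ge>N. S \<le> (1 + 1 / real (Suc m)) * H0" by (intro exI allI impI le2) simp
    qed
    then show ?thesis unfolding S H0 by (rule ennreal_leI)
  qed
  then show ?thesis using H_le[of 0] by (simp add: H_def antisym)
qed

section \<open>Means and Fourier coefficients of the periodization\<close>

context sampling_kernel
begin

lemma mean_periodization: "(LINT z:cell|lborel. periodization (x + z)) = (\<integral>x. \<psi> x \<partial>lborel)"
  unfolding integral_periodic_cell[OF periodization_measurable periodization_le periodization_periodic]
  by (subst integral_lattice_tiling[OF psi_integrable]) (simp add: set_lebesgue_integral_def periodization_def)

text \<open>At frequencies in \<open>2 * pi\<close> times the lattice the exponential is lattice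
  periodic, so the tiling lemma folds the integral over the space into one over the cell.\<close>

lemma ft_psi_lattice: "ft \<psi> (- (2 * pi) *\<^sub>R lattice_point n) = ft (\<lambda>x. indicator cell x *\<^sub>R periodization x) (- (2 * pi) *\<^sub>R lattice_point n)"
proof -
  let ?e = "\<lambda>x::real^'n. cis (- (x \<bullet> (- (2 * pi) *\<^sub>R lattice_point n)))"
  have e: "?e (x - lattice_point m) = ?e x" for x m
  proof -
    have "?e (x - lattice_point m) = ?e x * cis (2 * pi * (lattice_point (- m) \<bullet> lattice_point n))"
      unfolding cis_mult by (simp add: lattice_point_uminus inner_diff_left algebra_simps)
    then show ?thesis by (simp only: cis_2pi_lattice mult_1_right)
  qed
  have "ft \<psi> (- (2 * pi) *\<^sub>R lattice_point n) = (\<integral>x. indicator cell x *\<^sub>R (\<integral>m. \<psi> (x - lattice_point m) * ?e (x - lattice_point m) \<partial>count_space UNIV) \<partial>lborel)"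
    unfolding ft_def by (intro integral_lattice_tiling integrable_mult_cis psi_integrable) auto
  also have "\<dots> = ft (\<lambda>x. indicator cell x *\<^sub>R periodization x) (- (2 * pi) *\<^sub>R lattice_point n)"
    unfolding ft_def e periodization_def by simp
  finally show ?thesis .
qed

lemma parseval_periodization:
  "(\<Sum>\<^sub>\<infinity>n. ennreal ((norm (ft \<psi> ((2 * pi) *\<^sub>R lattice_point n)))\<^sup>2)) = sqn (\<lambda>x. indicator cell x *\<^sub>R periodization x)"
proof -
  have "(\<Sum>\<^sub>\<infinity>n. ennreal ((norm (ft \<psi> ((2 * pi) *\<^sub>R lattice_point n)))\<^sup>2)) = (\<integral>\<^sup>+n. ennreal ((norm (ft \<psi> ((2 * pi) *\<^sub>R lattice_point n)))\<^sup>2) \<partial>count_space UNIV)"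
    by (rule infsum_ennreal_eq_nn_integral)
  \<comment> \<open>Reindexing by \<open>- n\<close> reconciles the sign of the frequencies with
    that of \<open>parseval_cell\<close>.\<close>
  also have "\<dots> = (\<integral>\<^sup>+n. ennreal ((norm (ft \<psi> ((2 * pi) *\<^sub>R lattice_point (- n))))\<^sup>2) \<partial>count_space UNIV)"
    by (rule nn_integral_bij_count_space[symmetric, where g = uminus]) (auto intro!: bij_betwI[where g = uminus])
  also have "\<dots> = sqn (\<lambda>x. indicator cell x *\<^sub>R periodization x)"
    using parseval_cell[OF periodization_measurable periodization_le] by (simp add: lattice_point_uminus ft_psi_lattice[symmetric, simplified])
  finally show ?thesis .
qed

lemma mean_sq_periodization: "(LINT z:cell|lborel. complex_of_real ((norm (periodization (x + z)))\<^sup>2))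
    = complex_of_real (enn2real (sqn (\<lambda>x. indicator cell x *\<^sub>R periodization x)))"
proof -
  let ?g = "\<lambda>z. complex_of_real ((norm (periodization z))\<^sup>2)"
  have gb: "norm (?g z) \<le> (C * M)\<^sup>2" for z by (simp add: norm_power power_mono periodization_le)
  have "(LINT z:cell|lborel. ?g (x + z)) = (LINT z:cell|lborel. ?g z)"
    using gb by (intro integral_periodic_cell) (auto simp: periodization_periodic)
  also have "\<dots> = complex_of_real (\<integral>z. (norm (indicator cell z *\<^sub>R periodization z))\<^sup>2 \<partial>lborel)"
    unfolding set_lebesgue_integral_def
    by (subst integral_complex_of_real[symmetric]) (intro Bochner_Integration.integral_cong refl, auto simp: indicator_def)
  also have "(\<integral>z. (norm (indicator cell z *\<^sub>R periodization z))\<^sup>2 \<partial>lborel) = enn2real (sqn (\<lambda>x. indicator cell x *\<^sub>R periodization x))"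
    unfolding sqn_def by (rule enn2real_nn_integral_eq_integral[symmetric]) auto
  finally show ?thesis .
qed

lemma sqn_cell_periodization_finite: "sqn (\<lambda>x. indicator cell x *\<^sub>R periodization x) < \<infinity>"
proof (rule sqn_finite_bounded_integrable)
  show "integrable lborel (\<lambda>x. indicator cell x *\<^sub>R periodization x)"
    using integrable_cell_bounded[OF periodization_measurable periodization_le, of 0] by simp
  show "norm (indicator cell x *\<^sub>R periodization x) \<le> C * M" for x
    using periodization_le[of x] C M by (auto simp: indicator_def)
qed

end

section \<open>Partial Fourier transforms of Schwartz functions\<close>

lemma schwartz_has_derivative:
  assumes "f \<in> schwartz"
  shows "(f has_derivative (\<lambda>v. \<Sum>b\<in>Basis. (v \<bullet> b) *\<^sub>R partial_deriv b f x)) (at x)"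
proof -
  have d: "(f has_derivative frechet_derivative f (at x)) (at x)"
    using schwartz_differentiable[OF assms] by (simp add: frechet_derivative_works)
  interpret linear "frechet_derivative f (at x)"
    using d by (rule has_derivative_linear)
  have "frechet_derivative f (at x) v = (\<Sum>b\<in>Basis. (v \<bullet> b) *\<^sub>R partial_deriv b f x)" for v
  proof -
    have "frechet_derivative f (at x) v = frechet_derivative f (at x) (\<Sum>b\<in>Basis. (v \<bullet> b) *\<^sub>R b)" by (simp only: euclidean_representation)
    also have "\<dots> = (\<Sum>b\<in>Basis. (v \<bullet> b) *\<^sub>R partial_deriv b f x)"
      by (simp add: sum scale partial_deriv_def)
    finally show ?thesis .
  qed
  then have "frechet_derivative f (at x) = (\<lambda>v. \<Sum>b\<in>Basis. (v \<bullet> b) *\<^sub>R partial_deriv b f x)" by (rule ext)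
  with d show ?thesis by simp
qed

text \<open>The mean value inequality along a segment. The lower bound \<open>\<rho>\<close> for
  \<open>1 + norm\<close> on the segment is left open, because the segments in use move sometimes in
  the first and sometimes in the second variable.\<close>

lemma schwartz_increment:
  fixes f :: "'a::euclidean_space \<Rightarrow> complex"
  assumes f: "f \<in> schwartz"
  obtains K where "K > 0" "\<And>q v \<rho>. \<rho> > 0 \<Longrightarrow> (\<And>s. 0 \<le> s \<Longrightarrow> s \<le> 1 \<Longrightarrow> \<rho> \<le> 1 + norm (q + s *\<^sub>R v))
     \<Longrightarrow> norm (f (q + v) - f q) \<le> K * norm v * inverse (\<rho> ^ m)"
proof -
  have "\<exists>C>0. \<forall>x. norm (partial_deriv b f x) \<le> C * inverse ((1 + norm x) ^ m)" if "b \<in> Basis" for b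
    using schwartz_decay[OF schwartz_partial_deriv[OF f that]] by metis
  then obtain C where C: "\<And>b. b \<in> Basis \<Longrightarrow> C b > 0" "\<And>b x. b \<in> Basis \<Longrightarrow> norm (partial_deriv b f x) \<le> C b * inverse ((1 + norm x) ^ m)"
    by metis
  let ?K = "\<Sum>b\<in>(Basis :: 'a set). C b"
  have K0: "?K > 0" using C(1) by (intro sum_pos) auto
  have "norm (f (q + v) - f q) \<le> ?K * norm v * inverse (\<rho> ^ m)"
    if \<rho>: "\<rho> > 0" and far: "\<And>s. 0 \<le> s \<Longrightarrow> s \<le> 1 \<Longrightarrow> \<rho> \<le> 1 + norm (q + s *\<^sub>R v)" for q v \<rho>
  proof -
    let ?g = "\<lambda>s::real. f (q + s *\<^sub>R v)"
    let ?D = "\<lambda>s. \<Sum>b\<in>Basis. (v \<bullet> b) *\<^sub>R partial_deriv b f (q + s *\<^sub>R v)"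
    have D: "norm (?D s) \<le> ?K * norm v * inverse (\<rho> ^ m)" if s: "0 \<le> s" "s \<le> 1" for s
    proof -
      have "norm (?D s) \<le> (\<Sum>b\<in>Basis. norm v * (C b * inverse (\<rho> ^ m)))"
      proof (rule sum_norm_le)
        fix b :: 'a assume b: "b \<in> Basis"
        have "norm (partial_deriv b f (q + s *\<^sub>R v)) \<le> C b * inverse ((1 + norm (q + s *\<^sub>R v)) ^ m)" by (rule C(2)[OF b])
        also have "\<dots> \<le> C b * inverse (\<rho> ^ m)"
          using \<rho> far[OF s] C(1)[OF b] by (intro mult_left_mono le_imp_inverse_le power_mono) auto
        finally show "norm ((v \<bullet> b) *\<^sub>R partial_deriv b f (q + s *\<^sub>R v)) \<le> norm v * (C b * inverse (\<rho> ^ m))"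
          using Basis_le_norm[OF b, of v] by (simp add: mult_mono)
      qed
      then show ?thesis by (simp add: sum_distrib_left[symmetric] sum_distrib_right[symmetric] mult_ac)
    qed
    have "norm (?g 1 - ?g 0) \<le> (?K * norm v * inverse (\<rho> ^ m)) * norm (1 - 0 :: real)"
    proof (rule differentiable_bound[of "{0..1}" ?g "\<lambda>s h. h *\<^sub>R ?D s"])
      fix s :: real assume s: "s \<in> {0..1}"
      have "((\<lambda>s. q + s *\<^sub>R v) has_derivative (\<lambda>h. h *\<^sub>R v)) (at s within {0..1})"
        by (rule has_derivative_eq_rhs, (rule derivative_intros)+) auto
      from has_derivative_compose[OF this schwartz_has_derivative[OF f]]
      show "(?g has_derivative (\<lambda>h. h *\<^sub>R ?D s)) (at s within {0..1})"
        by (rule has_derivative_eq_rhs) (auto simp: scaleR_sum_right)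
      show "onorm (\<lambda>h. h *\<^sub>R ?D s) \<le> ?K * norm v * inverse (\<rho> ^ m)"
      proof (rule onorm_le)
        fix h :: real
        have "norm (h *\<^sub>R ?D s) = norm (?D s) * norm h" by simp
        also have "\<dots> \<le> (?K * norm v * inverse (\<rho> ^ m)) * norm h" using s by (intro mult_right_mono D) auto
        finally show "norm (h *\<^sub>R ?D s) \<le> (?K * norm v * inverse (\<rho> ^ m)) * norm h" .
      qed
    qed auto
    then show ?thesis by simp
  qed
  with K0 show ?thesis by (rule that)
qed

text \<open>The function \<open>A\<close> in the kernel of the Wigner pairing.\<close>

definition partial_ft :: "('a::euclidean_space \<times> 'a \<Rightarrow> complex) \<Rightarrow> 'a \<Rightarrow> 'a \<Rightarrow> complex" where
  "partial_ft a x z = ft (\<lambda>\<xi>. a (x, \<xi>)) z"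

lemma norm_snd_le: "norm \<xi> \<le> norm (x, \<xi>)"
  by (metis norm_snd_le snd_conv)

lemma schwartz_slice_measurable: "a \<in> schwartz \<Longrightarrow> (\<lambda>\<xi>. a (x, \<xi>)) \<in> borel_measurable borel"
  by (intro borel_measurable_continuous_onI continuous_on_compose2[OF schwartz_continuous[of a UNIV]] continuous_intros) auto

lemma schwartz_slice_decay:
  fixes a :: "'a::euclidean_space \<times> 'a \<Rightarrow> complex"
  assumes "a \<in> schwartz"
  obtains C where "C > 0" "\<And>x \<xi>. norm (a (x, \<xi>)) \<le> C * inverse ((1 + norm \<xi>) ^ m)"
proof -
  obtain C where C: "C > 0" "\<And>p. norm (a p) \<le> C * inverse ((1 + norm p) ^ m)" using schwartz_decay[OF assms] by blast
  have "norm (a (x, \<xi>)) \<le> C * inverse ((1 + norm \<xi>) ^ m)" for x \<xi>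
  proof -
    have "(1 + norm \<xi>) ^ m > 0" by (intro zero_less_power add_pos_nonneg) auto
    then have "C * inverse ((1 + norm (x, \<xi>)) ^ m) \<le> C * inverse ((1 + norm \<xi>) ^ m)"
      using C(1) norm_snd_le[of \<xi> x] by (intro mult_left_mono le_imp_inverse_le power_mono) auto
    then show ?thesis using C(2)[of "(x, \<xi>)"] by linarith
  qed
  with C(1) show ?thesis by (rule that)
qed

lemma schwartz_slice_integrable:
  fixes a :: "'a::euclidean_space \<times> 'a \<Rightarrow> complex"
  assumes a: "a \<in> schwartz"
  shows "integrable lborel (\<lambda>\<xi>. a (x, \<xi>))"
proof -
  obtain C where "C > 0" "\<And>x \<xi>. norm (a (x, \<xi>)) \<le> C * inverse ((1 + norm \<xi>) ^ Suc DIM('a))"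
    using schwartz_slice_decay[OF a] by metis
  then show ?thesis using schwartz_slice_measurable[OF a]
    by (intro Bochner_Integration.integrable_bound[OF integrable_mult_right[OF integrable_decay_nat, of C]])
       (auto intro!: AE_I2 order_trans[OF _ abs_ge_self])
qed

lemma inverse_power_shift_le:
  fixes \<xi> \<eta> :: "'a::real_normed_vector"
  assumes "norm \<eta> \<le> H"
  shows "inverse ((1 + norm (\<xi> + \<eta>)) ^ m) \<le> (1 + H) ^ m * inverse ((1 + norm \<xi>) ^ m)"
proof -
  have H: "0 \<le> H" using norm_ge_zero assms by (rule order_trans)
  have "norm \<xi> \<le> norm (\<xi> + \<eta>) + norm \<eta>" using norm_triangle_ineq4[of "\<xi> + \<eta>" \<eta>] by simp
  then have "1 + norm \<xi> \<le> (1 + H) * (1 + norm (\<xi> + \<eta>))"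
  proof -
    have "0 \<le> H * norm (\<xi> + \<eta>)" using H by simp
    moreover have "(1 + H) * (1 + norm (\<xi> + \<eta>)) = 1 + norm (\<xi> + \<eta>) + H + H * norm (\<xi> + \<eta>)" by (simp add: algebra_simps)
    ultimately show ?thesis using \<open>norm \<xi> \<le> norm (\<xi> + \<eta>) + norm \<eta>\<close> assms by linarith
  qed
  then have "(1 + norm \<xi>) ^ m \<le> ((1 + H) * (1 + norm (\<xi> + \<eta>))) ^ m" by (intro power_mono) auto
  moreover have "(1 + norm \<xi>) ^ m > 0" "(1 + norm (\<xi> + \<eta>)) ^ m > 0" by (auto intro!: zero_less_power add_pos_nonneg)
  ultimately show ?thesis by (simp add: power_mult_distrib divide_simps)
qed

lemma vector_derivative_quotient:
  fixes f :: "real \<Rightarrow> complex"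
  assumes "(f has_vector_derivative d) (at 0)"
  shows "((\<lambda>s. (f s - f 0) /\<^sub>R s) \<longlongrightarrow> d) (at 0)"
proof -
  have "((\<lambda>y. (f y - f 0 - y *\<^sub>R d) /\<^sub>R \<bar>y\<bar>) \<longlongrightarrow> 0) (at 0)"
    using assms by (simp add: has_vector_derivative_def has_derivative_def)
  then have "((\<lambda>y. norm ((f y - f 0 - y *\<^sub>R d) /\<^sub>R \<bar>y\<bar>)) \<longlongrightarrow> 0) (at 0)" by (rule tendsto_norm_zero)
  moreover have "eventually (\<lambda>y. norm ((f y - f 0 - y *\<^sub>R d) /\<^sub>R \<bar>y\<bar>) = norm ((f y - f 0) /\<^sub>R y - d)) (at 0)"
  proof (rule eventually_at_filter[THEN iffD2], rule always_eventually, intro allI impI)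
    fix y :: real assume y: "y \<noteq> 0"
    have "(f y - f 0) /\<^sub>R y - d = (f y - f 0 - y *\<^sub>R d) /\<^sub>R y" using y by (simp add: scaleR_diff_right)
    then show "norm ((f y - f 0 - y *\<^sub>R d) /\<^sub>R \<bar>y\<bar>) = norm ((f y - f 0) /\<^sub>R y - d)" by (simp only: norm_scaleR abs_inverse abs_idempotent)
  qed
  ultimately have "((\<lambda>y. norm ((f y - f 0) /\<^sub>R y - d)) \<longlongrightarrow> 0) (at 0)" by (rule Lim_transform_eventually)
  then show ?thesis by (rule LIM_zero_cancel[OF tendsto_norm_zero_cancel])
qed

text \<open>In place of integration by parts: the transform of a difference quotient in
  \<open>\<xi>\<close> equals \<open>partial_ft a x z\<close> times the difference quotient of
  \<open>cis\<close>, and the limits of the two sides are compared.\<close>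

lemma partial_ft_deriv:
  fixes a :: "'a::euclidean_space \<times> 'a \<Rightarrow> complex"
  assumes a: "a \<in> schwartz" and b: "b \<in> Basis"
  shows "\<i> * complex_of_real (z \<bullet> b) * partial_ft a x z = partial_ft (partial_deriv (0, b) a) x z"
proof -
  let ?a' = "partial_deriv (0, b) a"
  have b': "(0, b) \<in> Basis" using b by (auto simp: Basis_prod_def)
  have a': "?a' \<in> schwartz" by (rule schwartz_partial_deriv[OF a b'])
  define t where "t n = 1 / real (Suc n)" for n
  have t: "0 < t n" "t n \<le> 1" for n by (auto simp: t_def)
  have tl: "t \<longlonglongrightarrow> 0" unfolding t_def using LIMSEQ_inverse_real_of_nat by (simp add: inverse_eq_divide)
  let ?F = "\<lambda>n \<xi>. (a (x, \<xi> + t n *\<^sub>R b) - a (x, \<xi>)) /\<^sub>R t n * cis (- (\<xi> \<bullet> z))"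
  note [measurable] = schwartz_slice_measurable[OF a, of x] schwartz_slice_measurable[OF a', of x]
  have shiftm[measurable]: "(\<lambda>\<xi>. a (x, \<xi> + p)) \<in> borel_measurable borel" for p
    using measurable_compose[of "\<lambda>\<xi>. \<xi> + p" borel borel "\<lambda>\<xi>. a (x, \<xi>)" borel] schwartz_slice_measurable[OF a, of x] by simp
  obtain K where K: "K > 0" "\<And>q v \<rho>. \<rho> > 0 \<Longrightarrow> (\<And>s. 0 \<le> s \<Longrightarrow> s \<le> 1 \<Longrightarrow> \<rho> \<le> 1 + norm (q + s *\<^sub>R v))
     \<Longrightarrow> norm (a (q + v) - a q) \<le> K * norm v * inverse (\<rho> ^ Suc DIM('a))"
    using schwartz_increment[OF a] by blast
  have dom: "norm (?F n \<xi>) \<le> K * 2 ^ Suc DIM('a) * inverse ((1 + norm \<xi>) ^ Suc DIM('a))" for n \<xi>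
  proof -
    \<comment> \<open>As \<open>t n \<le> 1\<close>, the segment stays within distance 1 of its
      origin; halving \<open>1 + norm \<xi>\<close> absorbs this.\<close>
    have A: "norm (a ((x, \<xi>) + t n *\<^sub>R (0, b)) - a (x, \<xi>)) \<le> K * norm (t n *\<^sub>R (0::'a, b)) * inverse (((1 + norm \<xi>) / 2) ^ Suc DIM('a))"
    proof (rule K(2))
      show "0 < (1 + norm \<xi>) / 2" by (auto intro: add_pos_nonneg)
      fix s :: real assume s: "0 \<le> s" "s \<le> 1"
      have "norm \<xi> - norm ((s * t n) *\<^sub>R b) \<le> norm (\<xi> + (s * t n) *\<^sub>R b)"
        using norm_triangle_ineq4[of "\<xi> + (s * t n) *\<^sub>R b" "(s * t n) *\<^sub>R b"] by simp
      also have "\<dots> \<le> norm ((x, \<xi>) + s *\<^sub>R (t n *\<^sub>R (0::'a, b)))" using norm_snd_le[of "\<xi> + (s * t n) *\<^sub>R b" x] by simp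
      finally have "norm \<xi> - s * t n \<le> norm ((x, \<xi>) + s *\<^sub>R (t n *\<^sub>R (0::'a, b)))" using b s t[of n] by (simp add: abs_mult)
      moreover have "s * t n \<le> 1" using s t[of n] mult_mono[of s 1 "t n" 1] by simp
      ultimately have "norm \<xi> - 1 \<le> norm ((x, \<xi>) + s *\<^sub>R (t n *\<^sub>R (0::'a, b)))" by simp
      moreover have "0 \<le> norm ((x, \<xi>) + s *\<^sub>R (t n *\<^sub>R (0::'a, b)))" by (rule norm_ge_zero)
      moreover have "(1 + N) / 2 \<le> 1 + N'" if "N - 1 \<le> N'" "0 \<le> N'" for N N' :: real using that by simp
      ultimately show "(1 + norm \<xi>) / 2 \<le> 1 + norm ((x, \<xi>) + s *\<^sub>R (t n *\<^sub>R (0::'a, b)))" by blast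
    qed
    have n1: "norm (t n *\<^sub>R (0::'a, b)) = t n" using b t[of n] by (simp add: norm_Pair)
    have i1: "inverse (((1 + norm \<xi>) / 2) ^ Suc DIM('a)) = 2 ^ Suc DIM('a) * inverse ((1 + norm \<xi>) ^ Suc DIM('a))"
      by (simp only: power_divide inverse_divide) (simp only: divide_inverse)
    have pe: "(x, \<xi>) + t n *\<^sub>R (0, b) = (x, \<xi> + t n *\<^sub>R b)" by simp
    have "norm (a (x, \<xi> + t n *\<^sub>R b) - a (x, \<xi>)) \<le> t n * (K * 2 ^ Suc DIM('a) * inverse ((1 + norm \<xi>) ^ Suc DIM('a)))"
      using A unfolding pe n1 i1 by (simp only: mult_ac)
    then have "inverse (t n) * norm (a (x, \<xi> + t n *\<^sub>R b) - a (x, \<xi>)) \<le> inverse (t n) * (t n * (K * 2 ^ Suc DIM('a) * inverse ((1 + norm \<xi>) ^ Suc DIM('a))))"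
      using t[of n] by (intro mult_left_mono) auto
    also have "\<dots> = K * 2 ^ Suc DIM('a) * inverse ((1 + norm \<xi>) ^ Suc DIM('a))" using t[of n] by (simp only: mult.assoc[symmetric]) simp
    finally show ?thesis using t[of n] by (simp add: norm_mult)
  qed
  have lim1: "(\<lambda>n. \<integral>\<xi>. ?F n \<xi> \<partial>lborel) \<longlonglongrightarrow> (\<integral>\<xi>. ?a' (x, \<xi>) * cis (- (\<xi> \<bullet> z)) \<partial>lborel)"
  proof (rule integral_dominated_convergence[where w = "\<lambda>\<xi>. K * 2 ^ Suc DIM('a) * inverse ((1 + norm \<xi>) ^ Suc DIM('a))"])
    show "integrable lborel (\<lambda>\<xi>::'a. K * 2 ^ Suc DIM('a) * inverse ((1 + norm \<xi>) ^ Suc DIM('a)))"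
      by (intro integrable_mult_right integrable_decay_nat)
    show "AE \<xi> in lborel. norm (?F n \<xi>) \<le> K * 2 ^ Suc DIM('a) * inverse ((1 + norm \<xi>) ^ Suc DIM('a))" for n
      by (rule AE_I2) (rule dom)
    show "AE \<xi> in lborel. (\<lambda>n. ?F n \<xi>) \<longlonglongrightarrow> ?a' (x, \<xi>) * cis (- (\<xi> \<bullet> z))"
    proof (rule AE_I2)
      fix \<xi> :: 'a
      have "((\<lambda>s. (x, \<xi>) + s *\<^sub>R (0, b)) has_derivative (\<lambda>h. h *\<^sub>R (0, b))) (at (0::real))"
        by (rule has_derivative_eq_rhs, (rule derivative_intros)+) auto
      moreover have "(a has_derivative frechet_derivative a (at (x, \<xi>))) (at ((x, \<xi>) + 0 *\<^sub>R (0, b)))"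
        using schwartz_differentiable[OF a, of "(x, \<xi>)"] by (simp add: frechet_derivative_works)
      ultimately have "((\<lambda>s. a ((x, \<xi>) + s *\<^sub>R (0, b))) has_derivative (\<lambda>h. frechet_derivative a (at (x, \<xi>)) (h *\<^sub>R (0, b)))) (at (0::real))"
        by (rule has_derivative_compose)
      moreover have "frechet_derivative a (at (x, \<xi>)) (h *\<^sub>R (0, b)) = h *\<^sub>R ?a' (x, \<xi>)" for h
        unfolding partial_deriv_def by (rule linear_scale[OF linear_frechet_derivative[OF schwartz_differentiable[OF a]]])
      ultimately have "((\<lambda>s. a ((x, \<xi>) + s *\<^sub>R (0, b))) has_vector_derivative ?a' (x, \<xi>)) (at (0::real))"
        by (simp only: has_vector_derivative_def)
      then have "((\<lambda>s. (a ((x, \<xi>) + s *\<^sub>R (0, b)) - a (x, \<xi>)) /\<^sub>R s) \<longlongrightarrow> ?a' (x, \<xi>)) (at 0)"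
        using vector_derivative_quotient by fastforce
      moreover have "filterlim t (at 0) sequentially"
        using tl t by (intro filterlim_atI) (auto simp: less_imp_neq[symmetric] eventually_sequentially)
      ultimately have "(\<lambda>n. (a ((x, \<xi>) + t n *\<^sub>R (0, b)) - a (x, \<xi>)) /\<^sub>R t n) \<longlonglongrightarrow> ?a' (x, \<xi>)"
        by (rule filterlim_compose)
      then show "(\<lambda>n. ?F n \<xi>) \<longlonglongrightarrow> ?a' (x, \<xi>) * cis (- (\<xi> \<bullet> z))" by (intro tendsto_intros) simp
    qed
  qed auto
  have F_eq: "(\<integral>\<xi>. ?F n \<xi> \<partial>lborel) = ((cis (t n * (z \<bullet> b)) - 1) /\<^sub>R t n) * partial_ft a x z" for n
  proof -
    have i: "integrable lborel (\<lambda>\<xi>. a (x, \<xi>) * cis (- (\<xi> \<bullet> z)))"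
      by (intro integrable_mult_cis schwartz_slice_integrable a) auto
    have "integrable lborel (\<lambda>\<xi>. a (x, \<xi> + t n *\<^sub>R b))"
      using integrable_translate_iff[of "\<lambda>\<xi>. a (x, \<xi>)" "t n *\<^sub>R b"] schwartz_slice_integrable[OF a, of x] by simp
    then have i': "integrable lborel (\<lambda>\<xi>. a (x, \<xi> + t n *\<^sub>R b) * cis (- (\<xi> \<bullet> z)))"
      by (intro integrable_mult_cis) auto
    have tr: "(\<integral>\<xi>. a (x, \<xi> + t n *\<^sub>R b) * cis (- (\<xi> \<bullet> z)) \<partial>lborel) = cis (t n * (z \<bullet> b)) * partial_ft a x z"
    proof -
      have "(\<integral>\<xi>. a (x, \<xi> + t n *\<^sub>R b) * cis (- (\<xi> \<bullet> z)) \<partial>lborel) = (\<integral>\<xi>. cis (t n * (z \<bullet> b)) * (a (x, \<xi> + t n *\<^sub>R b) * cis (- ((\<xi> + t n *\<^sub>R b) \<bullet> z))) \<partial>lborel)"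
      proof (intro Bochner_Integration.integral_cong refl)
        fix \<xi> :: 'a
        have "cis (- (\<xi> \<bullet> z)) = cis (t n * (z \<bullet> b)) * cis (- ((\<xi> + t n *\<^sub>R b) \<bullet> z))"
          unfolding cis_mult by (intro arg_cong[where f = cis]) (simp add: inner_add_left inner_commute[of b z])
        then show "a (x, \<xi> + t n *\<^sub>R b) * cis (- (\<xi> \<bullet> z)) = cis (t n * (z \<bullet> b)) * (a (x, \<xi> + t n *\<^sub>R b) * cis (- ((\<xi> + t n *\<^sub>R b) \<bullet> z)))"
          by simp
      qed
      also have "\<dots> = cis (t n * (z \<bullet> b)) * (\<integral>\<xi>. a (x, \<xi> + t n *\<^sub>R b) * cis (- ((\<xi> + t n *\<^sub>R b) \<bullet> z)) \<partial>lborel)"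
        by (rule integral_mult_right_zero)
      also have "(\<integral>\<xi>. a (x, \<xi> + t n *\<^sub>R b) * cis (- ((\<xi> + t n *\<^sub>R b) \<bullet> z)) \<partial>lborel) = partial_ft a x z"
        unfolding partial_ft_def ft_def by (rule integral_translate[of "\<lambda>\<xi>. a (x, \<xi>) * cis (- (\<xi> \<bullet> z))"]) measurable
      finally show ?thesis .
    qed
    have "(\<integral>\<xi>. ?F n \<xi> \<partial>lborel) = (\<integral>\<xi>. (a (x, \<xi> + t n *\<^sub>R b) * cis (- (\<xi> \<bullet> z)) - a (x, \<xi>) * cis (- (\<xi> \<bullet> z))) /\<^sub>R t n \<partial>lborel)"
      by (intro Bochner_Integration.integral_cong refl) (simp add: algebra_simps)
    also have "\<dots> = ((\<integral>\<xi>. a (x, \<xi> + t n *\<^sub>R b) * cis (- (\<xi> \<bullet> z)) \<partial>lborel) - (\<integral>\<xi>. a (x, \<xi>) * cis (- (\<xi> \<bullet> z)) \<partial>lborel)) /\<^sub>R t n"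
      using i i' by simp
    also have "\<dots> = ((cis (t n * (z \<bullet> b)) - 1) /\<^sub>R t n) * partial_ft a x z"
      unfolding tr by (simp add: partial_ft_def ft_def[symmetric] algebra_simps)
    finally show ?thesis .
  qed
  have lim2: "(\<lambda>n. (cis (t n * (z \<bullet> b)) - 1) /\<^sub>R t n) \<longlonglongrightarrow> \<i> * complex_of_real (z \<bullet> b)"
  proof -
    have "((\<lambda>s. cis (s * (z \<bullet> b))) has_vector_derivative (\<i> * complex_of_real (z \<bullet> b))) (at (0::real))"
    proof -
      have "((\<lambda>s. exp (s *\<^sub>R (\<i> * complex_of_real (z \<bullet> b)))) has_vector_derivative exp (0 *\<^sub>R (\<i> * complex_of_real (z \<bullet> b))) * (\<i> * complex_of_real (z \<bullet> b))) (at (0::real))"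
        by (rule exp_scaleR_has_vector_derivative_right)
      moreover have "exp (s *\<^sub>R (\<i> * complex_of_real (z \<bullet> b))) = cis (s * (z \<bullet> b))" for s :: real
        by (simp add: cis_conv_exp scaleR_conv_of_real mult_ac)
      ultimately show ?thesis by simp
    qed
    then have "((\<lambda>s. (cis (s * (z \<bullet> b)) - 1) /\<^sub>R s) \<longlongrightarrow> \<i> * complex_of_real (z \<bullet> b)) (at 0)"
      using vector_derivative_quotient by fastforce
    moreover have "filterlim t (at 0) sequentially"
      using tl t by (intro filterlim_atI) (auto simp: less_imp_neq[symmetric] eventually_sequentially)
    ultimately show ?thesis by (rule filterlim_compose)
  qed
  have "(\<lambda>n. \<integral>\<xi>. ?F n \<xi> \<partial>lborel) \<longlonglongrightarrow> \<i> * complex_of_real (z \<bullet> b) * partial_ft a x z"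
    unfolding F_eq by (intro tendsto_intros lim2)
  from LIMSEQ_unique[OF this lim1] show ?thesis by (simp add: partial_ft_def ft_def)
qed

text \<open>The l1 weight fits the induction: its extra power is 1 plus the coordinates
  \<open>|z \<bullet> b|\<close>, and each coordinate is traded for one derivative of
  \<open>a\<close>. Hence \<open>a\<close> varies in the induction.\<close>

lemma partial_ft_decay_l1:
  fixes a :: "'a::euclidean_space \<times> 'a \<Rightarrow> complex"
  assumes "a \<in> schwartz"
  shows "\<exists>C>0. \<forall>x z. (1 + (\<Sum>b\<in>Basis. \<bar>z \<bullet> b\<bar>)) ^ N * norm (partial_ft a x z) \<le> C"
  using assms
proof (induction N arbitrary: a)
  case 0
  obtain C where C: "C > 0" "\<And>x \<xi>. norm (a (x, \<xi>)) \<le> C * inverse ((1 + norm \<xi>) ^ Suc DIM('a))"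
    using schwartz_slice_decay[OF 0] by metis
  let ?I = "\<integral>\<xi>. C * inverse ((1 + norm (\<xi>::'a)) ^ Suc DIM('a)) \<partial>lborel"
  have "norm (partial_ft a x z) \<le> ?I" for x z
  proof -
    have "norm (partial_ft a x z) \<le> (\<integral>\<xi>. norm (a (x, \<xi>)) \<partial>lborel)" unfolding partial_ft_def by (rule norm_ft_le)
    also have "\<dots> \<le> ?I"
      by (intro integral_mono integrable_mult_right integrable_decay_nat C(2) integrable_norm schwartz_slice_integrable 0)
    finally show ?thesis .
  qed
  then have "norm (partial_ft a x z) \<le> \<bar>?I\<bar> + 1" for x z using abs_ge_self[of ?I] by (smt (verit))
  then show ?case by (intro exI[of _ "\<bar>?I\<bar> + 1"]) auto
next
  case (Suc N)
  let ?s = "\<lambda>z::'a. 1 + (\<Sum>b\<in>Basis. \<bar>z \<bullet> b\<bar>)"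
  have s0: "?s z \<ge> 0" for z by (intro add_nonneg_nonneg sum_nonneg) auto
  obtain C0 where C0: "\<And>x z. ?s z ^ N * norm (partial_ft a x z) \<le> C0" "C0 > 0" using Suc.IH[OF Suc.prems] by blast
  have "\<exists>C>0. \<forall>x z. ?s z ^ N * norm (partial_ft (partial_deriv (0, b) a) x z) \<le> C" if "b \<in> Basis" for b
    using that by (intro Suc.IH schwartz_partial_deriv Suc.prems) (auto simp: Basis_prod_def)
  then obtain C where C: "\<And>b. b \<in> Basis \<Longrightarrow> C b > 0" "\<And>b x z. b \<in> Basis \<Longrightarrow> ?s z ^ N * norm (partial_ft (partial_deriv (0, b) a) x z) \<le> C b"
    by metis
  have "?s z ^ Suc N * norm (partial_ft a x z) \<le> C0 + (\<Sum>b\<in>Basis. C b)" for x z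
  proof -
    have "?s z ^ Suc N * norm (partial_ft a x z) = ?s z ^ N * norm (partial_ft a x z) + (\<Sum>b\<in>Basis. ?s z ^ N * (\<bar>z \<bullet> b\<bar> * norm (partial_ft a x z)))"
      by (simp add: algebra_simps sum_distrib_left sum_distrib_right)
    also have "(\<Sum>b\<in>Basis. ?s z ^ N * (\<bar>z \<bullet> b\<bar> * norm (partial_ft a x z))) = (\<Sum>b\<in>Basis. ?s z ^ N * norm (partial_ft (partial_deriv (0, b) a) x z))"
      by (intro sum.cong refl) (simp add: partial_ft_deriv[OF Suc.prems, symmetric] norm_mult)
    also have "?s z ^ N * norm (partial_ft a x z) + \<dots> \<le> C0 + (\<Sum>b\<in>Basis. C b)"
      by (intro add_mono sum_mono C0 C)
    finally show ?thesis .
  qed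
  moreover have "C0 + (\<Sum>b\<in>(Basis::'a set). C b) > 0" using C0 C by (intro add_pos_nonneg sum_nonneg) (auto intro: less_imp_le)
  ultimately show ?case by blast
qed

lemma partial_ft_decay:
  fixes a :: "'a::euclidean_space \<times> 'a \<Rightarrow> complex"
  assumes "a \<in> schwartz"
  obtains C where "C > 0" "\<And>x z. norm (partial_ft a x z) \<le> C * inverse ((1 + norm z) ^ N)"
proof -
  obtain C where C: "C > 0" "\<And>x z. (1 + (\<Sum>b\<in>Basis. \<bar>z \<bullet> b\<bar>)) ^ N * norm (partial_ft a x z) \<le> C"
    using partial_ft_decay_l1[OF assms] by blast
  have "norm (partial_ft a x z) \<le> C * inverse ((1 + norm z) ^ N)" for x z
  proof -
    have "(1 + norm z) ^ N * norm (partial_ft a x z) \<le> (1 + (\<Sum>b\<in>Basis. \<bar>z \<bullet> b\<bar>)) ^ N * norm (partial_ft a x z)"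
      by (intro mult_right_mono power_mono add_left_mono norm_le_l1) auto
    also have "\<dots> \<le> C" by (rule C(2))
    finally have "(1 + norm z) ^ N * norm (partial_ft a x z) \<le> C" .
    moreover have "(1 + norm z) ^ N > 0" by (intro zero_less_power add_pos_nonneg) auto
    ultimately show ?thesis by (simp add: divide_inverse[symmetric] pos_le_divide_eq mult.commute)
  qed
  with C(1) show ?thesis by (rule that)
qed

text \<open>A common integrable profile that dominates all kernels below; the exponent is the least
  natural number above the dimension.\<close>

definition poly_kernel :: "'a::euclidean_space \<Rightarrow> real" where
  "poly_kernel z = inverse ((1 + norm z) ^ Suc DIM('a))"

lemma poly_kernel_nonneg[simp]: "poly_kernel z \<ge> 0"
  by (simp add: poly_kernel_def)

lemma poly_kernel_measurable[measurable]: "poly_kernel \<in> borel_measurable borel"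
  unfolding poly_kernel_def by measurable

lemma poly_kernel_integrable: "integrable lborel (poly_kernel :: 'a::euclidean_space \<Rightarrow> real)"
  unfolding poly_kernel_def by (rule integrable_decay_nat)

lemma poly_kernel_nn_finite: "(\<integral>\<^sup>+z. ennreal (poly_kernel z) \<partial>(lborel :: 'a::euclidean_space measure)) < \<infinity>"
  using poly_kernel_integrable[where 'a = 'a] by (auto simp: integrable_iff_bounded)

lemma norm_cis_diff_le: "norm (cis s - cis t) \<le> \<bar>s - t\<bar>"
proof -
  have "cis s - cis t = cis t * (cis (s - t) - 1)" by (simp add: right_diff_distrib cis_mult)
  then show ?thesis using norm_cis_minus_1_le[of "s - t"] by (simp add: norm_mult)
qed

text \<open>In \<open>x\<close> the increment of \<open>a\<close> decays integrably in
  \<open>\<xi>\<close>; in \<open>z\<close> the factor \<open>norm \<xi>\<close> from the phase is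
  absorbed by one more power of decay of \<open>a\<close>.\<close>

lemma partial_ft_lipschitz:
  fixes a :: "'a::euclidean_space \<times> 'a \<Rightarrow> complex"
  assumes a: "a \<in> schwartz"
  obtains L where "L > 0" "\<And>x z p q. norm (partial_ft a (x + p) (z + q) - partial_ft a x z) \<le> L * (norm p + norm q)"
proof -
  obtain K where K: "K > 0" "\<And>q v \<rho>. \<rho> > 0 \<Longrightarrow> (\<And>s. 0 \<le> s \<Longrightarrow> s \<le> 1 \<Longrightarrow> \<rho> \<le> 1 + norm (q + s *\<^sub>R v))
     \<Longrightarrow> norm (a (q + v) - a q) \<le> K * norm v * inverse (\<rho> ^ Suc DIM('a))"
    using schwartz_increment[OF a] by blast
  obtain C where C: "C > 0" "\<And>x \<xi>. norm (a (x, \<xi>)) \<le> C * inverse ((1 + norm \<xi>) ^ Suc (Suc DIM('a)))"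
    using schwartz_slice_decay[OF a] by metis
  have K': "norm (a (x + p, \<xi>) - a (x, \<xi>)) \<le> K * norm p * poly_kernel \<xi>" for x p \<xi>
  proof -
    have "norm (a ((x, \<xi>) + (p, 0)) - a (x, \<xi>)) \<le> K * norm (p, 0::'a) * inverse ((1 + norm \<xi>) ^ Suc DIM('a))"
    proof (rule K(2))
      show "0 < 1 + norm \<xi>" by (auto intro: add_pos_nonneg)
      show "1 + norm \<xi> \<le> 1 + norm ((x, \<xi>) + s *\<^sub>R (p, 0))" for s
        using norm_snd_le[of \<xi> "x + s *\<^sub>R p"] by simp
    qed
    then show ?thesis by (simp add: poly_kernel_def norm_Pair)
  qed
  have C': "norm (a (x, \<xi>)) * norm \<xi> \<le> C * poly_kernel \<xi>" for x \<xi>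
  proof -
    have n: "1 + norm \<xi> > 0" by (auto intro: add_pos_nonneg)
    have "norm (a (x, \<xi>)) * norm \<xi> \<le> C * inverse ((1 + norm \<xi>) ^ Suc (Suc DIM('a))) * (1 + norm \<xi>)"
      using n C(1) by (intro mult_mono C(2)) auto
    also have "\<dots> = C * (inverse ((1 + norm \<xi>) ^ Suc DIM('a)) * (inverse (1 + norm \<xi>) * (1 + norm \<xi>)))"
      by (simp only: power_Suc[of _ "Suc _"] inverse_mult_distrib mult_ac)
    also have "inverse (1 + norm \<xi>) * (1 + norm \<xi>) = 1" using n by simp
    finally show ?thesis by (simp add: poly_kernel_def)
  qed
  let ?I = "\<integral>\<xi>. poly_kernel (\<xi>::'a) \<partial>lborel"
  have I0: "?I \<ge> 0" by (rule Bochner_Integration.integral_nonneg) auto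
  have "norm (partial_ft a (x + p) (z + q) - partial_ft a x z) \<le> ((K + C) * ?I + 1) * (norm p + norm q)" for x z p q
  proof -
    let ?f = "\<lambda>\<xi>. a (x + p, \<xi>) * cis (- (\<xi> \<bullet> (z + q)))" and ?g = "\<lambda>\<xi>. a (x, \<xi>) * cis (- (\<xi> \<bullet> z))"
    have fi: "integrable lborel ?f" and gi: "integrable lborel ?g"
      by (intro integrable_mult_cis schwartz_slice_integrable a; measurable)+
    have le: "norm (?f \<xi> - ?g \<xi>) \<le> (K * norm p + C * norm q) * poly_kernel \<xi>" for \<xi>
    proof -
      have "?f \<xi> - ?g \<xi> = (a (x + p, \<xi>) - a (x, \<xi>)) * cis (- (\<xi> \<bullet> (z + q))) + a (x, \<xi>) * (cis (- (\<xi> \<bullet> (z + q))) - cis (- (\<xi> \<bullet> z)))"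
        by (simp add: algebra_simps)
      then have "norm (?f \<xi> - ?g \<xi>) \<le> norm ((a (x + p, \<xi>) - a (x, \<xi>)) * cis (- (\<xi> \<bullet> (z + q)))) + norm (a (x, \<xi>) * (cis (- (\<xi> \<bullet> (z + q))) - cis (- (\<xi> \<bullet> z))))"
        by (simp only: norm_triangle_ineq)
      also have "\<dots> = norm (a (x + p, \<xi>) - a (x, \<xi>)) + norm (a (x, \<xi>)) * norm (cis (- (\<xi> \<bullet> (z + q))) - cis (- (\<xi> \<bullet> z)))"
        by (simp add: norm_mult)
      also have "\<dots> \<le> K * norm p * poly_kernel \<xi> + norm (a (x, \<xi>)) * (norm \<xi> * norm q)"
      proof (intro add_mono K' mult_left_mono)
        have "norm (cis (- (\<xi> \<bullet> (z + q))) - cis (- (\<xi> \<bullet> z))) \<le> \<bar>\<xi> \<bullet> q\<bar>"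
          using norm_cis_diff_le[of "- (\<xi> \<bullet> (z + q))" "- (\<xi> \<bullet> z)"] by (simp add: inner_add_right)
        then show "norm (cis (- (\<xi> \<bullet> (z + q))) - cis (- (\<xi> \<bullet> z))) \<le> norm \<xi> * norm q"
          using Cauchy_Schwarz_ineq2[of \<xi> q] by linarith
      qed auto
      also have "norm (a (x, \<xi>)) * (norm \<xi> * norm q) \<le> C * poly_kernel \<xi> * norm q"
        using mult_right_mono[OF C'[of x \<xi>], of "norm q"] by (simp add: mult.assoc)
      finally show ?thesis by (simp add: algebra_simps)
    qed
    have "norm (partial_ft a (x + p) (z + q) - partial_ft a x z) = norm (\<integral>\<xi>. ?f \<xi> - ?g \<xi> \<partial>lborel)"
      unfolding partial_ft_def ft_def using fi gi by simp
    also have "\<dots> \<le> (\<integral>\<xi>. norm (?f \<xi> - ?g \<xi>) \<partial>lborel)" by (rule integral_norm_bound)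
    also have "\<dots> \<le> (\<integral>\<xi>. (K * norm p + C * norm q) * poly_kernel (\<xi>::'a) \<partial>lborel)"
      by (intro integral_mono integrable_norm Bochner_Integration.integrable_diff fi gi integrable_mult_right poly_kernel_integrable le)
    also have "\<dots> = (K * norm p + C * norm q) * ?I" by simp
    also have "\<dots> \<le> ((K + C) * (norm p + norm q)) * ?I"
      using K(1) C(1) I0 by (intro mult_right_mono) (auto simp: algebra_simps)
    also have "\<dots> \<le> ((K + C) * ?I + 1) * (norm p + norm q)" by (simp add: algebra_simps)
    finally show ?thesis .
  qed
  moreover have "(K + C) * ?I + 1 > 0" using K(1) C(1) I0 by (intro add_nonneg_pos mult_nonneg_nonneg) auto
  ultimately show ?thesis by (intro that)
qed

lemma partial_ft_measurable:
  fixes a :: "'a::euclidean_space \<times> 'a \<Rightarrow> complex"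
  assumes a: "a \<in> schwartz"
  shows "(\<lambda>p. partial_ft a (fst p) (snd p)) \<in> borel_measurable borel"
proof -
  obtain L where L: "L > 0" "\<And>x z p q. norm (partial_ft a (x + p) (z + q) - partial_ft a x z) \<le> L * (norm p + norm q)"
    using partial_ft_lipschitz[OF a] by metis
  have "lipschitz_on (2 * L) UNIV (\<lambda>p. partial_ft a (fst p) (snd p))"
  proof (rule lipschitz_onI)
    fix p q :: "'a \<times> 'a"
    have "norm (partial_ft a (fst p) (snd p) - partial_ft a (fst q) (snd q)) \<le> L * (norm (fst p - fst q) + norm (snd p - snd q))"
      using L(2)[of "fst q" "fst p - fst q" "snd q" "snd p - snd q"] by simp
    also have "\<dots> \<le> L * (norm (p - q) + norm (p - q))"
    proof -
      have "norm (fst (p - q)) \<le> norm (p - q)" "norm (snd (p - q)) \<le> norm (p - q)"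
        using norm_fst_le[of "fst (p - q)" "snd (p - q)"] norm_snd_le[of "snd (p - q)" "fst (p - q)"] by (simp_all only: prod.collapse)
      then show ?thesis using L(1) by (intro mult_left_mono add_mono) auto
    qed
    finally show "dist (partial_ft a (fst p) (snd p)) (partial_ft a (fst q) (snd q)) \<le> 2 * L * dist p q"
      by (simp add: dist_norm)
  qed (use L in auto)
  then show ?thesis by (intro borel_measurable_continuous_onI lipschitz_on_continuous_on)
qed

text \<open>Interpolation: the Lipschitz bound is small but does not decay, the decay bound is not
  small. Their geometric mean is both, hence the square root and the doubled exponent
  \<open>?N\<close>. The restriction to \<open>norm q \<le> H\<close> keeps the decay of the shifted
  value comparable.\<close>

lemma partial_ft_shift:
  fixes a :: "'a::euclidean_space \<times> 'a \<Rightarrow> complex"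
  assumes a: "a \<in> schwartz" and H: "H \<ge> 0"
  obtains L where "L > 0" "\<And>x z p q. norm q \<le> H \<Longrightarrow> norm (partial_ft a (x + p) (z + q) - partial_ft a x z) \<le> L * sqrt (norm p + norm q) * poly_kernel z"
proof -
  obtain L where L: "L > 0" "\<And>x z p q. norm (partial_ft a (x + p) (z + q) - partial_ft a x z) \<le> L * (norm p + norm q)"
    using partial_ft_lipschitz[OF a] by metis
  let ?N = "2 * Suc DIM('a)"
  obtain C where C: "C > 0" "\<And>x z. norm (partial_ft a x z) \<le> C * inverse ((1 + norm z) ^ ?N)"
    using partial_ft_decay[OF a] by metis
  define D where "D = C * (1 + H) ^ ?N + C"
  have D0: "D > 0" unfolding D_def using C(1) H by (intro add_nonneg_pos mult_nonneg_nonneg) auto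
  have sq: "inverse ((1 + norm z) ^ ?N) = (poly_kernel z)\<^sup>2" for z :: 'a
    unfolding poly_kernel_def power_inverse[symmetric] by (simp only: power_mult[symmetric] mult.commute)
  have "norm (partial_ft a (x + p) (z + q) - partial_ft a x z) \<le> sqrt (L * D) * sqrt (norm p + norm q) * poly_kernel z" if q: "norm q \<le> H" for x z p q
  proof -
    let ?X = "norm (partial_ft a (x + p) (z + q) - partial_ft a x z)"
    have "?X \<le> norm (partial_ft a (x + p) (z + q)) + norm (partial_ft a x z)" by (rule norm_triangle_ineq4)
    also have "\<dots> \<le> C * ((1 + H) ^ ?N * inverse ((1 + norm z) ^ ?N)) + C * inverse ((1 + norm z) ^ ?N)"
      using C(1) by (intro add_mono C(2) order_trans[OF C(2)] mult_left_mono inverse_power_shift_le q) auto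
    also have "\<dots> = D * (poly_kernel z)\<^sup>2" unfolding sq D_def by (simp add: algebra_simps)
    finally have 1: "?X \<le> D * (poly_kernel z)\<^sup>2" .
    have "?X\<^sup>2 \<le> (L * (norm p + norm q)) * (D * (poly_kernel z)\<^sup>2)"
      unfolding power2_eq_square[of ?X] using L(1) by (intro mult_mono L(2) 1) auto
    then have "sqrt (?X\<^sup>2) \<le> sqrt ((L * (norm p + norm q)) * (D * (poly_kernel z)\<^sup>2))" by (rule real_sqrt_le_mono)
    also have "\<dots> = sqrt (L * D) * sqrt (norm p + norm q) * poly_kernel z"
      by (simp add: real_sqrt_mult)
    finally show ?thesis by simp
  qed
  moreover have "sqrt (L * D) > 0" using L(1) D0 by simp
  ultimately show ?thesis by (intro that)
qed

section \<open>Bilinear forms with rescaled convolution kernels\<close>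

text \<open>An absolute majorant of the Wigner pairing, whose kernel has a mass independent of
  \<open>e\<close>.\<close>

definition conv_form :: "real \<Rightarrow> ('a::euclidean_space \<Rightarrow> complex) \<Rightarrow> ('a \<Rightarrow> complex) \<Rightarrow> ennreal" where
  "conv_form e f g = (\<integral>\<^sup>+p. ennreal (norm (f (fst p)) * norm (g (snd p)) * (inverse (e ^ DIM('a)) * poly_kernel ((snd p - fst p) /\<^sub>R e))) \<partial>(lborel :: ('a \<times> 'a) measure))"

text \<open>Young's convolution inequality in additive form: substitute \<open>y = x + e z\<close>,
  and for fixed \<open>z\<close> apply \<open>nn_integral_mult_le\<close> in \<open>x\<close> with
  translation invariance.\<close>

lemma conv_form_le:
  fixes f g :: "'a::euclidean_space \<Rightarrow> complex"
  assumes fm[measurable]: "f \<in> borel_measurable borel" and gm[measurable]: "g \<in> borel_measurable borel" and e: "e > 0" and t: "t > 0"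
  shows "conv_form e f g \<le> (\<integral>\<^sup>+z. ennreal (poly_kernel (z::'a)) \<partial>lborel) * (ennreal (t/2) * sqn f + ennreal (1/(2*t)) * sqn g)"
proof -
  let ?F = "\<lambda>x y. ennreal (norm (f x) * norm (g y) * (inverse (e ^ DIM('a)) * poly_kernel ((y - x) /\<^sub>R e)))"
  have "conv_form e f g = (\<integral>\<^sup>+x. \<integral>\<^sup>+y. ?F x y \<partial>lborel \<partial>lborel)"
    unfolding conv_form_def lborel_prod[symmetric] by (subst lborel.nn_integral_fst[symmetric]) auto
  also have "\<dots> = (\<integral>\<^sup>+x. \<integral>\<^sup>+z. ennreal (norm (f x) * norm (g (x + e *\<^sub>R z))) * ennreal (poly_kernel z) \<partial>lborel \<partial>lborel)"
  proof (rule nn_integral_cong)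
    fix x
    have "(\<integral>\<^sup>+y. ?F x y \<partial>lborel) = (\<integral>\<^sup>+y. ?F x (y + x) \<partial>lborel)" by (rule nn_integral_translate[symmetric]) measurable
    also have "\<dots> = ennreal (\<bar>e\<bar> ^ DIM('a)) * (\<integral>\<^sup>+z. ?F x (e *\<^sub>R z + x) \<partial>lborel)"
      using e by (intro nn_integral_dilate[of "\<lambda>y. ?F x (y + x)"]) auto
    also have "\<dots> = (\<integral>\<^sup>+z. ennreal (\<bar>e\<bar> ^ DIM('a)) * ?F x (e *\<^sub>R z + x) \<partial>lborel)" by (intro nn_integral_cmult[symmetric]) measurable
    also have "\<dots> = (\<integral>\<^sup>+z. ennreal (norm (f x) * norm (g (x + e *\<^sub>R z))) * ennreal (poly_kernel z) \<partial>lborel)"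
    proof (rule nn_integral_cong)
      fix z :: 'a
      have "ennreal (\<bar>e\<bar> ^ DIM('a)) * ?F x (e *\<^sub>R z + x) = ennreal (e ^ DIM('a) * (norm (f x) * norm (g (e *\<^sub>R z + x)) * (inverse (e ^ DIM('a)) * poly_kernel z)))"
        using e by (simp add: ennreal_mult[symmetric])
      also have "e ^ DIM('a) * (norm (f x) * norm (g (e *\<^sub>R z + x)) * (inverse (e ^ DIM('a)) * poly_kernel z)) = norm (f x) * norm (g (x + e *\<^sub>R z)) * poly_kernel z"
        using e by (simp add: add.commute)
      finally show "ennreal (\<bar>e\<bar> ^ DIM('a)) * ?F x (e *\<^sub>R z + x) = ennreal (norm (f x) * norm (g (x + e *\<^sub>R z))) * ennreal (poly_kernel z)"
        by (simp add: ennreal_mult)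
    qed
    finally show "(\<integral>\<^sup>+y. ?F x y \<partial>lborel) = (\<integral>\<^sup>+z. ennreal (norm (f x) * norm (g (x + e *\<^sub>R z))) * ennreal (poly_kernel z) \<partial>lborel)" .
  qed
  also have "\<dots> = (\<integral>\<^sup>+z. \<integral>\<^sup>+x. ennreal (norm (f x) * norm (g (x + e *\<^sub>R z))) * ennreal (poly_kernel z) \<partial>lborel \<partial>lborel)"
    by (rule lborel_pair.Fubini') measurable
  also have "\<dots> \<le> (\<integral>\<^sup>+z. (ennreal (t/2) * sqn f + ennreal (1/(2*t)) * sqn g) * ennreal (poly_kernel (z::'a)) \<partial>lborel)"
  proof (rule nn_integral_mono)
    fix z :: 'a
    have "(\<integral>\<^sup>+x. ennreal (norm (f x) * norm (g (x + e *\<^sub>R z))) * ennreal (poly_kernel z) \<partial>lborel) = (\<integral>\<^sup>+x. ennreal (norm (f x) * norm (g (x + e *\<^sub>R z))) \<partial>lborel) * ennreal (poly_kernel z)"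
      by (rule nn_integral_multc) measurable
    also have "\<dots> \<le> (ennreal (t/2) * sqn f + ennreal (1/(2*t)) * sqn (\<lambda>x. g (x + e *\<^sub>R z))) * ennreal (poly_kernel z)"
      by (intro mult_right_mono nn_integral_mult_le t) auto
    finally show "(\<integral>\<^sup>+x. ennreal (norm (f x) * norm (g (x + e *\<^sub>R z))) * ennreal (poly_kernel z) \<partial>lborel) \<le> (ennreal (t/2) * sqn f + ennreal (1/(2*t)) * sqn g) * ennreal (poly_kernel z)"
      by (simp only: sqn_translate[OF gm])
  qed
  also have "\<dots> = (\<integral>\<^sup>+z. ennreal (poly_kernel (z::'a)) \<partial>lborel) * (ennreal (t/2) * sqn f + ennreal (1/(2*t)) * sqn g)"
    by (subst nn_integral_cmult) (auto simp: mult.commute)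
  finally show ?thesis .
qed

text \<open>A large \<open>t\<close> makes the bounded term small; for that \<open>t\<close> the
  term with \<open>a k\<close> is small for late \<open>k\<close>.\<close>

lemma tendsto_0_am_gm:
  fixes X a b :: "nat \<Rightarrow> ennreal"
  assumes X: "\<And>k t. t > 0 \<Longrightarrow> X k \<le> I * (ennreal (t/2) * a k + ennreal (1/(2*t)) * b k)" and I: "I < \<infinity>"
    and a: "a \<longlonglongrightarrow> 0" and b: "\<And>k. b k \<le> ennreal K"
  shows "X \<longlonglongrightarrow> 0"
proof (rule tendsto_0_ennrealI)
  fix e :: real assume e: "e > 0"
  obtain J where J: "I = ennreal J" "J \<ge> 0" using I by (cases I) auto
  define K' where "K' = max K 0"
  have b': "b k \<le> ennreal K'" and K'0: "K' \<ge> 0" for k using b[of k] by (auto simp: K'_def max_def ennreal_neg)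
  \<comment> \<open>Makes \<open>J * K' / (2 * t)\<close> at most \<open>e / 2\<close>; the 1 keeps
    \<open>t\<close> positive.\<close>
  define t where "t = (J * K' + 1) / e"
  have t: "t > 0" unfolding t_def using e J K'0 by (intro divide_pos_pos add_nonneg_pos) auto
  have JK: "J * K' \<ge> 0" using J K'0 by simp
  have half: "J * (1 / (2 * t) * K') \<le> e / 2"
  proof -
    have "J * (1 / (2 * t) * K') = (e / 2) * ((J * K') / (J * K' + 1))" unfolding t_def by (simp add: field_simps)
    also have "\<dots> \<le> (e / 2) * 1" using e JK by (intro mult_left_mono) (auto simp: divide_le_eq_1 add_nonneg_pos)
    finally show ?thesis by simp
  qed
  have "(\<lambda>k. (I * ennreal (t/2)) * a k) \<longlonglongrightarrow> 0"
    using I by (intro tendsto_0_ennreal_cmult a) (auto simp: ennreal_mult_less_top)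
  then have "eventually (\<lambda>k. (I * ennreal (t/2)) * a k \<le> ennreal (e/2)) sequentially" using e by (intro tendsto_0_ennrealD) auto
  then show "eventually (\<lambda>k. X k \<le> ennreal e) sequentially"
  proof eventually_elim
    case (elim k)
    have "X k \<le> (I * ennreal (t/2)) * a k + I * (ennreal (1/(2*t)) * b k)" using X[OF t, of k] by (simp add: distrib_left mult.assoc)
    also have "\<dots> \<le> ennreal (e/2) + I * (ennreal (1/(2*t)) * ennreal K')" by (intro add_mono elim mult_left_mono b') auto
    also have "I * (ennreal (1/(2*t)) * ennreal K') = ennreal (J * (1 / (2 * t) * K'))"
    proof -
      have "ennreal (1/(2*t)) * ennreal K' = ennreal (1/(2*t) * K')" using t K'0 by (intro ennreal_mult[symmetric]) auto
      moreover have "ennreal J * ennreal (1/(2*t) * K') = ennreal (J * (1/(2*t) * K'))" using t K'0 J(2) by (intro ennreal_mult[symmetric]) auto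
      ultimately show ?thesis by (simp only: J(1))
    qed
    also have "ennreal (e/2) + \<dots> \<le> ennreal (e/2) + ennreal (e/2)" by (intro add_mono ennreal_leI half) auto
    also have "\<dots> = ennreal e" using e by (simp flip: ennreal_plus)
    finally show ?case .
  qed
qed

text \<open>The second claim follows from the same bound with \<open>1/t\<close> for
  \<open>t\<close>, which exchanges the two weights.\<close>

lemma conv_form_tendsto_0:
  fixes f g :: "nat \<Rightarrow> 'a::euclidean_space \<Rightarrow> complex"
  assumes m: "\<And>k. f k \<in> borel_measurable borel" "\<And>k. g k \<in> borel_measurable borel" and e: "\<And>k. e k > 0"
  shows conv_form_tendsto_0_left: "(\<lambda>k. sqn (f k)) \<longlonglongrightarrow> 0 \<Longrightarrow> (\<And>k. sqn (g k) \<le> ennreal K) \<Longrightarrow> (\<lambda>k. conv_form (e k) (f k) (g k)) \<longlonglongrightarrow> 0"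
    and conv_form_tendsto_0_right: "(\<lambda>k. sqn (g k)) \<longlonglongrightarrow> 0 \<Longrightarrow> (\<And>k. sqn (f k) \<le> ennreal K) \<Longrightarrow> (\<lambda>k. conv_form (e k) (f k) (g k)) \<longlonglongrightarrow> 0"
proof -
  let ?I = "\<integral>\<^sup>+z. ennreal (poly_kernel (z::'a)) \<partial>lborel"
  show "(\<lambda>k. conv_form (e k) (f k) (g k)) \<longlonglongrightarrow> 0" if "(\<lambda>k. sqn (f k)) \<longlonglongrightarrow> 0" "\<And>k. sqn (g k) \<le> ennreal K"
    by (rule tendsto_0_am_gm[OF conv_form_le[OF m e] poly_kernel_nn_finite that])
  show "(\<lambda>k. conv_form (e k) (f k) (g k)) \<longlonglongrightarrow> 0" if "(\<lambda>k. sqn (g k)) \<longlonglongrightarrow> 0" "\<And>k. sqn (f k) \<le> ennreal K"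
  proof (rule tendsto_0_am_gm[OF _ poly_kernel_nn_finite that])
    fix k and t :: real assume t: "t > 0"
    have "conv_form (e k) (f k) (g k) \<le> ?I * (ennreal ((1/t)/2) * sqn (f k) + ennreal (1/(2*(1/t))) * sqn (g k))"
      using t by (intro conv_form_le m e) auto
    also have "1/(2*(1/t)) = t/2" by simp
    also have "(1/t)/2 = 1/(2*t)" by simp
    finally show "conv_form (e k) (f k) (g k) \<le> ?I * (ennreal (t/2) * sqn (g k) + ennreal (1/(2*t)) * sqn (f k))" by (simp only: add.commute)
  qed
qed

lemma conv_form_bounded:
  fixes f g :: "'a::euclidean_space \<Rightarrow> complex"
  assumes "f \<in> borel_measurable borel" "g \<in> borel_measurable borel" "e > 0" "sqn f \<le> ennreal K" "sqn g \<le> ennreal K"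
  shows "conv_form e f g \<le> (\<integral>\<^sup>+z. ennreal (poly_kernel (z::'a)) \<partial>lborel) * ennreal K"
proof -
  have "conv_form e f g \<le> (\<integral>\<^sup>+z. ennreal (poly_kernel (z::'a)) \<partial>lborel) * (ennreal (1/2) * sqn f + ennreal (1/(2*1)) * sqn g)"
    by (intro conv_form_le assms) auto
  also have "\<dots> \<le> (\<integral>\<^sup>+z. ennreal (poly_kernel (z::'a)) \<partial>lborel) * (ennreal (1/2) * ennreal K + ennreal (1/(2*1)) * ennreal K)"
    by (intro mult_left_mono add_mono assms) auto
  also have "ennreal (1/2) * ennreal K + ennreal (1/(2*1)) * ennreal K = ennreal (1/2 + 1/(2*1)) * ennreal K"
    by (subst ennreal_plus) (auto simp: distrib_right)
  finally show ?thesis by simp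
qed

section \<open>The Wigner transform as a bilinear form\<close>

definition wigner_kernel :: "real \<Rightarrow> ('a::euclidean_space \<times> 'a \<Rightarrow> complex) \<Rightarrow> 'a \<times> 'a \<Rightarrow> complex" where
  "wigner_kernel e a p = complex_of_real (inverse (e ^ DIM('a))) * partial_ft a (fst p) ((snd p - fst p) /\<^sub>R e)"

definition wigner_form :: "real \<Rightarrow> ('a::euclidean_space \<times> 'a \<Rightarrow> complex) \<Rightarrow> ('a \<Rightarrow> complex) \<Rightarrow> ('a \<Rightarrow> complex) \<Rightarrow> complex" where
  "wigner_form e a f g = (\<integral>p. cnj (f (fst p)) * g (snd p) * wigner_kernel e a p \<partial>lborel)"

lemma wigner_kernel_measurable:
  assumes "a \<in> schwartz"
  shows "wigner_kernel e a \<in> borel_measurable borel"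
proof -
  note [measurable] = partial_ft_measurable[OF assms]
  have "(\<lambda>p::'a \<times> 'a. (fst p, (snd p - fst p) /\<^sub>R e)) \<in> borel_measurable borel"
    by (intro borel_measurable_continuous_onI continuous_intros)
  from measurable_compose[OF this partial_ft_measurable[OF assms]]
  show ?thesis unfolding wigner_kernel_def by simp
qed

text \<open>Stated for any dominated kernel \<open>k\<close>, since it is applied to translated
  kernels and to differences of kernels as well.\<close>

lemma nn_integral_wigner_form_le:
  fixes f g :: "'a::euclidean_space \<Rightarrow> complex"
  assumes [measurable]: "f \<in> borel_measurable borel" "g \<in> borel_measurable borel"
    and e: "e > 0" and D: "D \<ge> 0"
    and k: "\<And>p. norm (k p) \<le> D * (inverse (e ^ DIM('a)) * poly_kernel ((snd p - fst p) /\<^sub>R e))"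
  shows "(\<integral>\<^sup>+p. ennreal (norm (cnj (f (fst p)) * g (snd p) * k p)) \<partial>(lborel :: ('a \<times> 'a) measure)) \<le> ennreal D * conv_form e f g"
proof -
  have "(\<integral>\<^sup>+p. ennreal (norm (cnj (f (fst p)) * g (snd p) * k p)) \<partial>(lborel :: ('a \<times> 'a) measure))
    \<le> (\<integral>\<^sup>+p. ennreal D * ennreal (norm (f (fst p)) * norm (g (snd p)) * (inverse (e ^ DIM('a)) * poly_kernel ((snd p - fst p) /\<^sub>R e))) \<partial>(lborel :: ('a \<times> 'a) measure))"
  proof (rule nn_integral_mono)
    fix p :: "'a \<times> 'a"
    have "norm (cnj (f (fst p)) * g (snd p) * k p) \<le> norm (f (fst p)) * norm (g (snd p)) * (D * (inverse (e ^ DIM('a)) * poly_kernel ((snd p - fst p) /\<^sub>R e)))"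
      unfolding norm_mult complex_mod_cnj by (intro mult_left_mono k) auto
    also have "\<dots> = D * (norm (f (fst p)) * norm (g (snd p)) * (inverse (e ^ DIM('a)) * poly_kernel ((snd p - fst p) /\<^sub>R e)))"
      by (simp only: mult_ac)
    finally show "ennreal (norm (cnj (f (fst p)) * g (snd p) * k p)) \<le> ennreal D * ennreal (norm (f (fst p)) * norm (g (snd p)) * (inverse (e ^ DIM('a)) * poly_kernel ((snd p - fst p) /\<^sub>R e)))"
      using D e by (subst ennreal_mult[symmetric]) (auto intro!: ennreal_leI mult_nonneg_nonneg)
  qed
  also have "\<dots> = ennreal D * conv_form e f g"
  proof -
    have [measurable]: "(\<lambda>p::'a \<times> 'a. poly_kernel ((snd p - fst p) /\<^sub>R e)) \<in> borel_measurable borel"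
      by (rule measurable_compose[OF _ poly_kernel_measurable]) (intro borel_measurable_continuous_onI continuous_intros)
    have [measurable]: "(\<lambda>p::'a \<times> 'a. f (fst p)) \<in> borel_measurable borel" "(\<lambda>p::'a \<times> 'a. g (snd p)) \<in> borel_measurable borel"
      by (rule measurable_compose[OF _ assms(1)] measurable_compose[OF _ assms(2)], intro borel_measurable_continuous_onI continuous_intros)+
    show ?thesis unfolding conv_form_def by (rule nn_integral_cmult) measurable
  qed
  finally show ?thesis .
qed

lemma measurable_tensor:
  fixes f g :: "'a::euclidean_space \<Rightarrow> complex"
  assumes "f \<in> borel_measurable borel" "g \<in> borel_measurable borel" and [measurable]: "k \<in> borel_measurable borel"
  shows "(\<lambda>p. cnj (f (fst p)) * g (snd p) * k p) \<in> borel_measurable (borel :: ('a \<times> 'a) measure)"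
proof -
  have [measurable]: "(\<lambda>p::'a \<times> 'a. f (fst p)) \<in> borel_measurable borel" "(\<lambda>p::'a \<times> 'a. g (snd p)) \<in> borel_measurable borel"
    by (rule measurable_compose[OF _ assms(1)] measurable_compose[OF _ assms(2)], intro borel_measurable_continuous_onI continuous_intros)+
  show ?thesis by measurable
qed

lemma wigner_kernel_le:
  assumes a: "a \<in> schwartz"
  obtains D where "D > 0" "\<And>e p. e > 0 \<Longrightarrow> norm (wigner_kernel e a (p :: 'a::euclidean_space \<times> 'a)) \<le> D * (inverse (e ^ DIM('a)) * poly_kernel ((snd p - fst p) /\<^sub>R e))"
proof -
  obtain D where D: "D > 0" "\<And>x z. norm (partial_ft a x z) \<le> D * inverse ((1 + norm z) ^ Suc DIM('a))"
    using partial_ft_decay[OF a] by metis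
  have "norm (wigner_kernel e a p) \<le> D * (inverse (e ^ DIM('a)) * poly_kernel ((snd p - fst p) /\<^sub>R e))" if e: "e > 0" for e p
  proof -
    have "norm (wigner_kernel e a p) = inverse (e ^ DIM('a)) * norm (partial_ft a (fst p) ((snd p - fst p) /\<^sub>R e))"
      using e by (simp add: wigner_kernel_def norm_mult norm_inverse norm_power)
    also have "\<dots> \<le> inverse (e ^ DIM('a)) * (D * poly_kernel ((snd p - fst p) /\<^sub>R e))"
      unfolding poly_kernel_def using e by (intro mult_left_mono D(2)) auto
    finally show ?thesis by (simp only: mult_ac)
  qed
  with D(1) show ?thesis by (rule that)
qed

lemma wigner_form_integrable:
  fixes f g :: "'a::euclidean_space \<Rightarrow> complex"
  assumes a: "a \<in> schwartz" and f: "f \<in> borel_measurable borel" and g: "g \<in> borel_measurable borel" and fin: "sqn f < \<infinity>" "sqn g < \<infinity>" and e: "e > 0"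
  shows "integrable lborel (\<lambda>p. cnj (f (fst p)) * g (snd p) * wigner_kernel e a p)"
proof (rule integrableI_bounded)
  show "(\<lambda>p. cnj (f (fst p)) * g (snd p) * wigner_kernel e a p) \<in> borel_measurable lborel"
    using measurable_tensor[OF f g wigner_kernel_measurable[OF a]] by simp
  obtain D where D: "D > 0" "\<And>e p. e > 0 \<Longrightarrow> norm (wigner_kernel e a (p :: 'a \<times> 'a)) \<le> D * (inverse (e ^ DIM('a)) * poly_kernel ((snd p - fst p) /\<^sub>R e))"
    using wigner_kernel_le[OF a] by blast
  have "(\<integral>\<^sup>+p. ennreal (norm (cnj (f (fst p)) * g (snd p) * wigner_kernel e a p)) \<partial>lborel) \<le> ennreal D * conv_form e f g"
    using D e by (intro nn_integral_wigner_form_le f g) auto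
  also have "conv_form e f g \<le> (\<integral>\<^sup>+z. ennreal (poly_kernel (z::'a)) \<partial>lborel) * (ennreal (2/2) * sqn f + ennreal (1/(2*2)) * sqn g)"
    by (intro conv_form_le f g e) auto
  also have "ennreal D * \<dots> < \<infinity>"
    using fin poly_kernel_nn_finite[where 'a = 'a] by (auto simp: ennreal_mult_less_top simp del: ennreal_1 intro: ennreal_less_top)
  finally show "(\<integral>\<^sup>+p. ennreal (norm (cnj (f (fst p)) * g (snd p) * wigner_kernel e a p)) \<partial>lborel) < \<infinity>"
    by (simp add: mult_left_mono)
qed

lemma wigner_form_norm_le:
  fixes f g :: "'a::euclidean_space \<Rightarrow> complex"
  assumes a: "a \<in> schwartz" and f: "f \<in> borel_measurable borel" and g: "g \<in> borel_measurable borel" and e: "e > 0"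
    and D: "D > 0" "\<And>e p. e > 0 \<Longrightarrow> norm (wigner_kernel e a (p :: 'a \<times> 'a)) \<le> D * (inverse (e ^ DIM('a)) * poly_kernel ((snd p - fst p) /\<^sub>R e))"
  shows "ennreal (norm (wigner_form e a f g)) \<le> ennreal D * conv_form e f g"
  unfolding wigner_form_def
  by (rule order_trans[OF norm_integral_le_nn nn_integral_wigner_form_le])
     (use measurable_tensor[OF f g wigner_kernel_measurable[OF a]] f g e D in auto)

lemma wigner_form_perturb:
  fixes w v :: "nat \<Rightarrow> 'a::euclidean_space \<Rightarrow> complex"
  assumes a: "a \<in> schwartz" and w[measurable]: "\<And>k. w k \<in> borel_measurable borel" and v[measurable]: "\<And>k. v k \<in> borel_measurable borel"
    and wK: "\<And>k. sqn (w k) \<le> ennreal K" and vK: "\<And>k. sqn (v k) \<le> ennreal K" and e: "\<And>k. e k > 0"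
    and d: "(\<lambda>k. sqn (\<lambda>x. w k x - v k x)) \<longlonglongrightarrow> 0"
  shows "(\<lambda>k. wigner_form (e k) a (w k) (w k) - wigner_form (e k) a (v k) (v k)) \<longlonglongrightarrow> 0"
proof -
  obtain D where D: "D > 0" "\<And>e p. e > 0 \<Longrightarrow> norm (wigner_kernel e a (p :: 'a \<times> 'a)) \<le> D * (inverse (e ^ DIM('a)) * poly_kernel ((snd p - fst p) /\<^sub>R e))"
    using wigner_kernel_le[OF a] by blast
  let ?r = "\<lambda>k x. w k x - v k x"
  have wf: "sqn (w k) < \<infinity>" and vf: "sqn (v k) < \<infinity>" for k using wK[of k] vK[of k] by (auto intro: le_less_trans)
  have rf: "sqn (?r k) < \<infinity>" for k
    using sqn_diff_le2[OF w v, of k k] wf[of k] vf[of k] by (auto simp: ennreal_mult_less_top intro: le_less_trans)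
  have rm[measurable]: "?r k \<in> borel_measurable borel" for k by measurable
  \<comment> \<open>The arguments are changed one at a time, so each term contains the vanishing
    difference once and a bounded sequence once.\<close>
  have eq: "wigner_form (e k) a (w k) (w k) - wigner_form (e k) a (v k) (v k) = wigner_form (e k) a (?r k) (w k) + wigner_form (e k) a (v k) (?r k)" for k
  proof -
    have "wigner_form (e k) a (?r k) (w k) + wigner_form (e k) a (v k) (?r k) =
       (\<integral>p. cnj (?r k (fst p)) * w k (snd p) * wigner_kernel (e k) a p + cnj (v k (fst p)) * ?r k (snd p) * wigner_kernel (e k) a p \<partial>lborel)"
      unfolding wigner_form_def by (intro Bochner_Integration.integral_add[symmetric] wigner_form_integrable a rm w v rf wf vf e)
    also have "\<dots> = (\<integral>p. cnj (w k (fst p)) * w k (snd p) * wigner_kernel (e k) a p - cnj (v k (fst p)) * v k (snd p) * wigner_kernel (e k) a p \<partial>lborel)"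
      by (intro Bochner_Integration.integral_cong refl) (simp add: algebra_simps)
    also have "\<dots> = wigner_form (e k) a (w k) (w k) - wigner_form (e k) a (v k) (v k)"
      unfolding wigner_form_def by (intro Bochner_Integration.integral_diff wigner_form_integrable a w v wf vf e)
    finally show ?thesis by simp
  qed
  have "(\<lambda>k. ennreal D * (conv_form (e k) (?r k) (w k) + conv_form (e k) (v k) (?r k))) \<longlonglongrightarrow> 0"
  proof (intro tendsto_0_ennreal_cmult)
    have "(\<lambda>k. conv_form (e k) (?r k) (w k) + conv_form (e k) (v k) (?r k)) \<longlonglongrightarrow> 0 + 0"
      by (intro tendsto_add conv_form_tendsto_0_left[OF rm w e d wK] conv_form_tendsto_0_right[OF v rm e d vK])
    then show "(\<lambda>k. conv_form (e k) (?r k) (w k) + conv_form (e k) (v k) (?r k)) \<longlonglongrightarrow> 0" by simp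
  qed auto
  moreover have "ennreal (norm (wigner_form (e k) a (w k) (w k) - wigner_form (e k) a (v k) (v k))) \<le> ennreal D * (conv_form (e k) (?r k) (w k) + conv_form (e k) (v k) (?r k))" for k
  proof -
    have "ennreal (norm (wigner_form (e k) a (?r k) (w k) + wigner_form (e k) a (v k) (?r k))) \<le> ennreal (norm (wigner_form (e k) a (?r k) (w k)) + norm (wigner_form (e k) a (v k) (?r k)))"
      by (intro ennreal_leI norm_triangle_ineq)
    also have "\<dots> = ennreal (norm (wigner_form (e k) a (?r k) (w k))) + ennreal (norm (wigner_form (e k) a (v k) (?r k)))" by simp
    also have "\<dots> \<le> ennreal D * conv_form (e k) (?r k) (w k) + ennreal D * conv_form (e k) (v k) (?r k)"
      by (intro add_mono wigner_form_norm_le a rm w v e D)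
    finally show ?thesis unfolding eq by (simp add: distrib_left)
  qed
  ultimately have "(\<lambda>k. ennreal (norm (wigner_form (e k) a (w k) (w k) - wigner_form (e k) a (v k) (v k)))) \<longlonglongrightarrow> 0"
    by (rule tendsto_0_ennreal_le)
  then have "(\<lambda>k. norm (wigner_form (e k) a (w k) (w k) - wigner_form (e k) a (v k) (v k))) \<longlonglongrightarrow> 0"
    by (subst (asm) ennreal_0[symmetric], subst (asm) tendsto_ennreal_iff) auto
  then show ?thesis by (rule tendsto_norm_zero_cancel)
qed

lemma schwartz_slice_scale_ft:
  fixes a :: "'a::euclidean_space \<times> 'a \<Rightarrow> complex"
  assumes a: "a \<in> schwartz" and e: "e > 0"
  shows "fourier (\<lambda>\<xi>. exp (\<i> * complex_of_real ((x \<bullet> (e *\<^sub>R \<xi>)) / e)) * a (x, e *\<^sub>R \<xi>)) y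
     = complex_of_real (inverse (e ^ DIM('a))) * partial_ft a x ((y - x) /\<^sub>R e)"
proof -
  note [measurable] = schwartz_slice_measurable[OF a, of x]
  have [measurable]: "(\<lambda>\<xi>. a (x, e *\<^sub>R \<xi>)) \<in> borel_measurable borel"
    using measurable_compose[of "\<lambda>\<xi>. e *\<^sub>R \<xi>" borel borel "\<lambda>\<xi>. a (x, \<xi>)" borel] schwartz_slice_measurable[OF a, of x] by simp
  have eq: "exp (\<i> * complex_of_real ((x \<bullet> (e *\<^sub>R \<xi>)) / e)) = cis (x \<bullet> \<xi>)" for \<xi>
    using e by (simp add: cis_conv_exp)
  have "fourier (\<lambda>\<xi>. exp (\<i> * complex_of_real ((x \<bullet> (e *\<^sub>R \<xi>)) / e)) * a (x, e *\<^sub>R \<xi>)) y = ft (\<lambda>\<xi>. cis (x \<bullet> \<xi>) * a (x, e *\<^sub>R \<xi>)) y"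
    unfolding eq by (subst fourier_eq_ft) auto
  also have "\<dots> = (\<integral>\<xi>. a (x, e *\<^sub>R \<xi>) * cis (- ((e *\<^sub>R \<xi>) \<bullet> ((y - x) /\<^sub>R e))) \<partial>lborel)"
    unfolding ft_def
  proof (intro Bochner_Integration.integral_cong refl)
    fix \<xi> :: 'a
    have c: "cis (x \<bullet> \<xi>) * cis (- (\<xi> \<bullet> y)) = cis (- ((e *\<^sub>R \<xi>) \<bullet> ((y - x) /\<^sub>R e)))"
      unfolding cis_mult using e by (intro arg_cong[where f = cis]) (simp add: inner_diff_right inner_commute[of \<xi> x] field_simps)
    have "cis (x \<bullet> \<xi>) * a (x, e *\<^sub>R \<xi>) * cis (- (\<xi> \<bullet> y)) = a (x, e *\<^sub>R \<xi>) * (cis (x \<bullet> \<xi>) * cis (- (\<xi> \<bullet> y)))"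
      by (simp only: mult_ac)
    then show "cis (x \<bullet> \<xi>) * a (x, e *\<^sub>R \<xi>) * cis (- (\<xi> \<bullet> y)) = a (x, e *\<^sub>R \<xi>) * cis (- ((e *\<^sub>R \<xi>) \<bullet> ((y - x) /\<^sub>R e)))"
      by (simp only: c)
  qed
  also have "partial_ft a x ((y - x) /\<^sub>R e) = (\<bar>e\<bar> ^ DIM('a)) *\<^sub>R \<dots>"
    unfolding partial_ft_def ft_def using e by (intro integral_dilate) auto
  finally have "partial_ft a x ((y - x) /\<^sub>R e) = (e ^ DIM('a)) *\<^sub>R fourier (\<lambda>\<xi>. exp (\<i> * complex_of_real ((x \<bullet> (e *\<^sub>R \<xi>)) / e)) * a (x, e *\<^sub>R \<xi>)) y"
    using e by simp
  then show ?thesis using e by (simp add: scaleR_conv_of_real)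
qed

text \<open>The distributional definition unfolds to an iterated integral of an explicit kernel. The
  factor \<open>e ^ DIM('a)\<close> of \<open>dist_rescale\<close> cancels the one in the prefactor,
  and Fubini yields an integral over pairs.\<close>

lemma wigner_transform_eq:
  fixes u u' :: "'a::euclidean_space \<Rightarrow> complex"
  assumes a: "a \<in> schwartz" and e: "e > 0" and um[measurable]: "u' \<in> borel_measurable borel" and fin: "sqn u' < \<infinity>"
    and ae: "AE x in lborel. u x = u' x"
  shows "wigner_transform e (fun_dist u) a = complex_of_real (1 / (2 * pi) ^ DIM('a)) * wigner_form e a u' u'"
proof -
  define k where "k x y = wigner_kernel e a (x, y)" for x y
  note km[measurable] = wigner_kernel_measurable[OF a, of e]
  have kxm[measurable]: "k x \<in> borel_measurable borel" for x
    unfolding k_def by (rule measurable_compose[OF _ km]) (intro borel_measurable_continuous_onI continuous_intros)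
  have km2: "(\<lambda>(x, y). u' y * k x y) \<in> borel_measurable (borel \<Otimes>\<^sub>M borel)"
    unfolding k_def split_beta' prod.collapse using km by (simp add: borel_prod[symmetric])
  have fk: "fourier (\<lambda>\<xi>. exp (\<i> * complex_of_real ((x \<bullet> (e *\<^sub>R \<xi>)) / e)) * a (x, e *\<^sub>R \<xi>)) y = k x y" for x y
    unfolding k_def wigner_kernel_def using schwartz_slice_scale_ft[OF a e, of x y] by simp
  define J where "J x = (\<integral>y. u' y * k x y \<partial>lborel)" for x
  have inner: "(\<integral>y. u y * k x y \<partial>lebesgue) = J x" for x
    unfolding J_def using ae by (intro integral_lebesgue_AE) auto
  have Jm[measurable]: "J \<in> borel_measurable borel"
    using lborel.borel_measurable_lebesgue_integral[of "\<lambda>x y. u' y * k x y" lborel] km2 by (simp add: J_def[abs_def])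
  have "wigner_transform e (fun_dist u) a = complex_of_real (1 / (2 * pi * e) ^ DIM('a)) *
      cnj (\<integral>x. u x * cnj (complex_of_real (e ^ DIM('a)) * (\<integral>y. u y * k x y \<partial>lebesgue)) \<partial>lebesgue)"
    unfolding wigner_transform_def dist_mult_def dist_tensor_def dist_cnj_def fun_dist_def dist_rescale_def fourier_dist_def prod.case fk ..
  also have "(\<integral>x. u x * cnj (complex_of_real (e ^ DIM('a)) * (\<integral>y. u y * k x y \<partial>lebesgue)) \<partial>lebesgue)
     = (\<integral>x. u' x * cnj (complex_of_real (e ^ DIM('a)) * J x) \<partial>lborel)"
    unfolding inner by (rule integral_lebesgue_AE, measurable) (use ae in \<open>eventually_elim, simp\<close>)
  also have "cnj \<dots> = (\<integral>x. complex_of_real (e ^ DIM('a)) * (cnj (u' x) * J x) \<partial>lborel)"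
    by (subst Bochner_Integration.integral_cnj[symmetric]) (simp add: mult_ac)
  also have "\<dots> = complex_of_real (e ^ DIM('a)) * (\<integral>x. cnj (u' x) * J x \<partial>lborel)"
    by (rule integral_mult_right_zero)
  also have "(\<integral>x. cnj (u' x) * J x \<partial>lborel) = (\<integral>x. cnj (u' x) * (\<integral>y. u' y * k x y \<partial>lborel) \<partial>lborel)"
    unfolding J_def ..
  also have "(\<integral>x. cnj (u' x) * (\<integral>y. u' y * k x y \<partial>lborel) \<partial>lborel) = (\<integral>x. (\<integral>y. cnj (u' x) * u' y * k x y \<partial>lborel) \<partial>lborel)"
    by (intro Bochner_Integration.integral_cong refl, subst integral_mult_right_zero[symmetric]) (simp add: mult.assoc)
  also have "\<dots> = wigner_form e a u' u'"
  proof -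
    have i: "integrable (lborel \<Otimes>\<^sub>M lborel) (\<lambda>p. cnj (u' (fst p)) * u' (snd p) * wigner_kernel e a p)"
      using wigner_form_integrable[OF a um um fin fin e] by (simp add: lborel_prod)
    from lborel_pair.integral_fst'[OF i]
    show ?thesis unfolding wigner_form_def k_def by (simp add: lborel_prod)
  qed
  finally show ?thesis using e by (simp add: power_mult_distrib)
qed

lemma integrable_tensor:
  fixes f :: "'a::euclidean_space \<Rightarrow> complex" and g :: "'b::euclidean_space \<Rightarrow> complex"
  assumes f: "integrable lborel f" and g: "integrable lborel g"
  shows "integrable (lborel \<Otimes>\<^sub>M lborel) (\<lambda>(x, y). f x * g y)"
proof -
  have [measurable]: "f \<in> borel_measurable borel" "g \<in> borel_measurable borel" using f g by (auto simp: integrable_iff_bounded)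
  show ?thesis
    by (rule lborel_pair.Fubini_integrable) (use f g in \<open>auto simp: norm_mult\<close>)
qed

section \<open>Averaging the Wigner form of a periodically modulated sequence\<close>

context sampling_kernel
begin

lemma mean_tensor_periodization:
  "(LINT z:cell \<times> cell|lborel. cnj (periodization (fst (p + z))) * periodization (snd (p + z))) = complex_of_real ((norm (\<integral>x. \<psi> x \<partial>lborel))\<^sup>2)"
proof -
  let ?P = "\<lambda>a x. indicator cell x *\<^sub>R periodization (a + x)"
  have Pi: "integrable lborel (?P a)" for a
    using integrable_cell_bounded[of "\<lambda>x. periodization (a + x)" "C * M" 0] periodization_le by simp
  have i: "integrable (lborel \<Otimes>\<^sub>M lborel) (\<lambda>(x, y). cnj (?P (fst p) x) * ?P (snd p) y)"
    by (intro integrable_tensor integrable_cnj Pi)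
  have PI: "(\<integral>x. ?P a x \<partial>lborel) = (\<integral>x. \<psi> x \<partial>lborel)" for a
    using mean_periodization[of a] by (simp add: set_lebesgue_integral_def)
  have "(LINT z:cell \<times> cell|lborel. cnj (periodization (fst (p + z))) * periodization (snd (p + z))) = (\<integral>z. (case z of (x, y) \<Rightarrow> cnj (?P (fst p) x) * ?P (snd p) y) \<partial>lborel)"
    unfolding set_lebesgue_integral_def by (intro Bochner_Integration.integral_cong refl) (auto simp: indicator_def)
  also have "\<dots> = (\<integral>x. \<integral>y. cnj (?P (fst p) x) * ?P (snd p) y \<partial>lborel \<partial>lborel)"
    unfolding lborel_prod[symmetric] by (rule lborel_pair.integral_fst[OF i, symmetric])
  also have "\<dots> = (\<integral>x. cnj (?P (fst p) x) \<partial>lborel) * (\<integral>y. ?P (snd p) y \<partial>lborel)"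
    by (simp only: integral_mult_right_zero integral_mult_left_zero)
  also have "\<dots> = complex_of_real ((norm (\<integral>x. \<psi> x \<partial>lborel))\<^sup>2)"
    by (simp only: Bochner_Integration.integral_cnj PI complex_norm_square mult.commute)
  finally show ?thesis .
qed

text \<open>\<open>averaging\<close> is applied in the doubled space with the cell
  \<open>cell \<times> cell\<close>. A translation by \<open>h k\<close> times \<open>(p, q)\<close>
  moves the first variable of the kernel by \<open>h k p\<close> and its second by
  \<open>(h k / e k) (q - p)\<close>, so the kernel varies slowly because both \<open>h k\<close>
  and \<open>h k / e k\<close> tend to 0.\<close>

lemma wigner_form_average:
  fixes u :: "nat \<Rightarrow> real^'n \<Rightarrow> complex"
  assumes b: "b \<in> schwartz" and h: "\<And>k. h k > 0" and e: "\<And>k. e k > 0" and hl: "h \<longlonglongrightarrow> 0" and he: "(\<lambda>k. h k / e k) \<longlonglongrightarrow> 0"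
    and um: "\<And>k. u k \<in> borel_measurable borel" and uK: "\<And>k. sqn (u k) \<le> ennreal K"
    and shift: "\<And>z. (\<lambda>k. sqn (\<lambda>x. u k (x + h k *\<^sub>R z) - u k x)) \<longlonglongrightarrow> 0"
  shows "(\<lambda>k. wigner_form (e k) b (\<lambda>x. periodization (x /\<^sub>R h k) * u k x) (\<lambda>x. periodization (x /\<^sub>R h k) * u k x)
     - wigner_form (e k) b (u k) (u k) * complex_of_real ((norm (\<integral>x. \<psi> x \<partial>lborel))\<^sup>2)) \<longlonglongrightarrow> 0"
proof -
  define F where "F k p = cnj (u k (fst p)) * u k (snd p) * wigner_kernel (e k) b p" for k p
  define Q where "Q p = cnj (periodization (fst p)) * periodization (snd p)" for p
  have uf: "sqn (u k) < \<infinity>" for k using uK[of k] by (auto intro: le_less_trans)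
  obtain D where D: "D > 0" "\<And>e p. e > 0 \<Longrightarrow> norm (wigner_kernel e b (p :: (real^'n) \<times> (real^'n))) \<le> D * (inverse (e ^ DIM(real^'n)) * poly_kernel ((snd p - fst p) /\<^sub>R e))"
    using wigner_kernel_le[OF b] by blast
  let ?I = "\<integral>\<^sup>+z. ennreal (poly_kernel (z::real^'n)) \<partial>lborel"
  have Fi: "integrable lborel (F k)" for k unfolding F_def by (rule wigner_form_integrable[OF b um um uf uf e])
  have Fb: "(\<integral>\<^sup>+p. ennreal (norm (F k p)) \<partial>lborel) \<le> ennreal (enn2real (ennreal D * (?I * ennreal K)))" for k
  proof -
    have "(\<integral>\<^sup>+p. ennreal (norm (F k p)) \<partial>lborel) \<le> ennreal D * conv_form (e k) (u k) (u k)"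
      unfolding F_def using D e by (intro nn_integral_wigner_form_le um) auto
    also have "\<dots> \<le> ennreal D * (?I * ennreal K)"
      by (intro mult_left_mono conv_form_bounded um e uK) auto
    also have "\<dots> = ennreal (enn2real (ennreal D * (?I * ennreal K)))"
      using poly_kernel_nn_finite[where 'a = "real^'n"] by (subst ennreal_enn2real) (auto simp: ennreal_mult_less_top)
    finally show ?thesis .
  qed
  have Fshift: "(\<lambda>k. shift_dist (F k) (h k *\<^sub>R pq)) \<longlonglongrightarrow> 0" for pq
  proof -
    obtain p q where pq: "pq = (p, q)" by (cases pq)
    \<comment> \<open>A bound for all \<open>k\<close>, because the constants of
      \<open>partial_ft_shift\<close> and of \<open>D'\<close> depend on \<open>H\<close> and must
      not depend on \<open>k\<close>.\<close>
    obtain B where B: "\<And>k. norm (h k / e k) \<le> B" using convergent_imp_Bseq[OF convergentI[OF he]] by (auto simp: Bseq_def)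
    have B0: "B \<ge> 0" using norm_ge_zero B[of 0] by (rule order_trans)
    define H where "H = B * norm (q - p)"
    have H0: "H \<ge> 0" unfolding H_def using B0 by simp
    obtain L where L: "L > 0" "\<And>x z p q. norm q \<le> H \<Longrightarrow> norm (partial_ft b (x + p) (z + q) - partial_ft b x z) \<le> L * sqrt (norm p + norm q) * poly_kernel z"
      using partial_ft_shift[OF b H0] by metis
    define r where "r k = (h k / e k) *\<^sub>R (q - p)" for k
    have rH: "norm (r k) \<le> H" for k unfolding r_def H_def norm_scaleR using B[of k] by (intro mult_right_mono) auto
    define kk where "kk k x = wigner_kernel (e k) b (x + h k *\<^sub>R (p, q))" for k and x :: "(real^'n) \<times> (real^'n)"
    have arg: "(snd (x + h k *\<^sub>R (p, q)) - fst (x + h k *\<^sub>R (p, q))) /\<^sub>R e k = (snd x - fst x) /\<^sub>R e k + r k" for k and x :: "(real^'n) \<times> (real^'n)"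
      unfolding r_def by (simp add: algebra_simps divide_inverse)
    define D' where "D' = D * (1 + H) ^ Suc DIM(real^'n)"
    have D'0: "D' \<ge> 0" unfolding D'_def using D(1) H0 by simp
    have kk_le: "norm (kk k x) \<le> D' * (inverse (e k ^ DIM(real^'n)) * poly_kernel ((snd x - fst x) /\<^sub>R e k))" for k x
    proof -
      have "norm (kk k x) \<le> D * (inverse (e k ^ DIM(real^'n)) * poly_kernel ((snd x - fst x) /\<^sub>R e k + r k))"
        unfolding kk_def arg[symmetric] by (rule D(2)[OF e])
      also have "\<dots> \<le> D * (inverse (e k ^ DIM(real^'n)) * ((1 + H) ^ Suc DIM(real^'n) * poly_kernel ((snd x - fst x) /\<^sub>R e k)))"
        unfolding poly_kernel_def using D(1) e[of k] by (intro mult_left_mono inverse_power_shift_le rH) (auto intro: less_imp_le)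
      finally show ?thesis by (simp only: D'_def mult_ac)
    qed
    have sq0: "L * sqrt (norm (h k *\<^sub>R p) + norm (r k)) \<ge> 0" for k using L(1) by simp
    have kd_le: "norm (kk k x - wigner_kernel (e k) b x) \<le> (L * sqrt (norm (h k *\<^sub>R p) + norm (r k))) * (inverse (e k ^ DIM(real^'n)) * poly_kernel ((snd x - fst x) /\<^sub>R e k))" for k x
    proof -
      have "kk k x - wigner_kernel (e k) b x = complex_of_real (inverse (e k ^ DIM(real^'n))) * (partial_ft b (fst x + h k *\<^sub>R p) ((snd x - fst x) /\<^sub>R e k + r k) - partial_ft b (fst x) ((snd x - fst x) /\<^sub>R e k))"
        unfolding kk_def wigner_kernel_def arg by (simp add: right_diff_distrib)
      then have "norm (kk k x - wigner_kernel (e k) b x) = inverse (e k ^ DIM(real^'n)) * norm (partial_ft b (fst x + h k *\<^sub>R p) ((snd x - fst x) /\<^sub>R e k + r k) - partial_ft b (fst x) ((snd x - fst x) /\<^sub>R e k))"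
        using e[of k] by (simp add: norm_mult norm_inverse norm_power)
      also have "\<dots> \<le> inverse (e k ^ DIM(real^'n)) * (L * sqrt (norm (h k *\<^sub>R p) + norm (r k)) * poly_kernel ((snd x - fst x) /\<^sub>R e k))"
        using e[of k] by (intro mult_left_mono L(2) rH) (auto intro: less_imp_le)
      finally show ?thesis by (simp only: mult_ac)
    qed
    have km: "wigner_kernel (e k) b \<in> borel_measurable borel" for k by (rule wigner_kernel_measurable[OF b])
    have kkm: "kk k \<in> borel_measurable borel" for k
      unfolding kk_def by (rule measurable_compose[OF _ km]) (intro borel_measurable_continuous_onI continuous_intros)
    define d1 where "d1 k x = u k (x + h k *\<^sub>R p) - u k x" for k x
    define d2 where "d2 k x = u k (x + h k *\<^sub>R q) - u k x" for k x
    define v where "v k x = u k (x + h k *\<^sub>R q)" for k x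
    have m1[measurable]: "d1 k \<in> borel_measurable borel" "d2 k \<in> borel_measurable borel" "v k \<in> borel_measurable borel" for k
      using um[of k] unfolding d1_def d2_def v_def by measurable
    have vK: "sqn (v k) \<le> ennreal K" for k unfolding v_def using sqn_translate[OF um] uK by metis
    \<comment> \<open>One factor is changed at a time: \<open>d1\<close> and \<open>d2\<close>
      vanish in mean square by \<open>shift\<close>, and the last term carries the increment of the
      kernel.\<close>
    have Fd: "F k (x + h k *\<^sub>R (p, q)) - F k x = cnj (d1 k (fst x)) * v k (snd x) * kk k x + (cnj (u k (fst x)) * d2 k (snd x) * kk k x
        + cnj (u k (fst x)) * u k (snd x) * (kk k x - wigner_kernel (e k) b x))" for k x
      unfolding F_def kk_def d1_def d2_def v_def by (simp add: algebra_simps)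
    have kdm: "(\<lambda>x. kk k x - wigner_kernel (e k) b x) \<in> borel_measurable borel" for k using kkm km by measurable
    note t1 = measurable_tensor[OF m1(1) m1(3) kkm]
    note t2 = measurable_tensor[OF um m1(2) kkm]
    note t3 = measurable_tensor[OF um um kdm]
    let ?B = "\<lambda>k. ennreal D' * conv_form (e k) (d1 k) (v k) + (ennreal D' * conv_form (e k) (u k) (d2 k) + ennreal (L * sqrt (norm (h k *\<^sub>R p) + norm (r k))) * conv_form (e k) (u k) (u k))"
    have le: "shift_dist (F k) (h k *\<^sub>R pq) \<le> ?B k" for k
    proof -
      have "shift_dist (F k) (h k *\<^sub>R pq) \<le> (\<integral>\<^sup>+x. ennreal (norm (cnj (d1 k (fst x)) * v k (snd x) * kk k x)) \<partial>lborel)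
         + (\<integral>\<^sup>+x. ennreal (norm (cnj (u k (fst x)) * d2 k (snd x) * kk k x + cnj (u k (fst x)) * u k (snd x) * (kk k x - wigner_kernel (e k) b x))) \<partial>lborel)"
        unfolding shift_dist_def pq Fd using t1[of k k k] t2[of k k k] t3[of k k k] by (intro nn_integral_norm_add) auto
      also have "\<dots> \<le> (\<integral>\<^sup>+x. ennreal (norm (cnj (d1 k (fst x)) * v k (snd x) * kk k x)) \<partial>lborel)
         + ((\<integral>\<^sup>+x. ennreal (norm (cnj (u k (fst x)) * d2 k (snd x) * kk k x)) \<partial>lborel) + (\<integral>\<^sup>+x. ennreal (norm (cnj (u k (fst x)) * u k (snd x) * (kk k x - wigner_kernel (e k) b x))) \<partial>lborel))"
        using t2[of k k k] t3[of k k k] by (intro add_left_mono nn_integral_norm_add) auto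
      also have "\<dots> \<le> ?B k"
        by (intro add_mono nn_integral_wigner_form_le m1 um e D'0 sq0 kk_le kd_le)
      finally show ?thesis .
    qed
    have "(\<lambda>k. ?B k) \<longlonglongrightarrow> 0 + (0 + 0)"
    proof (intro tendsto_add)
      show "(\<lambda>k. ennreal D' * conv_form (e k) (d1 k) (v k)) \<longlonglongrightarrow> 0"
        using shift[of p] by (intro tendsto_0_ennreal_cmult conv_form_tendsto_0_left[OF m1(1) m1(3) e _ vK]) (simp_all add: d1_def[abs_def])
      show "(\<lambda>k. ennreal D' * conv_form (e k) (u k) (d2 k)) \<longlonglongrightarrow> 0"
        using shift[of q] by (intro tendsto_0_ennreal_cmult conv_form_tendsto_0_right[OF um m1(2) e _ uK]) (simp_all add: d2_def[abs_def])
      have "(\<lambda>k. L * sqrt (norm (h k *\<^sub>R p) + norm (r k))) \<longlonglongrightarrow> L * sqrt (norm (0 *\<^sub>R p) + norm (0 *\<^sub>R (q - p)))"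
        unfolding r_def by (intro tendsto_intros hl he)
      then have "(\<lambda>k. ennreal (L * sqrt (norm (h k *\<^sub>R p) + norm (r k)))) \<longlonglongrightarrow> ennreal 0" by (intro tendsto_ennrealI) simp
      then have "(\<lambda>k. (?I * ennreal K) * ennreal (L * sqrt (norm (h k *\<^sub>R p) + norm (r k)))) \<longlonglongrightarrow> 0"
        using poly_kernel_nn_finite[where 'a = "real^'n"] by (intro tendsto_0_ennreal_cmult) (auto simp: ennreal_mult_less_top)
      then show "(\<lambda>k. ennreal (L * sqrt (norm (h k *\<^sub>R p) + norm (r k))) * conv_form (e k) (u k) (u k)) \<longlonglongrightarrow> 0"
      proof (rule tendsto_0_ennreal_le)
        fix k
        have "ennreal (L * sqrt (norm (h k *\<^sub>R p) + norm (r k))) * conv_form (e k) (u k) (u k) \<le> ennreal (L * sqrt (norm (h k *\<^sub>R p) + norm (r k))) * (?I * ennreal K)"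
          by (intro mult_left_mono conv_form_bounded um e uK) auto
        then show "ennreal (L * sqrt (norm (h k *\<^sub>R p) + norm (r k))) * conv_form (e k) (u k) (u k) \<le> (?I * ennreal K) * ennreal (L * sqrt (norm (h k *\<^sub>R p) + norm (r k)))"
          by (simp only: mult.commute)
      qed
    qed
    then have "(\<lambda>k. ?B k) \<longlonglongrightarrow> 0" by simp
    then show ?thesis using le by (rule tendsto_0_ennreal_le)
  qed
  have Qm: "Q \<in> borel_measurable borel"
    using measurable_tensor[OF periodization_measurable periodization_measurable, of "\<lambda>_. 1"] by (simp add: Q_def[abs_def])
  have QB: "norm (Q p) \<le> (C * M) * (C * M)" for p
    unfolding Q_def norm_mult complex_mod_cnj using C M by (intro mult_mono periodization_le) auto
  have Z: "cell \<times> cell \<in> sets (borel :: ((real^'n) \<times> (real^'n)) measure)"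
    unfolding borel_prod[symmetric] by (intro pair_measureI cell_measurable)
  have Z1: "emeasure lborel (cell \<times> cell :: ((real^'n) \<times> (real^'n)) set) = 1"
    unfolding lborel_prod[symmetric] by (subst lborel.emeasure_pair_measure_Times) (auto simp: emeasure_cell)
  have "(\<lambda>k. (\<integral>p. F k p * Q (p /\<^sub>R h k) \<partial>lborel) - (\<integral>p. F k p \<partial>lborel) * complex_of_real ((norm (\<integral>x. \<psi> x \<partial>lborel))\<^sup>2)) \<longlonglongrightarrow> 0"
    by (rule averaging[OF Fi Fb Fshift h Qm QB Z Z1]) (simp only: Q_def mean_tensor_periodization)
  moreover have "(\<integral>p. F k p * Q (p /\<^sub>R h k) \<partial>lborel) = wigner_form (e k) b (\<lambda>x. periodization (x /\<^sub>R h k) * u k x) (\<lambda>x. periodization (x /\<^sub>R h k) * u k x)" for k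
    unfolding wigner_form_def F_def Q_def by (intro Bochner_Integration.integral_cong refl) simp
  moreover have "(\<integral>p. F k p \<partial>lborel) = wigner_form (e k) b (u k) (u k)" for k
    unfolding wigner_form_def F_def ..
  ultimately show ?thesis by simp
qed

end

section \<open>Convergence of the densities\<close>

lemma norm_sq_diff_le: "\<bar>(norm a)\<^sup>2 - (norm b)\<^sup>2\<bar> \<le> norm (a - b) * norm a + norm (a - b) * norm b"
proof -
  have "\<bar>(norm a)\<^sup>2 - (norm b)\<^sup>2\<bar> = \<bar>norm a - norm b\<bar> * (norm a + norm b)"
    by (simp add: power2_eq_square square_diff_square_factored abs_mult mult.commute)
  also have "\<dots> \<le> norm (a - b) * (norm a + norm b)" by (intro mult_right_mono norm_triangle_ineq3) auto
  finally show ?thesis by (simp add: distrib_left)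
qed

text \<open>The difference of squares contains the factor \<open>w k - v k\<close>, which vanishes
  in mean square, multiplied by bounded sequences.\<close>

lemma sq_density_diff_tendsto_0:
  fixes w v :: "nat \<Rightarrow> 'a::euclidean_space \<Rightarrow> complex"
  assumes w[measurable]: "\<And>k. w k \<in> borel_measurable borel" and v[measurable]: "\<And>k. v k \<in> borel_measurable borel"
    and wK: "\<And>k. sqn (w k) \<le> ennreal K" and vK: "\<And>k. sqn (v k) \<le> ennreal K"
    and d: "(\<lambda>k. sqn (\<lambda>x. w k x - v k x)) \<longlonglongrightarrow> 0"
  shows "(\<lambda>k. \<integral>\<^sup>+x. ennreal \<bar>(norm (w k x))\<^sup>2 - (norm (v k x))\<^sup>2\<bar> \<partial>lborel) \<longlonglongrightarrow> 0"
proof (rule tendsto_0_ennreal_le)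
  let ?X = "\<lambda>z k. \<integral>\<^sup>+x. ennreal (norm (w k x - v k x) * norm (z k x)) \<partial>lborel"
  have X: "?X z \<longlonglongrightarrow> 0" if z[measurable]: "\<And>k. z k \<in> borel_measurable borel" and zK: "\<And>k. sqn (z k) \<le> ennreal K" for z :: "nat \<Rightarrow> 'a \<Rightarrow> complex"
  proof (rule tendsto_0_am_gm[where I = 1, OF _ _ d zK])
    show "?X z k \<le> 1 * (ennreal (t/2) * sqn (\<lambda>x. w k x - v k x) + ennreal (1/(2*t)) * sqn (z k))" if "t > 0" for k t
      unfolding mult_1_left using that by (intro nn_integral_mult_le) auto
  qed simp
  have "(\<lambda>k. ?X w k + ?X v k) \<longlonglongrightarrow> 0 + 0" by (intro tendsto_add X w v wK vK)
  then show "(\<lambda>k. ?X w k + ?X v k) \<longlonglongrightarrow> 0" by simp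
  fix k
  have "(\<integral>\<^sup>+x. ennreal \<bar>(norm (w k x))\<^sup>2 - (norm (v k x))\<^sup>2\<bar> \<partial>lborel) \<le> (\<integral>\<^sup>+x. ennreal (norm (w k x - v k x) * norm (w k x)) + ennreal (norm (w k x - v k x) * norm (v k x)) \<partial>lborel)"
    by (intro nn_integral_mono) (auto simp: norm_sq_diff_le simp flip: ennreal_plus)
  also have "\<dots> = ?X w k + ?X v k" by (intro nn_integral_add) measurable
  finally show "(\<integral>\<^sup>+x. ennreal \<bar>(norm (w k x))\<^sup>2 - (norm (v k x))\<^sup>2\<bar> \<partial>lborel) \<le> ?X w k + ?X v k" .
qed

lemma Cc_bounded:
  assumes f: "f \<in> Cc"
  obtains B where "B > 0" "\<And>x. norm (f x) \<le> B"
proof -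
  let ?S = "closure {x. f x \<noteq> 0}"
  have "compact (f ` ?S)" using f by (intro compact_continuous_image) (auto simp: Cc_def intro: continuous_on_subset)
  then obtain B where B: "B > 0" "\<And>y. y \<in> f ` ?S \<Longrightarrow> norm y \<le> B" by (meson bounded_pos compact_imp_bounded)
  have "norm (f x) \<le> B" for x
  proof (cases "f x = 0")
    case False
    then have "x \<in> ?S" using closure_subset[of "{x. f x \<noteq> 0}"] by auto
    then show ?thesis using B(2) by blast
  qed (use B in auto)
  with B(1) show ?thesis by (rule that)
qed

text \<open>\<open>K\<close> is the closed unit neighbourhood of the support: if \<open>f\<close> is
  nonzero at one of \<open>x\<close> and \<open>x + p\<close>, both lie in \<open>K\<close> as long
  as \<open>norm p < 1\<close>.\<close>

lemma Cc_uniformly_continuous: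
  fixes f :: "'a::euclidean_space \<Rightarrow> complex"
  assumes f: "f \<in> Cc" and e: "e > 0"
  obtains d where "d > 0" "\<And>x p. norm p < d \<Longrightarrow> norm (f (x + p) - f x) < e"
proof -
  define S where "S = closure {x. f x \<noteq> 0}"
  define K where "K = {x + y | x y. x \<in> S \<and> y \<in> cball (0::'a) 1}"
  have K: "compact K" unfolding K_def S_def using f by (intro compact_sums) (auto simp: Cc_def)
  have "uniformly_continuous_on K f"
    using f K by (intro compact_uniformly_continuous) (auto simp: Cc_def intro: continuous_on_subset)
  then obtain d where d: "d > 0" "\<And>x y. x \<in> K \<Longrightarrow> y \<in> K \<Longrightarrow> dist y x < d \<Longrightarrow> dist (f y) (f x) < e"
    using e by (rule uniformly_continuous_onE) blast
  have SK: "x + y \<in> K" if "f x \<noteq> 0" "norm y \<le> 1" for x y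
  proof -
    have "x \<in> S" unfolding S_def using that(1) closure_subset by fastforce
    moreover have "y \<in> cball 0 1" using that(2) by simp
    ultimately show ?thesis unfolding K_def by blast
  qed
  have "norm (f (x + p) - f x) < e" if p: "norm p < min d 1" for x p
  proof (cases "f x \<noteq> 0 \<or> f (x + p) \<noteq> 0")
    case True
    have "x \<in> K \<and> x + p \<in> K"
    proof (cases "f x \<noteq> 0")
      case True
      then show ?thesis using SK[of x 0] SK[of x p] p by simp
    next
      case False
      with True have n: "f (x + p) \<noteq> 0" by simp
      have "(x + p) + (- p) \<in> K" by (rule SK[OF n]) (use p in simp)
      moreover have "(x + p) + 0 \<in> K" by (rule SK[OF n]) simp
      ultimately show ?thesis by simp
    qed
    then show ?thesis using d(2)[of x "x + p"] p by (simp add: dist_norm)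
  qed (use e in simp)
  moreover have "min d 1 > 0" using d(1) by simp
  ultimately show ?thesis by (rule that[rotated])
qed

lemma integral_Cc_sq_perturb:
  fixes w v :: "nat \<Rightarrow> 'a::euclidean_space \<Rightarrow> complex"
  assumes f: "f \<in> Cc" and w[measurable]: "\<And>k. w k \<in> borel_measurable borel" and v[measurable]: "\<And>k. v k \<in> borel_measurable borel"
    and wK: "\<And>k. sqn (w k) \<le> ennreal K" and vK: "\<And>k. sqn (v k) \<le> ennreal K"
    and d: "(\<lambda>k. sqn (\<lambda>x. w k x - v k x)) \<longlonglongrightarrow> 0"
  shows "(\<lambda>k. (\<integral>x. f x * complex_of_real ((norm (w k x))\<^sup>2) \<partial>lborel) - (\<integral>x. f x * complex_of_real ((norm (v k x))\<^sup>2) \<partial>lborel)) \<longlonglongrightarrow> 0"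
proof -
  obtain B where B: "B > 0" "\<And>x. norm (f x) \<le> B" using Cc_bounded[OF f] by blast
  have fm[measurable]: "f \<in> borel_measurable borel" using f by (intro borel_measurable_continuous_onI) (simp add: Cc_def)
  have int: "integrable lborel (\<lambda>x. f x * complex_of_real ((norm (z x))\<^sup>2))" if [measurable]: "z \<in> borel_measurable borel" and "sqn z \<le> ennreal K" for z :: "'a \<Rightarrow> complex"
  proof (rule Bochner_Integration.integrable_bound)
    have "integrable lborel (\<lambda>x. (norm (z x))\<^sup>2)" using sqn_finite_iff[of z] that by (auto intro: le_less_trans)
    then show "integrable lborel (\<lambda>x. B * (norm (z x))\<^sup>2)" by (rule integrable_mult_right)
  qed (use B in \<open>auto simp: norm_mult norm_power abs_mult intro!: mult_right_mono\<close>)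
  have "(\<lambda>k. ennreal B * (\<integral>\<^sup>+x. ennreal \<bar>(norm (w k x))\<^sup>2 - (norm (v k x))\<^sup>2\<bar> \<partial>lborel)) \<longlonglongrightarrow> 0"
    by (intro tendsto_0_ennreal_cmult sq_density_diff_tendsto_0[OF w v wK vK d]) auto
  moreover have "ennreal (norm ((\<integral>x. f x * complex_of_real ((norm (w k x))\<^sup>2) \<partial>lborel) - (\<integral>x. f x * complex_of_real ((norm (v k x))\<^sup>2) \<partial>lborel)))
     \<le> ennreal B * (\<integral>\<^sup>+x. ennreal \<bar>(norm (w k x))\<^sup>2 - (norm (v k x))\<^sup>2\<bar> \<partial>lborel)" for k
  proof -
    have "(\<integral>x. f x * complex_of_real ((norm (w k x))\<^sup>2) \<partial>lborel) - (\<integral>x. f x * complex_of_real ((norm (v k x))\<^sup>2) \<partial>lborel)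
       = (\<integral>x. f x * complex_of_real ((norm (w k x))\<^sup>2) - f x * complex_of_real ((norm (v k x))\<^sup>2) \<partial>lborel)"
      by (rule Bochner_Integration.integral_diff[symmetric]) (intro int w v wK vK)+
    also have "\<dots> = (\<integral>x. f x * complex_of_real ((norm (w k x))\<^sup>2 - (norm (v k x))\<^sup>2) \<partial>lborel)"
      by (intro Bochner_Integration.integral_cong refl) (simp add: right_diff_distrib)
    also have "ennreal (norm \<dots>) \<le> (\<integral>\<^sup>+x. ennreal (norm (f x * complex_of_real ((norm (w k x))\<^sup>2 - (norm (v k x))\<^sup>2))) \<partial>lborel)"
      by (rule norm_integral_le_nn) measurable
    also have "\<dots> \<le> (\<integral>\<^sup>+x. ennreal B * ennreal \<bar>(norm (w k x))\<^sup>2 - (norm (v k x))\<^sup>2\<bar> \<partial>lborel)"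
      using B by (intro nn_integral_mono) (simp only: norm_mult norm_of_real ennreal_mult[symmetric] abs_ge_zero less_imp_le ennreal_leI mult_right_mono)
    also have "\<dots> = ennreal B * (\<integral>\<^sup>+x. ennreal \<bar>(norm (w k x))\<^sup>2 - (norm (v k x))\<^sup>2\<bar> \<partial>lborel)"
      by (rule nn_integral_cmult) measurable
    finally show ?thesis .
  qed
  ultimately have "(\<lambda>k. ennreal (norm ((\<integral>x. f x * complex_of_real ((norm (w k x))\<^sup>2) \<partial>lborel) - (\<integral>x. f x * complex_of_real ((norm (v k x))\<^sup>2) \<partial>lborel)))) \<longlonglongrightarrow> 0"
    by (rule tendsto_0_ennreal_le)
  then have "(\<lambda>k. norm ((\<integral>x. f x * complex_of_real ((norm (w k x))\<^sup>2) \<partial>lborel) - (\<integral>x. f x * complex_of_real ((norm (v k x))\<^sup>2) \<partial>lborel))) \<longlonglongrightarrow> 0"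
    by (subst (asm) ennreal_0[symmetric], subst (asm) tendsto_ennreal_iff) auto
  then show ?thesis by (rule tendsto_norm_zero_cancel)
qed

text \<open>The increment of \<open>F k\<close> splits into that of \<open>f\<close>, uniformly
  small, and that of the density of \<open>u k\<close>, small in L1.\<close>

lemma (in sampling_kernel) integral_Cc_sq_average:
  fixes u :: "nat \<Rightarrow> real^'n \<Rightarrow> complex"
  assumes f: "f \<in> Cc" and h: "\<And>k. h k > 0" and hl: "h \<longlonglongrightarrow> 0"
    and um[measurable]: "\<And>k. u k \<in> borel_measurable borel" and uK: "\<And>k. sqn (u k) \<le> ennreal K"
    and shift: "\<And>z. (\<lambda>k. sqn (\<lambda>x. u k (x + h k *\<^sub>R z) - u k x)) \<longlonglongrightarrow> 0"
  shows "(\<lambda>k. (\<integral>x. f x * complex_of_real ((norm (periodization (x /\<^sub>R h k) * u k x))\<^sup>2) \<partial>lborel)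
     - (\<integral>x. f x * complex_of_real ((norm (u k x))\<^sup>2) \<partial>lborel) * complex_of_real (enn2real (sqn (\<lambda>x. indicator cell x *\<^sub>R periodization x)))) \<longlonglongrightarrow> 0"
proof -
  obtain B where B: "B > 0" "\<And>x. norm (f x) \<le> B" using Cc_bounded[OF f] by blast
  have fm[measurable]: "f \<in> borel_measurable borel" using f by (intro borel_measurable_continuous_onI) (simp add: Cc_def)
  define F where "F k x = f x * complex_of_real ((norm (u k x))\<^sup>2)" for k x
  define Q where "Q x = complex_of_real ((norm (periodization x))\<^sup>2)" for x
  have Fm[measurable]: "F k \<in> borel_measurable borel" for k unfolding F_def by measurable
  have Qm[measurable]: "Q \<in> borel_measurable borel" unfolding Q_def by measurable
  have uf: "sqn (u k) < \<infinity>" for k using uK[of k] by (auto intro: le_less_trans)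
  have Fb: "(\<integral>\<^sup>+x. ennreal (norm (F k x)) \<partial>lborel) \<le> ennreal B * ennreal K" for k
  proof -
    have "(\<integral>\<^sup>+x. ennreal (norm (F k x)) \<partial>lborel) \<le> (\<integral>\<^sup>+x. ennreal B * ennreal ((norm (u k x))\<^sup>2) \<partial>lborel)"
      unfolding F_def using B
      by (intro nn_integral_mono) (simp add: norm_mult norm_power ennreal_mult[symmetric] less_imp_le ennreal_leI mult_right_mono)
    also have "\<dots> = ennreal B * sqn (u k)" unfolding sqn_def by (rule nn_integral_cmult) measurable
    also have "\<dots> \<le> ennreal B * ennreal K" by (intro mult_left_mono uK) auto
    finally show ?thesis .
  qed
  have Fb': "(\<integral>\<^sup>+x. ennreal (norm (F k x)) \<partial>lborel) \<le> ennreal (enn2real (ennreal B * ennreal K))" for k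
    using Fb[of k] by (subst ennreal_enn2real) (auto simp: ennreal_mult_less_top)
  have Fi: "integrable lborel (F k)" for k
    using Fb[of k] by (auto simp: integrable_iff_bounded ennreal_mult_less_top intro: le_less_trans)
  have Fs: "(\<lambda>k. shift_dist (F k) (h k *\<^sub>R z)) \<longlonglongrightarrow> 0" for z
  proof -
    define v where "v k x = u k (x + h k *\<^sub>R z)" for k x
    have vm[measurable]: "v k \<in> borel_measurable borel" for k unfolding v_def by measurable
    have vK: "sqn (v k) \<le> ennreal K" for k unfolding v_def using sqn_translate[OF um] uK by metis
    let ?A = "\<lambda>k. \<integral>\<^sup>+x. ennreal (norm (f (x + h k *\<^sub>R z) - f x) * (norm (v k x))\<^sup>2) \<partial>lborel"
    let ?B = "\<lambda>k. ennreal B * (\<integral>\<^sup>+x. ennreal \<bar>(norm (v k x))\<^sup>2 - (norm (u k x))\<^sup>2\<bar> \<partial>lborel)"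
    have le: "shift_dist (F k) (h k *\<^sub>R z) \<le> ?A k + ?B k" for k
    proof -
      have "shift_dist (F k) (h k *\<^sub>R z) \<le> (\<integral>\<^sup>+x. ennreal (norm (f (x + h k *\<^sub>R z) - f x) * (norm (v k x))\<^sup>2) + ennreal B * ennreal \<bar>(norm (v k x))\<^sup>2 - (norm (u k x))\<^sup>2\<bar> \<partial>lborel)"
        unfolding shift_dist_def
      proof (rule nn_integral_mono)
        fix x
        have "F k (x + h k *\<^sub>R z) - F k x = (f (x + h k *\<^sub>R z) - f x) * complex_of_real ((norm (v k x))\<^sup>2) + f x * complex_of_real ((norm (v k x))\<^sup>2 - (norm (u k x))\<^sup>2)"
          unfolding F_def v_def by (simp add: algebra_simps)
        then have "norm (F k (x + h k *\<^sub>R z) - F k x) \<le> norm ((f (x + h k *\<^sub>R z) - f x) * complex_of_real ((norm (v k x))\<^sup>2)) + norm (f x * complex_of_real ((norm (v k x))\<^sup>2 - (norm (u k x))\<^sup>2))"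
          by (simp only: norm_triangle_ineq)
        also have "\<dots> = norm (f (x + h k *\<^sub>R z) - f x) * (norm (v k x))\<^sup>2 + norm (f x) * \<bar>(norm (v k x))\<^sup>2 - (norm (u k x))\<^sup>2\<bar>"
          by (simp only: norm_mult norm_of_real abs_power2)
        also have "\<dots> \<le> norm (f (x + h k *\<^sub>R z) - f x) * (norm (v k x))\<^sup>2 + B * \<bar>(norm (v k x))\<^sup>2 - (norm (u k x))\<^sup>2\<bar>"
          by (intro add_left_mono mult_right_mono B) auto
        finally have "ennreal (norm (F k (x + h k *\<^sub>R z) - F k x)) \<le> ennreal (norm (f (x + h k *\<^sub>R z) - f x) * (norm (v k x))\<^sup>2 + B * \<bar>(norm (v k x))\<^sup>2 - (norm (u k x))\<^sup>2\<bar>)"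
          by (rule ennreal_leI)
        also have "\<dots> = ennreal (norm (f (x + h k *\<^sub>R z) - f x) * (norm (v k x))\<^sup>2) + ennreal B * ennreal \<bar>(norm (v k x))\<^sup>2 - (norm (u k x))\<^sup>2\<bar>"
          using B(1) by (subst ennreal_plus) (auto simp: ennreal_mult)
        finally show "ennreal (norm (F k (x + h k *\<^sub>R z) - F k x)) \<le> \<dots>" .
      qed
      also have "\<dots> = ?A k + ?B k" by (subst nn_integral_add) (auto simp: nn_integral_cmult)
      finally show ?thesis .
    qed
    have "?A \<longlonglongrightarrow> 0"
    proof (rule tendsto_0_ennrealI)
      fix r :: real assume r: "r > 0"
      define K' where "K' = max K 0 + 1"
      have K'0: "K' > 0" and KK: "ennreal K \<le> ennreal K'" by (auto simp: K'_def intro!: ennreal_leI)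
      obtain d where d: "d > 0" "\<And>x p. norm p < d \<Longrightarrow> norm (f (x + p) - f x) < r / K'"
        using Cc_uniformly_continuous[OF f, of "r / K'"] r K'0 by auto
      have "(\<lambda>k. norm (h k *\<^sub>R z)) \<longlonglongrightarrow> norm (0 *\<^sub>R z)" by (intro tendsto_intros hl)
      then have "eventually (\<lambda>k. norm (h k *\<^sub>R z) < d) sequentially" using d(1) by (intro order_tendstoD(2)) auto
      then show "eventually (\<lambda>k. ?A k \<le> ennreal r) sequentially"
      proof eventually_elim
        case (elim k)
        have "?A k \<le> (\<integral>\<^sup>+x. ennreal (r / K') * ennreal ((norm (v k x))\<^sup>2) \<partial>lborel)"
        proof (rule nn_integral_mono)
          fix x
          have "norm (f (x + h k *\<^sub>R z) - f x) * (norm (v k x))\<^sup>2 \<le> r / K' * (norm (v k x))\<^sup>2"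
            by (intro mult_right_mono less_imp_le[OF d(2)[OF elim]]) auto
          then have "ennreal (norm (f (x + h k *\<^sub>R z) - f x) * (norm (v k x))\<^sup>2) \<le> ennreal (r / K' * (norm (v k x))\<^sup>2)" by (rule ennreal_leI)
          also have "\<dots> = ennreal (r / K') * ennreal ((norm (v k x))\<^sup>2)" using r K'0 by (intro ennreal_mult) auto
          finally show "ennreal (norm (f (x + h k *\<^sub>R z) - f x) * (norm (v k x))\<^sup>2) \<le> \<dots>" .
        qed
        also have "\<dots> = ennreal (r / K') * sqn (v k)" unfolding sqn_def by (rule nn_integral_cmult) measurable
        also have "\<dots> \<le> ennreal (r / K') * ennreal K'" by (intro mult_left_mono order_trans[OF vK KK]) auto
        also have "\<dots> = ennreal r" using r K'0 by (simp add: ennreal_mult[symmetric])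
        finally show ?case .
      qed
    qed
    moreover have "?B \<longlonglongrightarrow> 0"
      using shift[of z] by (intro tendsto_0_ennreal_cmult sq_density_diff_tendsto_0[OF vm um vK uK]) (simp_all add: v_def[abs_def])
    ultimately have "(\<lambda>k. ?A k + ?B k) \<longlonglongrightarrow> 0 + 0" by (rule tendsto_add)
    then have "(\<lambda>k. ?A k + ?B k) \<longlonglongrightarrow> 0" by simp
    then show ?thesis using le by (rule tendsto_0_ennreal_le)
  qed
  have QB: "norm (Q x) \<le> (C * M)\<^sup>2" for x unfolding Q_def by (simp add: norm_power power_mono periodization_le)
  have "(\<lambda>k. (\<integral>x. F k x * Q (x /\<^sub>R h k) \<partial>lborel) - (\<integral>x. F k x \<partial>lborel) * complex_of_real (enn2real (sqn (\<lambda>x. indicator cell x *\<^sub>R periodization x)))) \<longlonglongrightarrow> 0"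
    by (rule averaging[OF Fi Fb' Fs h Qm QB cell_measurable emeasure_cell]) (simp only: Q_def mean_sq_periodization)
  moreover have "F k x * Q (x /\<^sub>R h k) = f x * complex_of_real ((norm (periodization (x /\<^sub>R h k) * u k x))\<^sup>2)" for k x
    by (simp add: F_def Q_def norm_mult power_mult_distrib mult_ac)
  ultimately show ?thesis by (simp only: F_def)
qed

section \<open>Radon measures are determined by continuous functions of compact support\<close>

lemma scale_measure_eq_density: "scale_measure r M = density M (\<lambda>_. r)"
  by (rule measure_eqI) (auto simp: emeasure_density nn_integral_cmult_indicator)

lemma
  fixes f :: "'a \<Rightarrow> complex"
  assumes f: "f \<in> borel_measurable M" and c: "c \<ge> 0"
  shows integrable_scale_measure: "integrable M f \<Longrightarrow> integrable (scale_measure (ennreal c) M) f"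
    and integral_scale_measure: "integral\<^sup>L (scale_measure (ennreal c) M) f = complex_of_real c * integral\<^sup>L M f"
  unfolding scale_measure_eq_density using f c
  by (simp_all add: integrable_density integral_density scaleR_conv_of_real)

text \<open>These functions increase with \<open>n\<close> to the indicator of the open box.\<close>

lemma box_bump_Cc:
  fixes l u :: "'a::euclidean_space"
  shows "(\<lambda>x. complex_of_real (min 1 (real n * infdist x (- box l u)))) \<in> Cc"
proof -
  have "{x. complex_of_real (min 1 (real n * infdist x (- box l u))) \<noteq> 0} \<subseteq> box l u"
  proof
    fix x assume "x \<in> {x. complex_of_real (min 1 (real n * infdist x (- box l u))) \<noteq> 0}"
    then have "infdist x (- box l u) \<noteq> 0" by auto
    then show "x \<in> box l u" by (metis ComplI infdist_zero)
  qed
  then have "bounded {x. complex_of_real (min 1 (real n * infdist x (- box l u))) \<noteq> 0}"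
    using bounded_box bounded_subset by blast
  then show ?thesis unfolding Cc_def by (auto simp: compact_closure intro!: continuous_intros)
qed

lemma radon_measure_box_finite:
  assumes "radon_measure N"
  shows "emeasure N (cbox l u) < \<infinity>" "emeasure N (box l u) < \<infinity>"
proof -
  show 1: "emeasure N (cbox l u) < \<infinity>" using assms by (auto simp: radon_measure_def)
  have "emeasure N (box l u) \<le> emeasure N (cbox l u)"
    using assms by (intro emeasure_mono box_subset_cbox) (auto simp: radon_measure_def)
  then show "emeasure N (box l u) < \<infinity>" using 1 by (rule le_less_trans)
qed

lemma radon_box_limit:
  fixes l u :: "'a::euclidean_space"
  assumes N: "radon_measure N"
  shows "(\<lambda>n. \<integral>x. complex_of_real (min 1 (real n * infdist x (- box l u))) \<partial>N) \<longlonglongrightarrow> complex_of_real (measure N (box l u))"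
proof -
  have [measurable_cong]: "sets N = sets borel" using N by (simp add: radon_measure_def)
  have bs: "box l u \<in> sets N" by simp
  \<comment> \<open>\<open>infdist\<close> from the empty set is 0 by convention, so the bumps reach
    1 inside the box only if its complement has a point.\<close>
  have ne: "- box l u \<noteq> {}"
  proof
    assume "- box l u = {}"
    then have "box l u = UNIV" using double_complement[of "box l u"] by simp
    then have "bounded (UNIV :: 'a set)" using bounded_box by metis
    then show False by simp
  qed
  have "(\<lambda>n. \<integral>x. complex_of_real (min 1 (real n * infdist x (- box l u))) \<partial>N) \<longlonglongrightarrow> (\<integral>x. complex_of_real (indicator (box l u) x) \<partial>N)"
  proof (rule integral_dominated_convergence[where w = "indicator (box l u)"])
    show "integrable N (indicator (box l u) :: 'a \<Rightarrow> real)"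
      using radon_measure_box_finite(2)[OF N, of l u] bs by (simp add: less_top)
    show "AE x in N. (\<lambda>n. complex_of_real (min 1 (real n * infdist x (- box l u)))) \<longlonglongrightarrow> complex_of_real (indicator (box l u) x)"
    proof (rule AE_I2)
      fix x :: 'a
      show "(\<lambda>n. complex_of_real (min 1 (real n * infdist x (- box l u)))) \<longlonglongrightarrow> complex_of_real (indicator (box l u) x)"
      proof (cases "x \<in> box l u")
        case True
        have "infdist x (- box l u) \<noteq> 0"
          using True ne in_closed_iff_infdist_zero[of "- box l u" x] by (auto simp: closed_Compl)
        then have pos: "infdist x (- box l u) > 0" using infdist_nonneg[of x "- box l u"] by linarith
        obtain m where m: "1 / infdist x (- box l u) < real m" using reals_Archimedean2 by blast
        have "eventually (\<lambda>n. complex_of_real (min 1 (real n * infdist x (- box l u))) = 1) sequentially"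
          using eventually_ge_at_top[of m]
        proof eventually_elim
          case (elim n)
          then have "1 / infdist x (- box l u) < real n" using m by linarith
          then have "1 < real n * infdist x (- box l u)" using pos by (simp add: divide_less_eq)
          then show ?case by simp
        qed
        then show ?thesis using True by (simp add: tendsto_eventually)
      next
        case False
        then show ?thesis by simp
      qed
    qed
    show "AE x in N. norm (complex_of_real (min 1 (real n * infdist x (- box l u)))) \<le> indicator (box l u) x" for n
      by (rule AE_I2) (auto simp: indicator_def infdist_nonneg)
    show "(\<lambda>x. complex_of_real (min 1 (real n * infdist x (- box l u)))) \<in> borel_measurable N" for n
    proof -
      have "(\<lambda>x. complex_of_real (min 1 (real n * infdist x (- box l u)))) \<in> borel_measurable borel"
        by (intro borel_measurable_continuous_onI continuous_intros)
      then show ?thesis by measurable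
    qed
    show "(\<lambda>x. complex_of_real (indicator (box l u) x)) \<in> borel_measurable N" by measurable
  qed
  also have "(\<integral>x. complex_of_real (indicator (box l u) x) \<partial>N) = complex_of_real (measure N (box l u))"
    using sets_eq_imp_space_eq[of N borel] N by (simp add: integral_complex_of_real radon_measure_def)
  finally show ?thesis .
qed

text \<open>Open boxes are stable under intersection and generate the Borel sets, and the boxes
  \<open>?A n\<close> of finite measure exhaust the space; \<open>radon_box_limit\<close> recovers
  their measures from integrals over \<open>Cc\<close>.\<close>

lemma radon_measure_eqI:
  fixes M N :: "'a::euclidean_space measure"
  assumes M: "radon_measure M" and N: "radon_measure N" and eq: "\<And>f. f \<in> Cc \<Longrightarrow> (\<integral>x. f x \<partial>M) = (\<integral>x. f x \<partial>N)"
  shows "M = N"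
proof (rule measure_eqI_generator_eq)
  let ?E = "range (\<lambda>(a, b). box a b::'a set)"
  show "Int_stable ?E" by (auto simp: Int_stable_def box_Int_box)
  show "?E \<subseteq> Pow UNIV" "sets M = sigma_sets UNIV ?E" "sets N = sigma_sets UNIV ?E"
    using M N by (simp_all add: borel_eq_box radon_measure_def)
  let ?A = "\<lambda>n::nat. box (- (real n *\<^sub>R One)) (real n *\<^sub>R One) :: 'a set"
  show "range ?A \<subseteq> ?E" "(\<Union>i. ?A i) = UNIV" unfolding UN_box_eq_UNIV by auto
  show "emeasure M (?A i) \<noteq> \<infinity>" for i using radon_measure_box_finite(2)[OF M] by (simp add: less_top)
  show "emeasure M X = emeasure N X" if XE: "X \<in> ?E" for X
  proof -
    obtain l u where X: "X = box l u" using XE by auto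
    have "complex_of_real (measure M X) = complex_of_real (measure N X)"
      unfolding X using radon_box_limit[OF M, of l u, unfolded eq[OF box_bump_Cc]] radon_box_limit[OF N, of l u] by (rule LIMSEQ_unique)
    then have "measure M X = measure N X" by (simp only: of_real_eq_iff)
    then show ?thesis
      using radon_measure_box_finite(2)[OF M, of l u] radon_measure_box_finite(2)[OF N, of l u]
      by (simp add: X emeasure_eq_ennreal_measure less_top)
  qed
qed

lemma radon_measure_scale:
  assumes "radon_measure M"
  shows "radon_measure (scale_measure (ennreal c) M)"
  using assms by (auto simp: radon_measure_def ennreal_mult_less_top)

section \<open>Passing between Lebesgue and Borel measurable representatives\<close>

lemma AE_affine:
  fixes c :: "'a::euclidean_space"
  assumes ae: "AE y in lborel. P y" and r: "r \<noteq> 0"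
  shows "AE x in lborel. P (r *\<^sub>R x + c)"
proof -
  obtain N where N: "{y. \<not> P y} \<subseteq> N" "emeasure lborel N = 0" "N \<in> sets borel" using ae by (elim AE_E) auto
  note [measurable] = N(3)
  have "0 = (\<integral>\<^sup>+y. indicator N y \<partial>lborel)" using N by simp
  also have "\<dots> = (\<integral>\<^sup>+y. indicator N (y + c) \<partial>lborel)" by (rule nn_integral_translate[symmetric]) measurable
  also have "\<dots> = ennreal (\<bar>r\<bar> ^ DIM('a)) * (\<integral>\<^sup>+x. indicator N (r *\<^sub>R x + c) \<partial>lborel)" using r by (intro nn_integral_dilate) auto
  finally have "(\<integral>\<^sup>+x. indicator N (r *\<^sub>R x + c) \<partial>lborel) = 0" using r by auto
  then have "AE x in lborel. indicator N (r *\<^sub>R x + c) = (0::ennreal)" by (subst (asm) nn_integral_0_iff_AE) auto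
  then show ?thesis
  proof eventually_elim
    case (elim x)
    then have "r *\<^sub>R x + c \<notin> N" by (auto simp: indicator_def split: if_splits)
    then show ?case using N(1) by blast
  qed
qed

lemma sqn_representative:
  assumes u: "u \<in> L2" and ae: "AE x in lborel. u x = u' x"
  shows "sqn u' = ennreal ((L2_norm u)\<^sup>2)"
proof -
  have i: "integrable lebesgue (\<lambda>x. (norm (u x))\<^sup>2)" using u by (simp add: L2_def)
  have "sqn u' = (\<integral>\<^sup>+x. ennreal ((norm (u x))\<^sup>2) \<partial>lebesgue)"
    unfolding sqn_def nn_integral_completion using ae by (intro nn_integral_cong_AE) auto
  also have "\<dots> = ennreal (\<integral>x. (norm (u x))\<^sup>2 \<partial>lebesgue)" by (rule nn_integral_eq_integral[OF i]) auto
  also have "(\<integral>x. (norm (u x))\<^sup>2 \<partial>lebesgue) = (L2_norm u)\<^sup>2"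
    unfolding L2_norm_def by (subst real_sqrt_pow2) (auto intro!: Bochner_Integration.integral_nonneg)
  finally show ?thesis .
qed

lemma lebesgue_measurable_AE:
  fixes u u' :: "'a::euclidean_space \<Rightarrow> complex"
  assumes "u' \<in> borel_measurable borel" "AE x in lborel. u x = u' x"
  shows "u \<in> borel_measurable lebesgue"
proof -
  have "u' \<in> borel_measurable lebesgue" using assms(1) by (intro measurable_completion) simp
  moreover have "AE x in lebesgue. u' x = u x" using AE_completion[OF assms(2)] by eventually_elim simp
  ultimately show ?thesis by (rule borel_measurable_AE)
qed

lemma L2_AE:
  fixes u u' :: "'a::euclidean_space \<Rightarrow> complex"
  assumes um[measurable]: "u' \<in> borel_measurable borel" and ae: "AE x in lborel. u x = u' x" and fin: "sqn u' < \<infinity>"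
  shows "u \<in> L2"
proof -
  have [measurable]: "u \<in> borel_measurable lebesgue" by (rule lebesgue_measurable_AE[OF um ae])
  have "(\<integral>\<^sup>+x. ennreal ((norm (u x))\<^sup>2) \<partial>lebesgue) = sqn u'"
    unfolding sqn_def nn_integral_completion using ae by (intro nn_integral_cong_AE) auto
  then show ?thesis using fin by (simp add: L2_def integrable_iff_bounded)
qed

text \<open>The predicates under the two choices coincide, so the chosen functions are equal
  outright; the oscillation hypothesis can thus be rewritten.\<close>

lemma fourier_L2_AE:
  fixes u u' :: "'a::euclidean_space \<Rightarrow> complex"
  assumes um[measurable]: "u' \<in> borel_measurable borel" and ae: "AE x in lborel. u x = u' x"
  shows "fourier_L2 u = fourier_L2 u'"
proof -
  have "fourier_dist (fun_dist u) f = fourier_dist (fun_dist u') f" if f: "f \<in> schwartz" for f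
  proof -
    have [measurable]: "f \<in> borel_measurable borel" by (rule schwartz_measurable[OF f])
    have "(\<integral>x. u x * fourier f x \<partial>lebesgue) = (\<integral>x. u' x * ft f x \<partial>lborel)"
      unfolding fourier_eq_ft[OF schwartz_measurable[OF f]] by (rule integral_lebesgue_AE, measurable) (use ae in \<open>eventually_elim, simp\<close>)
    moreover have "(\<integral>x. u' x * fourier f x \<partial>lebesgue) = (\<integral>x. u' x * ft f x \<partial>lborel)"
      unfolding fourier_eq_ft[OF schwartz_measurable[OF f]] by (rule integral_lebesgue_AE, measurable)
    ultimately show ?thesis by (simp add: fourier_dist_def fun_dist_def)
  qed
  then show ?thesis unfolding fourier_L2_def by (metis (no_types, lifting))
qed

lemma schwartz_seminorm_bdd:
  assumes "f \<in> schwartz" "bs \<in> lists Basis"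
  shows "bdd_above (range (\<lambda>x. (1 + norm x) ^ m * norm (iter_partial bs f x)))"
proof -
  have "bounded (range (\<lambda>x. (1 + norm x) ^ m *\<^sub>R iter_partial bs f x))" using assms unfolding schwartz_def by blast
  then obtain C where "\<And>x. norm ((1 + norm x) ^ m *\<^sub>R iter_partial bs f x) \<le> C" by (auto simp: bounded_iff)
  then show ?thesis by (intro bdd_aboveI[of _ C]) auto
qed

text \<open>\<open>|f|\<close> is at most its undifferentiated seminorm times
  \<open>poly_kernel\<close>, and \<open>poly_kernel\<close> is square integrable, so its product
  with \<open>u\<close> is integrable.\<close>

lemma tempered_distribution_L2:
  fixes u :: "'a::euclidean_space \<Rightarrow> complex"
  assumes u: "u \<in> L2"
  shows "tempered_distribution (fun_dist u)"
proof -
  obtain u' where um[measurable]: "u' \<in> borel_measurable borel" and ae: "AE x in lborel. u x = u' x"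
    using lebesgue_borel_representative[of u] u by (auto simp: L2_def)
  have fin: "sqn u' < \<infinity>" unfolding sqn_representative[OF u ae] by simp
  have eq: "fun_dist u f = (\<integral>x. u' x * f x \<partial>lborel)" if f: "f \<in> borel_measurable borel" for f
    unfolding fun_dist_def by (rule integral_lebesgue_AE, use f in measurable) (use ae in \<open>eventually_elim, simp\<close>)
  note sm = schwartz_measurable
  have add: "fun_dist u (\<lambda>x. f x + g x) = fun_dist u f + fun_dist u g" if f: "f \<in> schwartz" and g: "g \<in> schwartz" for f g
  proof -
    have [measurable]: "f \<in> borel_measurable borel" "g \<in> borel_measurable borel" by (rule sm[OF f] sm[OF g])+
    show ?thesis
      by (simp add: eq distrib_left)
         (intro Bochner_Integration.integral_add integrable_mult_sqn fin schwartz_sqn_finite f g um sm)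
  qed
  have scale: "fun_dist u (\<lambda>x. c * f x) = c * fun_dist u f" for c f
    unfolding fun_dist_def by (subst integral_mult_right_zero[symmetric]) (simp add: mult.left_commute)
  let ?m = "Suc DIM('a)"
  let ?S = "\<lambda>f. schwartz_seminorm ?m [] f"
  define C where "C = (\<integral>x. norm (u' x) * poly_kernel x \<partial>lborel)"
  have C0: "C \<ge> 0" unfolding C_def by (rule Bochner_Integration.integral_nonneg) auto
  have pk1: "norm (complex_of_real (poly_kernel (x::'a))) \<le> 1" for x
  proof -
    have "(1::real) \<le> (1 + norm x) ^ Suc DIM('a)" by (intro one_le_power) simp
    from le_imp_inverse_le[OF this] have "poly_kernel x \<le> 1" by (simp only: poly_kernel_def inverse_1 zero_less_one)
    then show ?thesis by (simp only: norm_of_real abs_of_nonneg[OF poly_kernel_nonneg])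
  qed
  have "sqn (\<lambda>x::'a. complex_of_real (poly_kernel x)) < \<infinity>"
    by (rule sqn_finite_bounded_integrable[OF _ pk1]) (use poly_kernel_integrable in auto)
  then have ui: "integrable lborel (\<lambda>x. u' x * complex_of_real (poly_kernel x))" using fin by (intro integrable_mult_sqn) auto
  then have ui': "integrable lborel (\<lambda>x. norm (u' x) * poly_kernel x)" using integrable_norm[OF ui] by (simp add: norm_mult)
  have bound: "norm (fun_dist u f) \<le> C * (\<Sum>bs | set bs \<subseteq> Basis \<and> length bs \<le> ?m. schwartz_seminorm ?m bs f)" if f: "f \<in> schwartz" for f
  proof -
    have fm[measurable]: "f \<in> borel_measurable borel" by (rule sm[OF f])
    have fx: "norm (f x) \<le> ?S f * poly_kernel x" for x
    proof -
      have "(1 + norm x) ^ ?m * norm (iter_partial [] f x) \<le> ?S f"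
        unfolding schwartz_seminorm_def by (rule cSUP_upper[OF UNIV_I schwartz_seminorm_bdd[OF f]]) simp
      then have "(1 + norm x) ^ ?m * norm (f x) \<le> ?S f" by (simp add: iter_partial_def)
      moreover have "(1 + norm x) ^ ?m > 0" by (intro zero_less_power add_pos_nonneg) auto
      ultimately show ?thesis unfolding poly_kernel_def divide_inverse[symmetric] by (simp only: pos_le_divide_eq mult.commute)
    qed
    have "norm (fun_dist u f) \<le> (\<integral>x. norm (u' x * f x) \<partial>lborel)" unfolding eq[OF fm] by (rule integral_norm_bound)
    also have "\<dots> \<le> (\<integral>x. ?S f * (norm (u' x) * poly_kernel x) \<partial>lborel)"
    proof (rule integral_mono)
      show "integrable lborel (\<lambda>x. norm (u' x * f x))" by (intro integrable_norm integrable_mult_sqn fin schwartz_sqn_finite f um fm)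
      show "integrable lborel (\<lambda>x. ?S f * (norm (u' x) * poly_kernel x))" by (intro integrable_mult_right ui')
      show "norm (u' x * f x) \<le> ?S f * (norm (u' x) * poly_kernel x)" for x
        using mult_left_mono[OF fx[of x], of "norm (u' x)"] by (simp add: norm_mult mult.left_commute)
    qed
    also have "\<dots> = C * ?S f" unfolding C_def by simp
    also have "\<dots> \<le> C * (\<Sum>bs | set bs \<subseteq> Basis \<and> length bs \<le> ?m. schwartz_seminorm ?m bs f)"
    proof (intro mult_left_mono C0)
      have nn: "schwartz_seminorm ?m bs f \<ge> 0" if "set bs \<subseteq> Basis" for bs
      proof -
        have b: "bs \<in> lists Basis" using that by auto
        have "0 \<le> (1 + norm (0::'a)) ^ ?m * norm (iter_partial bs f 0)" by simp
        also have "\<dots> \<le> schwartz_seminorm ?m bs f"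
          unfolding schwartz_seminorm_def by (rule cSUP_upper[OF UNIV_I schwartz_seminorm_bdd[OF f b]])
        finally show ?thesis .
      qed
      show "?S f \<le> (\<Sum>bs | set bs \<subseteq> Basis \<and> length bs \<le> ?m. schwartz_seminorm ?m bs f)"
        by (rule member_le_sum) (auto intro: nn finite_lists_length_le)
    qed
    finally show ?thesis .
  qed
  show ?thesis unfolding tempered_distribution_def
    using add scale bound by (intro conjI ballI allI exI[of _ C] exI[of _ ?m]) auto
qed

text \<open>The identity is also assumed on sums and multiples; this stands in for closure of
  \<open>schwartz\<close> under these operations.\<close>

lemma tempered_distribution_scale:
  assumes "tempered_distribution T" and eq: "\<And>f. f \<in> schwartz \<Longrightarrow> T' f = c * T f"
    and closed: "\<And>f g. f \<in> schwartz \<Longrightarrow> g \<in> schwartz \<Longrightarrow> T' (\<lambda>x. f x + g x) = c * T (\<lambda>x. f x + g x)"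
      "\<And>r f. f \<in> schwartz \<Longrightarrow> T' (\<lambda>x. r * f x) = c * T (\<lambda>x. r * f x)"
  shows "tempered_distribution T'"
proof -
  obtain K m where K: "\<And>f. f \<in> schwartz \<Longrightarrow> norm (T f) \<le> K * (\<Sum>bs | set bs \<subseteq> Basis \<and> length bs \<le> m. schwartz_seminorm m bs f)"
    and add: "\<And>f g. f \<in> schwartz \<Longrightarrow> g \<in> schwartz \<Longrightarrow> T (\<lambda>x. f x + g x) = T f + T g"
    and sc: "\<And>r f. f \<in> schwartz \<Longrightarrow> T (\<lambda>x. r * f x) = r * T f"
    using assms(1) unfolding tempered_distribution_def by blast
  have "norm (T' f) \<le> (norm c * K) * (\<Sum>bs | set bs \<subseteq> Basis \<and> length bs \<le> m. schwartz_seminorm m bs f)" if "f \<in> schwartz" for f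
    using mult_left_mono[OF K[OF that], of "norm c"] by (simp add: eq[OF that] norm_mult mult.assoc)
  then show ?thesis unfolding tempered_distribution_def
    by (intro conjI ballI allI exI[of _ "norm c * K"] exI[of _ m])
       (simp_all add: closed eq add sc distrib_left mult.left_commute)
qed

lemma integral_sq_density:
  fixes f :: "'a::euclidean_space \<Rightarrow> complex"
  assumes f: "f \<in> Cc" and wm: "w' \<in> borel_measurable borel" and ae: "AE x in lborel. w x = w' x"
  shows "(\<integral>x. f x \<partial>sq_density w) = (\<integral>x. f x * complex_of_real ((norm (w' x))\<^sup>2) \<partial>lborel)"
proof -
  note [measurable] = wm
  have fm[measurable]: "f \<in> borel_measurable borel" using f by (intro borel_measurable_continuous_onI) (simp add: Cc_def)
  have w: "w \<in> borel_measurable lebesgue" by (rule lebesgue_measurable_AE[OF wm ae])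
  have "(\<integral>x. f x \<partial>sq_density w) = (\<integral>x. (norm (w x))\<^sup>2 *\<^sub>R f x \<partial>lebesgue)"
    unfolding sq_density_def using w by (intro integral_density) (auto intro: measurable_completion)
  also have "\<dots> = (\<integral>x. f x * complex_of_real ((norm (w' x))\<^sup>2) \<partial>lborel)"
    by (rule integral_lebesgue_AE, measurable) (use ae in \<open>eventually_elim, simp add: scaleR_conv_of_real mult.commute\<close>)
  finally show ?thesis .
qed

context sampling_kernel
begin

lemma sampling_eq_sample:
  assumes h: "h > 0" and um[measurable]: "u' \<in> borel_measurable borel" and aeu: "AE x in lborel. u x = u' x" and aep: "AE x in lborel. \<phi>' x = \<phi> x"
  shows "sampling \<phi>' h u = sample h u'"
proof
  fix n
  have "AE x in lborel. \<phi>' (inverse h *\<^sub>R x + (- lattice_point n)) = \<phi> (inverse h *\<^sub>R x + (- lattice_point n))"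
    using h by (intro AE_affine[OF aep]) auto
  then have ae: "AE x in lborel. u x * cnj (\<phi>' (x /\<^sub>R h - lattice_point n)) = u' x * cnj (\<phi> (x /\<^sub>R h - lattice_point n))"
    using aeu by eventually_elim simp
  have "(\<integral>x. u x * cnj (\<phi>' (x /\<^sub>R h - lattice_point n)) \<partial>lebesgue) = (\<integral>x. u' x * cnj (\<phi> (x /\<^sub>R h - lattice_point n)) \<partial>lborel)"
    by (rule integral_lebesgue_AE[OF _ ae]) measurable
  then show "sampling \<phi>' h u n = sample h u' n" by (simp add: sampling_def sample_def)
qed

text \<open>Each lattice point has its own exceptional null set; countability gives a common one.
  Bounded samples make the series absolutely summable, which identifies \<open>infsum\<close> with
  the integral over counting measure.\<close>

lemma reconstruction_eq_reconstruct:
  assumes h: "h > 0" and um: "u \<in> borel_measurable borel" and fin: "sqn u < \<infinity>" and aep: "AE x in lborel. \<psi>' x = \<psi> x"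
  shows "AE x in lborel. reconstruction \<psi>' h (sample h u) x = reconstruct h u x"
proof -
  obtain B where B: "\<And>n. norm (sample h u n) \<le> B" using sample_bounded[OF h um fin] by blast
  have "AE x in lborel. \<psi>' (inverse h *\<^sub>R x + (- lattice_point n)) = \<psi> (inverse h *\<^sub>R x + (- lattice_point n))" for n
    using h by (intro AE_affine[OF aep]) auto
  then have "AE x in lborel. \<forall>n. \<psi>' (inverse h *\<^sub>R x + (- lattice_point n)) = \<psi> (inverse h *\<^sub>R x + (- lattice_point n))"
    by (subst AE_all_countable) auto
  then show ?thesis
  proof eventually_elim
    case (elim x)
    have i: "integrable (count_space UNIV) (\<lambda>n. sample h u n * \<psi> (x /\<^sub>R h - lattice_point n))"
      by (rule Bochner_Integration.integrable_bound[OF integrable_mult_right[OF psi_lattice_integrable[of "x /\<^sub>R h"], of "complex_of_real \<bar>B\<bar>"]])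
         (auto simp: norm_mult intro!: mult_right_mono order_trans[OF B])
    have "reconstruction \<psi>' h (sample h u) x = (\<Sum>\<^sub>\<infinity>n. sample h u n * \<psi> (x /\<^sub>R h - lattice_point n))"
      using elim by (simp add: reconstruction_def)
    also have "\<dots> = infsetsum (\<lambda>n. sample h u n * \<psi> (x /\<^sub>R h - lattice_point n)) UNIV"
      using i by (intro infsetsum_infsum[symmetric]) (simp add: Infinite_Set_Sum.abs_summable_on_def)
    also have "\<dots> = reconstruct h u x" by (simp add: infsetsum_def reconstruct_def)
    finally show ?case .
  qed
qed

text \<open>Bounds through \<open>K\<close> alone: they give square integrability and the uniform
  boundedness that the perturbation lemmas require.\<close>

lemma sqn_reconstruct_le:
  assumes h: "h > 0" and um[measurable]: "u \<in> borel_measurable borel" and K: "sqn u \<le> ennreal K"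
  defines "I \<equiv> \<integral>\<^sup>+z. ennreal (residual_kernel z) \<partial>lborel"
  shows "sqn (\<lambda>x. phi_mean * periodization (x /\<^sub>R h) * u x) \<le> ennreal ((norm phi_mean * (C * M))\<^sup>2) * ennreal K" (is ?A)
    and "sqn (reconstruct h u) \<le> 2 * (I * (I * (4 * ennreal K))) + 2 * (ennreal ((norm phi_mean * (C * M))\<^sup>2) * ennreal K)" (is ?B)
proof -
  let ?v = "\<lambda>x. phi_mean * periodization (x /\<^sub>R h) * u x"
  have fin: "sqn u < \<infinity>" using K by (auto intro: le_less_trans)
  have "sqn ?v \<le> ennreal ((norm phi_mean * (C * M))\<^sup>2) * sqn u"
    by (rule sqn_bounded_mult[OF um]) (auto simp: norm_mult intro!: mult_left_mono periodization_le)
  also have "\<dots> \<le> ennreal ((norm phi_mean * (C * M))\<^sup>2) * ennreal K" by (intro mult_left_mono K) auto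
  finally show A: ?A .
  have "sqn (\<lambda>x. reconstruct h u x - ?v x) \<le> I * (\<integral>\<^sup>+z. ennreal (residual_kernel z) * sqn (\<lambda>x. u (x + h *\<^sub>R z) - u x) \<partial>lborel)"
    unfolding I_def by (rule sqn_residual_le[OF h um fin])
  also have "\<dots> \<le> I * (\<integral>\<^sup>+z. ennreal (residual_kernel z) * (4 * ennreal K) \<partial>lborel)"
  proof (intro mult_left_mono nn_integral_mono)
    fix z
    have "sqn (\<lambda>x. u (x + h *\<^sub>R z) - u x) \<le> 2 * sqn (\<lambda>x. u (x + h *\<^sub>R z)) + 2 * sqn u" by (rule sqn_diff_le2) auto
    also have "\<dots> = 4 * sqn u" by (simp add: sqn_translate flip: distrib_right)
    also have "\<dots> \<le> 4 * ennreal K" by (intro mult_left_mono K) auto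
    finally show "sqn (\<lambda>x. u (x + h *\<^sub>R z) - u x) \<le> 4 * ennreal K" .
  qed auto
  also have "\<dots> = I * (I * (4 * ennreal K))" unfolding I_def by (subst nn_integral_multc) auto
  finally have R: "sqn (\<lambda>x. reconstruct h u x - ?v x) \<le> I * (I * (4 * ennreal K))" .
  have "sqn (reconstruct h u) = sqn (\<lambda>x. (reconstruct h u x - ?v x) + ?v x)" by simp
  also have "\<dots> \<le> 2 * sqn (\<lambda>x. reconstruct h u x - ?v x) + 2 * sqn ?v" by (rule sqn_add_le2) measurable
  also have "\<dots> \<le> 2 * (I * (I * (4 * ennreal K))) + 2 * (ennreal ((norm phi_mean * (C * M))\<^sup>2) * ennreal K)"
    by (intro add_mono mult_left_mono R A) auto
  finally show ?B .
qed

end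

text \<open>Lattice sums evaluate the function at every point, so the bound must hold everywhere;
  setting the representative to 0 where it fails alters a null set only.\<close>

lemma decaying_borel_representative:
  fixes \<gamma> :: "'a::euclidean_space \<Rightarrow> complex"
  assumes "\<gamma> \<in> borel_measurable lebesgue" and le: "\<And>x. norm (\<gamma> x) \<le> C * decay a x"
  obtains g where "g \<in> borel_measurable borel" "AE x in lborel. \<gamma> x = g x" "\<And>x. norm (g x) \<le> C * decay a x"
proof -
  obtain g where g[measurable]: "g \<in> borel_measurable borel" and ae: "AE x in lborel. \<gamma> x = g x"
    using lebesgue_borel_representative[OF assms(1)] by blast
  define g' where "g' x = (if norm (g x) \<le> C * decay a x then g x else 0)" for x
  show ?thesis
  proof (rule that[of g'])
    show "g' \<in> borel_measurable borel" unfolding g'_def by measurable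
    show "AE x in lborel. \<gamma> x = g' x"
      using ae
    proof eventually_elim
      case (elim x)
      with le[of x] show ?case by (simp add: g'_def)
    qed
    show "norm (g' x) \<le> C * decay a x" for x
      using order_trans[OF norm_ge_zero le[of x]] by (simp add: g'_def)
  qed
qed

theorem theorem1p6:
  fixes \<phi> \<psi> :: "real ^ 'n \<Rightarrow> complex"
    and C \<delta> :: real
    and h \<epsilon> :: "nat \<Rightarrow> real"
    and u :: "nat \<Rightarrow> real ^ 'n \<Rightarrow> complex"
  assumes "\<phi> \<in> borel_measurable lebesgue" and "\<psi> \<in> borel_measurable lebesgue"
    and "C > 0" and "\<delta> > 0"
    and "\<And>\<gamma> x. \<gamma> \<in> {\<phi>, \<psi>} \<Longrightarrow>
           norm (\<gamma> x) \<le> C * (1 + norm x) powr (- real CARD('n) - \<delta>)"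
    and "is_scale h" and "is_scale \<epsilon>"
    and "(\<lambda>k. h k / \<epsilon> k) \<longlonglongrightarrow> 0"
    and "\<And>k. u k \<in> L2"
    and "bounded (range (\<lambda>k. L2_norm (u k)))"
    and "oscillatory \<epsilon> u"
  defines "w \<equiv> (\<lambda>k. reconstruction \<psi> (h k) (sampling \<phi> (h k) (u k)))"
  shows "(\<forall>k. w k \<in> L2) \<and>
    (\<forall>\<mu>. is_wigner_measure \<epsilon> (\<lambda>k. fun_dist (u k)) \<mu> \<longrightarrow>
       is_wigner_measure \<epsilon> (\<lambda>k. fun_dist (w k))
         (scale_measure (ennreal ((norm (fourier \<psi> 0))\<^sup>2 * (norm (fourier \<phi> 0))\<^sup>2)) \<mu>)) \<and>
    (\<forall>\<nu>' \<nu>. weakly_converges_to (\<lambda>k. sq_density (w k)) \<nu>' \<and>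
            weakly_converges_to (\<lambda>k. sq_density (u k)) \<nu> \<longrightarrow>
       \<nu>' = scale_measure
              (\<Sum>\<^sub>\<infinity>n::int ^ 'n. ennreal ((norm (fourier \<psi> ((2 * pi) *\<^sub>R lattice_point n)))\<^sup>2 *
                 (norm (fourier \<phi> 0))\<^sup>2)) \<nu>)"
proof -
  define a where "a = real CARD('n) + \<delta>"
  have a: "a > real CARD('n)" using assms(4) by (simp add: a_def)
  have exponent: "- real CARD('n) - \<delta> = - a" by (simp add: a_def)
  have phi_le: "norm (\<phi> x) \<le> C * decay a x" and psi_le: "norm (\<psi> x) \<le> C * decay a x" for x
    using assms(5)[of \<phi> x] assms(5)[of \<psi> x] by (simp_all add: decay_def exponent)
  obtain \<phi>' where phi': "\<phi>' \<in> borel_measurable borel" "AE x in lborel. \<phi> x = \<phi>' x" "\<And>x. norm (\<phi>' x) \<le> C * decay a x"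
    using decaying_borel_representative[OF assms(1) phi_le] by blast
  obtain \<psi>' where psi': "\<psi>' \<in> borel_measurable borel" "AE x in lborel. \<psi> x = \<psi>' x" "\<And>x. norm (\<psi>' x) \<le> C * decay a x"
    using decaying_borel_representative[OF assms(2) psi_le] by blast
  obtain M where M: "M > 0" "\<And>x::real^'n. (\<integral>\<^sup>+n. ennreal (decay a (x - lattice_point n)) \<partial>count_space UNIV) \<le> ennreal M"
    using lattice_sum_decay[OF a] by blast
  interpret sampling_kernel \<phi>' \<psi>' C a M
    by unfold_locales (use a assms(3) M phi' psi' in auto)
  have h: "h k > 0" and e: "\<epsilon> k > 0" for k using assms(6,7) by (auto simp: is_scale_def)
  have hl: "h \<longlonglongrightarrow> 0" using assms(6) by (simp add: is_scale_def)
  have "\<exists>v. v \<in> borel_measurable borel \<and> (AE x in lborel. u k x = v x)" for k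
    using lebesgue_borel_representative[of "u k"] assms(9)[of k] by (auto simp: L2_def)
  then obtain u' where um: "\<And>k. u' k \<in> borel_measurable borel" and uae: "\<And>k. AE x in lborel. u k x = u' k x"
    by metis
  obtain B where B: "\<And>k. norm (L2_norm (u k)) \<le> B" using assms(10) by (auto simp: bounded_iff)
  have uK: "sqn (u' k) \<le> ennreal (B\<^sup>2)" for k
    unfolding sqn_representative[OF assms(9) uae] using power_mono[OF B[of k], of 2] by (intro ennreal_leI) simp
  have uf: "sqn (u' k) < \<infinity>" for k using uK[of k] by (auto intro: le_less_trans)
  have "oscillatory \<epsilon> u'"
    using assms(11) unfolding oscillatory_def fourier_L2_AE[OF um uae] .
  then have shift: "(\<lambda>k. sqn (\<lambda>x. u' k (x + h k *\<^sub>R z) - u' k x)) \<longlonglongrightarrow> 0" for z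
    by (intro oscillatory_shift[OF um uK _ h e assms(8)])
  define r where "r k = reconstruct (h k) (u' k)" for k
  \<comment> \<open>Kept apart from \<open>v\<close>, because the averaging lemmas treat the
    periodic factor without the constant \<open>phi_mean\<close>.\<close>
  define p where "p k x = periodization (x /\<^sub>R h k) * u' k x" for k x
  define v where "v k x = phi_mean * periodization (x /\<^sub>R h k) * u' k x" for k x
  have vp: "v k x = phi_mean * p k x" for k x by (simp add: v_def p_def)
  have rm: "r k \<in> borel_measurable borel" for k unfolding r_def by (rule reconstruct_measurable)
  have pm: "p k \<in> borel_measurable borel" for k
    unfolding p_def using um[of k] by (intro borel_measurable_times measurable_compose[OF _ periodization_measurable]) auto
  have vm: "v k \<in> borel_measurable borel" for k unfolding vp using pm[of k] by measurable
  have rv: "(\<lambda>k. sqn (\<lambda>x. r k x - v k x)) \<longlonglongrightarrow> 0"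
    unfolding r_def v_def by (rule sqn_residual_tendsto[OF h um uK shift])
  obtain K where rK: "\<And>k. sqn (r k) \<le> ennreal K" and vK: "\<And>k. sqn (v k) \<le> ennreal K"
  proof -
    let ?I = "\<integral>\<^sup>+z. ennreal (residual_kernel z) \<partial>lborel"
    let ?A = "ennreal ((norm phi_mean * (C * M))\<^sup>2) * ennreal (B\<^sup>2)"
    let ?K = "2 * (?I * (?I * (4 * ennreal (B\<^sup>2)))) + 2 * ?A"
    have K: "?K = ennreal (enn2real ?K)"
      using residual_kernel_finite by (subst ennreal_enn2real) (auto simp: ennreal_mult_less_top)
    have "?A \<le> 2 * ?A" by (simp add: mult_2)
    also have "\<dots> \<le> ?K" by simp
    finally have AK: "?A \<le> ?K" .
    show ?thesis
    proof (rule that)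
      show "sqn (r k) \<le> ennreal (enn2real ?K)" for k
        unfolding K[symmetric] r_def by (rule sqn_reconstruct_le(2)[OF h um uK])
      show "sqn (v k) \<le> ennreal (enn2real ?K)" for k
        unfolding K[symmetric] v_def by (rule order_trans[OF sqn_reconstruct_le(1)[OF h um uK] AK])
    qed
  qed
  have rf: "sqn (r k) < \<infinity>" for k using rK[of k] by (auto intro: le_less_trans)
  have wae: "AE x in lborel. w k x = r k x" for k
  proof -
    have "w k = reconstruction \<psi> (h k) (sample (h k) (u' k))"
      using sampling_eq_sample[OF h um uae phi'(2)] by (simp add: w_def)
    then show ?thesis
      using reconstruction_eq_reconstruct[OF h um uf psi'(2)] by (simp add: r_def)
  qed
  have wL2: "w k \<in> L2" for k by (rule L2_AE[OF rm wae rf])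
  \<comment> \<open>Equality holds at every single frequency, as it must for values at lattice
    frequencies to be compared.\<close>
  have f_psi: "fourier \<psi> \<xi> = ft \<psi>' \<xi>" for \<xi>
    unfolding fourier_def ft_def
    by (rule integral_lebesgue_AE, use psi'(1) in measurable) (use psi'(2) in \<open>eventually_elim, simp add: cis_conv_exp\<close>)
  have "fourier \<phi> 0 = (\<integral>x. \<phi>' x \<partial>lborel)"
    unfolding fourier_def by (rule integral_lebesgue_AE[OF phi'(1)]) (use phi'(2) in \<open>eventually_elim, simp\<close>)
  then have n_phi: "norm (fourier \<phi> 0) = norm phi_mean"
    unfolding phi_mean_def Bochner_Integration.integral_cnj complex_mod_cnj by (rule arg_cong)
  have n_psi: "norm (fourier \<psi> 0) = norm (\<integral>x. \<psi>' x \<partial>lborel)" unfolding f_psi ft_def by simp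
  define c where "c = (norm (fourier \<psi> 0))\<^sup>2 * (norm (fourier \<phi> 0))\<^sup>2"
  have c0: "c \<ge> 0" by (simp add: c_def)

  have wigner: "is_wigner_measure \<epsilon> (\<lambda>k. fun_dist (w k)) (scale_measure (ennreal c) \<mu>)"
    if W: "is_wigner_measure \<epsilon> (\<lambda>k. fun_dist (u k)) \<mu>" for \<mu>
  proof -
    have radon: "radon_measure \<mu>" and int: "\<And>b. b \<in> schwartz \<Longrightarrow> integrable \<mu> b" and temp: "tempered_distribution (measure_dist \<mu>)"
      and conv: "\<And>b. b \<in> schwartz \<Longrightarrow> (\<lambda>k. wigner_transform (\<epsilon> k) (fun_dist (u k)) b) \<longlonglongrightarrow> measure_dist \<mu> b"
      using W by (auto simp: is_wigner_measure_def)
    have bm: "b \<in> borel_measurable \<mu>" if "b \<in> borel_measurable borel" for b :: "(real^'n) \<times> (real^'n) \<Rightarrow> complex"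
      using that radon measurable_cong_sets[of \<mu> borel borel borel] by (auto simp: radon_measure_def)
    have scale: "measure_dist (scale_measure (ennreal c) \<mu>) b = complex_of_real c * measure_dist \<mu> b"
      if "b \<in> borel_measurable borel" for b
      unfolding measure_dist_def by (rule integral_scale_measure[OF bm[OF that] c0])
    have lim: "(\<lambda>k. wigner_transform (\<epsilon> k) (fun_dist (w k)) b) \<longlonglongrightarrow> complex_of_real c * measure_dist \<mu> b" if b: "b \<in> schwartz" for b
    proof -
      let ?W = "\<lambda>k g. wigner_form (\<epsilon> k) b (g k) (g k)"
      let ?m = "(norm (\<integral>x. \<psi>' x \<partial>lborel))\<^sup>2"
      let ?d = "complex_of_real (1 / (2 * pi) ^ DIM(real^'n))"
      have l1: "(\<lambda>k. ?W k r - ?W k v) \<longlonglongrightarrow> 0" by (rule wigner_form_perturb[OF b rm vm rK vK e rv])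
      have l2: "(\<lambda>k. ?W k p - ?W k u' * complex_of_real ?m) \<longlonglongrightarrow> 0"
        unfolding p_def by (rule wigner_form_average[OF b h e hl assms(8) um uK shift])
      have vW: "?W k v = complex_of_real ((norm phi_mean)\<^sup>2) * ?W k p" for k
        unfolding wigner_form_def vp complex_norm_square
        by (subst integral_mult_right_zero[symmetric]) (intro Bochner_Integration.integral_cong refl, simp add: mult_ac)
      have Wu: "wigner_transform (\<epsilon> k) (fun_dist (u k)) b = ?d * ?W k u'" for k
        by (rule wigner_transform_eq[OF b e um uf uae])
      have Ww: "wigner_transform (\<epsilon> k) (fun_dist (w k)) b = ?d * ?W k r" for k
        by (rule wigner_transform_eq[OF b e rm rf wae])
      have ceq: "complex_of_real c = complex_of_real ((norm phi_mean)\<^sup>2) * complex_of_real ?m"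
        unfolding c_def n_psi n_phi by (simp only: of_real_mult mult.commute)
      \<comment> \<open>The transform of \<open>w k\<close> is split into the reconstruction error,
        the averaging error and \<open>c\<close> times the transform of \<open>u k\<close>, whose
        limit is given.\<close>
      have "(\<lambda>k. ?d * ((?W k r - ?W k v) + complex_of_real ((norm phi_mean)\<^sup>2) * (?W k p - ?W k u' * complex_of_real ?m))
            + complex_of_real c * wigner_transform (\<epsilon> k) (fun_dist (u k)) b)
          \<longlonglongrightarrow> ?d * (0 + complex_of_real ((norm phi_mean)\<^sup>2) * 0) + complex_of_real c * measure_dist \<mu> b"
        by (intro tendsto_add tendsto_mult tendsto_const l1 l2 conv b)
      moreover have "?d * ((?W k r - ?W k v) + complex_of_real ((norm phi_mean)\<^sup>2) * (?W k p - ?W k u' * complex_of_real ?m))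
            + complex_of_real c * wigner_transform (\<epsilon> k) (fun_dist (u k)) b = wigner_transform (\<epsilon> k) (fun_dist (w k)) b" for k
        unfolding Wu Ww vW ceq by (simp only: algebra_simps)
      ultimately show ?thesis by simp
    qed
    show ?thesis unfolding is_wigner_measure_def
    proof (intro conjI allI ballI)
      show "tempered_distribution (fun_dist (w k))" for k by (rule tempered_distribution_L2[OF wL2])
      show "radon_measure (scale_measure (ennreal c) \<mu>)" by (rule radon_measure_scale[OF radon])
      show "integrable (scale_measure (ennreal c) \<mu>) b" if "b \<in> schwartz" for b
        by (rule integrable_scale_measure[OF bm[OF schwartz_measurable[OF that]] c0 int[OF that]])
      show "tempered_distribution (measure_dist (scale_measure (ennreal c) \<mu>))"
      proof (rule tempered_distribution_scale[OF temp, where c = "complex_of_real c"])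
        fix f g :: "(real^'n) \<times> (real^'n) \<Rightarrow> complex" and r :: complex assume f: "f \<in> schwartz"
        have fm[measurable]: "f \<in> borel_measurable borel" by (rule schwartz_measurable[OF f])
        show "measure_dist (scale_measure (ennreal c) \<mu>) f = complex_of_real c * measure_dist \<mu> f" by (rule scale) measurable
        show "measure_dist (scale_measure (ennreal c) \<mu>) (\<lambda>x. r * f x) = complex_of_real c * measure_dist \<mu> (\<lambda>x. r * f x)"
          by (rule scale) measurable
        assume "g \<in> schwartz"
        then have [measurable]: "g \<in> borel_measurable borel" by (rule schwartz_measurable)
        show "measure_dist (scale_measure (ennreal c) \<mu>) (\<lambda>x. f x + g x) = complex_of_real c * measure_dist \<mu> (\<lambda>x. f x + g x)"
          by (rule scale) measurable
      qed
      show "(\<lambda>k. wigner_transform (\<epsilon> k) (fun_dist (w k)) b) \<longlonglongrightarrow> measure_dist (scale_measure (ennreal c) \<mu>) b" if "b \<in> schwartz" for b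
        unfolding scale[OF schwartz_measurable[OF that]] by (rule lim[OF that])
    qed
  qed

  \<comment> \<open>The mean of the squared modulus of the periodization; it is finite, so nothing
    is lost by passing to a real number.\<close>
  define m where "m = enn2real (sqn (\<lambda>x. indicator cell x *\<^sub>R periodization x))"
  have m0: "m \<ge> 0" by (simp add: m_def)
  have mass: "(\<Sum>\<^sub>\<infinity>n::int ^ 'n. ennreal ((norm (fourier \<psi> ((2 * pi) *\<^sub>R lattice_point n)))\<^sup>2 * (norm (fourier \<phi> 0))\<^sup>2)) = ennreal (m * (norm phi_mean)\<^sup>2)"
  proof -
    have "(\<Sum>\<^sub>\<infinity>n::int ^ 'n. ennreal ((norm (fourier \<psi> ((2 * pi) *\<^sub>R lattice_point n)))\<^sup>2 * (norm (fourier \<phi> 0))\<^sup>2))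
       = (\<integral>\<^sup>+n. ennreal ((norm (ft \<psi>' ((2 * pi) *\<^sub>R lattice_point n)))\<^sup>2) * ennreal ((norm phi_mean)\<^sup>2) \<partial>count_space (UNIV :: (int^'n) set))"
      unfolding infsum_ennreal_eq_nn_integral f_psi n_phi by (simp add: ennreal_mult)
    also have "\<dots> = (\<integral>\<^sup>+n. ennreal ((norm (ft \<psi>' ((2 * pi) *\<^sub>R lattice_point n)))\<^sup>2) \<partial>count_space (UNIV :: (int^'n) set)) * ennreal ((norm phi_mean)\<^sup>2)"
      by (rule nn_integral_multc) simp
    also have "(\<integral>\<^sup>+n. ennreal ((norm (ft \<psi>' ((2 * pi) *\<^sub>R lattice_point n)))\<^sup>2) \<partial>count_space (UNIV :: (int^'n) set)) = ennreal m"
      unfolding infsum_ennreal_eq_nn_integral[symmetric] parseval_periodization m_def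
      using sqn_cell_periodization_finite by (simp add: less_top)
    finally show ?thesis using m0 by (simp add: ennreal_mult)
  qed
  have density: "\<nu>' = scale_measure (ennreal (m * (norm phi_mean)\<^sup>2)) \<nu>"
    if W: "weakly_converges_to (\<lambda>k. sq_density (w k)) \<nu>'" and U: "weakly_converges_to (\<lambda>k. sq_density (u k)) \<nu>" for \<nu>' \<nu>
  proof (rule radon_measure_eqI)
    show "radon_measure \<nu>'" using W by (simp add: weakly_converges_to_def)
    have rn: "radon_measure \<nu>" using U by (simp add: weakly_converges_to_def)
    then show "radon_measure (scale_measure (ennreal (m * (norm phi_mean)\<^sup>2)) \<nu>)" by (rule radon_measure_scale)
    fix f :: "real^'n \<Rightarrow> complex" assume f: "f \<in> Cc"
    let ?J = "\<lambda>k g. \<integral>x. f x * complex_of_real ((norm (g k x))\<^sup>2) \<partial>lborel"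
    have Wf: "(\<lambda>k. ?J k r) \<longlonglongrightarrow> (\<integral>x. f x \<partial>\<nu>')"
    proof -
      have "(\<lambda>k. \<integral>x. f x \<partial>sq_density (w k)) \<longlonglongrightarrow> (\<integral>x. f x \<partial>\<nu>')"
        using W f by (simp add: weakly_converges_to_def)
      then show ?thesis by (simp only: integral_sq_density[OF f rm wae])
    qed
    have Uf: "(\<lambda>k. ?J k u') \<longlonglongrightarrow> (\<integral>x. f x \<partial>\<nu>)"
    proof -
      have "(\<lambda>k. \<integral>x. f x \<partial>sq_density (u k)) \<longlonglongrightarrow> (\<integral>x. f x \<partial>\<nu>)"
        using U f by (simp add: weakly_converges_to_def)
      then show ?thesis by (simp only: integral_sq_density[OF f um uae])
    qed
    have l1: "(\<lambda>k. ?J k r - ?J k v) \<longlonglongrightarrow> 0" by (rule integral_Cc_sq_perturb[OF f rm vm rK vK rv])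
    have l2: "(\<lambda>k. ?J k p - ?J k u' * complex_of_real m) \<longlonglongrightarrow> 0"
      unfolding p_def m_def by (rule integral_Cc_sq_average[OF f h hl um uK shift])
    have vJ: "?J k v = complex_of_real ((norm phi_mean)\<^sup>2) * ?J k p" for k
      unfolding vp norm_mult power_mult_distrib
      by (subst integral_mult_right_zero[symmetric]) (intro Bochner_Integration.integral_cong refl, simp add: mult_ac)
    \<comment> \<open>The same splitting as for the Wigner transform, with the diagonal mean
      \<open>m\<close> in place of the product mean.\<close>
    have "(\<lambda>k. (?J k r - ?J k v) + complex_of_real ((norm phi_mean)\<^sup>2) * (?J k p - ?J k u' * complex_of_real m)
        + complex_of_real ((norm phi_mean)\<^sup>2) * (?J k u' * complex_of_real m))
       \<longlonglongrightarrow> 0 + complex_of_real ((norm phi_mean)\<^sup>2) * 0 + complex_of_real ((norm phi_mean)\<^sup>2) * ((\<integral>x. f x \<partial>\<nu>) * complex_of_real m)"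
      by (intro tendsto_add tendsto_mult tendsto_const l1 l2 Uf)
    moreover have "(?J k r - ?J k v) + complex_of_real ((norm phi_mean)\<^sup>2) * (?J k p - ?J k u' * complex_of_real m)
        + complex_of_real ((norm phi_mean)\<^sup>2) * (?J k u' * complex_of_real m) = ?J k r" for k
      unfolding vJ by (simp only: algebra_simps)
    ultimately have "(\<lambda>k. ?J k r) \<longlonglongrightarrow> complex_of_real ((norm phi_mean)\<^sup>2) * ((\<integral>x. f x \<partial>\<nu>) * complex_of_real m)" by (simp only: add_0_left mult_zero_right)
    from LIMSEQ_unique[OF Wf this]
    have "(\<integral>x. f x \<partial>\<nu>') = complex_of_real (m * (norm phi_mean)\<^sup>2) * (\<integral>x. f x \<partial>\<nu>)" by (simp only: of_real_mult mult_ac)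
    moreover have "(\<integral>x. f x \<partial>scale_measure (ennreal (m * (norm phi_mean)\<^sup>2)) \<nu>) = complex_of_real (m * (norm phi_mean)\<^sup>2) * (\<integral>x. f x \<partial>\<nu>)"
    proof (rule integral_scale_measure)
      have "f \<in> borel_measurable borel" using f by (intro borel_measurable_continuous_onI) (simp add: Cc_def)
      then show "f \<in> borel_measurable \<nu>" using rn measurable_cong_sets[of \<nu> borel borel borel] by (auto simp: radon_measure_def)
    qed (use m0 in simp)
    ultimately show "(\<integral>x. f x \<partial>\<nu>') = (\<integral>x. f x \<partial>scale_measure (ennreal (m * (norm phi_mean)\<^sup>2)) \<nu>)" by simp
  qed
  show ?thesis
    unfolding mass using wL2 wigner density unfolding c_def by blast
qed

end
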